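(* Suppose Assumptions (A1)–(A5) hold and there is a constant $C_2>0$ with $\sup_{\tau\in[\underline\tau,\bar\tau]}J(\beta_0(\cdot,\tau),\beta_0(\cdot,\tau))\le C_2$. Then, as $\lambda\to0$ with $h=O(\lambda^{1/(2s+2)})$, for every $\tau\in[\underline\tau,\bar\tau]$ there exists a unique minimizer $\theta_{0h,\lambda}(\tau)$ over $\mathcal H$ of $\ell_{h\lambda}(\theta)=R_h(\theta;\tau)+\frac\lambda2J(\beta,\beta)$, and $\|\theta_{0h,\lambda}(\tau)-\theta_0(\tau)\|=O(\lambda^{1/2})$ uniformly over $\tau\in[\underline\tau,\bar\tau]$.
   Context: Standing setup. $\mathbb I=[0,1]$; $X$ is a random element of $L^2(\mathbb I)$, $Y$ a real random variable, $(X_i,Y_i)$, $i=1,\dots,n$, i.i.d. copies of $(X,Y)$. $0<\underline\tau<\bar\tau<1$, $\mathcal U=[\underline\tau,\bar\tau]$. $H^m(\mathbb I)$ is the $m$-th order Sobolev space ($m>1/2$), $J(\beta_1,\beta_2)=\int_0^1\beta_1^{(m)}\beta_2^{(m)}dt$, $\mathcal H=\mathbb R\times H^m(\mathbb I)$. The model: $Q_{Y|X}(\tau\mid X)=\alpha_0(\tau)+\int_0^1\beta_0(t,\tau)X(t)dt$ for $\tau\in\mathcal U$, $\theta_0(\tau)=(\alpha_0(\tau),\beta_0(\cdot,\tau))\in\mathcal H$. $f(y|x),F(y|x)$: conditional density and cdf of $Y$ given $X=x$. $\rho_\tau(u)=u(\tau-\mathbb 1(u<0))$. $k$ is a kernel,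 $h>0$ a bandwidth, $k_h(v)=k(v/h)/h$, $\bar K(u)=\int_{-\infty}^uk(v)dv$. For $\theta=(\alpha,\beta)\in\mathcal H$: $\epsilon(\theta)=Y-\alpha-\int_0^1\beta X$, $\epsilon_i(\theta)=Y_i-\alpha-\int_0^1\beta X_i$; $R(\theta;\tau)=E\rho_\tau(\epsilon(\theta))$; $R_h(\theta;\tau)=E\int\rho_\tau(u)k_h(u-\epsilon(\theta))du$. Inner products (for given $\tau$ and $\lambda>0$): $B_\tau(X)=f(\alpha_0(\tau)+\int_0^1\beta_0(t,\tau)X(t)dt\mid X)$; $C(s,t;\tau)=E[B_\tau(X)X(s)X(t)]$; $V(\beta,\tilde\beta)=\iint C(s,t;\tau)\beta(t)\tilde\beta(s)dsdt$; $\langle\beta,\tilde\beta\rangle_1=V(\beta,\tilde\beta)+\lambda J(\beta,\tilde\beta)$; for $\theta=(\alpha,\beta),\tilde\theta=(\tilde\alpha,\tilde\beta)\in\mathcal H$, $\langle\theta,\tilde\theta\rangle=E\{B_\tau(X)(\alpha+\int X\beta)(\tilde\alpha+\int X\tilde\beta)\}+\lambda J(\beta,\tilde\beta)$, with norm $\|\theta\|$. (A1) (a) $f(y|x)$ is continuous and strictly positive on $\mathbb R\times\mathrm{supp}(X)$; (b) for an integer $s\ge1$, $\lim_{\epsilon\to0}\sup_{(y,x)}\sup_{|t|\le\epsilon}|f^{(s)}(y+t|x)-f^{(s)}(y|x)|=0$ (derivatives in $y$), and for $j=0,\dots,s$, $\sup_{(y,x)}|f^{(j)}(y|x)|<\infty$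 and $\lim_{y\to\pm\infty}f^{(j)}(y|x)=0$; (c) $E\{B_\tau(X)X(t)\}=0$ for every $t\in\mathbb I$ and there is $C_1>0$ with $C_1^{-1}\le B_\tau(X)\le C_1$ a.s. (A2) (a) $k$ is even, integrable, twice differentiable with bounded first and second derivatives, $\int k=1$, $0<\int_0^\infty\bar K(u)[1-\bar K(u)]du<\infty$, $\int|u^{s+1}k(u)|du<\infty$, $\int u^jk(u)du=0$ for $j=1,\dots,s$, and $\int u^{s+1}k(u)du\ne0$; (b) $h=h_n=o(1)$. (A3) $C(s,t;\tau)$ is continuous on $\mathbb I\times\mathbb I$, and for $\beta\in L^2(\mathbb I)$, $\int_0^1C(s,\cdot;\tau)\beta(s)ds=0$ iff $\beta=0$. (A4) There is a sequence $\{\phi_\nu\}_{\nu\ge1}\subset H^m(\mathbb I)$ with $\|\phi_\nu\|_{L^2}\le C_\phi\nu^a$ (constants $a\ge0$, $C_\phi>0$), $V(\phi_\mu,\phi_\nu)=\delta_{\mu\nu}$, $J(\phi_\mu,\phi_\nu)=\rho_\nu\delta_{\mu\nu}$, where $\rho_\nu\ge0$ is nondecreasing with $\rho_\nu\asymp\nu^{2l}$ for some $l>a+1/2$; every $\beta\in H^m(\mathbb I)$ satisfies $\beta=\sum_\nu V(\beta,\phi_\nu)\phi_\nu$ with convergence in $\langle\cdot,\cdot\rangle_1$. (A5) There is $s'\in(0,1)$ with $E\exp(s'\|X\|_{L^2})<\infty$, and $M_0>0$ with $E|\int_0^1X\beta|^4\le M_0(E|\int_0^1X\beta|^2)^2$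 for all $\beta\in H^m(\mathbb I)$.
   Formalization: The formal theorem additionally assumes E|Y| < ∞; without it (e.g. Y Cauchy and independent of X) R_h(θ;τ) is infinite for every θ and no unique minimizer exists. *)

theory Defs
  imports "HOL-Probability.Probability" "HOL-Library.Landau_Symbols"
begin

text \<open>Functions on I = [0,1] are modelled as real => real; only their values on [0,1] matter.\<close>

definition L2 :: "(real \<Rightarrow> real) \<Rightarrow> bool" where
  "L2 x \<longleftrightarrow> (\<lambda>t. indicator {0..1} t * x t) \<in> borel_measurable lborel
          \<and> set_integrable lborel {0..1} (\<lambda>t. (x t)^2)"

definition l2norm :: "(real \<Rightarrow> real) \<Rightarrow> real" where
  "l2norm x = sqrt (LBINT t:{0..1}. (x t)^2)"

definition lin :: "(real \<Rightarrow> real) \<Rightarrow> (real \<Rightarrow> real) \<Rightarrow> real" where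
  "lin \<beta> x = (LBINT t:{0..1}. \<beta> t * x t)"

text \<open>Sobolev space H^m(I): d 0 = beta, d j absolutely continuous on [0,1] with
  derivative d (j+1) (j < m), and the m-th derivative d m in L^2(I).\<close>
definition sob_witness :: "nat \<Rightarrow> (real \<Rightarrow> real) \<Rightarrow> (nat \<Rightarrow> real \<Rightarrow> real) \<Rightarrow> bool" where
  "sob_witness m \<beta> d \<longleftrightarrow> d 0 = \<beta> \<and>
     (\<forall>j<m. set_integrable lborel {0..1} (d (Suc j)) \<and>
            (\<forall>t\<in>{0..1}. d j t = d j 0 + (LBINT u:{0..t}. d (Suc j) u))) \<and>
     L2 (d m)"

definition sobolev :: "nat \<Rightarrow> (real \<Rightarrow> real) set" where
  "sobolev m = {\<beta>. \<exists>d. sob_witness m \<beta> d}"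

definition sob_deriv :: "nat \<Rightarrow> (real \<Rightarrow> real) \<Rightarrow> real \<Rightarrow> real" where
  "sob_deriv m \<beta> = (SOME d. sob_witness m \<beta> d) m"

definition Jpen :: "nat \<Rightarrow> (real \<Rightarrow> real) \<Rightarrow> (real \<Rightarrow> real) \<Rightarrow> real" where
  "Jpen m \<beta>1 \<beta>2 = (LBINT t:{0..1}. sob_deriv m \<beta>1 t * sob_deriv m \<beta>2 t)"

definition Hspace :: "nat \<Rightarrow> (real \<times> (real \<Rightarrow> real)) set" where
  "Hspace m = UNIV \<times> sobolev m"

definition check_fun :: "real \<Rightarrow> real \<Rightarrow> real" where
  "check_fun \<tau> u = u * (\<tau> - (if u < 0 then 1 else 0))"

definition kh :: "(real \<Rightarrow> real) \<Rightarrow> real \<Rightarrow> real \<Rightarrow> real" where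
  "kh k h v = k (v / h) / h"

definition Kbar :: "(real \<Rightarrow> real) \<Rightarrow> real \<Rightarrow> real" where
  "Kbar k u = (LBINT v:{..u}. k v)"

definition resid :: "real \<times> (real \<Rightarrow> real) \<Rightarrow> (real \<Rightarrow> real) \<Rightarrow> real \<Rightarrow> real" where
  "resid \<theta> x y = y - fst \<theta> - lin (snd \<theta>) x"

definition Rh :: "'a measure \<Rightarrow> ('a \<Rightarrow> real \<Rightarrow> real) \<Rightarrow> ('a \<Rightarrow> real) \<Rightarrow> (real \<Rightarrow> real)
                  \<Rightarrow> real \<Rightarrow> real \<Rightarrow> real \<times> (real \<Rightarrow> real) \<Rightarrow> real" where
  "Rh M X Y k h \<tau> \<theta> =
     (\<integral>\<omega>. (LBINT u. check_fun \<tau> u * kh k h (u - resid \<theta> (X \<omega>) (Y \<omega>))) \<partial>M)"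

definition ell :: "'a measure \<Rightarrow> ('a \<Rightarrow> real \<Rightarrow> real) \<Rightarrow> ('a \<Rightarrow> real) \<Rightarrow> (real \<Rightarrow> real)
                  \<Rightarrow> real \<Rightarrow> nat \<Rightarrow> real \<Rightarrow> real \<Rightarrow> real \<times> (real \<Rightarrow> real) \<Rightarrow> real" where
  "ell M X Y k h m \<tau> lam \<theta> = Rh M X Y k h \<tau> \<theta> + lam / 2 * Jpen m (snd \<theta>) (snd \<theta>)"

definition is_minimizer :: "'a measure \<Rightarrow> ('a \<Rightarrow> real \<Rightarrow> real) \<Rightarrow> ('a \<Rightarrow> real) \<Rightarrow> (real \<Rightarrow> real)
                  \<Rightarrow> real \<Rightarrow> nat \<Rightarrow> real \<Rightarrow> real \<Rightarrow> real \<times> (real \<Rightarrow> real) \<Rightarrow> bool" where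
  "is_minimizer M X Y k h m \<tau> lam \<theta> \<longleftrightarrow> \<theta> \<in> Hspace m \<and>
     (\<forall>\<theta>'\<in>Hspace m. ell M X Y k h m \<tau> lam \<theta> \<le> ell M X Y k h m \<tau> lam \<theta>')"

definition cdf :: "((real \<Rightarrow> real) \<Rightarrow> real \<Rightarrow> real) \<Rightarrow> (real \<Rightarrow> real) \<Rightarrow> real \<Rightarrow> real" where
  "cdf f x y = (LBINT u:{..y}. f x u)"

definition cond_quantile :: "((real \<Rightarrow> real) \<Rightarrow> real \<Rightarrow> real) \<Rightarrow> (real \<Rightarrow> real) \<Rightarrow> real \<Rightarrow> real" where
  "cond_quantile f x \<tau> = Inf {y. \<tau> \<le> cdf f x y}"

text \<open>sigma-algebra generated by the L^2-valued random element X (generated by the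
  coordinates int g X, g in L^2).\<close>
definition sigmaX :: "'a measure \<Rightarrow> ('a \<Rightarrow> real \<Rightarrow> real) \<Rightarrow> 'a measure" where
  "sigmaX M X = sigma (space M)
     {(\<lambda>\<omega>. lin g (X \<omega>)) -` B \<inter> space M | g B. L2 g \<and> B \<in> sets borel}"

definition is_cond_density :: "'a measure \<Rightarrow> ('a \<Rightarrow> real \<Rightarrow> real) \<Rightarrow> ('a \<Rightarrow> real)
                  \<Rightarrow> ((real \<Rightarrow> real) \<Rightarrow> real \<Rightarrow> real) \<Rightarrow> bool" where
  "is_cond_density M X Y f \<longleftrightarrow>
     (\<forall>\<omega>\<in>space M. (\<forall>u. 0 \<le> f (X \<omega>) u) \<and> integrable lborel (f (X \<omega>))) \<and>
     (\<forall>y. (\<lambda>\<omega>. cdf f (X \<omega>) y) \<in> borel_measurable (sigmaX M X) \<and>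
          (\<forall>A\<in>sets (sigmaX M X).
             measure M (A \<inter> {\<omega>\<in>space M. Y \<omega> \<le> y}) = (LINT \<omega>:A|M. cdf f (X \<omega>) y)))"

definition supp :: "'a measure \<Rightarrow> ('a \<Rightarrow> real \<Rightarrow> real) \<Rightarrow> (real \<Rightarrow> real) set" where
  "supp M X = {x. L2 x \<and>
     (\<forall>\<delta>>0. 0 < measure M {\<omega>\<in>space M. l2norm (\<lambda>t. X \<omega> t - x t) < \<delta>})}"

definition Btau :: "((real \<Rightarrow> real) \<Rightarrow> real \<Rightarrow> real) \<Rightarrow> (real \<Rightarrow> real) \<Rightarrow> (real \<Rightarrow> real \<Rightarrow> real)
                  \<Rightarrow> real \<Rightarrow> (real \<Rightarrow> real) \<Rightarrow> real" where
  "Btau f \<alpha>0 \<beta>0 \<tau> x = f x (\<alpha>0 \<tau> + lin (\<beta>0 \<tau>) x)"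

definition Cov :: "'a measure \<Rightarrow> ('a \<Rightarrow> real \<Rightarrow> real) \<Rightarrow> ((real \<Rightarrow> real) \<Rightarrow> real \<Rightarrow> real)
                  \<Rightarrow> (real \<Rightarrow> real) \<Rightarrow> (real \<Rightarrow> real \<Rightarrow> real) \<Rightarrow> real \<Rightarrow> real \<Rightarrow> real \<Rightarrow> real" where
  "Cov M X f \<alpha>0 \<beta>0 \<tau> s t = (\<integral>\<omega>. Btau f \<alpha>0 \<beta>0 \<tau> (X \<omega>) * X \<omega> s * X \<omega> t \<partial>M)"

definition Vform :: "'a measure \<Rightarrow> ('a \<Rightarrow> real \<Rightarrow> real) \<Rightarrow> ((real \<Rightarrow> real) \<Rightarrow> real \<Rightarrow> real)
                  \<Rightarrow> (real \<Rightarrow> real) \<Rightarrow> (real \<Rightarrow> real \<Rightarrow> real) \<Rightarrow> real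
                  \<Rightarrow> (real \<Rightarrow> real) \<Rightarrow> (real \<Rightarrow> real) \<Rightarrow> real" where
  "Vform M X f \<alpha>0 \<beta>0 \<tau> \<beta> \<beta>' =
     (LBINT t:{0..1}. LBINT s:{0..1}. Cov M X f \<alpha>0 \<beta>0 \<tau> s t * \<beta> t * \<beta>' s)"

definition thnorm :: "'a measure \<Rightarrow> ('a \<Rightarrow> real \<Rightarrow> real) \<Rightarrow> ((real \<Rightarrow> real) \<Rightarrow> real \<Rightarrow> real)
                  \<Rightarrow> (real \<Rightarrow> real) \<Rightarrow> (real \<Rightarrow> real \<Rightarrow> real) \<Rightarrow> nat \<Rightarrow> real \<Rightarrow> real
                  \<Rightarrow> real \<times> (real \<Rightarrow> real) \<Rightarrow> real" where
  "thnorm M X f \<alpha>0 \<beta>0 m \<tau> lam \<theta> =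
     sqrt ((\<integral>\<omega>. Btau f \<alpha>0 \<beta>0 \<tau> (X \<omega>) * (fst \<theta> + lin (snd \<theta>) (X \<omega>))^2 \<partial>M)
           + lam * Jpen m (snd \<theta>) (snd \<theta>))"

end

theory Submission
  imports Defs
begin

text \<open>With d(X) = (a - \<alpha>_0) + \<integral>(\<beta> - \<beta>_0)X, the excess risk R_h(\<theta>) - R_h(\<theta>_0) is the expectation of the gain
  \<integral>k(v) (P(q - hv + d) - P(q - hv)) dv - \<tau> d at d = d(X), where P is an antiderivative of the conditional
  cdf and q the conditional quantile. Its slope at d = 0 is O(h^(s+1)) by Taylor expansion and the vanishing
  moments of k. Since k may take negative values, R_h need not be convex; but the fourth moment condition makes
  it strongly convex in the norm (E d(X)^2)^(1/2) on a ball of fixed radius r, while outside that ball the convexity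
  of the unsmoothed risk and |R_h - R| = O(h) keep the objective above its value at \<theta>_0. Hence for small
  \<lambda> all minimizers lie in the ball, where existence follows by completeness of \<real> \<times> H^m and uniqueness by strict
  convexity, and comparison with \<theta>_0 gives E d(X)^2 + \<lambda> J = O(h^(2s+2) + \<lambda>) = O(\<lambda>).

  Completeness needs control of the polynomial part of \<beta> (the null space of J), which comes from the
  injectivity of the covariance operator C. As B_\<tau>(X) is only almost everywhere equal to a
  measurable function, C is first shown to be positive semidefinite through the expansion in the \<phi>_\<nu>; then
  C(t,t) = 0 forces C(.,t) = 0, so by injectivity the diagonal vanishes only on a null set, and elsewhere
  B_\<tau>(X) may be replaced by its measurable version.\<close>

subsection \<open>Square integrable functions\<close>

text \<open>Smoothness of the density is given only on the support of X and measurability only for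
  the conditional cdf. So the excess risk is computed without integrating a density over the sample
  space, and separability of L2 is proved to place X in its support almost surely. The radius r
  comes from the Taylor error L E|d|^3: the fourth moment bound turns it into L \<open>K4\<close> (E
  d^2)^(3/2), a small share of the curvature c E d^2, c = 1/C1, once (E d^2)^(1/2) \<le> r with r of
  order c/(L \<open>K4\<close> + 1). None of L, \<open>K4\<close>, c, r depends on the quantile
  level, hence the uniformity. For the same reason the covariance operator is examined at the lower
  end of the quantile range only: it serves to make E d^2 a norm, which does not involve B_\<tau>,
  and the weights of other levels enter only through the bounds 1/C1 and C1. The possible negativity
  of k forces two-sided estimates: each comparison of a smoothed with an unsmoothed quantity bounds
  an absolute value by absolute moments of k.\<close>

definition sq_int :: "'a measure \<Rightarrow> ('a \<Rightarrow> real) \<Rightarrow> bool" where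
  "sq_int M f \<longleftrightarrow> f \<in> borel_measurable M \<and> integrable M (\<lambda>x. (f x)\<^sup>2)"

lemma sq_int_integrable: "sq_int M f \<Longrightarrow> integrable M (\<lambda>x. (f x)\<^sup>2)"
  by (simp add: sq_int_def)

lemma sq_int_mult:
  assumes "sq_int M f" "sq_int M g"
  shows "integrable M (\<lambda>x. f x * g x)"
proof (rule Bochner_Integration.integrable_bound)
  show "integrable M (\<lambda>x. (f x)\<^sup>2 + (g x)\<^sup>2)"
    using assms by (auto simp: sq_int_def)
  show "(\<lambda>x. f x * g x) \<in> borel_measurable M"
    using assms by (auto simp: sq_int_def)
  have "\<bar>a * b\<bar> \<le> a\<^sup>2 + b\<^sup>2" for a b :: real
  proof -
    have "2 * (\<bar>a\<bar> * \<bar>b\<bar>) \<le> a\<^sup>2 + b\<^sup>2" "0 \<le> \<bar>a\<bar> * \<bar>b\<bar>"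
      using sum_squares_bound[of "\<bar>a\<bar>" "\<bar>b\<bar>"] by (simp_all add: mult.assoc)
    then show ?thesis unfolding abs_mult by linarith
  qed
  then show "AE x in M. norm (f x * g x) \<le> norm ((f x)\<^sup>2 + (g x)\<^sup>2)"
    by simp
qed

lemma sq_int_cmult: "sq_int M f \<Longrightarrow> sq_int M (\<lambda>x. c * f x)"
  by (auto simp: sq_int_def power_mult_distrib)

lemma sq_int_add:
  assumes "sq_int M f" "sq_int M g"
  shows "sq_int M (\<lambda>x. f x + g x)"
  using assms sq_int_mult[OF assms]
  by (auto simp: sq_int_def power2_sum mult.assoc)

lemma sq_int_diff:
  assumes "sq_int M f" "sq_int M g"
  shows "sq_int M (\<lambda>x. f x - g x)"
  using sq_int_add[OF assms(1) sq_int_cmult[OF assms(2), of "-1"]] by simp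

lemma sq_int_bound:
  assumes "sq_int M f" "g \<in> borel_measurable M" "\<And>x. \<bar>g x\<bar> \<le> \<bar>f x\<bar>"
  shows "sq_int M g"
  unfolding sq_int_def
proof
  show "integrable M (\<lambda>x. (g x)\<^sup>2)"
    by (rule Bochner_Integration.integrable_bound[OF sq_int_integrable[OF assms(1)]])
       (use assms in \<open>auto simp: abs_le_square_iff\<close>)
qed (use assms in auto)

text \<open>Expands the integral of (a g - b f)^2, which is nonnegative, with a = \<integral>f^2 and
  b = \<integral>f g; it equals a times the claimed difference. The degenerate case a = 0 forces f =
  0 almost everywhere.\<close>

lemma Cauchy_Schwarz_integral:
  assumes f: "sq_int M f" and g: "sq_int M g"
  shows "(\<integral>x. f x * g x \<partial>M)\<^sup>2 \<le> (\<integral>x. (f x)\<^sup>2 \<partial>M) * (\<integral>x. (g x)\<^sup>2 \<partial>M)"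
proof -
  define a b c where "a = (\<integral>x. (f x)\<^sup>2 \<partial>M)" and "b = (\<integral>x. f x * g x \<partial>M)" and "c = (\<integral>x. (g x)\<^sup>2 \<partial>M)"
  have a: "a \<ge> 0" unfolding a_def by simp
  show ?thesis
  proof (cases "a = 0")
    case True
    have "AE x in M. (f x)\<^sup>2 = 0"
      using integral_nonneg_eq_0_iff_AE[OF sq_int_integrable[OF f]] True by (simp add: a_def)
    then have "b = (\<integral>x. 0 \<partial>M)"
      unfolding b_def using f g by (intro integral_cong_AE) (auto simp: sq_int_def)
    then show ?thesis unfolding a_def[symmetric] b_def[symmetric] c_def[symmetric] True by simp
  next
    case False
    have "0 \<le> (\<integral>x. (a * g x - b * f x)\<^sup>2 \<partial>M)" by simp
    also have "\<dots> = (\<integral>x. a\<^sup>2 * (g x)\<^sup>2 - 2 * a * b * (f x * g x) + b\<^sup>2 * (f x)\<^sup>2 \<partial>M)"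
      by (intro Bochner_Integration.integral_cong) (auto simp: power2_eq_square algebra_simps)
    also have "\<dots> = a\<^sup>2 * c - 2 * a * b * b + b\<^sup>2 * a"
      using sq_int_mult[OF f g] sq_int_integrable[OF f] sq_int_integrable[OF g]
      by (simp add: a_def b_def c_def)
    also have "\<dots> = a * (a * c - b\<^sup>2)" by (simp add: power2_eq_square algebra_simps)
    finally have "b\<^sup>2 \<le> a * c" using a False by (simp add: zero_le_mult_iff)
    then show ?thesis by (simp add: a_def b_def c_def)
  qed
qed

lemma integral_abs_mult_le_sqrt:
  assumes f: "sq_int M f" and g: "sq_int M g"
  shows "(\<integral>x. \<bar>f x * g x\<bar> \<partial>M) \<le> sqrt (\<integral>x. (f x)\<^sup>2 \<partial>M) * sqrt (\<integral>x. (g x)\<^sup>2 \<partial>M)"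
proof -
  have "sq_int M (\<lambda>x. \<bar>f x\<bar>)" "sq_int M (\<lambda>x. \<bar>g x\<bar>)" using f g by (auto simp: sq_int_def)
  from Cauchy_Schwarz_integral[OF this] show ?thesis
    by (simp add: abs_mult real_sqrt_mult[symmetric] real_le_rsqrt)
qed

lemma integral_square_add_le:
  assumes f: "sq_int M f" and g: "sq_int M g"
  shows "(\<integral>x. (f x + g x)\<^sup>2 \<partial>M) \<le> 2 * (\<integral>x. (f x)\<^sup>2 \<partial>M) + 2 * (\<integral>x. (g x)\<^sup>2 \<partial>M)"
proof -
  have "(\<integral>x. (f x + g x)\<^sup>2 \<partial>M) \<le> (\<integral>x. 2 * (f x)\<^sup>2 + 2 * (g x)\<^sup>2 \<partial>M)"
  proof (rule integral_mono)
    show "integrable M (\<lambda>x. (f x + g x)\<^sup>2)" using sq_int_add[OF f g] by (simp add: sq_int_def)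
    show "integrable M (\<lambda>x. 2 * (f x)\<^sup>2 + 2 * (g x)\<^sup>2)" using f g by (simp add: sq_int_def)
    show "(f x + g x)\<^sup>2 \<le> 2 * (f x)\<^sup>2 + 2 * (g x)\<^sup>2" for x
      using zero_le_power2[of "f x - g x"] by (simp add: power2_eq_square algebra_simps)
  qed
  then show ?thesis using f g by (simp add: sq_int_def)
qed

lemma sqrt_integral_square_triangle:
  assumes f: "sq_int M f" and g: "sq_int M g"
  shows "sqrt (\<integral>x. (f x + g x)\<^sup>2 \<partial>M) \<le> sqrt (\<integral>x. (f x)\<^sup>2 \<partial>M) + sqrt (\<integral>x. (g x)\<^sup>2 \<partial>M)"
proof (rule real_le_lsqrt)
  have "(\<integral>x. f x * g x \<partial>M) \<le> (\<integral>x. \<bar>f x * g x\<bar> \<partial>M)"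
    using sq_int_mult[OF f g] by (intro integral_mono) auto
  also note integral_abs_mult_le_sqrt[OF f g]
  finally have *: "(\<integral>x. f x * g x \<partial>M) \<le> sqrt (\<integral>x. (f x)\<^sup>2 \<partial>M) * sqrt (\<integral>x. (g x)\<^sup>2 \<partial>M)" .
  have "(\<integral>x. (f x + g x)\<^sup>2 \<partial>M) = (\<integral>x. (f x)\<^sup>2 + (g x)\<^sup>2 + 2 * (f x * g x) \<partial>M)"
    by (intro Bochner_Integration.integral_cong) (auto simp: power2_sum)
  also have "\<dots> = (\<integral>x. (f x)\<^sup>2 \<partial>M) + (\<integral>x. (g x)\<^sup>2 \<partial>M) + 2 * (\<integral>x. f x * g x \<partial>M)"
    using sq_int_mult[OF f g] f g by (simp add: sq_int_def)
  also have "\<dots> \<le> (sqrt (\<integral>x. (f x)\<^sup>2 \<partial>M) + sqrt (\<integral>x. (g x)\<^sup>2 \<partial>M))\<^sup>2"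
    using * by (simp add: power2_sum)
  finally show "(\<integral>x. (f x + g x)\<^sup>2 \<partial>M) \<le> (sqrt (\<integral>x. (f x)\<^sup>2 \<partial>M) + sqrt (\<integral>x. (g x)\<^sup>2 \<partial>M))\<^sup>2" .
qed auto

text \<open>The rate 4^-i leaves room for a weight 2^i, which is what turns summable squared
  distances into summable increments.\<close>

lemma Cauchy_fast_subseq:
  fixes d :: "nat \<Rightarrow> nat \<Rightarrow> real"
  assumes "\<And>e. e > 0 \<Longrightarrow> \<exists>N. \<forall>m\<ge>N. \<forall>n\<ge>N. d m n < e"
  obtains r :: "nat \<Rightarrow> nat" where "strict_mono r" "\<And>i. d (r i) (r (Suc i)) < (1/4) ^ i"
proof -
  have "\<forall>i. \<exists>N. \<forall>m\<ge>N. \<forall>n\<ge>N. d m n < (1/4) ^ i" using assms by auto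
  then obtain N where N: "\<And>i m n. m \<ge> N i \<Longrightarrow> n \<ge> N i \<Longrightarrow> d m n < (1/4) ^ i" by metis
  define r where "r = rec_nat (N 0) (\<lambda>i p. Suc p + N (Suc i))"
  have r: "strict_mono r" by (auto simp: strict_mono_Suc_iff r_def)
  have ge: "r i \<ge> N i" for i by (cases i) (auto simp: r_def)
  have "d (r i) (r (Suc i)) < (1/4) ^ i" for i
    using N[of i "r i" "r (Suc i)"] ge[of i] strict_monoD[OF r, of i "Suc i"] by auto
  with r show ?thesis by (rule that)
qed

text \<open>The measure may be infinite, so increments are not controlled in L1. Along the fast
  subsequence the sum of 2^i |f_i - f_(i+1)|^2 is finite almost everywhere, which makes the
  increments absolutely summable pointwise; Fatou's lemma in the index of the subsequence then gives
  convergence of the whole sequence.\<close>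

lemma Riesz_Fischer_L2:
  assumes f: "\<And>n. sq_int M (f n)"
    and C: "\<And>e. e > 0 \<Longrightarrow> \<exists>N. \<forall>m\<ge>N. \<forall>n\<ge>N. (\<integral>x. (f m x - f n x)\<^sup>2 \<partial>M) < e"
  shows "\<exists>g. sq_int M g \<and> (\<lambda>n. \<integral>x. (f n x - g x)\<^sup>2 \<partial>M) \<longlonglongrightarrow> 0"
proof -
  have [measurable]: "f n \<in> borel_measurable M" for n using f by (simp add: sq_int_def)
  obtain r :: "nat \<Rightarrow> nat" where r: "strict_mono r"
    and rb: "\<And>i. (\<integral>x. (f (r i) x - f (r (Suc i)) x)\<^sup>2 \<partial>M) < (1/4) ^ i"
    using Cauchy_fast_subseq[of "\<lambda>m n. \<integral>x. (f m x - f n x)\<^sup>2 \<partial>M", OF C] by blast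
  have nn: "(\<integral>\<^sup>+x. ennreal ((f m x - f n x)\<^sup>2) \<partial>M) = ennreal (\<integral>x. (f m x - f n x)\<^sup>2 \<partial>M)" for m n
    using sq_int_diff[OF f f, of m n] by (intro nn_integral_eq_integral) (auto simp: sq_int_def)
  define u where "u i x = 2 ^ i * (f (r i) x - f (r (Suc i)) x)\<^sup>2" for i x
  have [measurable]: "u i \<in> borel_measurable M" for i unfolding u_def by measurable
  have "(\<integral>\<^sup>+x. ennreal (u i x) \<partial>M) \<le> ennreal ((1/2)^i)" for i
  proof -
    have "(\<integral>\<^sup>+x. ennreal (u i x) \<partial>M) = ennreal (2^i) * (\<integral>\<^sup>+x. ennreal ((f (r i) x - f (r (Suc i)) x)\<^sup>2) \<partial>M)"
      unfolding u_def by (simp add: ennreal_mult nn_integral_cmult del: ennreal_power)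
    also have "\<dots> \<le> ennreal (2^i) * ennreal ((1/4)^i)"
      unfolding nn using rb[of i] by (intro mult_left_mono ennreal_leI) auto
    also have "\<dots> = ennreal ((1/2)^i)"
      by (simp add: ennreal_mult[symmetric] power_mult_distrib[symmetric] del: ennreal_power)
    finally show ?thesis .
  qed
  then have "(\<integral>\<^sup>+x. (\<Sum>i. ennreal (u i x)) \<partial>M) \<le> (\<Sum>i. ennreal ((1/2)^i))"
    by (subst nn_integral_suminf) (auto intro!: suminf_le)
  also have "\<dots> = ennreal (\<Sum>i. (1/2)^i)" by (intro suminf_ennreal2) auto
  also have "\<dots> < \<infinity>" by simp
  finally have "AE x in M. (\<Sum>i. ennreal (u i x)) \<noteq> \<infinity>"
    by (intro nn_integral_noteq_infinite) auto
  then have conv: "AE x in M. convergent (\<lambda>i. f (r i) x)"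
  proof eventually_elim
    case (elim x)
    then have s: "summable (\<lambda>i. u i x)"
      by (intro summable_suminf_not_top) (auto simp: u_def)
    have "summable (\<lambda>i. norm (f (r (Suc i)) x - f (r i) x))"
    proof (rule summable_comparison_test')
      show "summable (\<lambda>i. (1/2)^i + u i x)" by (intro summable_add s) auto
      fix i :: nat
      define w where "w = \<bar>f (r i) x - f (r (Suc i)) x\<bar>"
      have w: "w\<^sup>2 = (f (r i) x - f (r (Suc i)) x)\<^sup>2" by (simp add: w_def)
      \<comment> \<open>Arithmetic-geometric mean inequality in the form 2 w \<le> 2^-i + 2^i w^2:
        it trades the increment for its weighted square.\<close>
      have "0 \<le> (1 - 2^i * w)\<^sup>2 / 2^i" by simp
      also have "\<dots> = (1/2)^i - 2 * w + u i x"
        unfolding u_def w[symmetric] by (simp add: power2_eq_square field_simps)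
      finally have "w \<le> (1/2)^i + u i x" using w_def by linarith
      then show "norm (norm (f (r (Suc i)) x - f (r i) x)) \<le> (1/2)^i + u i x" by (simp add: w_def)
    qed
    then have "summable (\<lambda>i. f (r (Suc i)) x - f (r i) x)" by (rule summable_norm_cancel)
    then have "convergent (\<lambda>n. \<Sum>i<n. f (r (Suc i)) x - f (r i) x)" by (simp add: summable_iff_convergent)
    then have "convergent (\<lambda>n. f (r n) x - f (r 0) x)"
      by (subst (asm) sum_lessThan_telescope[of "\<lambda>i. f (r i) x"])
    from convergent_add[OF this convergent_const[of "f (r 0) x"]] show ?case by simp
  qed
  define g where "g x = lim (\<lambda>i. f (r i) x)" for x
  have [measurable]: "g \<in> borel_measurable M" unfolding g_def by measurable
  have lim: "AE x in M. (\<lambda>i. f (r i) x) \<longlonglongrightarrow> g x"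
    using conv by eventually_elim (simp add: g_def convergent_LIMSEQ_iff)
  have key: "(\<integral>\<^sup>+x. ennreal ((f n x - g x)\<^sup>2) \<partial>M) \<le> ennreal e"
    if N: "\<forall>m\<ge>N. \<forall>n\<ge>N. (\<integral>x. (f m x - f n x)\<^sup>2 \<partial>M) < e" and n: "n \<ge> N" for n N e
  proof -
    have "(\<integral>\<^sup>+x. ennreal ((f n x - g x)\<^sup>2) \<partial>M) = (\<integral>\<^sup>+x. liminf (\<lambda>i. ennreal ((f n x - f (r i) x)\<^sup>2)) \<partial>M)"
    proof (rule nn_integral_cong_AE)
      show "AE x in M. ennreal ((f n x - g x)\<^sup>2) = liminf (\<lambda>i. ennreal ((f n x - f (r i) x)\<^sup>2))"
        using lim
      proof eventually_elim
        case (elim x)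
        have "(\<lambda>i. ennreal ((f n x - f (r i) x)\<^sup>2)) \<longlonglongrightarrow> ennreal ((f n x - g x)\<^sup>2)"
          by (intro tendsto_ennrealI tendsto_power tendsto_diff tendsto_const elim)
        from lim_imp_Liminf[OF _ this] show ?case by simp
      qed
    qed
    also have "\<dots> \<le> liminf (\<lambda>i. \<integral>\<^sup>+x. ennreal ((f n x - f (r i) x)\<^sup>2) \<partial>M)"
      by (intro nn_integral_liminf) auto
    also have "\<dots> \<le> ennreal e"
    proof (rule Liminf_le)
      have "(\<integral>\<^sup>+x. ennreal ((f n x - f (r i) x)\<^sup>2) \<partial>M) \<le> ennreal e" if "i \<ge> N" for i
        unfolding nn using N n that seq_suble[OF r, of i] by (intro ennreal_leI less_imp_le) auto
      then show "\<forall>\<^sub>F i in sequentially. (\<integral>\<^sup>+x. ennreal ((f n x - f (r i) x)\<^sup>2) \<partial>M) \<le> ennreal e"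
        by (auto simp: eventually_sequentially)
    qed simp
    finally show ?thesis .
  qed
  obtain N1 where N1: "\<forall>m\<ge>N1. \<forall>n\<ge>N1. (\<integral>x. (f m x - f n x)\<^sup>2 \<partial>M) < 1" using C[of 1] by auto
  have "sq_int M (\<lambda>x. f N1 x - g x)"
    unfolding sq_int_def
  proof
    have "(\<integral>\<^sup>+x. ennreal (norm ((f N1 x - g x)\<^sup>2)) \<partial>M) \<le> ennreal 1"
      using key[OF N1 order_refl] by simp
    also have "\<dots> < \<infinity>" by simp
    finally show "integrable M (\<lambda>x. (f N1 x - g x)\<^sup>2)" by (intro integrableI_bounded) auto
  qed simp
  from sq_int_diff[OF f[of N1] this] have g: "sq_int M g" by simp
  have "(\<lambda>n. \<integral>x. (f n x - g x)\<^sup>2 \<partial>M) \<longlonglongrightarrow> 0"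
  proof (rule LIMSEQ_I)
    fix e :: real assume "e > 0"
    then obtain N where N: "\<forall>m\<ge>N. \<forall>n\<ge>N. (\<integral>x. (f m x - f n x)\<^sup>2 \<partial>M) < e/2" using C[of "e/2"] by auto
    have "(\<integral>x. (f n x - g x)\<^sup>2 \<partial>M) \<le> e/2" if "n \<ge> N" for n
    proof -
      have "ennreal (\<integral>x. (f n x - g x)\<^sup>2 \<partial>M) \<le> ennreal (e/2)"
        using key[OF N that] sq_int_diff[OF f g, of n]
        by (subst nn_integral_eq_integral[symmetric]) (auto simp: sq_int_def)
      then show ?thesis using \<open>e > 0\<close> by (subst (asm) ennreal_le_iff) auto
    qed
    then have "norm ((\<integral>x. (f n x - g x)\<^sup>2 \<partial>M) - 0) < e" if "n \<ge> N" for n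
      using \<open>e > 0\<close> that by (simp add: le_less_trans[of _ "e/2"])
    then show "\<exists>no. \<forall>n\<ge>no. norm ((\<integral>x. (f n x - g x)\<^sup>2 \<partial>M) - 0) < e" by blast
  qed
  with g show ?thesis by blast
qed

subsection \<open>Functions on the unit interval\<close>

text \<open>Extension by zero. Only values on the unit interval carry meaning, and after
  \<open>cut01\<close> interval integrals become integrals over the line, so the facts about
  \<open>sq_int\<close> apply to paths of X and to Sobolev functions alike.\<close>

definition cut01 :: "(real \<Rightarrow> real) \<Rightarrow> real \<Rightarrow> real" where
  "cut01 x t = indicator {0..1} t * x t"

lemma cut01_add: "cut01 (\<lambda>t. x t + y t) = (\<lambda>t. cut01 x t + cut01 y t)"
  and cut01_diff: "cut01 (\<lambda>t. x t - y t) = (\<lambda>t. cut01 x t - cut01 y t)"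
  and cut01_cmult: "cut01 (\<lambda>t. c * x t) = (\<lambda>t. c * cut01 x t)"
  by (auto simp: cut01_def fun_eq_iff algebra_simps)

lemma cut01_eqI: "(\<And>t. t \<in> {0..1} \<Longrightarrow> x t = y t) \<Longrightarrow> cut01 x = cut01 y"
  by (auto simp: cut01_def fun_eq_iff indicator_def)

lemma cut01_square: "(cut01 x t)\<^sup>2 = indicator {0..1} t *\<^sub>R (x t)\<^sup>2"
  by (simp add: cut01_def indicator_def)

lemma L2_iff_sq_int: "L2 x \<longleftrightarrow> sq_int lborel (cut01 x)"
  unfolding L2_def sq_int_def set_integrable_def cut01_square by (simp add: cut01_def[abs_def])

lemma l2norm_eq: "l2norm x = sqrt (\<integral>t. (cut01 x t)\<^sup>2 \<partial>lborel)"
  by (simp add: l2norm_def set_lebesgue_integral_def cut01_square)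

lemma l2norm_square: "(l2norm x)\<^sup>2 = (\<integral>t. (cut01 x t)\<^sup>2 \<partial>lborel)"
  by (simp add: l2norm_eq)

lemma l2norm_nonneg [simp]: "0 \<le> l2norm x"
  by (simp add: l2norm_eq)

lemma lin_eq: "lin b x = (\<integral>t. cut01 b t * cut01 x t \<partial>lborel)"
  unfolding lin_def set_lebesgue_integral_def
  by (intro Bochner_Integration.integral_cong) (auto simp: cut01_def indicator_def)

lemma L2_measurable: "L2 x \<Longrightarrow> cut01 x \<in> borel_measurable lborel"
  by (simp add: L2_iff_sq_int sq_int_def)

lemma L2_cong: "cut01 x = cut01 y \<Longrightarrow> L2 x \<longleftrightarrow> L2 y"
  by (simp add: L2_iff_sq_int)

lemma L2_add: "L2 x \<Longrightarrow> L2 y \<Longrightarrow> L2 (\<lambda>t. x t + y t)"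
  and L2_diff: "L2 x \<Longrightarrow> L2 y \<Longrightarrow> L2 (\<lambda>t. x t - y t)"
  and L2_cmult: "L2 x \<Longrightarrow> L2 (\<lambda>t. c * x t)"
  by (simp_all add: L2_iff_sq_int cut01_add cut01_diff cut01_cmult sq_int_add sq_int_diff sq_int_cmult)

lemma lin_add: "L2 b \<Longrightarrow> L2 c \<Longrightarrow> L2 x \<Longrightarrow> lin (\<lambda>t. b t + c t) x = lin b x + lin c x"
  and lin_diff: "L2 b \<Longrightarrow> L2 c \<Longrightarrow> L2 x \<Longrightarrow> lin (\<lambda>t. b t - c t) x = lin b x - lin c x"
  by (simp_all add: L2_iff_sq_int lin_eq cut01_add cut01_diff sq_int_mult algebra_simps)

lemma lin_cmult: "lin (\<lambda>t. a * b t) x = a * lin b x"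
  by (simp add: lin_eq cut01_cmult mult.assoc)

lemma abs_lin_le: "L2 b \<Longrightarrow> L2 x \<Longrightarrow> \<bar>lin b x\<bar> \<le> l2norm b * l2norm x"
  unfolding lin_eq L2_iff_sq_int l2norm_eq
  by (rule order_trans[OF integral_abs_bound integral_abs_mult_le_sqrt])

lemma l2norm_triangle: "L2 x \<Longrightarrow> L2 y \<Longrightarrow> l2norm (\<lambda>t. x t + y t) \<le> l2norm x + l2norm y"
  unfolding L2_iff_sq_int l2norm_eq cut01_add by (rule sqrt_integral_square_triangle)

lemma l2norm_cmult: "l2norm (\<lambda>t. c * x t) = \<bar>c\<bar> * l2norm x"
  by (simp add: l2norm_eq cut01_cmult power_mult_distrib real_sqrt_mult)

lemma l2norm_minus_commute: "l2norm (\<lambda>t. x t - y t) = l2norm (\<lambda>t. y t - x t)"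
  using l2norm_cmult[of "-1" "\<lambda>t. x t - y t"] by simp

lemma L2_bounded:
  assumes [measurable]: "cut01 x \<in> borel_measurable lborel" and b: "\<And>t. t \<in> {0..1} \<Longrightarrow> \<bar>x t\<bar> \<le> B"
  shows "L2 x" "l2norm x \<le> B"
proof -
  have B: "0 \<le> B" using b[of 0] by auto
  have i: "integrable lborel (\<lambda>t. B\<^sup>2 * indicator {0..1::real} t)" by simp
  have le: "(cut01 x t)\<^sup>2 \<le> B\<^sup>2 * indicator {0..1} t" for t
    using b[of t] B abs_le_square_iff[of "x t" B] by (auto simp: cut01_def indicator_def)
  have s: "sq_int lborel (cut01 x)" unfolding sq_int_def
    by (intro conjI assms Bochner_Integration.integrable_bound[OF i]) (use le in auto)
  then show "L2 x" by (simp add: L2_iff_sq_int)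
  have "(\<integral>t. (cut01 x t)\<^sup>2 \<partial>lborel) \<le> (\<integral>t. B\<^sup>2 * indicator {0..1::real} t \<partial>lborel)"
    by (intro integral_mono sq_int_integrable[OF s] i le)
  also have "\<dots> = B\<^sup>2" by simp
  finally show "l2norm x \<le> B" unfolding l2norm_eq using B by (simp add: real_le_lsqrt)
qed

lemma L2_continuous:
  assumes "continuous_on {0..1} x"
  shows "L2 x"
proof -
  obtain B where "\<And>t. t \<in> {0..1} \<Longrightarrow> norm (x t) \<le> B"
    using compact_imp_bounded[OF compact_continuous_image[OF assms compact_Icc]]
    unfolding bounded_iff by blast
  then show ?thesis
    using borel_measurable_continuous_on_indicator[OF _ assms]
    by (intro L2_bounded(1)[of x B]) (auto simp: cut01_def[abs_def])
qed

lemma l2norm_dominated_convergence: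
  assumes "L2 u" and U: "\<And>i. U i \<in> borel_measurable borel" and le: "\<And>i t. \<bar>U i t\<bar> \<le> \<bar>u t\<bar>"
    and lim: "\<And>t. (\<lambda>i. U i t) \<longlonglongrightarrow> u t"
  shows "(\<lambda>i. l2norm (\<lambda>t. u t - U i t)) \<longlonglongrightarrow> 0"
proof -
  have s: "sq_int lborel (cut01 u)" using assms by (simp add: L2_iff_sq_int)
  have m[measurable]: "cut01 u \<in> borel_measurable borel" using s by (simp add: sq_int_def)
  have m2[measurable]: "cut01 (U i) \<in> borel_measurable borel" for i using U unfolding cut01_def[abs_def] by measurable
  have "(\<lambda>i. \<integral>t. (cut01 (\<lambda>t. u t - U i t) t)\<^sup>2 \<partial>lborel) \<longlonglongrightarrow> (\<integral>t. 0 \<partial>(lborel :: real measure))"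
  proof (rule integral_dominated_convergence[where w="\<lambda>t. 4 * (cut01 u t)\<^sup>2"])
    show "AE t in lborel. (\<lambda>i. (cut01 (\<lambda>t. u t - U i t) t)\<^sup>2) \<longlonglongrightarrow> 0"
    proof (rule AE_I2)
      fix t
      have "(\<lambda>i. (indicator {0..1} t * (u t - U i t))\<^sup>2) \<longlonglongrightarrow> (indicator {0..1} t * (u t - u t))\<^sup>2"
        by (intro tendsto_intros lim)
      then show "(\<lambda>i. (cut01 (\<lambda>t. u t - U i t) t)\<^sup>2) \<longlonglongrightarrow> 0" by (simp add: cut01_def)
    qed
    show "AE t in lborel. norm ((cut01 (\<lambda>t. u t - U i t) t)\<^sup>2) \<le> 4 * (cut01 u t)\<^sup>2" for i
    proof (rule AE_I2)
      fix t
      have "\<bar>u t - U i t\<bar> \<le> \<bar>2 * u t\<bar>" using le[of i t] by linarith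
      then have "(u t - U i t)\<^sup>2 \<le> 4 * (u t)\<^sup>2" unfolding abs_le_square_iff by (simp add: power_mult_distrib)
      then show "norm ((cut01 (\<lambda>t. u t - U i t) t)\<^sup>2) \<le> 4 * (cut01 u t)\<^sup>2" by (auto simp: cut01_def indicator_def)
    qed
  qed (use s in \<open>auto simp: sq_int_def cut01_diff\<close>)
  from tendsto_real_sqrt[OF this] show ?thesis by (simp add: l2norm_eq)
qed

section \<open>Separability of L2 on the unit interval\<close>

definition step :: "(rat \<times> rat) list \<Rightarrow> real \<Rightarrow> real" where
  "step l t = (\<Sum>(c, q)\<leftarrow>l. of_rat c * indicator {..of_rat q} t)"

lemma L2_step: "L2 (step l)"
proof (induction l)
  case Nil
  then show ?case using L2_continuous[of "\<lambda>_. 0"] by (simp add: step_def[abs_def])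
next
  case (Cons p l)
  obtain c q where p: "p = (c, q)" by (cases p)
  have "L2 (indicator {..of_rat q})"
    by (rule L2_bounded(1)[where B=1]) (auto simp: cut01_def[abs_def] indicator_def)
  from L2_add[OF L2_cmult[OF this, of "of_rat c"] Cons.IH] show ?case
    by (simp add: step_def[abs_def] p)
qed

text \<open>Membership in the closure of the family \<open>step\<close>. That family is indexed by
  lists of rational pairs, hence countable; half-lines rather than intervals are used because they
  generate the Borel sets and are stable under intersection.\<close>

definition step_approx :: "(real \<Rightarrow> real) \<Rightarrow> bool" where
  "step_approx x \<longleftrightarrow> L2 x \<and> (\<forall>e>0. \<exists>l. l2norm (\<lambda>t. x t - step l t) < e)"

lemma step_approx_L2: "step_approx x \<Longrightarrow> L2 x" by (simp add: step_approx_def)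

lemma step_approx_cong: "cut01 x = cut01 y \<Longrightarrow> step_approx x \<longleftrightarrow> step_approx y"
  by (simp add: step_approx_def L2_iff_sq_int l2norm_eq cut01_diff)

lemma step_approx_add:
  assumes x: "step_approx x" and y: "step_approx y"
  shows "step_approx (\<lambda>t. x t + y t)"
  unfolding step_approx_def
proof (intro conjI allI impI)
  show "L2 (\<lambda>t. x t + y t)" using assms by (intro L2_add step_approx_L2)
  fix e :: real assume "e > 0"
  then obtain l l' where l: "l2norm (\<lambda>t. x t - step l t) < e/2" "l2norm (\<lambda>t. y t - step l' t) < e/2"
    using x y unfolding step_approx_def by (meson half_gt_zero)
  have "l2norm (\<lambda>t. (x t - step l t) + (y t - step l' t)) \<le> l2norm (\<lambda>t. x t - step l t) + l2norm (\<lambda>t. y t - step l' t)"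
    by (intro l2norm_triangle L2_diff L2_step step_approx_L2 assms)
  also have "\<dots> < e" using l by simp
  also have "(\<lambda>t. (x t - step l t) + (y t - step l' t)) = (\<lambda>t. x t + y t - step (l @ l') t)"
    by (auto simp: step_def)
  finally show "\<exists>l. l2norm (\<lambda>t. x t + y t - step l t) < e" by blast
qed

text \<open>A real factor destroys rationality of the coefficients, so c is replaced by a rational r
  and the error is split into (c - r) x and r times the error for x. The offsets by 1 in
  \<open>n\<close> and \<open>a\<close> keep the divisions legitimate when the norm of x or r
  vanishes.\<close>

lemma step_approx_cmult:
  assumes x: "step_approx x"
  shows "step_approx (\<lambda>t. c * x t)"
  unfolding step_approx_def
proof (intro conjI allI impI)
  show "L2 (\<lambda>t. c * x t)" using assms by (intro L2_cmult step_approx_L2)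
  fix e :: real assume e: "e > 0"
  define n where "n = l2norm x + 1"
  have n: "n > 0" by (simp add: n_def add_nonneg_pos)
  have "c < c + e / (2 * n)" using e n by simp
  from of_rat_dense[OF this] obtain r where r: "c < of_rat r" "of_rat r < c + e / (2 * n)" by blast
  define a where "a = \<bar>of_rat r\<bar> + (1::real)"
  have a: "a > 0" by (simp add: a_def add_nonneg_pos)
  have "e / (2 * a) > 0" using e a by simp
  then obtain l where l: "l2norm (\<lambda>t. x t - step l t) < e / (2 * a)"
    using x unfolding step_approx_def by blast
  have st: "of_rat r * step l t = step (map (\<lambda>(c, q). (r * c, q)) l) t" for t
    by (induction l) (auto simp: step_def algebra_simps of_rat_mult)
  have "l2norm (\<lambda>t. (c - of_rat r) * x t + of_rat r * (x t - step l t))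
      \<le> l2norm (\<lambda>t. (c - of_rat r) * x t) + l2norm (\<lambda>t. of_rat r * (x t - step l t))"
    by (intro l2norm_triangle L2_cmult L2_diff L2_step step_approx_L2 assms)
  also have "\<dots> = \<bar>c - of_rat r\<bar> * l2norm x + \<bar>of_rat r\<bar> * l2norm (\<lambda>t. x t - step l t)"
    by (simp only: l2norm_cmult)
  also have "\<dots> < e / 2 + e / 2"
  proof (rule add_le_less_mono)
    have "\<bar>c - of_rat r\<bar> * l2norm x \<le> e / (2 * n) * n"
      using r by (intro mult_mono) (auto simp: n_def)
    then show "\<bar>c - of_rat r\<bar> * l2norm x \<le> e / 2" using n by simp
    have "\<bar>of_rat r\<bar> * l2norm (\<lambda>t. x t - step l t) \<le> a * l2norm (\<lambda>t. x t - step l t)"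
      by (intro mult_right_mono) (auto simp: a_def)
    also have "\<dots> < a * (e / (2 * a))" using l a by (intro mult_strict_left_mono)
    finally show "\<bar>of_rat r\<bar> * l2norm (\<lambda>t. x t - step l t) < e / 2" using a by simp
  qed
  also have "(\<lambda>t. (c - of_rat r) * x t + of_rat r * (x t - step l t)) = (\<lambda>t. c * x t - step (map (\<lambda>(c, q). (r * c, q)) l) t)"
    by (simp add: algebra_simps st)
  finally show "\<exists>l. l2norm (\<lambda>t. c * x t - step l t) < e" by auto
qed

lemma step_approx_diff: "step_approx x \<Longrightarrow> step_approx y \<Longrightarrow> step_approx (\<lambda>t. x t - y t)"
  using step_approx_add[of x "\<lambda>t. -1 * y t"] step_approx_cmult[of y "-1"] by simp

lemma step_approx_limit:
  assumes "L2 x" "\<And>i. step_approx (U i)" "(\<lambda>i. l2norm (\<lambda>t. x t - U i t)) \<longlonglongrightarrow> 0"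
  shows "step_approx x"
  unfolding step_approx_def
proof (intro conjI allI impI)
  fix e :: real assume e: "e > 0"
  have "eventually (\<lambda>i. l2norm (\<lambda>t. x t - U i t) < e/2) sequentially"
    using order_tendstoD(2)[OF assms(3), of "e/2"] e by simp
  then obtain i where i: "l2norm (\<lambda>t. x t - U i t) < e/2" by (auto simp: eventually_sequentially)
  obtain l where l: "l2norm (\<lambda>t. U i t - step l t) < e/2"
    using assms(2)[of i] e unfolding step_approx_def by (meson half_gt_zero)
  have "l2norm (\<lambda>t. (x t - U i t) + (U i t - step l t)) \<le> l2norm (\<lambda>t. x t - U i t) + l2norm (\<lambda>t. U i t - step l t)"
    by (intro l2norm_triangle L2_diff L2_step step_approx_L2 assms)
  also have "\<dots> < e" using i l by simp
  finally show "\<exists>l. l2norm (\<lambda>t. x t - step l t) < e" by auto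
qed (rule assms)

text \<open>Moving the endpoint a up to a rational q changes the indicator on (a, q] only, so the
  squared distance is at most q - a; hence q is sought within e^2 of a.\<close>

lemma step_approx_atMost: "step_approx (indicator {..a})"
  unfolding step_approx_def
proof (intro conjI allI impI)
  show "L2 (indicator {..a})"
    by (rule L2_bounded(1)[where B=1]) (auto simp: cut01_def[abs_def] indicator_def)
  fix e :: real assume e: "e > 0"
  then have "a < a + e\<^sup>2" by simp
  from of_rat_dense[OF this] obtain q where q: "a < of_rat q" "of_rat q < a + e\<^sup>2" by blast
  have "(\<integral>t. (cut01 (\<lambda>t. indicator {..a} t - step [(1, q)] t) t)\<^sup>2 \<partial>lborel) \<le> (\<integral>t. indicator {a<..of_rat q} t \<partial>lborel)"
  proof (rule integral_mono')
    show "integrable lborel (indicator {a<..real_of_rat q} :: real \<Rightarrow> real)"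
      using q by (intro integrable_real_indicator) auto
  qed (use q in \<open>auto simp: cut01_def step_def indicator_def\<close>)
  also have "\<dots> < e\<^sup>2" using q by simp
  finally have "l2norm (\<lambda>t. indicator {..a} t - step [(1, q)] t) < sqrt (e\<^sup>2)"
    unfolding l2norm_eq by (rule real_sqrt_less_mono)
  then show "\<exists>l. l2norm (\<lambda>t. indicator {..a} t - step l t) < e" using e by auto
qed

text \<open>Dynkin's argument: half-lines are stable under intersection and generate the Borel sets,
  and approximability survives complements and countable disjoint unions, the latter by dominated
  convergence.\<close>

lemma step_approx_indicator:
  assumes "A \<in> sets (borel :: real measure)"
  shows "step_approx (indicator A)"
proof -
  have A: "A \<in> sigma_sets UNIV (range (\<lambda>a::real. {..a}))"
    using assms unfolding borel_eq_atMost by simp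
  have I: "Int_stable (range (\<lambda>a::real. {..a}))"
    by (auto simp: Int_stable_def)
  have sub: "range (\<lambda>a::real. {..a}) \<subseteq> Pow UNIV" by simp
  have sb: "sigma_sets UNIV (range (\<lambda>a::real. {..a})) = sets borel"
    unfolding borel_eq_atMost by simp
  show ?thesis
    using I sub A
  proof (induction rule: sigma_sets_induct_disjoint)
    case (basic A)
    then show ?case using step_approx_atMost by auto
  next
    case empty
    then show ?case using step_approx_cmult[OF step_approx_atMost, of 0] by (simp add: indicator_def[abs_def])
  next
    case (compl A)
    \<comment> \<open>On the unit interval the half-line up to 1 is everything, so it stands in for
      the whole line, whose indicator is not of the generating form.\<close>
    have "step_approx (\<lambda>t. indicator {..1} t - indicator A t)"
      by (intro step_approx_diff step_approx_atMost compl)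
    moreover have "cut01 (\<lambda>t. indicator {..1} t - indicator A t) = cut01 (indicator (UNIV - A))"
      by (auto simp: cut01_def fun_eq_iff indicator_def)
    ultimately show ?case using step_approx_cong by blast
  next
    case (union A)
    have m[measurable]: "A i \<in> sets borel" for i using union sb by auto
    have U: "step_approx (\<lambda>t. \<Sum>i<n. indicator (A i) t)" for n
    proof (induction n)
      case 0
      then show ?case using step_approx_cmult[OF step_approx_atMost, of 0] by simp
    next
      case (Suc n)
      then show ?case using step_approx_add[OF _ union(3)[of n]] by simp
    qed
    have eq: "(\<Sum>i<n. indicator (A i) t) = (indicator (\<Union>i<n. A i) t :: real)" for n t
      by (subst indicator_UN_disjoint)
         (use union(1) in \<open>auto simp: disjoint_family_on_def\<close>)
    have "(\<lambda>n. l2norm (\<lambda>t. indicator (\<Union>i. A i) t - (\<Sum>i<n. indicator (A i) t))) \<longlonglongrightarrow> 0"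
    proof (rule l2norm_dominated_convergence)
      show "L2 (indicator (\<Union>i. A i))"
        by (rule L2_bounded(1)[where B=1]) (auto simp: cut01_def[abs_def] indicator_def[of "\<Union>i. A i"])
      show "(\<lambda>n. \<Sum>i<n. indicator (A i) t) \<longlonglongrightarrow> (indicator (\<Union>i. A i) t :: real)" for t
        unfolding eq by (rule LIMSEQ_indicator_UN)
      show "\<bar>\<Sum>i<n. indicator (A i) t\<bar> \<le> \<bar>indicator (\<Union>i. A i) t :: real\<bar>" for n t
        unfolding eq by (auto simp: indicator_def)
    qed simp
    then show ?case
      by (intro step_approx_limit[OF _ U]) (auto intro!: L2_bounded(1)[where B=1] simp: cut01_def[abs_def] indicator_def[of "\<Union>i. A i"])
  qed
qed

text \<open>Monotone class induction handles nonnegative functions; the general case subtracts the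
  negative from the positive part.\<close>

lemma step_approx_all:
  assumes "L2 x"
  shows "step_approx x"
proof -
  have nonneg: "step_approx u" if "u \<in> borel_measurable borel" "\<And>t. 0 \<le> u t" "L2 u" for u
    using that
  proof (induct u rule: borel_measurable_induct_real)
    case (set A)
    then show ?case by (intro step_approx_indicator)
  next
    case (mult u c)
    show ?case
    \<comment> \<open>For c = 0 square integrability of the product says nothing about u, so the
      induction hypothesis is out of reach there.\<close>
    proof (cases "c = 0")
      case True
      then show ?thesis using step_approx_cmult[OF step_approx_atMost, of 0] by simp
    next
      case False
      then have "L2 u" using L2_cmult[OF mult(5), of "1/c"] by simp
      then show ?thesis using mult by (intro step_approx_cmult) auto
    qed
  next
    case (add u v)
    have L: "sq_int lborel (cut01 (\<lambda>x. v x + u x))" using add.prems by (simp add: L2_iff_sq_int)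
    have [measurable]: "u \<in> borel_measurable borel" "v \<in> borel_measurable borel" using add by auto
    have "\<bar>u t\<bar> \<le> \<bar>v t + u t\<bar>" "\<bar>v t\<bar> \<le> \<bar>v t + u t\<bar>" for t
      using add(2)[of t] add(5)[of t] by linarith+
    then have le: "\<bar>cut01 u t\<bar> \<le> \<bar>cut01 (\<lambda>x. v x + u x) t\<bar>"
        "\<bar>cut01 v t\<bar> \<le> \<bar>cut01 (\<lambda>x. v x + u x) t\<bar>" for t
      unfolding cut01_def abs_mult by (intro mult_left_mono; simp)+
    have "sq_int lborel (cut01 u)" "sq_int lborel (cut01 v)"
      by (rule sq_int_bound[OF L _ le(1)] sq_int_bound[OF L _ le(2)], simp add: cut01_def[abs_def])+
    then show ?case using add by (intro step_approx_add) (auto simp: L2_iff_sq_int)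
  next
    case (seq U)
    have L: "sq_int lborel (cut01 u)" using seq.prems by (simp add: L2_iff_sq_int)
    have le: "U i t \<le> u t" for i t
      using seq(5)[of t] seq(4) by (intro incseq_le[of "\<lambda>i. U i t"]) (auto simp: incseq_def le_fun_def)
    have [measurable]: "U i \<in> borel_measurable borel" for i using seq by auto
    have abs_le: "\<bar>U i t\<bar> \<le> \<bar>u t\<bar>" for i t using le[of i t] seq(2)[of i t] by linarith
    have "sq_int lborel (cut01 (U i))" for i
    proof (rule sq_int_bound[OF L])
      show "cut01 (U i) \<in> borel_measurable lborel" unfolding cut01_def[abs_def] by measurable
      show "\<bar>cut01 (U i) t\<bar> \<le> \<bar>cut01 u t\<bar>" for t
        unfolding cut01_def abs_mult by (intro mult_left_mono abs_le) auto
    qed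
    then have "step_approx (U i)" for i using seq(3)[of i] by (simp add: L2_iff_sq_int)
    moreover have "(\<lambda>i. l2norm (\<lambda>t. u t - U i t)) \<longlonglongrightarrow> 0"
    proof (rule l2norm_dominated_convergence)
      show "L2 u" by (rule seq.prems)
      show "(\<lambda>i. U i t) \<longlonglongrightarrow> u t" for t by (rule seq(5)) simp
    qed (use abs_le in auto)
    ultimately show ?case by (rule step_approx_limit[OF seq.prems])
  qed
  have s: "sq_int lborel (cut01 x)" using assms by (simp add: L2_iff_sq_int)
  have [measurable]: "cut01 x \<in> borel_measurable borel" using s by (simp add: sq_int_def)
  have c: "cut01 (cut01 z) = cut01 z" for z by (auto simp: cut01_def fun_eq_iff indicator_def)
  have "step_approx (\<lambda>t. max 0 (a * cut01 x t))" if "a = 1 \<or> a = -1" for a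
  proof (rule nonneg)
    show "L2 (\<lambda>t. max 0 (a * cut01 x t))" unfolding L2_iff_sq_int
    proof (rule sq_int_bound[OF s])
      show "cut01 (\<lambda>t. max 0 (a * cut01 x t)) \<in> borel_measurable lborel" unfolding cut01_def[of "\<lambda>t. max 0 (a * cut01 x t)", abs_def] by measurable
      show "\<bar>cut01 (\<lambda>t. max 0 (a * cut01 x t)) t\<bar> \<le> \<bar>cut01 x t\<bar>" for t
        using that by (auto simp: cut01_def indicator_def)
    qed
  qed auto
  from this[of 1] this[of "-1"] have "step_approx (\<lambda>t. max 0 (cut01 x t))" "step_approx (\<lambda>t. max 0 (- cut01 x t))"
    by simp_all
  from step_approx_diff[OF this] have "step_approx (\<lambda>t. max 0 (cut01 x t) - max 0 (- cut01 x t))" .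
  also have "(\<lambda>t. max 0 (cut01 x t) - max 0 (- cut01 x t)) = cut01 x" by (auto simp: fun_eq_iff max_def)
  finally show ?thesis using step_approx_cong[of "cut01 x" x] c by blast
qed

section \<open>Random elements of L2 and the support of their law\<close>

locale random_function = prob_space M for M :: "'a measure" +
  fixes X :: "'a \<Rightarrow> real \<Rightarrow> real"
  assumes X_meas: "(\<lambda>(\<omega>, t). X \<omega> t) \<in> borel_measurable (M \<Otimes>\<^sub>M lborel)"
    and X_L2: "\<And>\<omega>. \<omega> \<in> space M \<Longrightarrow> L2 (X \<omega>)"
begin

lemma cutX_meas [measurable]: "(\<lambda>(\<omega>, t). cut01 (X \<omega>) t) \<in> borel_measurable (M \<Otimes>\<^sub>M lborel)"
proof -
  have "(\<lambda>p. indicator {0..1} (snd p) * (case p of (\<omega>, t) \<Rightarrow> X \<omega> t)) \<in> borel_measurable (M \<Otimes>\<^sub>M lborel)"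
    using X_meas by measurable
  then show ?thesis by (simp add: cut01_def case_prod_unfold)
qed

lemma lin_X_measurable [measurable]:
  assumes "L2 b"
  shows "(\<lambda>\<omega>. lin b (X \<omega>)) \<in> borel_measurable M"
proof -
  have [measurable]: "cut01 b \<in> borel_measurable lborel" by (rule L2_measurable[OF assms])
  show ?thesis unfolding lin_eq by measurable
qed

lemma l2norm_diff_measurable:
  assumes "L2 x"
  shows "(\<lambda>\<omega>. l2norm (\<lambda>t. X \<omega> t - x t)) \<in> borel_measurable M"
proof -
  have [measurable]: "cut01 x \<in> borel_measurable lborel" by (rule L2_measurable[OF assms])
  show ?thesis unfolding l2norm_eq cut01_diff by measurable
qed

lemma l2norm_X_measurable [measurable]: "(\<lambda>\<omega>. l2norm (X \<omega>)) \<in> borel_measurable M"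
  unfolding l2norm_eq by measurable

text \<open>The balls of radius 1/(n+1) about the countably many step functions that carry no mass
  form a null event. Outside it, every ball about X contains one of the remaining balls, namely one
  that contains X, and so has positive mass.\<close>

lemma AE_supp: "AE \<omega> in M. X \<omega> \<in> supp M X"
proof -
  define A where "A l n = {\<omega> \<in> space M. l2norm (\<lambda>t. X \<omega> t - step l t) < 1 / real (Suc n)}" for l n
  have A[measurable]: "A l n \<in> sets M" for l n
    unfolding A_def using l2norm_diff_measurable[OF L2_step[of l]] by measurable
  have "AE \<omega> in M. \<omega> \<in> A l n \<longrightarrow> measure M (A l n) \<noteq> 0" for l n
  proof (cases "measure M (A l n) = 0")
    case True
    then have "A l n \<in> null_sets M" by (simp add: null_sets_def emeasure_eq_measure)
    then show ?thesis using True by (auto dest: AE_not_in)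
  qed simp
  then have "AE \<omega> in M. \<forall>l n. \<omega> \<in> A l n \<longrightarrow> measure M (A l n) \<noteq> 0"
    unfolding AE_all_countable by blast
  then show ?thesis
    using AE_space
  proof eventually_elim
    case (elim \<omega>)
    show ?case unfolding supp_def
    proof (intro CollectI conjI allI impI)
      show L: "L2 (X \<omega>)" using elim X_L2 by auto
      fix d :: real assume "d > 0"
      then obtain n where n: "1 / real (Suc n) < d / 2"
        using nat_approx_posE[of "d/2"] by auto
      obtain l where l: "l2norm (\<lambda>t. X \<omega> t - step l t) < 1 / real (Suc n)"
        using step_approx_all[OF L] unfolding step_approx_def by (metis zero_less_divide_1_iff of_nat_0_less_iff zero_less_Suc)
      then have "measure M (A l n) \<noteq> 0" using elim by (auto simp: A_def)
      then have "0 < measure M (A l n)" by (simp add: order_less_le)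
      also have "\<dots> \<le> measure M {\<omega>' \<in> space M. l2norm (\<lambda>t. X \<omega>' t - X \<omega> t) < d}"
      proof (rule finite_measure_mono)
        show "{\<omega>' \<in> space M. l2norm (\<lambda>t. X \<omega>' t - X \<omega> t) < d} \<in> sets M"
          using l2norm_diff_measurable[OF L] by measurable
        show "A l n \<subseteq> {\<omega>' \<in> space M. l2norm (\<lambda>t. X \<omega>' t - X \<omega> t) < d}"
        proof
          fix \<omega>' assume "\<omega>' \<in> A l n"
          then have w: "\<omega>' \<in> space M" "l2norm (\<lambda>t. X \<omega>' t - step l t) < 1 / real (Suc n)" by (auto simp: A_def)
          have "l2norm (\<lambda>t. (X \<omega>' t - step l t) + (step l t - X \<omega> t))
             \<le> l2norm (\<lambda>t. X \<omega>' t - step l t) + l2norm (\<lambda>t. step l t - X \<omega> t)"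
            using w by (intro l2norm_triangle L2_diff L2_step L X_L2)
          also have "\<dots> < d" using w l n l2norm_minus_commute[of "X \<omega>" "step l"] by linarith
          finally show "\<omega>' \<in> {\<omega>' \<in> space M. l2norm (\<lambda>t. X \<omega>' t - X \<omega> t) < d}" using w by simp
        qed
      qed
      finally show "0 < measure M {\<omega>' \<in> space M. l2norm (\<lambda>t. X \<omega>' t - X \<omega> t) < d}" .
    qed
  qed
qed

end

subsection \<open>Sobolev functions and the roughness penalty\<close>

text \<open>The integral of the cut function over every half-line vanishes, hence by Dynkin's
  argument over every Borel set, and a function with this property is zero almost
  everywhere.\<close>

lemma primitive_zero_imp_AE_zero:
  fixes u :: "real \<Rightarrow> real"
  assumes u: "set_integrable lborel {0..1} u"
    and z: "\<And>t. t \<in> {0..1} \<Longrightarrow> (LBINT v:{0..t}. u v) = 0"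
  shows "AE t in lborel. t \<in> {0..1} \<longrightarrow> u t = 0"
proof -
  have i: "integrable lborel (cut01 u)" using u by (simp add: set_integrable_def cut01_def[abs_def])
  have si: "set_integrable lborel A (cut01 u)" if "A \<in> sets borel" for A
    unfolding set_integrable_def using integrable_mult_indicator[OF _ i, of A] that by simp
  have sb: "sigma_sets UNIV (range (\<lambda>a::real. {..a})) = sets borel"
    unfolding borel_eq_atMost by simp
  have at: "(LBINT v:{..a}. cut01 u v) = 0" for a
  proof (cases "a < 0")
    case True
    then have "(LBINT v:{..a}. cut01 u v) = (LBINT v:{..a}. 0)"
      by (intro set_lebesgue_integral_cong) (auto simp: cut01_def indicator_def)
    then show ?thesis by (simp add: set_lebesgue_integral_def)
  next
    case False
    have "(LBINT v:{..a}. cut01 u v) = (LBINT v:{0..min a 1}. u v)"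
      unfolding set_lebesgue_integral_def
      by (intro Bochner_Integration.integral_cong) (auto simp: cut01_def indicator_def)
    then show ?thesis using z[of "min a 1"] False by simp
  qed
  have all: "(LBINT v:UNIV. cut01 u v) = 0"
  proof -
    have "(LBINT v:UNIV. cut01 u v) = (LBINT v:{..1}. cut01 u v)"
      unfolding set_lebesgue_integral_def
      by (intro Bochner_Integration.integral_cong) (auto simp: cut01_def indicator_def)
    then show ?thesis using at by simp
  qed
  have "(LBINT v:A. cut01 u v) = 0" if "A \<in> sets lborel" for A
  proof -
    have A: "A \<in> sigma_sets UNIV (range (\<lambda>a::real. {..a}))" using that sb by simp
    have "Int_stable (range (\<lambda>a::real. {..a}))" "range (\<lambda>a::real. {..a}) \<subseteq> Pow UNIV"
      by (auto simp: Int_stable_def)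
    from this A show ?thesis
    proof (induction rule: sigma_sets_induct_disjoint)
      case (basic A) then show ?case using at by auto
    next
      case empty then show ?case by (simp add: set_lebesgue_integral_def)
    next
      case (compl A)
      have "(LBINT v:A \<union> (UNIV - A). cut01 u v) = (LBINT v:A. cut01 u v) + (LBINT v:UNIV - A. cut01 u v)"
        using compl(1) sb by (intro set_integral_Un si) auto
      then show ?case using compl all by (simp add: Un_Diff_cancel)
    next
      case (union A)
      have "(\<Sum>i. (LBINT v:A i. cut01 u v)) = (LBINT v:(\<Union>i. A i). cut01 u v)"
        using union sb by (intro lebesgue_integral_countable_add[symmetric] si) (auto simp: disjoint_family_on_def)
      then show ?case using union by simp
    qed
  qed
  then have "AE t in lborel. cut01 u t = 0" by (rule sigma_finite_measure.density_zero[OF lborel.sigma_finite_measure_axioms i])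
  then show ?thesis by eventually_elim (auto simp: cut01_def)
qed

lemma L2_set_integrable:
  assumes "L2 w"
  shows "set_integrable lborel {0..1} w"
proof -
  have "integrable lborel (\<lambda>t. cut01 w t * cut01 (\<lambda>_. 1) t)"
    using assms L2_continuous[of "\<lambda>_. 1"] by (intro sq_int_mult) (auto simp: L2_iff_sq_int)
  also have "(\<lambda>t. cut01 w t * cut01 (\<lambda>_. 1) t) = (\<lambda>t. indicator {0..1} t *\<^sub>R w t)"
    by (auto simp: fun_eq_iff cut01_def indicator_def)
  finally show ?thesis by (simp add: set_integrable_def)
qed

lemma set_integral_singleton_0 [simp]: "(LBINT u:{0::real}. f u) = (0::real)"
  unfolding set_lebesgue_integral_def
  by (rule integral_eq_zero_AE) (use AE_lborel_singleton[of "0::real"] in \<open>eventually_elim, auto simp: indicator_def\<close>)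

lemma sob_witnessD:
  assumes "sob_witness m b d"
  shows sob_witness_0: "d 0 = b"
    and sob_witness_integrable: "j < m \<Longrightarrow> set_integrable lborel {0..1} (d (Suc j))"
    and sob_witness_primitive: "j < m \<Longrightarrow> t \<in> {0..1} \<Longrightarrow> d j t = d j 0 + (LBINT u:{0..t}. d (Suc j) u)"
    and sob_witness_L2: "L2 (d m)"
  using assms unfolding sob_witness_def by blast+

lemma sob_witness_Suc:
  assumes "sob_witness (Suc m) b d"
  shows "sob_witness m (d 1) (\<lambda>j. d (Suc j))"
  unfolding sob_witness_def
proof (intro conjI allI impI ballI)
  fix j and t :: real assume "j < m" "t \<in> {0..1}"
  then show "d (Suc j) t = d (Suc j) 0 + (LBINT u:{0..t}. d (Suc (Suc j)) u)"
    by (intro sob_witness_primitive[OF assms]) auto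
qed (use sob_witness_integrable[OF assms] sob_witness_L2[OF assms] in auto)

lemma set_integrable_Icc_subset:
  "set_integrable lborel {0..1} (u :: real \<Rightarrow> real) \<Longrightarrow> t \<in> {0..1} \<Longrightarrow> set_integrable lborel {0..t} u"
  by (erule set_integrable_subset) auto

lemma continuous_on_primitive:
  fixes u :: "real \<Rightarrow> real"
  assumes u: "set_integrable lborel {0..1} u"
  shows "continuous_on {0..1} (\<lambda>t. LBINT v:{0..t}. u v)"
proof -
  have "continuous_on {0..1} (\<lambda>t. integral {0..t} u)"
    by (intro indefinite_integral_continuous_1 set_borel_integral_eq_integral(1) u)
  then show ?thesis
    by (rule continuous_on_eq)
       (use set_borel_integral_eq_integral(2)[OF set_integrable_Icc_subset[OF u]] in auto)
qed

lemma continuous_AE_zero_imp_zero: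
  fixes u :: "real \<Rightarrow> real"
  assumes c: "continuous_on {0..1} u" and z: "AE t in lborel. t \<in> {0..1} \<longrightarrow> u t = 0" and t: "t \<in> {0..1}"
  shows "u t = 0"
proof -
  have c': "continuous_on {0..1} (\<lambda>t. \<bar>u t\<bar>)" by (intro continuous_intros c)
  have i: "set_integrable lborel {0..1} (\<lambda>t. \<bar>u t\<bar>)" by (rule borel_integrable_atLeastAtMost'[OF c'])
  have "(LBINT t:{0..1}. \<bar>u t\<bar>) = 0"
    unfolding set_lebesgue_integral_def
    by (rule integral_eq_zero_AE) (use z in \<open>eventually_elim, auto simp: indicator_def\<close>)
  then have "integral {0..1} (\<lambda>t. \<bar>u t\<bar>) = 0"
    using set_borel_integral_eq_integral(2)[OF i] by simp
  then show ?thesis using integral_eq_0_iff[OF c'] t by simp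
qed

text \<open>Taylor's formula with integral remainder, read backwards: the derivatives c 0, ..., c
  (m-1) at 0 and the m-th derivative w determine the function. This identifies H^m with \<real>^m
  \<times> L2; for w = 0 the result is a polynomial of degree below m, that is, an element of the
  null space of the penalty.\<close>

primrec sob_build :: "nat \<Rightarrow> (nat \<Rightarrow> real) \<Rightarrow> (real \<Rightarrow> real) \<Rightarrow> real \<Rightarrow> real" where
  "sob_build 0 c w = w"
| "sob_build (Suc m) c w = (\<lambda>t. c 0 + (LBINT u:{0..t}. sob_build m (\<lambda>j. c (Suc j)) w u))"

lemma sob_build_L2: "L2 w \<Longrightarrow> L2 (sob_build m c w)"
  and sob_build_continuous: "L2 w \<Longrightarrow> continuous_on {0..1} (sob_build (Suc m) c w)"
proof -
  have *: "L2 (sob_build m c w) \<and> continuous_on {0..1} (sob_build (Suc m) c w)" if "L2 w" for m c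
  proof (induction m arbitrary: c)
    case 0
    then show ?case using that by (auto intro!: continuous_intros continuous_on_primitive L2_set_integrable)
  next
    case (Suc m)
    have "L2 (sob_build (Suc m) c w)" for c using Suc by (intro L2_continuous) auto
    then show ?case by (auto intro!: continuous_intros continuous_on_primitive L2_set_integrable simp del: sob_build.simps(2) simp: sob_build.simps(2)[of "Suc m"])
  qed
  show "L2 w \<Longrightarrow> L2 (sob_build m c w)" "L2 w \<Longrightarrow> continuous_on {0..1} (sob_build (Suc m) c w)"
    using * by auto
qed

lemma sob_build_linear:
  assumes "L2 w" "L2 v" "t \<in> {0..1}"
  shows "sob_build m (\<lambda>j. a * c j + b * e j) (\<lambda>t. a * w t + b * v t) t = a * sob_build m c w t + b * sob_build m e v t"
  using assms(3)
proof (induction m arbitrary: c e t)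
  case (Suc m)
  let ?c = "\<lambda>j. c (Suc j)" and ?e = "\<lambda>j. e (Suc j)"
  have i: "set_integrable lborel {0..t} (sob_build m c w)" if "L2 w" for c w
    by (rule set_integrable_Icc_subset[OF L2_set_integrable[OF sob_build_L2[OF that]] Suc.prems])
  have "(LBINT u:{0..t}. sob_build m (\<lambda>j. a * ?c j + b * ?e j) (\<lambda>t. a * w t + b * v t) u)
      = (LBINT u:{0..t}. a * sob_build m ?c w u + b * sob_build m ?e v u)"
    using Suc.prems by (intro set_lebesgue_integral_cong) (auto simp: Suc.IH)
  also have "\<dots> = a * (LBINT u:{0..t}. sob_build m ?c w u) + b * (LBINT u:{0..t}. sob_build m ?e v u)"
    using i assms by (subst set_integral_add) auto
  finally show ?case by (simp add: algebra_simps)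
qed simp

lemma abs_primitive_le:
  assumes u: "L2 u" and t: "t \<in> {0..1}"
  shows "\<bar>LBINT v:{0..t}. u v\<bar> \<le> l2norm u"
proof -
  have "L2 (indicator {0..t})"
    by (rule L2_bounded(1)[where B=1]) (auto simp: cut01_def[abs_def] indicator_def[of "{0..t}"])
  moreover have "l2norm (indicator {0..t}) \<le> 1"
    by (rule L2_bounded(2)) (auto simp: cut01_def[abs_def] indicator_def[of "{0..t}"])
  moreover have "(LBINT v:{0..t}. u v) = lin (indicator {0..t}) u"
    unfolding lin_def set_lebesgue_integral_def
    using t by (intro Bochner_Integration.integral_cong) (auto simp: indicator_def)
  ultimately show ?thesis
    using order_trans[OF abs_lin_le[of "indicator {0..t}" u] mult_right_mono[of _ 1 "l2norm u"]] u by simp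
qed

text \<open>Each integration is a contraction, since |\<integral>_0^t u| is at most the L2 norm of u
  on the unit interval; only the initial values add to the bound.\<close>

lemma sob_build_bound:
  assumes w: "L2 w"
  shows "l2norm (sob_build m c w) \<le> (\<Sum>j<m. \<bar>c j\<bar>) + l2norm w"
    and "t \<in> {0..1} \<Longrightarrow> \<bar>sob_build (Suc m) c w t\<bar> \<le> (\<Sum>j<Suc m. \<bar>c j\<bar>) + l2norm w"
proof -
  have pw: "\<bar>sob_build (Suc m) c w t\<bar> \<le> \<bar>c 0\<bar> + l2norm (sob_build m (\<lambda>j. c (Suc j)) w)" if "t \<in> {0..1}" for m c t
    using abs_primitive_le[OF sob_build_L2[OF w] that, of m "\<lambda>j. c (Suc j)"] by simp
  have norm: "l2norm (sob_build m c w) \<le> (\<Sum>j<m. \<bar>c j\<bar>) + l2norm w" for m c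
  proof (induction m arbitrary: c)
    case (Suc m)
    have "l2norm (sob_build (Suc m) c w) \<le> \<bar>c 0\<bar> + l2norm (sob_build m (\<lambda>j. c (Suc j)) w)"
      by (rule L2_bounded(2)[OF L2_measurable[OF sob_build_L2[OF w]] pw])
    also have "\<dots> \<le> \<bar>c 0\<bar> + ((\<Sum>j<m. \<bar>c (Suc j)\<bar>) + l2norm w)" using Suc.IH by simp
    also have "\<dots> = (\<Sum>j<Suc m. \<bar>c j\<bar>) + l2norm w" unfolding sum.lessThan_Suc_shift by simp
    finally show ?case .
  qed simp
  show "l2norm (sob_build m c w) \<le> (\<Sum>j<m. \<bar>c j\<bar>) + l2norm w" by (rule norm)
  show "\<bar>sob_build (Suc m) c w t\<bar> \<le> (\<Sum>j<Suc m. \<bar>c j\<bar>) + l2norm w" if "t \<in> {0..1}"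
    using pw[OF that, of m c] norm[of m "\<lambda>j. c (Suc j)"] unfolding sum.lessThan_Suc_shift by simp
qed

text \<open>Independence of the monomials: for positive m the function is continuous, so it vanishes
  everywhere; its value at 0 gives the first coefficient, and the vanishing primitive passes the
  claim on to the remaining ones.\<close>

lemma sob_build_zero_iff:
  assumes "AE t in lborel. t \<in> {0..1} \<longrightarrow> sob_build m c (\<lambda>_. 0) t = 0" "j < m"
  shows "c j = 0"
  using assms
proof (induction m arbitrary: c j)
  case (Suc m)
  have L0: "L2 (\<lambda>_. 0)" by (intro L2_continuous) auto
  have all: "sob_build (Suc m) c (\<lambda>_. 0) t = 0" if "t \<in> {0..1}" for t
    by (rule continuous_AE_zero_imp_zero[OF sob_build_continuous[OF L0] Suc.prems(1) that])
  have c0: "c 0 = 0" using all[of 0] by simp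
  have "AE t in lborel. t \<in> {0..1} \<longrightarrow> sob_build m (\<lambda>j. c (Suc j)) (\<lambda>_. 0) t = 0"
    using all c0 by (intro primitive_zero_imp_AE_zero L2_set_integrable sob_build_L2 L0) auto
  from Suc.IH[OF this, of "j - 1"] show ?case using Suc.prems(2) c0 by (cases "j = 0") auto
qed simp

lemma sob_witness_build:
  assumes "L2 w"
  shows "sob_witness m (sob_build m c w) (\<lambda>j. sob_build (m - j) (\<lambda>i. c (i + j)) w)"
  unfolding sob_witness_def
proof (intro conjI allI impI ballI)
  fix j assume j: "j < m"
  then have mj: "m - j = Suc (m - Suc j)" by simp
  show "set_integrable lborel {0..1} (sob_build (m - Suc j) (\<lambda>i. c (i + Suc j)) w)"
    by (intro L2_set_integrable sob_build_L2 assms)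
  show "sob_build (m - j) (\<lambda>i. c (i + j)) w t = sob_build (m - j) (\<lambda>i. c (i + j)) w 0 +
           (LBINT u:{0..t}. sob_build (m - Suc j) (\<lambda>i. c (i + Suc j)) w u)" for t
    unfolding mj by simp
qed (use assms in auto)

lemma sobolev_build: "L2 w \<Longrightarrow> sob_build m c w \<in> sobolev m"
  using sob_witness_build unfolding sobolev_def by blast

lemma sob_witness_eq_build:
  assumes "sob_witness m b d" "t \<in> {0..1}"
  shows "b t = sob_build m (\<lambda>j. d j 0) (d m) t"
  using assms
proof (induction m arbitrary: b d t)
  case (Suc m)
  note * = sob_witness_Suc[OF Suc.prems(1)]
  have "b t = d 0 0 + (LBINT u:{0..t}. d 1 u)"
    using sob_witness_0[OF Suc.prems(1)] sob_witness_primitive[OF Suc.prems(1) _ Suc.prems(2), of 0] by simp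
  also have "(LBINT u:{0..t}. d 1 u) = (LBINT u:{0..t}. sob_build m (\<lambda>j. d (Suc j) 0) (d (Suc m)) u)"
    using Suc.prems(2) Suc.IH[OF *] by (intro set_lebesgue_integral_cong) auto
  finally show ?case by simp
qed (use sob_witness_0 in fastforce)

lemma sob_witness_linear:
  assumes "sob_witness m b d" "sob_witness m g e"
  shows "sob_witness m (\<lambda>t. p * b t + q * g t) (\<lambda>j t. p * d j t + q * e j t)"
  unfolding sob_witness_def
proof (intro conjI allI impI ballI)
  show "(\<lambda>t. p * d 0 t + q * e 0 t) = (\<lambda>t. p * b t + q * g t)" using sob_witness_0 assms by metis
  show "L2 (\<lambda>t. p * d m t + q * e m t)" using assms by (intro L2_add L2_cmult sob_witness_L2)
  fix j assume j: "j < m"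
  have i: "set_integrable lborel {0..1} (d (Suc j))" "set_integrable lborel {0..1} (e (Suc j))"
    using assms j sob_witness_integrable by blast+
  then show "set_integrable lborel {0..1} (\<lambda>t. p * d (Suc j) t + q * e (Suc j) t)" by auto
  fix t :: real assume t: "t \<in> {0..1}"
  have i': "set_integrable lborel {0..t} (d (Suc j))" "set_integrable lborel {0..t} (e (Suc j))"
    using i t by (auto intro: set_integrable_Icc_subset)
  have eq: "d j t = d j 0 + (LBINT u:{0..t}. d (Suc j) u)" "e j t = e j 0 + (LBINT u:{0..t}. e (Suc j) u)"
    using assms j t by (blast intro: sob_witness_primitive)+
  have "(LBINT u:{0..t}. p * d (Suc j) u + q * e (Suc j) u) = p * (LBINT u:{0..t}. d (Suc j) u) + q * (LBINT u:{0..t}. e (Suc j) u)"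
    using i' by (subst set_integral_add) auto
  then show "p * d j t + q * e j t = p * d j 0 + q * e j 0 + (LBINT u:{0..t}. p * d (Suc j) u + q * e (Suc j) u)"
    unfolding eq by (simp add: algebra_simps)
qed

lemma sobolev_linear: "b \<in> sobolev m \<Longrightarrow> g \<in> sobolev m \<Longrightarrow> (\<lambda>t. p * b t + q * g t) \<in> sobolev m"
  unfolding sobolev_def using sob_witness_linear by blast

lemma sobolev_diff: "b \<in> sobolev m \<Longrightarrow> g \<in> sobolev m \<Longrightarrow> (\<lambda>t. b t - g t) \<in> sobolev m"
  using sobolev_linear[of b m g 1 "-1"] by simp

lemma sobolev_add: "b \<in> sobolev m \<Longrightarrow> g \<in> sobolev m \<Longrightarrow> (\<lambda>t. b t + g t) \<in> sobolev m"
  using sobolev_linear[of b m g 1 1] by simp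

lemma sobolev_cmult: "b \<in> sobolev m \<Longrightarrow> (\<lambda>t. p * b t) \<in> sobolev m"
  using sobolev_linear[of b m b p 0] by simp

lemma sobolev_continuous:
  assumes "b \<in> sobolev m" "m \<ge> 1"
  shows "continuous_on {0..1} b"
proof -
  obtain d where d: "sob_witness m b d" using assms(1) by (auto simp: sobolev_def)
  note L = sob_witness_L2[OF d]
  obtain n where n: "m = Suc n" using assms(2) by (cases m) auto
  show ?thesis
    by (rule continuous_on_eq[OF sob_build_continuous[OF L, of n "\<lambda>j. d j 0"]])
       (use sob_witness_eq_build[OF d] n in auto)
qed

lemma sobolev_L2: "b \<in> sobolev m \<Longrightarrow> L2 b"
proof -
  assume "b \<in> sobolev m"
  then obtain d where d: "sob_witness m b d" by (auto simp: sobolev_def)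
  then have "cut01 b = cut01 (sob_build m (\<lambda>j. d j 0) (d m))"
    by (intro cut01_eqI sob_witness_eq_build)
  then show "L2 b" using L2_cong sob_build_L2[OF sob_witness_L2[OF d]] by blast
qed

text \<open>Uniqueness of the weak derivative. A vanishing primitive makes the first derivative
  vanish almost everywhere; if further derivatives follow it is continuous, hence zero everywhere,
  and the induction continues. The last derivative is only in L2, so the conclusion stays almost
  everywhere.\<close>

lemma sob_witness_zero_AE:
  assumes d: "sob_witness m b d" and b: "\<And>t. t \<in> {0..1} \<Longrightarrow> b t = 0"
  shows "AE t in lborel. t \<in> {0..1} \<longrightarrow> d m t = 0"
  using assms
proof (induction m arbitrary: b d)
  case (Suc m)
  note w = sob_witness_Suc[OF Suc.prems(1)]
  have ae: "AE t in lborel. t \<in> {0..1} \<longrightarrow> d 1 t = 0"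
  proof (rule primitive_zero_imp_AE_zero)
    show "set_integrable lborel {0..1} (d 1)" using sob_witness_integrable[OF Suc.prems(1), of 0] by simp
    fix t :: real assume t: "t \<in> {0..1}"
    have "d 0 t = d 0 0 + (LBINT u:{0..t}. d 1 u)"
      using sob_witness_primitive[OF Suc.prems(1) _ t, of 0] by simp
    then show "(LBINT u:{0..t}. d 1 u) = 0" using Suc.prems(2) t sob_witness_0[OF Suc.prems(1)] by simp
  qed
  show ?case
  proof (cases m)
    case 0
    then show ?thesis using ae by simp
  next
    case (Suc n)
    have "d 1 \<in> sobolev m" using w by (auto simp: sobolev_def)
    then have "continuous_on {0..1} (d 1)" by (rule sobolev_continuous) (simp add: Suc)
    from continuous_AE_zero_imp_zero[OF this ae] show ?thesis using Suc.IH[OF w] by simp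
  qed
qed (use sob_witness_0 in fastforce)

text \<open>The penalty is defined through a derivative picked by choice. Two witnesses of one
  function differ by a witness of zero, whose top derivative vanishes almost everywhere, so any
  witness may be used for computation.\<close>

lemma Jpen_witness:
  assumes d: "sob_witness m b d" and e: "sob_witness m g e"
  shows "Jpen m b g = lin (d m) (e m)"
proof -
  have AE_d: "AE t in lborel. cut01 (sob_deriv m b) t = cut01 (d m) t" and L_d: "L2 (sob_deriv m b)"
    if d: "sob_witness m b d" for b d
  proof -
    have d': "sob_witness m b (SOME d. sob_witness m b d)" using d by (rule someI[where P="sob_witness m b"])
    then show "L2 (sob_deriv m b)" unfolding sob_deriv_def by (rule sob_witness_L2)
    have "AE t in lborel. t \<in> {0..1} \<longrightarrow> 1 * (SOME d. sob_witness m b d) m t + (-1) * d m t = 0"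
      by (rule sob_witness_zero_AE[OF sob_witness_linear[OF d' d]]) simp
    then show "AE t in lborel. cut01 (sob_deriv m b) t = cut01 (d m) t"
      by eventually_elim (auto simp: cut01_def sob_deriv_def indicator_def)
  qed
  have "Jpen m b g = (\<integral>t. cut01 (sob_deriv m b) t * cut01 (sob_deriv m g) t \<partial>lborel)"
    using lin_eq by (simp add: Jpen_def lin_def)
  also have "\<dots> = lin (d m) (e m)"
    unfolding lin_eq
  proof (rule integral_cong_AE)
    show "AE t in lborel. cut01 (sob_deriv m b) t * cut01 (sob_deriv m g) t = cut01 (d m) t * cut01 (e m) t"
      using AE_d[OF d] AE_d[OF e] by eventually_elim simp
  qed (intro borel_measurable_times L2_measurable L_d[OF d] L_d[OF e] sob_witness_L2[OF d] sob_witness_L2[OF e])+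
  finally show ?thesis .
qed

lemma Jpen_self: "sob_witness m b d \<Longrightarrow> Jpen m b b = (l2norm (d m))\<^sup>2"
  by (simp add: Jpen_witness lin_eq l2norm_square) (simp add: power2_eq_square)

lemma Jpen_nonneg: "0 \<le> Jpen m b b"
  unfolding Jpen_def set_lebesgue_integral_def by (intro integral_nonneg_AE) auto

lemma Jpen_parallelogram:
  assumes "b \<in> sobolev m" "g \<in> sobolev m"
  shows "Jpen m (\<lambda>t. b t + g t) (\<lambda>t. b t + g t) + Jpen m (\<lambda>t. b t - g t) (\<lambda>t. b t - g t) = 2 * Jpen m b b + 2 * Jpen m g g"
proof -
  obtain d e where de: "sob_witness m b d" "sob_witness m g e" using assms by (auto simp: sobolev_def)
  have L: "sq_int lborel (cut01 (d m))" "sq_int lborel (cut01 (e m))"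
    using sob_witness_L2[OF de(1)] sob_witness_L2[OF de(2)] by (auto simp: L2_iff_sq_int)
  note i = sq_int_integrable[OF sq_int_add[OF L]] sq_int_integrable[OF sq_int_diff[OF L]]
    sq_int_integrable[OF L(1)] sq_int_integrable[OF L(2)]
  have "Jpen m (\<lambda>t. b t + g t) (\<lambda>t. b t + g t) + Jpen m (\<lambda>t. b t - g t) (\<lambda>t. b t - g t)
    = (\<integral>t. (cut01 (d m) t + cut01 (e m) t)\<^sup>2 \<partial>lborel) + (\<integral>t. (cut01 (d m) t - cut01 (e m) t)\<^sup>2 \<partial>lborel)"
    using Jpen_self[OF sob_witness_linear[OF de, of 1 1]] Jpen_self[OF sob_witness_linear[OF de, of 1 "-1"]]
    by (simp add: l2norm_square cut01_add cut01_diff)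
  also have "\<dots> = (\<integral>t. (cut01 (d m) t + cut01 (e m) t)\<^sup>2 + (cut01 (d m) t - cut01 (e m) t)\<^sup>2 \<partial>lborel)"
    using i by simp
  also have "\<dots> = (\<integral>t. 2 * (cut01 (d m) t)\<^sup>2 + 2 * (cut01 (e m) t)\<^sup>2 \<partial>lborel)"
    by (intro Bochner_Integration.integral_cong) (auto simp: power2_eq_square algebra_simps)
  also have "\<dots> = 2 * Jpen m b b + 2 * Jpen m g g"
    using i by (simp add: Jpen_self[OF de(1)] Jpen_self[OF de(2)] l2norm_square)
  finally show ?thesis .
qed

lemma Jpen_cmult: "b \<in> sobolev m \<Longrightarrow> Jpen m (\<lambda>t. a * b t) (\<lambda>t. a * b t) = a\<^sup>2 * Jpen m b b"
proof -
  assume "b \<in> sobolev m"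
  then obtain d where d: "sob_witness m b d" by (auto simp: sobolev_def)
  show ?thesis
    using Jpen_self[OF sob_witness_linear[OF d d, of a 0]] Jpen_self[OF d] by (simp add: l2norm_cmult power_mult_distrib)
qed

text \<open>Polynomials lie in every Sobolev space and are uniformly dense among continuous
  functions; they carry positivity of the covariance form from the Sobolev space to all continuous
  functions.\<close>

lemma sobolev_poly: "poly p \<in> sobolev m"
proof -
  have "sob_witness m (poly p) (\<lambda>j. poly ((pderiv ^^ j) p))"
    unfolding sob_witness_def
  proof (intro conjI allI impI ballI)
    have c: "continuous_on {a..b} (poly q)" for a b :: real and q by (intro continuous_intros)
    show "L2 (poly ((pderiv ^^ m) p))" by (intro L2_continuous c)
    fix j
    show "set_integrable lborel {0..1} (poly ((pderiv ^^ Suc j) p))" by (intro borel_integrable_atLeastAtMost' c)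
    fix t :: real assume "t \<in> {0..1}"
    then have "(LBINT u. indicator {0..t} u *\<^sub>R poly ((pderiv ^^ Suc j) p) u) = poly ((pderiv ^^ j) p) t - poly ((pderiv ^^ j) p) 0"
      by (intro integral_FTC_atLeastAtMost c)
         (auto simp: has_real_derivative_iff_has_vector_derivative[symmetric] intro!: has_field_derivative_at_within poly_DERIV)
    then show "poly ((pderiv ^^ j) p) t = poly ((pderiv ^^ j) p) 0 + (LBINT u:{0..t}. poly ((pderiv ^^ Suc j) p) u)"
      by (simp add: set_lebesgue_integral_def)
  qed simp
  then show ?thesis by (auto simp: sobolev_def)
qed

subsection \<open>Kernel-smoothed gain\<close>

lemma has_real_derivative_shift:
  fixes g :: "real \<Rightarrow> real"
  assumes "(g has_real_derivative D) (at (a + t))"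
  shows "((\<lambda>t. g (a + t)) has_real_derivative D) (at t)"
proof -
  have "((\<lambda>t. a + t) has_real_derivative 1) (at t)" by (auto intro!: derivative_eq_intros)
  from DERIV_chain2[OF assms this] show ?thesis by simp
qed

text \<open>With u half the distance, the second difference is H u - H 0 for H z = g (a + u + z) - g
  (a + z); the mean value theorem for H and then for g' leaves u^2 g'' at a point between a and
  b.\<close>

lemma second_difference_ge:
  fixes g g' g'' :: "real \<Rightarrow> real"
  assumes g: "\<And>x. (g has_real_derivative g' x) (at x)" and g': "\<And>x. (g' has_real_derivative g'' x) (at x)"
    and ge: "\<And>x. min a b \<le> x \<Longrightarrow> x \<le> max a b \<Longrightarrow> K \<le> g'' x"
  shows "K * ((a - b) / 2)\<^sup>2 \<le> g a + g b - 2 * g ((a + b) / 2)"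
proof -
  have *: "K * ((a - b) / 2)\<^sup>2 \<le> g a + g b - 2 * g ((a + b) / 2)"
    if ab: "a < b" and ge: "\<And>x. a \<le> x \<Longrightarrow> x \<le> b \<Longrightarrow> K \<le> g'' x" for a b
  proof -
    define u where "u = (b - a) / 2"
    have u: "u > 0" using ab by (simp add: u_def)
    define H where "H z = g (a + u + z) - g (a + z)" for z
    have H: "(H has_real_derivative g' (a + u + z) - g' (a + z)) (at z)" for z
      unfolding H_def by (intro DERIV_diff has_real_derivative_shift g)
    obtain z where z: "0 < z" "z < u" "H u - H 0 = (u - 0) * (g' (a + u + z) - g' (a + z))"
      using MVT2[of 0 u H "\<lambda>z. g' (a + u + z) - g' (a + z)"] u H by auto
    obtain y where y: "a + z < y" "y < a + u + z" "g' (a + u + z) - g' (a + z) = (a + u + z - (a + z)) * g'' y"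
      using MVT2[of "a + z" "a + u + z" g' g''] u g' by auto
    have "K \<le> g'' y" using y z u by (intro ge) (auto simp: u_def field_simps)
    then have "u * (u * K) \<le> u * (u * g'' y)" using u by simp
    also have "\<dots> = H u - H 0" using y z by simp
    also have "\<dots> = g a + g b - 2 * g ((a + b) / 2)" by (simp add: H_def u_def field_simps)
    also have "u * (u * K) = K * ((a - b) / 2)\<^sup>2" by (simp add: u_def power2_eq_square field_simps)
    finally show ?thesis .
  qed
  consider "a < b" | "b < a" | "a = b" by linarith
  then show ?thesis
  proof cases
    case 2
    have "((a - b) / 2)\<^sup>2 = ((b - a) / 2)\<^sup>2" by (simp add: power2_commute power_divide)
    then show ?thesis using *[OF 2] ge 2 by (simp add: add.commute)
  qed (use * ge in auto)
qed

text \<open>Lagrange's form of the remainder. The bound is one-sided so that it can be applied to a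
  function and to its negative separately.\<close>

lemma Taylor2_ge:
  fixes g g' g'' :: "real \<Rightarrow> real"
  assumes g: "\<And>x. (g has_real_derivative g' x) (at x)" and g': "\<And>x. (g' has_real_derivative g'' x) (at x)"
    and ge: "\<And>x. \<bar>x - a\<bar> \<le> \<bar>d\<bar> \<Longrightarrow> K \<le> g'' x"
  shows "K * d\<^sup>2 / 2 \<le> g (a + d) - g a - d * g' a"
proof -
  define D where "D m = (if m = 0 then (\<lambda>t. g (a + t)) else if m = 1 then (\<lambda>t. g' (a + t)) else (\<lambda>t. g'' (a + t)))" for m :: nat
  have "\<exists>t. \<bar>t\<bar> \<le> \<bar>d\<bar> \<and> g (a + d) = (\<Sum>m<2. D m 0 / fact m * d ^ m) + D 2 t / fact 2 * d ^ 2"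
  proof (rule Maclaurin_bi_le)
    show "\<forall>m t. m < 2 \<and> \<bar>t\<bar> \<le> \<bar>d\<bar> \<longrightarrow> (D m has_real_derivative D (Suc m) t) (at t)"
      by (auto simp: D_def less_2_cases_iff intro!: has_real_derivative_shift g g')
  qed (simp add: D_def)
  then obtain t where t: "\<bar>t\<bar> \<le> \<bar>d\<bar>" "g (a + d) = g a + g' a * d + g'' (a + t) / 2 * d\<^sup>2"
    by (auto simp: D_def numeral_2_eq_2 lessThan_Suc)
  have "K \<le> g'' (a + t)" using t by (intro ge) auto
  then have "K * d\<^sup>2 / 2 \<le> g'' (a + t) / 2 * d\<^sup>2" by (simp add: mult_right_mono)
  then show ?thesis using t by (simp add: mult.commute)
qed

lemma abs_diff_le_of_deriv_bound:
  fixes g g' :: "real \<Rightarrow> real"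
  assumes g: "\<And>x. (g has_real_derivative g' x) (at x)" and b: "\<And>x. \<bar>g' x\<bar> \<le> B"
  shows "\<bar>g x - g y\<bar> \<le> B * \<bar>x - y\<bar>"
proof -
  have *: "\<bar>g x - g y\<bar> \<le> B * \<bar>x - y\<bar>" if yx: "y < x" for x y
  proof -
    obtain z where "g x - g y = (x - y) * g' z" using MVT2[OF yx, of g g'] g by blast
    then show ?thesis using b[of z] by (simp add: abs_mult mult.commute mult_right_mono)
  qed
  show ?thesis using *[of x y] *[of y x] by (cases x y rule: linorder_cases) (auto simp: abs_minus_commute)
qed

locale smoothing_kernel =
  fixes k :: "real \<Rightarrow> real" and s :: nat
  assumes k_int: "integrable lborel k"
    and k_one: "(LBINT u. k u) = 1"
    and k_mom_int: "integrable lborel (\<lambda>u. u ^ (s + 1) * k u)"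
    and k_mom0: "\<And>j. j \<in> {1..s} \<Longrightarrow> (LBINT u. u ^ j * k u) = 0"
begin

text \<open>Absolute moments: k may change sign, so errors are measured against |k|, while the main
  terms use the mass 1 of k itself.\<close>

definition mom :: "nat \<Rightarrow> real" where "mom j = (LBINT v. \<bar>v\<bar> ^ j * \<bar>k v\<bar>)"

lemma k_measurable [measurable]: "k \<in> borel_measurable borel"
  using k_int by auto

lemma integrable_abs_mom:
  assumes "j \<le> s + 1"
  shows "integrable lborel (\<lambda>v. \<bar>v\<bar> ^ j * \<bar>k v\<bar>)"
proof (rule Bochner_Integration.integrable_bound)
  show "integrable lborel (\<lambda>v. \<bar>k v\<bar> + \<bar>v ^ (s + 1) * k v\<bar>)"
    by (intro Bochner_Integration.integrable_add integrable_abs k_int k_mom_int)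
  have "\<bar>v\<bar> ^ j \<le> 1 + \<bar>v\<bar> ^ (s + 1)" for v :: real
  proof (cases "\<bar>v\<bar> \<le> 1")
    case True
    then have "\<bar>v\<bar> ^ j \<le> 1" by (intro power_le_one) auto
    then show ?thesis by (simp add: add_increasing2)
  next
    case False
    then have "\<bar>v\<bar> ^ j \<le> \<bar>v\<bar> ^ (s + 1)" using assms by (intro power_increasing) auto
    then show ?thesis by simp
  qed
  from mult_right_mono[OF this abs_ge_zero]
  have "\<bar>v\<bar> ^ j * \<bar>k v\<bar> \<le> \<bar>k v\<bar> + \<bar>v ^ (s + 1) * k v\<bar>" for v
    by (simp add: abs_mult power_abs algebra_simps)
  then show "AE v in lborel. norm (\<bar>v\<bar> ^ j * \<bar>k v\<bar>) \<le> norm (\<bar>k v\<bar> + \<bar>v ^ (s + 1) * k v\<bar>)"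
    by (intro AE_I2) (auto simp: abs_mult)
qed simp

lemma mom_nonneg: "0 \<le> mom j"
  unfolding mom_def by (intro integral_nonneg_AE) auto

lemma integrable_k_mult:
  assumes [measurable]: "g \<in> borel_measurable borel" and j: "j \<le> s + 1" and b: "\<And>v. \<bar>g v\<bar> \<le> B * \<bar>v\<bar> ^ j"
  shows "integrable lborel (\<lambda>v. k v * g v)" "\<bar>LBINT v. k v * g v\<bar> \<le> B * mom j"
proof -
  have i: "integrable lborel (\<lambda>v. B * (\<bar>v\<bar> ^ j * \<bar>k v\<bar>))"
    by (intro integrable_mult_right integrable_abs_mom j)
  have le: "\<bar>k v * g v\<bar> \<le> B * (\<bar>v\<bar> ^ j * \<bar>k v\<bar>)" for v
    using mult_left_mono[OF b[of v] abs_ge_zero[of "k v"]] by (simp add: abs_mult mult_ac)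
  show kg: "integrable lborel (\<lambda>v. k v * g v)"
    by (rule Bochner_Integration.integrable_bound[OF i]) (use order_trans[OF le abs_ge_self] in \<open>auto simp: mult.assoc\<close>)
  have "\<bar>LBINT v. k v * g v\<bar> \<le> (LBINT v. \<bar>k v * g v\<bar>)" by (rule integral_abs_bound)
  also have "\<dots> \<le> (LBINT v. B * (\<bar>v\<bar> ^ j * \<bar>k v\<bar>))"
    by (intro integral_mono integrable_abs kg i le)
  finally show "\<bar>LBINT v. k v * g v\<bar> \<le> B * mom j" by (simp add: mom_def)
qed

text \<open>As k integrates to 1, replacing g by the constant c costs only the integral of k (g -
  c). Where k is negative a lower bound on g would work in the wrong direction, hence the two-sided
  hypothesis.\<close>

lemma integral_k_ge:
  assumes [measurable]: "g \<in> borel_measurable borel" and b: "\<And>v. \<bar>g v - c\<bar> \<le> B * \<bar>v\<bar>"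
  shows "integrable lborel (\<lambda>v. k v * g v)" "c - B * mom 1 \<le> (LBINT v. k v * g v)"
proof -
  have i: "integrable lborel (\<lambda>v. k v * (g v - c))" "\<bar>LBINT v. k v * (g v - c)\<bar> \<le> B * mom 1"
    using integrable_k_mult[of "\<lambda>v. g v - c" 1 B] b by auto
  have "integrable lborel (\<lambda>v. k v * (g v - c) + k v * c)"
    using i k_int by (intro Bochner_Integration.integrable_add) auto
  then show ig: "integrable lborel (\<lambda>v. k v * g v)" by (simp add: algebra_simps)
  have "(LBINT v. k v * (g v - c)) = (LBINT v. k v * g v) - c"
    using ig k_int k_one by (simp add: right_diff_distrib)
  then show "c - B * mom 1 \<le> (LBINT v. k v * g v)" using i by linarith
qed

definition smoothed_gain :: "real \<Rightarrow> real \<Rightarrow> (real \<Rightarrow> real) \<Rightarrow> real \<Rightarrow> real \<Rightarrow> real" where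
  "smoothed_gain h \<tau> P q d = (LBINT v. k v * (P (q + d - h * v) - P (q - h * v))) - \<tau> * d"

end

definition gain :: "real \<Rightarrow> (real \<Rightarrow> real) \<Rightarrow> real \<Rightarrow> real \<Rightarrow> real" where
  "gain \<tau> P q d = P (q + d) - P q - \<tau> * d"

locale smooth_cdf =
  fixes P F f :: "real \<Rightarrow> real" and L :: real
  assumes P: "\<And>y. (P has_real_derivative F y) (at y)"
    and F: "\<And>y. (F has_real_derivative f y) (at y)"
    and lip: "\<And>x y. \<bar>f x - f y\<bar> \<le> L * \<bar>x - y\<bar>"
    and F01: "\<And>y. 0 \<le> F y" "\<And>y. F y \<le> 1"
    and f_nonneg: "\<And>y. 0 \<le> f y"
begin

lemma P_Lipschitz: "\<bar>P x - P y\<bar> \<le> \<bar>x - y\<bar>"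
  using abs_diff_le_of_deriv_bound[of P F 1 x y] P F01 by simp

lemma P_continuous [continuous_intros]: "continuous_on S P"
  by (intro continuous_at_imp_continuous_on) (auto intro: DERIV_isCont P)

lemma F_continuous [continuous_intros]: "continuous_on S F"
  by (intro continuous_at_imp_continuous_on) (auto intro: DERIV_isCont F)

lemma P_measurable [measurable]: "P \<in> borel_measurable borel"
  by (intro borel_measurable_continuous_onI P_continuous)

lemma F_measurable [measurable]: "F \<in> borel_measurable borel"
  by (intro borel_measurable_continuous_onI F_continuous)

lemma L_nonneg: "0 \<le> L"
  using lip[of 1 0] by simp

text \<open>The increment of P under a shift by a has second derivative f (y - a) - f y, of size at
  most L |a|. Feeding these increments and their negatives into the second-order estimates bounds
  the effect of smoothing by a multiple of h d^2; the Lipschitz bound on P would lose the factor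
  d^2.\<close>

lemma shift_deriv:
  "((\<lambda>y. P (y - a) - P y) has_real_derivative F (y - a) - F y) (at y)"
  "((\<lambda>y. F (y - a) - F y) has_real_derivative f (y - a) - f y) (at y)"
  using DERIV_diff[OF has_real_derivative_shift[OF P, of "- a" y] P]
    DERIV_diff[OF has_real_derivative_shift[OF F, of "- a" y] F] by (simp_all add: algebra_simps)

lemma gain_ge: "d\<^sup>2 / 2 * (f q - L * \<bar>d\<bar>) \<le> gain (F q) P q d"
proof -
  have "(f q - L * \<bar>d\<bar>) * d\<^sup>2 / 2 \<le> P (q + d) - P q - d * F q"
  proof (rule Taylor2_ge[OF P F])
    fix x assume "\<bar>x - q\<bar> \<le> \<bar>d\<bar>"
    then have "L * \<bar>q - x\<bar> \<le> L * \<bar>d\<bar>" using L_nonneg by (intro mult_left_mono) auto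
    then show "f q - L * \<bar>d\<bar> \<le> f x" using lip[of q x] by linarith
  qed
  then show ?thesis by (simp add: gain_def mult_ac)
qed

text \<open>P is convex because its second derivative f is nonnegative, and the gain vanishes at d =
  0, so along a ray it lies below its chord.\<close>

lemma gain_convex:
  assumes "0 \<le> t" "t \<le> 1"
  shows "gain \<tau> P q (t * d) \<le> t * gain \<tau> P q d"
proof -
  have "convex_on UNIV P"
    by (rule f''_ge0_imp_convex[OF convex_UNIV, of _ F f]) (use P F f_nonneg in auto)
  from convex_onD[OF this assms, of q "q + d"]
  have "P (q + t * d) \<le> (1 - t) * P q + t * P (q + d)" by (simp add: algebra_simps)
  then show ?thesis by (simp add: gain_def algebra_simps)
qed

end

locale smooth_cdf_kernel = smooth_cdf P F f L + smoothing_kernel k s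
  for P F f L k s +
  fixes h :: real
  assumes h_pos: "0 < h"
begin

lemma integrable_increment: "integrable lborel (\<lambda>v. k v * (P (a - h * v) - P (b - h * v)))"
proof (rule integrable_k_mult(1)[where j=0 and B="\<bar>a - b\<bar>"])
  show "\<bar>P (a - h * v) - P (b - h * v)\<bar> \<le> \<bar>a - b\<bar> * \<bar>v\<bar> ^ 0" for v
    using P_Lipschitz[of "a - h * v" "b - h * v"] by simp
qed auto

text \<open>The second difference of the smoothed gain is the kernel average of
  \<open>S (h * v)\<close>, the second difference of P shifted by h v. At shift 0 the curvature is
  at least f q - L r; the shift changes S by at most ((d - e)/2)^2 L h |v|. Both terms scale with
  the same square, so a kernel with negative values still preserves strong convexity for small
  h.\<close>

lemma smoothed_gain_second_difference:
  assumes r: "\<bar>d\<bar> \<le> r" "\<bar>e\<bar> \<le> r"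
  shows "((d - e) / 2)\<^sup>2 * (f q - L * r - L * h * mom 1)
     \<le> smoothed_gain h \<tau> P q d + smoothed_gain h \<tau> P q e - 2 * smoothed_gain h \<tau> P q ((d + e) / 2)"
proof -
  define S where "S a = P (q + d - a) + P (q + e - a) - 2 * P ((q + d + (q + e)) / 2 - a)" for a
  define u where "u = ((d - e) / 2)\<^sup>2"
  have u0: "0 \<le> u" by (simp add: u_def)
  have mid: "q + (d + e) / 2 = (q + d + (q + e)) / 2" by (simp add: field_simps)
  have "(f q - L * r) * ((q + d - (q + e)) / 2)\<^sup>2 \<le> P (q + d) + P (q + e) - 2 * P ((q + d + (q + e)) / 2)"
  proof (rule second_difference_ge[OF P F])
    fix x assume "min (q + d) (q + e) \<le> x" "x \<le> max (q + d) (q + e)"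
    then have "L * \<bar>q - x\<bar> \<le> L * r" using L_nonneg r by (intro mult_left_mono) (auto simp: abs_if split: if_splits)
    then show "f q - L * r \<le> f x" using lip[of q x] by linarith
  qed
  then have S0: "u * (f q - L * r) \<le> S 0" by (simp add: S_def u_def mult.commute)
  have Sd: "\<bar>S (h * v) - S 0\<bar> \<le> (u * L * h) * \<bar>v\<bar>" for v
  proof -
    have "\<bar>f (y - h * v) - f y\<bar> \<le> L * h * \<bar>v\<bar>" for y
      using lip[of "y - h * v" y] h_pos by (simp add: abs_mult mult_ac)
    then have b: "- (L * h * \<bar>v\<bar>) \<le> f (y - h * v) - f y" "- (L * h * \<bar>v\<bar>) \<le> - (f (y - h * v) - f y)" for y
      unfolding abs_le_iff by (metis minus_le_iff, metis le_imp_neg_le)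
    have 1: "- (L * h * \<bar>v\<bar>) * ((q + d - (q + e)) / 2)\<^sup>2 \<le> (P (q + d - h * v) - P (q + d)) + (P (q + e - h * v) - P (q + e))
        - 2 * (P ((q + d + (q + e)) / 2 - h * v) - P ((q + d + (q + e)) / 2))"
      by (rule second_difference_ge[OF shift_deriv]) (rule b)
    have 2: "- (L * h * \<bar>v\<bar>) * ((q + d - (q + e)) / 2)\<^sup>2 \<le> - (P (q + d - h * v) - P (q + d)) + - (P (q + e - h * v) - P (q + e))
        - 2 * - (P ((q + d + (q + e)) / 2 - h * v) - P ((q + d + (q + e)) / 2))"
      by (rule second_difference_ge[OF DERIV_minus[OF shift_deriv(1)] DERIV_minus[OF shift_deriv(2)]])
         (rule b)
    have "(q + d - (q + e)) / 2 = (d - e) / 2" by simp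
    then show ?thesis using 1 2 unfolding S_def u_def by (simp add: abs_le_iff algebra_simps)
  qed
  have [measurable]: "S \<in> borel_measurable borel" unfolding S_def by measurable
  note kS = integral_k_ge[of "\<lambda>v. S (h * v)" "S 0" "u * L * h", OF _ Sd]
  have "smoothed_gain h \<tau> P q d + smoothed_gain h \<tau> P q e - 2 * smoothed_gain h \<tau> P q ((d + e) / 2)
      = (LBINT v. k v * (P (q + d - h * v) - P (q - h * v))) + (LBINT v. k v * (P (q + e - h * v) - P (q - h * v)))
        - 2 * (LBINT v. k v * (P (q + (d + e) / 2 - h * v) - P (q - h * v)))"
    by (simp add: smoothed_gain_def algebra_simps)
  also have "\<dots> = (LBINT v. k v * (P (q + d - h * v) - P (q - h * v)) + k v * (P (q + e - h * v) - P (q - h * v))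
        - 2 * (k v * (P (q + (d + e) / 2 - h * v) - P (q - h * v))))"
    using integrable_increment by simp
  also have "\<dots> = (LBINT v. k v * S (h * v))"
    by (intro Bochner_Integration.integral_cong) (auto simp: S_def mid algebra_simps)
  also have "\<dots> \<ge> S 0 - u * L * h * mom 1" using kS(2) by simp
  finally have "S 0 - u * L * h * mom 1 \<le> smoothed_gain h \<tau> P q d + smoothed_gain h \<tau> P q e - 2 * smoothed_gain h \<tau> P q ((d + e) / 2)" .
  then show ?thesis using S0 unfolding u_def[symmetric] by (simp add: algebra_simps)
qed

text \<open>The scheme of the second difference, with S the first-order Taylor remainder at q. The
  linear term left over has as coefficient the bias of the smoothed cdf at q, which need not vanish
  even where F q = \<tau>.\<close>

lemma smoothed_gain_ge:
  "d\<^sup>2 / 2 * (f q - L * \<bar>d\<bar> - L * h * mom 1) - \<bar>d\<bar> * \<bar>(LBINT v. k v * F (q - h * v)) - \<tau>\<bar> \<le> smoothed_gain h \<tau> P q d"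
proof -
  define S where "S a = P (q + d - a) - P (q - a) - d * F (q - a)" for a
  have S0: "d\<^sup>2 / 2 * (f q - L * \<bar>d\<bar>) \<le> S 0" using gain_ge[of d q] by (simp add: gain_def S_def mult.commute)
  have Sd: "\<bar>S (h * v) - S 0\<bar> \<le> (L * h * d\<^sup>2 / 2) * \<bar>v\<bar>" for v
  proof -
    have "\<bar>f (y - h * v) - f y\<bar> \<le> L * h * \<bar>v\<bar>" for y
      using lip[of "y - h * v" y] h_pos by (simp add: abs_mult mult_ac)
    then have b: "- (L * h * \<bar>v\<bar>) \<le> f (y - h * v) - f y" "- (L * h * \<bar>v\<bar>) \<le> - (f (y - h * v) - f y)" for y
      unfolding abs_le_iff by (metis minus_le_iff, metis le_imp_neg_le)
    have 1: "- (L * h * \<bar>v\<bar>) * d\<^sup>2 / 2 \<le> (P (q + d - h * v) - P (q + d)) - (P (q - h * v) - P q) - d * (F (q - h * v) - F q)"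
      by (rule Taylor2_ge[OF shift_deriv]) (rule b)
    have 2: "- (L * h * \<bar>v\<bar>) * d\<^sup>2 / 2 \<le> - (P (q + d - h * v) - P (q + d)) - - (P (q - h * v) - P q) - d * - (F (q - h * v) - F q)"
      by (rule Taylor2_ge[OF DERIV_minus[OF shift_deriv(1)] DERIV_minus[OF shift_deriv(2)]]) (rule b)
    show ?thesis using 1 2 unfolding S_def by (intro abs_leI) (simp_all add: algebra_simps)
  qed
  have [measurable]: "S \<in> borel_measurable borel" unfolding S_def by measurable
  note kS = integral_k_ge[of "\<lambda>v. S (h * v)" "S 0" "L * h * d\<^sup>2 / 2", OF _ Sd]
  have kF: "integrable lborel (\<lambda>v. k v * F (q - h * v))"
    using F01 by (intro integrable_k_mult(1)[where j=0 and B=1]) auto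
  have "smoothed_gain h \<tau> P q d = (LBINT v. k v * S (h * v) + d * (k v * F (q - h * v))) - \<tau> * d"
    unfolding smoothed_gain_def
    by (intro arg_cong2[where f="(-)"] Bochner_Integration.integral_cong) (auto simp: S_def algebra_simps)
  also have "\<dots> = (LBINT v. k v * S (h * v)) + d * ((LBINT v. k v * F (q - h * v)) - \<tau>)"
    using kS(1) kF by (simp add: algebra_simps)
  finally have eq: "smoothed_gain h \<tau> P q d = (LBINT v. k v * S (h * v)) + d * ((LBINT v. k v * F (q - h * v)) - \<tau>)" .
  have "- (\<bar>d\<bar> * \<bar>(LBINT v. k v * F (q - h * v)) - \<tau>\<bar>) \<le> d * ((LBINT v. k v * F (q - h * v)) - \<tau>)"
    unfolding abs_mult[symmetric] by linarith
  moreover have "S 0 - L * h * d\<^sup>2 / 2 * mom 1 \<le> (LBINT v. k v * S (h * v))" using kS(2) by simp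
  ultimately show ?thesis using S0 unfolding eq by (simp add: algebra_simps)
qed

text \<open>P is 1-Lipschitz, so each of its two values moves by at most h |v|. The bound does not
  depend on d, which makes it usable far from the optimum, where the quadratic estimates are
  worthless.\<close>

lemma smoothed_gain_near_gain: "\<bar>smoothed_gain h \<tau> P q d - gain \<tau> P q d\<bar> \<le> 2 * h * mom 1"
proof -
  define G where "G v = P (q + d - h * v) - P (q - h * v) - (P (q + d) - P q)" for v
  have G: "\<bar>G v\<bar> \<le> (2 * h) * \<bar>v\<bar> ^ 1" for v
    using P_Lipschitz[of "q + d - h * v" "q + d"] P_Lipschitz[of "q - h * v" q] h_pos
    by (simp add: G_def abs_mult)
  have "(LBINT v. k v * (P (q + d - h * v) - P (q - h * v))) - (P (q + d) - P q)
      = (LBINT v. k v * (P (q + d - h * v) - P (q - h * v)) - k v * (P (q + d) - P q))"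
    using integrable_increment k_int k_one by simp
  also have "\<dots> = (LBINT v. k v * G v)"
    by (intro Bochner_Integration.integral_cong) (auto simp: G_def algebra_simps)
  finally have "smoothed_gain h \<tau> P q d - gain \<tau> P q d = (LBINT v. k v * G v)"
    by (simp add: smoothed_gain_def gain_def)
  moreover have "G \<in> borel_measurable borel" unfolding G_def by measurable
  from integrable_k_mult(2)[OF this _ G] have "\<bar>LBINT v. k v * G v\<bar> \<le> 2 * h * mom 1" by simp
  ultimately show ?thesis by simp
qed

text \<open>Taylor's formula up to order s: the mass 1 of k returns F q, its moments of orders 1 to
  s vanish, and the remainder carries h^(s+1). \<open>D\<close> lists F and its derivatives, so
  \<open>D (Suc s)\<close> is in effect the s-th derivative of the density.\<close>

lemma smoothing_bias:
  assumes D0: "D 0 = F" and D: "\<And>j y. j \<le> s \<Longrightarrow> (D j has_real_derivative D (Suc j) y) (at y)"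
    and b: "\<And>y. \<bar>D (Suc s) y\<bar> \<le> B"
  shows "\<bar>(LBINT v. k v * F (q - h * v)) - F q\<bar> \<le> B * mom (s + 1) * h ^ (s + 1)"
proof -
  define T where "T v = (\<Sum>j<Suc s. D j q / fact j * (- h * v) ^ j)" for v
  have T: "\<bar>F (q - h * v) - T v\<bar> \<le> (B * h ^ (s + 1)) * \<bar>v\<bar> ^ (s + 1)" for v
  proof -
    define E where "E j t = D j (q + t)" for j t
    have "\<exists>t. \<bar>t\<bar> \<le> \<bar>- h * v\<bar> \<and> F (q + (- h * v)) = (\<Sum>j<Suc s. E j 0 / fact j * (- h * v) ^ j) + E (Suc s) t / fact (Suc s) * (- h * v) ^ Suc s"
    proof (rule Maclaurin_bi_le[where f="\<lambda>t. F (q + t)"])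
      show "E 0 = (\<lambda>t. F (q + t))" by (simp add: E_def D0 fun_eq_iff)
      show "\<forall>j t. j < Suc s \<and> \<bar>t\<bar> \<le> \<bar>- h * v\<bar> \<longrightarrow> (E j has_real_derivative E (Suc j) t) (at t)"
        unfolding E_def by (auto intro!: has_real_derivative_shift D)
    qed
    then obtain t where t: "F (q - h * v) = T v + D (Suc s) (q + t) / fact (Suc s) * (- h * v) ^ Suc s"
      by (auto simp: E_def T_def)
    have "\<bar>F (q - h * v) - T v\<bar> = \<bar>D (Suc s) (q + t)\<bar> / fact (Suc s) * (h * \<bar>v\<bar>) ^ Suc s"
      unfolding t using h_pos by (simp add: abs_mult power_abs)
    \<comment> \<open>The factorial is merely bounded below by 1.\<close>
    also have "\<dots> \<le> B / 1 * (h * \<bar>v\<bar>) ^ Suc s"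
      using b[of "q + t"] h_pos fact_ge_1[of "Suc s", where 'a=real] by (intro mult_right_mono frac_le) (auto intro: order_trans[OF abs_ge_zero])
    finally show ?thesis by (simp add: power_mult_distrib mult_ac)
  qed
  have im: "integrable lborel (\<lambda>v. k v * v ^ j)" if "j \<le> s + 1" for j
    by (rule integrable_k_mult(1)[where B=1, OF _ that]) (auto simp: power_abs)
  have kT: "integrable lborel (\<lambda>v. k v * T v)" "(LBINT v. k v * T v) = F q"
  proof -
    have eq: "k v * T v = (\<Sum>j<Suc s. D j q / fact j * (- h) ^ j * (k v * v ^ j))" for v
      unfolding T_def sum_distrib_left
      by (intro sum.cong refl) (simp only: power_mult_distrib mult_ac)
    show "integrable lborel (\<lambda>v. k v * T v)" unfolding eq
      by (intro Bochner_Integration.integrable_sum integrable_mult_right im) auto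
    have m: "(LBINT v. k v * v ^ j) = (if j = 0 then 1 else 0)" if "j < Suc s" for j
      using k_mom0[of j] k_one that by (auto simp: mult.commute)
    have "(LBINT v. k v * T v) = (\<Sum>j<Suc s. D j q / fact j * (- h) ^ j * (LBINT v. k v * v ^ j))"
      unfolding eq by (subst Bochner_Integration.integral_sum) (auto intro!: im integrable_mult_right)
    also have "\<dots> = (\<Sum>j<Suc s. if j = 0 then F q else 0)"
      by (intro sum.cong) (auto simp: m D0)
    finally show "(LBINT v. k v * T v) = F q" by simp
  qed
  have kF: "integrable lborel (\<lambda>v. k v * F (q - h * v))"
    using F01 by (intro integrable_k_mult(1)[where j=0 and B=1]) auto
  have [measurable]: "T \<in> borel_measurable borel" unfolding T_def by measurable
  have "(LBINT v. k v * F (q - h * v)) - F q = (LBINT v. k v * (F (q - h * v) - T v))"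
    using kT kF by (simp add: right_diff_distrib)
  moreover have "\<bar>LBINT v. k v * (F (q - h * v) - T v)\<bar> \<le> (B * h ^ (s + 1)) * mom (s + 1)"
    by (rule integrable_k_mult(2)[OF _ _ T]) auto
  ultimately show ?thesis by (simp add: mult_ac)
qed

end

subsection \<open>Conditional distribution functions and the excess risk\<close>

text \<open>The product bound is asked for almost every x only, since the conditional cdf is known
  to stay below 1 only up to a null event. Integrability of the inner integrals belongs to the
  conclusion so that sums can be split afterwards.\<close>

lemma Fubini_bounded:
  fixes g :: "'a \<Rightarrow> 'b \<Rightarrow> real"
  assumes M: "sigma_finite_measure M" and N: "sigma_finite_measure N"
    and g[measurable]: "(\<lambda>(x, y). g x y) \<in> borel_measurable (M \<Otimes>\<^sub>M N)"
    and a: "integrable M a" and b: "integrable N b"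
    and le: "AE x in M. \<forall>y\<in>space N. \<bar>g x y\<bar> \<le> a x * b y"
  shows "integrable (M \<Otimes>\<^sub>M N) (\<lambda>(x, y). g x y)"
    and "(\<integral>x. (\<integral>y. g x y \<partial>N) \<partial>M) = (\<integral>y. (\<integral>x. g x y \<partial>M) \<partial>N)"
    and "integrable M (\<lambda>x. \<integral>y. g x y \<partial>N)" and "integrable N (\<lambda>y. \<integral>x. g x y \<partial>M)"
proof -
  interpret pair_sigma_finite M N using M N by (simp add: pair_sigma_finite_def)
  have i1: "AE x in M. integrable N (\<lambda>y. g x y)"
    using le AE_space
  proof eventually_elim
    case (elim x)
    have [measurable]: "g x \<in> borel_measurable N" using g elim(2) by measurable
    have "integrable N (\<lambda>y. a x * b y)" using b by simp
    then show ?case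
      by (rule Bochner_Integration.integrable_bound) (use elim in \<open>auto intro!: AE_I2 order_trans[OF _ abs_ge_self]\<close>)
  qed
  show i: "integrable (M \<Otimes>\<^sub>M N) (\<lambda>(x, y). g x y)"
  proof (rule Fubini_integrable)
    show "integrable M (\<lambda>x. \<integral>y. norm (case (x, y) of (x, y) \<Rightarrow> g x y) \<partial>N)"
    proof (rule Bochner_Integration.integrable_bound)
      show "integrable M (\<lambda>x. a x * (\<integral>y. b y \<partial>N))" using a by simp
      show "AE x in M. norm (\<integral>y. norm (case (x, y) of (x, y) \<Rightarrow> g x y) \<partial>N) \<le> norm (a x * (\<integral>y. b y \<partial>N))"
        using le i1
      proof eventually_elim
        case (elim x)
        have "(\<integral>y. \<bar>g x y\<bar> \<partial>N) \<le> (\<integral>y. a x * b y \<partial>N)"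
          using elim b by (intro integral_mono) auto
        then show ?case by simp
      qed
    qed simp
  qed (use i1 in auto)
  show "(\<integral>x. (\<integral>y. g x y \<partial>N) \<partial>M) = (\<integral>y. (\<integral>x. g x y \<partial>M) \<partial>N)"
    using Fubini_integral[of g] i by simp
  show "integrable M (\<lambda>x. \<integral>y. g x y \<partial>N)" using integrable_fst'[OF i] by simp
  show "integrable N (\<lambda>y. \<integral>x. g x y \<partial>M)" using integrable_snd[OF i] by simp
qed

lemma cdf_mono:
  assumes "integrable lborel (f x)" "\<And>u. 0 \<le> f x u" "a \<le> b"
  shows "Defs.cdf f x a \<le> Defs.cdf f x b"
  unfolding Defs.cdf_def set_lebesgue_integral_def
  using assms by (intro integral_mono integrable_mult_indicator) (auto simp: indicator_def)

lemma cdf_nonneg: "(\<And>u. 0 \<le> f x u) \<Longrightarrow> 0 \<le> Defs.cdf f x y"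
  unfolding Defs.cdf_def set_lebesgue_integral_def by (intro integral_nonneg_AE) auto

lemma cdf_tendsto:
  assumes i: "integrable lborel (f x)" and lim: "AE u in lborel. (\<lambda>n. indicator {..a n} u) \<longlonglongrightarrow> (indicator A u :: real)"
    and A: "A \<in> sets borel"
  shows "(\<lambda>n. Defs.cdf f x (a n)) \<longlonglongrightarrow> (LBINT u:A. f x u)"
  unfolding Defs.cdf_def set_lebesgue_integral_def
proof (rule integral_dominated_convergence[where w="\<lambda>u. \<bar>f x u\<bar>"])
  show "AE u in lborel. (\<lambda>n. indicator {..a n} u *\<^sub>R f x u) \<longlonglongrightarrow> indicator A u *\<^sub>R f x u"
    using lim by eventually_elim (intro tendsto_intros)
qed (use i A in \<open>auto simp: indicator_def\<close>)

lemma cdf_isCont: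
  assumes i: "integrable lborel (f x)"
  shows "isCont (Defs.cdf f x) y"
proof (rule continuous_at_sequentiallyI)
  fix a assume a: "a \<longlonglongrightarrow> y"
  have "(\<lambda>n. Defs.cdf f x (a n)) \<longlonglongrightarrow> (LBINT u:{..y}. f x u)"
  proof (rule cdf_tendsto[where f=f and x=x, OF i])
    show "AE u in lborel. (\<lambda>n. indicator {..a n} u) \<longlonglongrightarrow> (indicator {..y} u :: real)"
      using AE_lborel_singleton[of y]
    proof eventually_elim
      case (elim u)
      show ?case
      proof (cases "u < y")
        case True
        from order_tendstoD(1)[OF a this] show ?thesis using True
          by (intro tendsto_eventually) (auto elim!: eventually_mono simp: indicator_def)
      next
        case False
        then have "y < u" using elim by auto
        from order_tendstoD(2)[OF a this] show ?thesis using \<open>y < u\<close>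
          by (intro tendsto_eventually) (auto elim!: eventually_mono simp: indicator_def)
      qed
    qed
  qed simp
  then show "(\<lambda>n. Defs.cdf f x (a n)) \<longlonglongrightarrow> Defs.cdf f x y" by (simp add: Defs.cdf_def)
qed

lemma cdf_at_bot:
  assumes i: "integrable lborel (f x)"
  shows "(\<lambda>n. Defs.cdf f x (- real n)) \<longlonglongrightarrow> 0"
proof -
  have "(\<lambda>n. Defs.cdf f x (- real n)) \<longlonglongrightarrow> (LBINT u:{}. f x u)"
  proof (rule cdf_tendsto[where f=f and x=x, OF i])
    show "AE u in lborel. (\<lambda>n. indicator {..- real n} u) \<longlonglongrightarrow> (indicator {} u :: real)"
    proof (rule AE_I2)
      fix u :: real
      obtain N where "- u < real N" using reals_Archimedean2 by blast
      then have "eventually (\<lambda>n. indicator {..- real n} u = (indicator {} u :: real)) sequentially"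
        by (intro eventually_sequentiallyI[of N]) (auto simp: indicator_def)
      then show "(\<lambda>n. indicator {..- real n} u) \<longlonglongrightarrow> (indicator {} u :: real)" by (rule tendsto_eventually)
    qed
  qed simp
  then show ?thesis by (simp add: set_lebesgue_integral_def)
qed

lemma cdf_at_top:
  assumes i: "integrable lborel (f x)"
  shows "(\<lambda>n. Defs.cdf f x (real n)) \<longlonglongrightarrow> (LBINT u. f x u)"
proof -
  have "(\<lambda>n. Defs.cdf f x (real n)) \<longlonglongrightarrow> (LBINT u:UNIV. f x u)"
  proof (rule cdf_tendsto[where f=f and x=x, OF i])
    show "AE u in lborel. (\<lambda>n. indicator {..real n} u) \<longlonglongrightarrow> (indicator UNIV u :: real)"
    proof (rule AE_I2)
      fix u :: real
      obtain N where "u < real N" using reals_Archimedean2 by blast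
      then have "eventually (\<lambda>n. indicator {..real n} u = (indicator UNIV u :: real)) sequentially"
        by (intro eventually_sequentiallyI[of N]) (auto simp: indicator_def)
      then show "(\<lambda>n. indicator {..real n} u) \<longlonglongrightarrow> (indicator UNIV u :: real)" by (rule tendsto_eventually)
    qed
  qed simp
  then show ?thesis by (simp add: set_lebesgue_integral_def)
qed

text \<open>The set in the definition of the quantile is closed by continuity of the cdf, so its
  infimum q belongs to it; the intermediate value theorem supplies a point up to q with value
  exactly t, and minimality makes it q.\<close>

lemma cdf_cond_quantile:
  assumes i: "integrable lborel (f x)" and nn: "\<And>u. 0 \<le> f x u" and one: "(LBINT u. f x u) = 1"
    and t: "0 < t" "t < 1"
  shows "Defs.cdf f x (cond_quantile f x t) = t"
proof -
  let ?G = "Defs.cdf f x" and ?A = "{y. t \<le> Defs.cdf f x y}"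
  note mono = cdf_mono[where f=f and x=x, OF i nn]
  have cont: "continuous_on S ?G" for S by (intro continuous_at_imp_continuous_on ballI cdf_isCont[where f=f and x=x, OF i])
  obtain n where n: "?G (- real n) < t"
    using order_tendstoD(2)[OF cdf_at_bot[where f=f and x=x, OF i] t(1)] by (auto simp: eventually_sequentially)
  have "eventually (\<lambda>n. t < ?G (real n)) sequentially"
    using order_tendstoD(1)[OF cdf_at_top[where f=f and x=x, OF i], of t] t(2) one by simp
  then obtain N where N: "t < ?G (real N)" by (auto simp: eventually_sequentially)
  have lb: "- real n \<le> y" if "y \<in> ?A" for y
    using that n mono[of y "- real n"] by (cases "- real n \<le> y") auto
  have ne: "?A \<noteq> {}" using N by (auto intro!: exI[of _ "real N"])
  have bdd: "bdd_below ?A" using lb by (intro bdd_belowI[of _ "- real n"])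
  have cl: "closed ?A" by (intro closed_Collect_le cont continuous_on_const)
  define q where "q = Inf ?A"
  have q: "t \<le> ?G q" using closed_contains_Inf[OF ne bdd cl] by (simp add: q_def)
  have "- real n \<le> q" using cInf_greatest[OF ne lb] by (simp add: q_def)
  from IVT'[OF less_imp_le[OF n] q this cont] obtain y where y: "y \<le> q" "?G y = t" by auto
  have "q \<le> y" unfolding q_def using y by (intro cInf_lower bdd) auto
  with y have "?G q = t" by simp
  then show ?thesis by (simp add: cond_quantile_def q_def)
qed

text \<open>Discretisation of a random threshold to countably many values. Rounding upwards makes
  the events Y \<le> threshold converge even if Y hits the threshold exactly.\<close>

definition dyadic_up :: "nat \<Rightarrow> real \<Rightarrow> real" where
  "dyadic_up n y = of_int \<lceil>y * 2 ^ n\<rceil> / 2 ^ n"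

lemma dyadic_up: "y \<le> dyadic_up n y" "(\<lambda>n. dyadic_up n y) \<longlonglongrightarrow> y"
proof -
  have b: "y \<le> dyadic_up n y" "dyadic_up n y \<le> y + (1/2)^n" for n
  proof -
    have "y * 2 ^ n \<le> of_int \<lceil>y * 2 ^ n\<rceil>" "of_int \<lceil>y * 2 ^ n\<rceil> \<le> y * 2 ^ n + 1" by linarith+
    then show "y \<le> dyadic_up n y" "dyadic_up n y \<le> y + (1/2)^n"
      by (auto simp: dyadic_up_def field_simps power_divide)
  qed
  show "y \<le> dyadic_up n y" by (rule b)
  have l: "(\<lambda>n. y + (1/2)^n) \<longlonglongrightarrow> y + 0" by (intro tendsto_intros LIMSEQ_realpow_zero) auto
  show "(\<lambda>n. dyadic_up n y) \<longlonglongrightarrow> y"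
    by (rule tendsto_sandwich[of "\<lambda>_. y" _ _ "\<lambda>n. y + (1/2)^n"]) (use b l in auto)
qed

text \<open>Decomposition over the level sets of J; with nonnegative integrals the exchange with the
  sum raises no question of summability.\<close>

lemma nn_integral_split_int:
  fixes J :: "'a \<Rightarrow> int" and g :: "int \<Rightarrow> 'a \<Rightarrow> ennreal"
  assumes [measurable]: "J \<in> measurable M (count_space UNIV)" "\<And>j. g j \<in> borel_measurable M"
  shows "(\<integral>\<^sup>+x. g (J x) x \<partial>M) = (\<integral>\<^sup>+j. (\<integral>\<^sup>+x. g j x * indicator {x. J x = j} x \<partial>M) \<partial>count_space UNIV)"
proof -
  have "(\<integral>\<^sup>+x. g (J x) x \<partial>M) = (\<integral>\<^sup>+x. (\<integral>\<^sup>+j. g j x * indicator {x. J x = j} x \<partial>count_space UNIV) \<partial>M)"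
  proof (rule nn_integral_cong)
    fix x
    have "(\<integral>\<^sup>+j. g j x * indicator {x. J x = j} x \<partial>count_space UNIV) = (\<integral>\<^sup>+j. g (J x) x * indicator {J x} j \<partial>count_space UNIV)"
      by (intro nn_integral_cong) (auto simp: indicator_def)
    then show "g (J x) x = (\<integral>\<^sup>+j. g j x * indicator {x. J x = j} x \<partial>count_space UNIV)"
      by (simp add: nn_integral_cmult)
  qed
  also have "\<dots> = (\<integral>\<^sup>+j. (\<integral>\<^sup>+x. g j x * indicator {x. J x = j} x \<partial>M) \<partial>count_space UNIV)"
    by (intro nn_integral_count_space_nn_integral) auto
  finally show ?thesis .
qed

section \<open>Conditioning on the random function\<close>

locale cond_density = random_function M X for M :: "'a measure" and X +
  fixes Y :: "'a \<Rightarrow> real" and f :: "(real \<Rightarrow> real) \<Rightarrow> real \<Rightarrow> real"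
  assumes Y_meas [measurable]: "Y \<in> borel_measurable M"
    and Y_int: "integrable M Y"
    and cond_dens: "is_cond_density M X Y f"
begin

abbreviation "S \<equiv> sigmaX M X"
abbreviation "G \<omega> y \<equiv> Defs.cdf f (X \<omega>) y"

lemma space_S [simp]: "space S = space M"
  by (simp add: sigmaX_def space_measure_of_conv)

lemma subalg: "subalgebra M S"
proof -
  have "sigma_sets (space M) {(\<lambda>\<omega>. lin g (X \<omega>)) -` B \<inter> space M | g B. L2 g \<and> B \<in> sets borel} \<subseteq> sets M"
    by (rule sets.sigma_sets_subset) (auto intro: measurable_sets lin_X_measurable)
  moreover have "{(\<lambda>\<omega>. lin g (X \<omega>)) -` B \<inter> space M | g B. L2 g \<and> B \<in> sets borel} \<subseteq> Pow (space M)" by auto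
  ultimately show ?thesis by (simp add: subalgebra_def) (simp add: sigmaX_def)
qed

lemma measurable_S: "g \<in> borel_measurable S \<Longrightarrow> g \<in> borel_measurable M"
  using subalg by (rule measurable_from_subalg)

lemma sets_S: "A \<in> sets S \<Longrightarrow> A \<in> sets M"
  using subalg by (auto simp: subalgebra_def)

lemma lin_S [measurable]:
  assumes "L2 g"
  shows "(\<lambda>\<omega>. lin g (X \<omega>)) \<in> borel_measurable S"
proof (rule measurableI)
  fix B :: "real set" assume "B \<in> sets borel"
  then have "(\<lambda>\<omega>. lin g (X \<omega>)) -` B \<inter> space M \<in> {(\<lambda>\<omega>. lin g (X \<omega>)) -` B \<inter> space M | g B. L2 g \<and> B \<in> sets borel}"
    using assms by blast
  moreover have "{(\<lambda>\<omega>. lin g (X \<omega>)) -` B \<inter> space M | g B. L2 g \<and> B \<in> sets borel} \<subseteq> Pow (space M)" by auto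
  ultimately show "(\<lambda>\<omega>. lin g (X \<omega>)) -` B \<inter> space S \<in> sets S"
    by simp (simp add: sigmaX_def)
qed simp

lemma f_X:
  assumes "\<omega> \<in> space M"
  shows f_X_nonneg: "0 \<le> f (X \<omega>) u" and f_X_integrable: "integrable lborel (f (X \<omega>))"
  using cond_dens assms unfolding is_cond_density_def by blast+

lemma G_meas_S [measurable]: "(\<lambda>\<omega>. G \<omega> y) \<in> borel_measurable S"
  using cond_dens unfolding is_cond_density_def by blast

lemma G_meas [measurable]: "(\<lambda>\<omega>. G \<omega> y) \<in> borel_measurable M"
  by (rule measurable_S[OF G_meas_S])

lemma G_mono: "\<omega> \<in> space M \<Longrightarrow> a \<le> b \<Longrightarrow> G \<omega> a \<le> G \<omega> b"
  by (intro cdf_mono f_X_nonneg f_X_integrable)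

lemma G_nonneg: "\<omega> \<in> space M \<Longrightarrow> 0 \<le> G \<omega> y"
  by (intro cdf_nonneg f_X_nonneg)

lemma G_isCont: "\<omega> \<in> space M \<Longrightarrow> isCont (Defs.cdf f (X \<omega>)) y"
  by (intro cdf_isCont f_X_integrable)

lemma G_measure: "A \<in> sets S \<Longrightarrow> measure M (A \<inter> {\<omega> \<in> space M. Y \<omega> \<le> y}) = (\<integral>\<omega>. indicator A \<omega> * G \<omega> y \<partial>M)"
  using cond_dens unfolding is_cond_density_def set_lebesgue_integral_def by (simp add: mult.commute)

text \<open>The defining identity of the conditional density uses the Bochner integral, whose
  default value is 0. If the cdf at n were not integrable, the identity on the whole space would
  give probability 0 to Y \<le> n, impossible for large n; smaller arguments follow by
  monotonicity.\<close>

lemma G_integrable: "integrable M (\<lambda>\<omega>. G \<omega> y)"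
proof -
  have "(\<lambda>n. measure M {\<omega> \<in> space M. Y \<omega> \<le> real n}) \<longlonglongrightarrow> measure M (\<Union>n. {\<omega> \<in> space M. Y \<omega> \<le> real n})"
    by (intro finite_Lim_measure_incseq) (auto simp: incseq_def)
  also have "(\<Union>n. {\<omega> \<in> space M. Y \<omega> \<le> real n}) = space M"
    using real_arch_simple by auto
  finally have "eventually (\<lambda>n. 0 < measure M {\<omega> \<in> space M. Y \<omega> \<le> real n}) sequentially"
    by (intro order_tendstoD(1)) (auto simp: prob_space)
  then obtain N where N: "\<And>n. n \<ge> N \<Longrightarrow> 0 < measure M {\<omega> \<in> space M. Y \<omega> \<le> real n}"
    by (auto simp: eventually_sequentially)
  obtain n where n: "y \<le> real n" using real_arch_simple by blast
  define n' where "n' = max n N"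
  have n': "y \<le> real n'" "n' \<ge> N" using n by (auto simp: n'_def)
  have i: "integrable M (\<lambda>\<omega>. G \<omega> (real n'))"
  proof (rule ccontr)
    assume "\<not> integrable M (\<lambda>\<omega>. G \<omega> (real n'))"
    then have "\<not> integrable M (\<lambda>\<omega>. indicator (space M) \<omega> * G \<omega> (real n'))"
      by (simp cong: Bochner_Integration.integrable_cong)
    then have "measure M (space M \<inter> {\<omega> \<in> space M. Y \<omega> \<le> real n'}) = 0"
      using G_measure[of "space M" "real n'"] sets.top[of S] not_integrable_integral_eq by (simp del: sets.top)
    then show False using N[OF n'(2)] by (simp add: Int_absorb1)
  qed
  show ?thesis
    by (rule Bochner_Integration.integrable_bound[OF i])
       (use n' in \<open>auto intro!: AE_I2 simp: G_nonneg G_mono\<close>)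
qed

text \<open>Letting the threshold grow in the defining identity shows that the total mass T
  integrates to P(A) over each A in the sigma-algebra of X. As a limit of cdf values T is measurable
  for that sigma-algebra, so uniqueness of densities there gives T = 1.\<close>

lemma AE_mass_one: "AE \<omega> in M. (LBINT u. f (X \<omega>) u) = 1"
proof -
  define T where "T \<omega> = (LBINT u. f (X \<omega>) u)" for \<omega>
  have lim: "(\<lambda>n. G \<omega> (real n)) \<longlonglongrightarrow> T \<omega>" if "\<omega> \<in> space M" for \<omega>
    unfolding T_def by (intro cdf_at_top f_X_integrable that)
  have T[measurable]: "T \<in> borel_measurable S"
    by (rule borel_measurable_LIMSEQ_real[OF _ G_meas_S]) (use lim in auto)
  note [measurable] = measurable_S[OF T]
  have *: "integrable M (\<lambda>\<omega>. indicator A \<omega> * T \<omega>) \<and> (\<integral>\<omega>. indicator A \<omega> * T \<omega> \<partial>M) = measure M A"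
    if A: "A \<in> sets S" for A
  proof -
    have [measurable]: "A \<in> sets M" by (rule sets_S[OF A])
    have "(\<lambda>n. measure M (A \<inter> {\<omega> \<in> space M. Y \<omega> \<le> real n})) \<longlonglongrightarrow> measure M (\<Union>n. A \<inter> {\<omega> \<in> space M. Y \<omega> \<le> real n})"
      by (intro finite_Lim_measure_incseq) (auto simp: incseq_def)
    also have "(\<Union>n. A \<inter> {\<omega> \<in> space M. Y \<omega> \<le> real n}) = A"
      using real_arch_simple subsetD[OF sets.sets_into_space[OF sets_S[OF A]]] by auto
    finally have l: "(\<lambda>n. \<integral>\<omega>. indicator A \<omega> * G \<omega> (real n) \<partial>M) \<longlonglongrightarrow> measure M A"
      unfolding G_measure[OF A] .
    have mono: "AE \<omega> in M. mono (\<lambda>n. indicator A \<omega> * G \<omega> (real n))"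
      by (rule AE_I2) (auto intro!: monoI mult_left_mono G_mono)
    have pos: "AE \<omega> in M. 0 \<le> indicator A \<omega> * G \<omega> (real n)" for n
      by (rule AE_I2) (auto simp: G_nonneg)
    have lm: "AE \<omega> in M. (\<lambda>n. indicator A \<omega> * G \<omega> (real n)) \<longlonglongrightarrow> indicator A \<omega> * T \<omega>"
      by (rule AE_I2) (auto intro!: tendsto_intros lim)
    have i: "integrable M (\<lambda>\<omega>. indicator A \<omega> * G \<omega> (real n))" for n
      using integrable_mult_indicator[OF _ G_integrable, of A "real n"] by simp
    show ?thesis
      using integral_monotone_convergence_nonneg[OF i mono pos lm l] by auto
  qed
  interpret R: prob_space "restr_to_subalg M S" by (rule prob_space_restr_to_subalg[OF subalg prob_space_axioms])
  have TR: "T \<in> borel_measurable (restr_to_subalg M S)" by (rule measurable_in_subalg[OF subalg T])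
  have Ti: "integrable M T" using *[of "space M"] sets.top[of S]
    by (simp add: sets.top[of S, simplified] cong: Bochner_Integration.integrable_cong)
  have "AE \<omega> in restr_to_subalg M S. T \<omega> = 1"
  proof (rule R.density_unique_banach)
    show "integrable (restr_to_subalg M S) T" by (rule integrable_in_subalg[OF subalg T Ti])
    fix A assume "A \<in> sets (restr_to_subalg M S)"
    then have A: "A \<in> sets S" by (simp add: sets_restr_to_subalg[OF subalg])
    have "set_lebesgue_integral (restr_to_subalg M S) A T = (\<integral>\<omega>. indicator A \<omega> * T \<omega> \<partial>M)"
      unfolding set_lebesgue_integral_def using A T by (subst integral_subalgebra2[OF subalg]) auto
    also have "\<dots> = measure M A" using * A by simp
    also have "\<dots> = measure (restr_to_subalg M S) A" using A by (simp add: measure_def emeasure_restr_to_subalg[OF subalg])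
    finally show "set_lebesgue_integral (restr_to_subalg M S) A T = set_lebesgue_integral (restr_to_subalg M S) A (\<lambda>_. 1)"
      using A by (simp add: set_lebesgue_integral_def sets_restr_to_subalg[OF subalg])
  qed simp
  from AE_restr_to_subalg[OF subalg this] show ?thesis by (simp add: T_def)
qed

lemma AE_G_le_1: "AE \<omega> in M. \<forall>y. G \<omega> y \<le> 1"
  using AE_mass_one AE_space
proof eventually_elim
  case (elim \<omega>)
  have "G \<omega> y \<le> (LBINT u. f (X \<omega>) u)" for y
  proof (rule LIMSEQ_le_const[OF cdf_at_top[of f "X \<omega>"]])
    obtain N where "y \<le> real N" using real_arch_simple by blast
    then show "\<exists>N. \<forall>n\<ge>N. G \<omega> y \<le> G \<omega> (real n)" using elim by (intro exI[of _ N]) (auto intro!: G_mono)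
  qed (use elim f_X_integrable in auto)
  then show ?case using elim by simp
qed

text \<open>Measurability is known for each fixed y only. Rounding y up to dyadics reduces to
  countably many values, and continuity of the cdf recovers y in the limit.\<close>

lemma G_joint_S: "(\<lambda>(\<omega>, y). G \<omega> y) \<in> borel_measurable (S \<Otimes>\<^sub>M (borel :: real measure))"
proof (rule borel_measurable_LIMSEQ_real)
  show "(\<lambda>p. G (fst p) (dyadic_up n (snd p))) \<in> borel_measurable (S \<Otimes>\<^sub>M (borel :: real measure))" for n
    unfolding dyadic_up_def
    by (rule measurable_compose_countable[where f="\<lambda>j p. G (fst p) (of_int j / 2 ^ n)" and g="\<lambda>p. \<lceil>snd p * 2 ^ n\<rceil>"]) measurable
  fix p assume "p \<in> space (S \<Otimes>\<^sub>M (borel :: real measure))"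
  then have "fst p \<in> space M" by (auto simp: space_pair_measure)
  from isCont_tendsto_compose[OF G_isCont[OF this] dyadic_up(2)]
  show "(\<lambda>n. G (fst p) (dyadic_up n (snd p))) \<longlonglongrightarrow> (case p of (\<omega>, y) \<Rightarrow> G \<omega> y)"
    by (simp add: case_prod_unfold)
qed

lemma G_joint [measurable]: "(\<lambda>(\<omega>, y). G \<omega> y) \<in> borel_measurable (M \<Otimes>\<^sub>M (borel :: real measure))"
proof -
  have "(\<lambda>\<omega>. \<omega>) \<in> measurable M S" using subalg by (auto simp: measurable_def subalgebra_def sets.Int_space_eq2)
  then have "(\<lambda>p. (fst p, snd p)) \<in> measurable (M \<Otimes>\<^sub>M (borel :: real measure)) (S \<Otimes>\<^sub>M borel)"
    by (intro measurable_Pair measurable_compose[OF measurable_fst]) auto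
  from measurable_compose[OF this G_joint_S] show ?thesis by (simp add: case_prod_unfold)
qed

lemma G_comp_measurable [measurable]:
  assumes [measurable]: "p \<in> measurable N M" "W \<in> borel_measurable N"
  shows "(\<lambda>x. G (p x) (W x)) \<in> borel_measurable N"
  using measurable_compose[of "\<lambda>x. (p x, W x)" N "M \<Otimes>\<^sub>M borel", OF _ G_joint] by simp

text \<open>The defining identity concerns constant thresholds. For a threshold rounded to dyadics
  it applies on each level set, which lies in the sigma-algebra of X because W is measurable for it;
  dominated convergence removes the rounding.\<close>

lemma measure_le_random:
  assumes A: "A \<in> sets S" and W: "W \<in> borel_measurable S"
  shows "(\<integral>\<omega>. indicator A \<omega> * (if Y \<omega> \<le> W \<omega> then 1 else 0) \<partial>M) = (\<integral>\<omega>. indicator A \<omega> * G \<omega> (W \<omega>) \<partial>M)"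
proof -
  note AM[measurable] = sets_S[OF A]
  note WM[measurable] = measurable_S[OF W]
  have du[measurable]: "(\<lambda>\<omega>. dyadic_up n (W \<omega>)) \<in> borel_measurable M" for n unfolding dyadic_up_def by measurable
  have step: "(\<integral>\<omega>. indicator A \<omega> * (if Y \<omega> \<le> dyadic_up n (W \<omega>) then 1 else 0) \<partial>M) = (\<integral>\<omega>. indicator A \<omega> * G \<omega> (dyadic_up n (W \<omega>)) \<partial>M)" for n
  proof -
    define J where "J \<omega> = \<lceil>W \<omega> * 2 ^ n\<rceil>" for \<omega>
    have JS[measurable]: "J \<in> measurable S (count_space UNIV)" unfolding J_def using W by measurable
    have [measurable]: "J \<in> measurable M (count_space UNIV)" unfolding J_def by measurable
    define g1 where "g1 j \<omega> = (ennreal (indicator A \<omega> * (if Y \<omega> \<le> of_int j / 2 ^ n then 1 else 0)))" for j :: int and \<omega>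
    define g2 where "g2 j \<omega> = ennreal (indicator A \<omega> * G \<omega> (of_int j / 2 ^ n))" for j :: int and \<omega>
    have [measurable]: "g1 j \<in> borel_measurable M" "g2 j \<in> borel_measurable M" for j unfolding g1_def g2_def by measurable
    have "(\<integral>\<^sup>+\<omega>. g1 j \<omega> * indicator {\<omega>. J \<omega> = j} \<omega> \<partial>M) = (\<integral>\<^sup>+\<omega>. g2 j \<omega> * indicator {\<omega>. J \<omega> = j} \<omega> \<partial>M)" for j
    proof -
      define A' where "A' = A \<inter> {\<omega> \<in> space S. J \<omega> = j}"
      have A': "A' \<in> sets S" unfolding A'_def using A by measurable
      note [measurable] = sets_S[OF A']
      have i: "integrable M (\<lambda>\<omega>. indicator A' \<omega> * G \<omega> (of_int j / 2 ^ n))"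
        using integrable_mult_indicator[OF _ G_integrable, of A'] by simp
      have "(\<integral>\<^sup>+\<omega>. g1 j \<omega> * indicator {\<omega>. J \<omega> = j} \<omega> \<partial>M) = (\<integral>\<^sup>+\<omega>. indicator (A' \<inter> {\<omega> \<in> space M. Y \<omega> \<le> of_int j / 2 ^ n}) \<omega> \<partial>M)"
        by (intro nn_integral_cong) (auto simp: g1_def A'_def indicator_def)
      also have "\<dots> = ennreal (measure M (A' \<inter> {\<omega> \<in> space M. Y \<omega> \<le> of_int j / 2 ^ n}))"
        by (simp add: emeasure_eq_measure)
      also have "\<dots> = ennreal (\<integral>\<omega>. indicator A' \<omega> * G \<omega> (of_int j / 2 ^ n) \<partial>M)" by (simp add: G_measure[OF A'])
      also have "\<dots> = (\<integral>\<^sup>+\<omega>. ennreal (indicator A' \<omega> * G \<omega> (of_int j / 2 ^ n)) \<partial>M)"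
        by (rule nn_integral_eq_integral[symmetric, OF i]) (auto simp: G_nonneg)
      also have "\<dots> = (\<integral>\<^sup>+\<omega>. g2 j \<omega> * indicator {\<omega>. J \<omega> = j} \<omega> \<partial>M)"
        by (intro nn_integral_cong) (auto simp: g2_def A'_def indicator_def)
      finally show ?thesis .
    qed
    then have "(\<integral>\<^sup>+\<omega>. g1 (J \<omega>) \<omega> \<partial>M) = (\<integral>\<^sup>+\<omega>. g2 (J \<omega>) \<omega> \<partial>M)"
      by (simp add: nn_integral_split_int)
    then have "enn2real (\<integral>\<^sup>+\<omega>. g1 (J \<omega>) \<omega> \<partial>M) = enn2real (\<integral>\<^sup>+\<omega>. g2 (J \<omega>) \<omega> \<partial>M)" by simp
    then show ?thesis
      unfolding g1_def g2_def J_def dyadic_up_def[symmetric]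
      by (subst (1 2) integral_eq_nn_integral) (auto simp: G_nonneg)
  qed
  have "(\<lambda>n. \<integral>\<omega>. indicator A \<omega> * (if Y \<omega> \<le> dyadic_up n (W \<omega>) then 1 else 0 :: real) \<partial>M) \<longlonglongrightarrow> (\<integral>\<omega>. indicator A \<omega> * (if Y \<omega> \<le> W \<omega> then 1 else 0 :: real) \<partial>M)"
  proof (rule integral_dominated_convergence[where w="\<lambda>_. 1"])
    show "AE \<omega> in M. (\<lambda>n. indicator A \<omega> * (if Y \<omega> \<le> dyadic_up n (W \<omega>) then 1 else 0)) \<longlonglongrightarrow> indicator A \<omega> * (if Y \<omega> \<le> W \<omega> then 1 else 0 :: real)"
    proof (intro AE_I2 tendsto_intros)
      fix \<omega>
      show "(\<lambda>n. (if Y \<omega> \<le> dyadic_up n (W \<omega>) then 1 else 0)) \<longlonglongrightarrow> (if Y \<omega> \<le> W \<omega> then 1 else 0 :: real)"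
      proof (cases "Y \<omega> \<le> W \<omega>")
        case True
        then show ?thesis using order_trans[OF True dyadic_up(1)] by (simp add: indicator_def)
      next
        case False
        then have "eventually (\<lambda>n. dyadic_up n (W \<omega>) < Y \<omega>) sequentially"
          by (intro order_tendstoD(2)[OF dyadic_up(2)]) auto
        then show ?thesis using False by (intro tendsto_eventually) (auto elim!: eventually_mono simp: indicator_def)
      qed
    qed
  qed (auto simp: indicator_def)
  moreover have "(\<lambda>n. \<integral>\<omega>. indicator A \<omega> * G \<omega> (dyadic_up n (W \<omega>)) \<partial>M) \<longlonglongrightarrow> (\<integral>\<omega>. indicator A \<omega> * G \<omega> (W \<omega>) \<partial>M)"
  proof (rule integral_dominated_convergence[where w="\<lambda>_. 1"])
    show "AE \<omega> in M. (\<lambda>n. indicator A \<omega> * G \<omega> (dyadic_up n (W \<omega>))) \<longlonglongrightarrow> indicator A \<omega> * G \<omega> (W \<omega>)"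
      by (intro AE_I2 tendsto_intros isCont_tendsto_compose[OF G_isCont dyadic_up(2)])
    show "AE \<omega> in M. norm (indicator A \<omega> * G \<omega> (dyadic_up n (W \<omega>))) \<le> 1" for n
      using AE_G_le_1 AE_space by eventually_elim (auto simp: indicator_def G_nonneg)
  qed auto
  ultimately show ?thesis unfolding step by (rule LIMSEQ_unique)
qed

text \<open>The indicator of Y \<le> W and the cdf at W are densities of two measures that agree on
  the sigma-algebra of X. Integrating Z against both settles every measurable Z at once: without
  integrability both Bochner integrals take the same default value.\<close>

lemma expectation_le_random:
  assumes Z: "Z \<in> borel_measurable S" and W: "W \<in> borel_measurable S"
  shows "(\<integral>\<omega>. Z \<omega> * (if Y \<omega> \<le> W \<omega> then 1 else 0) \<partial>M) = (\<integral>\<omega>. Z \<omega> * G \<omega> (W \<omega>) \<partial>M)"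
proof -
  note [measurable] = measurable_S[OF W] measurable_S[OF Z]
  define g1 where "g1 \<omega> = (if Y \<omega> \<le> W \<omega> then 1 else 0 :: real)" for \<omega>
  define g2 where "g2 \<omega> = G \<omega> (W \<omega>)" for \<omega>
  have [measurable]: "g1 \<in> borel_measurable M" "g2 \<in> borel_measurable M" unfolding g1_def g2_def by measurable
  have g1_nn: "AE \<omega> in M. 0 \<le> g1 \<omega>" by (simp add: g1_def)
  have g2_nn: "AE \<omega> in M. 0 \<le> g2 \<omega>" by (auto simp: g2_def G_nonneg)
  have sa: "subalgebra (density M g) S" for g using subalg by (simp add: subalgebra_def)
  have "restr_to_subalg (density M g1) S = restr_to_subalg (density M g2) S"
  proof (rule measure_eqI)
    show "sets (restr_to_subalg (density M g1) S) = sets (restr_to_subalg (density M g2) S)"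
      by (simp add: sets_restr_to_subalg[OF sa])
    fix A assume "A \<in> sets (restr_to_subalg (density M g1) S)"
    then have A: "A \<in> sets S" by (simp add: sets_restr_to_subalg[OF sa])
    note [measurable] = sets_S[OF A]
    have e: "emeasure (density M g) A = ennreal (\<integral>\<omega>. indicator A \<omega> * g \<omega> \<partial>M)"
      if "g \<in> borel_measurable M" "AE \<omega> in M. 0 \<le> g \<omega>" "AE \<omega> in M. g \<omega> \<le> 1" for g
    proof -
      have [measurable]: "g \<in> borel_measurable M" by fact
      have "AE \<omega> in M. norm (indicator A \<omega> * g \<omega>) \<le> norm (1::real)"
        using that(2,3) by eventually_elim (auto simp: indicator_def)
      then have i: "integrable M (\<lambda>\<omega>. indicator A \<omega> * g \<omega>)"
        by (rule Bochner_Integration.integrable_bound[where f="\<lambda>_. 1::real", rotated 2]) auto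
      have "emeasure (density M g) A = (\<integral>\<^sup>+\<omega>. ennreal (indicator A \<omega> * g \<omega>) \<partial>M)"
        by (subst emeasure_density) (auto intro!: nn_integral_cong simp: indicator_def)
      also have "\<dots> = ennreal (\<integral>\<omega>. indicator A \<omega> * g \<omega> \<partial>M)"
        using that(2) by (intro nn_integral_eq_integral[OF i]) (auto elim!: eventually_mono)
      finally show ?thesis .
    qed
    have "AE \<omega> in M. g1 \<omega> \<le> 1" by (simp add: g1_def indicator_def)
    moreover have "AE \<omega> in M. g2 \<omega> \<le> 1" using AE_G_le_1 by eventually_elim (simp add: g2_def)
    ultimately show "emeasure (restr_to_subalg (density M g1) S) A = emeasure (restr_to_subalg (density M g2) S) A"
      using measure_le_random[OF A W] g1_nn g2_nn
      by (simp add: emeasure_restr_to_subalg[OF sa A] e) (simp add: g1_def g2_def)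
  qed
  then have "(\<integral>\<omega>. Z \<omega> \<partial>density M g1) = (\<integral>\<omega>. Z \<omega> \<partial>density M g2)"
    using integral_subalgebra2[OF sa Z] by metis
  then have "(\<integral>\<omega>. g1 \<omega> *\<^sub>R Z \<omega> \<partial>M) = (\<integral>\<omega>. g2 \<omega> *\<^sub>R Z \<omega> \<partial>M)"
    using g1_nn g2_nn by (simp add: integral_density)
  then show ?thesis by (simp add: g1_def g2_def mult.commute)
qed

end

text \<open>The antiderivative of g that vanishes at 0, written over the fixed interval [0,1]. In
  this form measurability in further parameters of g is inherited, and the sign of y needs no case
  distinction.\<close>

definition prim :: "(real \<Rightarrow> real) \<Rightarrow> real \<Rightarrow> real" where
  "prim g y = y * (LBINT t:{0..1}. g (t * y))"

lemma exists_antiderivative: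
  fixes g :: "real \<Rightarrow> real"
  assumes "\<And>y. isCont g y"
  obtains Q where "\<And>y. (Q has_real_derivative g y) (at y)"
  using einterval_antiderivative[of "-\<infinity>" "\<infinity>" g] assms
  by (auto simp: has_real_derivative_iff_has_vector_derivative)

lemma integral_along_segment:
  fixes g :: "real \<Rightarrow> real"
  assumes Q: "\<And>y. (Q has_real_derivative g y) (at y)" and g: "\<And>y. isCont g y"
  shows "d * (LBINT t:{0..1}. g (c + t * d)) = Q (c + d) - Q c"
proof -
  have gc: "continuous_on UNIV g" using g by (simp add: continuous_on_eq_continuous_within)
  have "(LBINT t. indicator {0..1} t *\<^sub>R (g (c + t * d) * d)) = Q (c + 1 * d) - Q (c + 0 * d)"
  proof (rule integral_FTC_atLeastAtMost)
    show "continuous_on {0..1} (\<lambda>t. g (c + t * d) * d)"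
      by (intro continuous_intros continuous_on_compose2[OF gc]) auto
    show "((\<lambda>t. Q (c + t * d)) has_vector_derivative g (c + t * d) * d) (at t within {0..1})" for t
    proof -
      have "((\<lambda>t. c + t * d) has_real_derivative d) (at t)" by (auto intro!: derivative_eq_intros)
      from DERIV_chain2[OF Q this] show ?thesis
        by (auto simp: has_real_derivative_iff_has_vector_derivative intro: has_vector_derivative_at_within)
    qed
  qed simp
  also have "(LBINT t. indicator {0..1} t *\<^sub>R (g (c + t * d) * d)) = d * (LBINT t:{0..1}. g (c + t * d))"
    unfolding set_lebesgue_integral_def by (simp flip: integral_mult_right_zero add: mult_ac)
  finally show ?thesis by simp
qed

lemma prim_deriv:
  assumes "\<And>y. isCont g y"
  shows "(prim g has_real_derivative g y) (at y)"
proof -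
  obtain Q where Q: "\<And>y. (Q has_real_derivative g y) (at y)" using exists_antiderivative assms by blast
  have "prim g = (\<lambda>y. Q y - Q 0)"
    using integral_along_segment[OF Q assms, of _ 0] by (auto simp: prim_def fun_eq_iff)
  then show ?thesis using Q by (auto intro!: derivative_eq_intros)
qed

lemma prim_diff:
  assumes "\<And>y. isCont g y"
  shows "prim g (c + d) - prim g c = d * (LBINT t:{0..1}. g (c + t * d))"
  using integral_along_segment[OF prim_deriv[OF assms] assms] by simp

text \<open>The function max 0 (t d - e) of t has slope d where t d exceeds e and slope 0 where it
  stays below; the fundamental theorem applies away from the kink e / d. This is a form of Knight's
  identity: increments of the check loss become averages of events.\<close>

lemma pos_part_diff:
  "max 0 (d - e) - max 0 (- e) = d * (LBINT t:{0..1}. if e \<le> t * d then 1 else 0 :: real)"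
proof (cases "d = 0")
  case False
  let ?g = "\<lambda>t. if e \<le> t * d then d else 0" and ?f = "\<lambda>t. max 0 (t * d - e)"
  have "(?g has_integral (?f 1 - ?f 0)) {0..1}"
  proof (rule fundamental_theorem_of_calculus_interior_strong[of "{e / d}"])
    show "continuous_on {0..1} ?f" by (intro continuous_intros)
    fix t assume "t \<in> {0<..<1} - {e / d}"
    then have ne: "t * d \<noteq> e" using False by (auto simp: field_simps)
    show "(?f has_vector_derivative ?g t) (at t)"
    proof (cases "e < t * d")
      case True
      have "((\<lambda>t. t * d - e) has_vector_derivative d) (at t)" by (auto intro!: derivative_eq_intros)
      moreover have "open {t. e < t * d}" by (intro open_Collect_less continuous_intros)
      ultimately have "(?f has_vector_derivative d) (at t)"
        by (rule has_vector_derivative_transform_within_open) (use True in auto)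
      then show ?thesis using True by simp
    next
      case False
      then have lt: "t * d < e" using ne by simp
      have "((\<lambda>t. 0) has_vector_derivative 0) (at t)" by (auto intro!: derivative_eq_intros)
      moreover have "open {t. t * d < e}" by (intro open_Collect_less continuous_intros)
      ultimately have "(?f has_vector_derivative 0) (at t)"
        by (rule has_vector_derivative_transform_within_open) (use lt in auto)
      then show ?thesis using lt by simp
    qed
  qed auto
  then have "integral {0..1} ?g = max 0 (d - e) - max 0 (- e)" by (simp add: integral_unique)
  moreover have "set_integrable lborel {0..1} ?g"
    unfolding set_integrable_def
  proof (rule Bochner_Integration.integrable_bound[where f="\<lambda>t. indicator {0..1} t *\<^sub>R d"])
    show "AE t in lborel. norm (indicator {0..1} t *\<^sub>R ?g t) \<le> norm (indicator {0..1} t *\<^sub>R d)"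
      by (intro AE_I2) (auto simp: indicator_def)
  qed auto
  ultimately have "(LBINT t:{0..1}. ?g t) = max 0 (d - e) - max 0 (- e)"
    by (simp add: set_borel_integral_eq_integral(2))
  moreover have "(LBINT t:{0..1}. ?g t) = (LBINT t:{0..1}. d * (if e \<le> t * d then 1 else 0))"
    by (intro set_lebesgue_integral_cong) auto
  ultimately show ?thesis by simp
qed simp

lemma abs_pos_part_diff: "\<bar>max 0 (d - e) - max 0 (- e :: real)\<bar> \<le> \<bar>d\<bar>"
  by auto

lemma check_fun_eq: "check_fun \<tau> u = \<tau> * u + max 0 (- u)"
  by (auto simp: check_fun_def algebra_simps)

lemma abs_check_fun_le: "0 \<le> \<tau> \<Longrightarrow> \<tau> \<le> 1 \<Longrightarrow> \<bar>check_fun \<tau> u\<bar> \<le> \<bar>u\<bar>"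
  by (auto simp: check_fun_def abs_mult intro: mult_left_le)

text \<open>To the right of a the cdf is a constant, the mass below a, plus an antiderivative of the
  continuous density; a = y - 1 puts y into the open half-line where this holds.\<close>

lemma cdf_deriv:
  fixes f :: "(real \<Rightarrow> real) \<Rightarrow> real \<Rightarrow> real"
  assumes i: "integrable lborel (f x)" and c: "\<And>y. isCont (f x) y"
  shows "(Defs.cdf f x has_real_derivative f x y) (at y)"
proof -
  obtain Q where Q: "\<And>y. (Q has_real_derivative f x y) (at y)" using exists_antiderivative c by blast
  define a where "a = y - 1"
  have si: "set_integrable lborel A (f x)" if "A \<in> sets borel" for A
    unfolding set_integrable_def using integrable_mult_indicator[OF _ i, of A] that by simp
  have eq: "Defs.cdf f x z = (LBINT u:{..<a}. f x u) + (Q z - Q a)" if "z \<in> {a<..}" for z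
  proof -
    have "(LBINT u. indicator {a..z} u *\<^sub>R f x u) = Q z - Q a"
      using that c by (intro integral_FTC_atLeastAtMost continuous_at_imp_continuous_on)
        (auto simp: has_real_derivative_iff_has_vector_derivative[symmetric] intro: has_field_derivative_at_within Q)
    moreover have "(LBINT u:{..<a} \<union> {a..z}. f x u) = (LBINT u:{..<a}. f x u) + (LBINT u:{a..z}. f x u)"
      by (intro set_integral_Un si) auto
    moreover have "{..<a} \<union> {a..z} = {..z}" using that by auto
    ultimately show ?thesis by (simp add: Defs.cdf_def set_lebesgue_integral_def)
  qed
  have "((\<lambda>z. (LBINT u:{..<a}. f x u) + (Q z - Q a)) has_real_derivative f x y) (at y)"
    using Q by (auto intro!: derivative_eq_intros)
  then show ?thesis
    by (rule has_field_derivative_transform_within_open[of _ _ _ "{a<..}"]) (auto simp: eq a_def)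
qed

lemma smooth_cdf_of_density:
  assumes i: "integrable lborel (f x)" and nn: "\<And>u. 0 \<le> f x u" and one: "(LBINT u. f x u) = 1"
    and d: "\<And>y. (f x has_real_derivative f' y) (at y)" and b: "\<And>y. \<bar>f' y\<bar> \<le> B"
  shows "smooth_cdf (prim (Defs.cdf f x)) (Defs.cdf f x) (f x) B"
proof
  have c: "isCont (f x) y" for y using d by (rule DERIV_isCont)
  show "(prim (Defs.cdf f x) has_real_derivative Defs.cdf f x y) (at y)" for y
    by (intro prim_deriv cdf_isCont i)
  show "(Defs.cdf f x has_real_derivative f x y) (at y)" for y by (rule cdf_deriv[where f=f and x=x, OF i c])
  show "\<bar>f x u - f x v\<bar> \<le> B * \<bar>u - v\<bar>" for u v by (rule abs_diff_le_of_deriv_bound[OF d b])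
  show "0 \<le> Defs.cdf f x y" for y by (intro cdf_nonneg nn)
  show "0 \<le> f x y" for y by (rule nn)
  show "Defs.cdf f x y \<le> 1" for y
  proof (rule LIMSEQ_le_const[OF cdf_at_top[where f=f and x=x, OF i, unfolded one]])
    obtain N where "y \<le> real N" using real_arch_simple by blast
    then show "\<exists>N. \<forall>n\<ge>N. Defs.cdf f x y \<le> Defs.cdf f x (real n)"
      by (intro exI[of _ N]) (auto intro!: cdf_mono i nn)
  qed
qed

section \<open>Excess risk in terms of the conditional distribution function\<close>

locale qr_model = cond_density M X Y f + smoothing_kernel k s
  for M :: "'a measure" and X Y f k s
begin

text \<open>The increment of the positive part is an average over t of \<delta> times the indicator
  of Y \<le> q - a + t \<delta>. After exchanging the integrals, conditioning replaces the indicator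
  by the cdf at the same threshold for each t; exchanging back, the average along the segment is an
  increment of \<open>prim\<close>.\<close>

lemma expected_pos_part:
  assumes q: "q \<in> borel_measurable S" and \<delta>: "\<delta> \<in> borel_measurable S" and i: "integrable M \<delta>"
  shows "(\<integral>\<omega>. max 0 (\<delta> \<omega> - (Y \<omega> - q \<omega> + a)) - max 0 (- (Y \<omega> - q \<omega> + a)) \<partial>M)
       = (\<integral>\<omega>. prim (Defs.cdf f (X \<omega>)) (q \<omega> + \<delta> \<omega> - a) - prim (Defs.cdf f (X \<omega>)) (q \<omega> - a) \<partial>M)"
proof -
  note [measurable] = measurable_S[OF q] measurable_S[OF \<delta>]
  let ?I = "\<lambda>t. indicator {0..1::real} t :: real"
  define g1 where "g1 \<omega> t = ?I t * (\<delta> \<omega> * (if Y \<omega> \<le> q \<omega> - a + t * \<delta> \<omega> then 1 else 0))" for \<omega> t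
  define g2 where "g2 \<omega> t = ?I t * (\<delta> \<omega> * G \<omega> (q \<omega> - a + t * \<delta> \<omega>))" for \<omega> t
  have iI: "integrable lborel ?I" by simp
  have ia: "integrable M (\<lambda>\<omega>. \<bar>\<delta> \<omega>\<bar>)" using i by simp
  have "(\<lambda>(\<omega>, t). g1 \<omega> t) \<in> borel_measurable (M \<Otimes>\<^sub>M lborel)" unfolding g1_def by measurable
  from Fubini_bounded(2)[OF sigma_finite_measure_axioms lborel.sigma_finite_measure_axioms this ia iI]
  have F1: "(\<integral>\<omega>. (LBINT t. g1 \<omega> t) \<partial>M) = (LBINT t. (\<integral>\<omega>. g1 \<omega> t \<partial>M))"
    by (auto simp: g1_def indicator_def)
  have "(\<lambda>(\<omega>, t). g2 \<omega> t) \<in> borel_measurable (M \<Otimes>\<^sub>M lborel)" unfolding g2_def by measurable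
  note F2' = Fubini_bounded(2)[OF sigma_finite_measure_axioms lborel.sigma_finite_measure_axioms this ia iI]
  have F2: "(\<integral>\<omega>. (LBINT t. g2 \<omega> t) \<partial>M) = (LBINT t. (\<integral>\<omega>. g2 \<omega> t \<partial>M))"
  proof (rule F2')
    show "AE \<omega> in M. \<forall>t\<in>space lborel. \<bar>g2 \<omega> t\<bar> \<le> \<bar>\<delta> \<omega>\<bar> * ?I t"
      using AE_G_le_1 AE_space
    proof eventually_elim
      case (elim \<omega>)
      then have "\<bar>\<delta> \<omega> * G \<omega> y\<bar> \<le> \<bar>\<delta> \<omega>\<bar>" for y
        using G_nonneg[of \<omega> y] by (simp add: abs_mult mult_left_le)
      then show ?case by (auto simp: g2_def indicator_def)
    qed
  qed
  have eq12: "(\<integral>\<omega>. g1 \<omega> t \<partial>M) = (\<integral>\<omega>. g2 \<omega> t \<partial>M)" for t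
    using expectation_le_random[OF \<delta>, of "\<lambda>\<omega>. q \<omega> - a + t * \<delta> \<omega>"] q \<delta> by (simp add: g1_def g2_def)
  have "(\<integral>\<omega>. max 0 (\<delta> \<omega> - (Y \<omega> - q \<omega> + a)) - max 0 (- (Y \<omega> - q \<omega> + a)) \<partial>M) = (\<integral>\<omega>. (LBINT t. g1 \<omega> t) \<partial>M)"
  proof (intro Bochner_Integration.integral_cong refl)
    fix \<omega>
    have "(LBINT t. g1 \<omega> t) = \<delta> \<omega> * (LBINT t:{0..1}. if Y \<omega> - q \<omega> + a \<le> t * \<delta> \<omega> then 1 else 0)"
      unfolding g1_def set_lebesgue_integral_def integral_mult_right_zero[symmetric]
      by (intro Bochner_Integration.integral_cong) (auto simp: algebra_simps)
    then show "max 0 (\<delta> \<omega> - (Y \<omega> - q \<omega> + a)) - max 0 (- (Y \<omega> - q \<omega> + a)) = (LBINT t. g1 \<omega> t)"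
      by (simp only: pos_part_diff)
  qed
  also have "\<dots> = (\<integral>\<omega>. (LBINT t. g2 \<omega> t) \<partial>M)" unfolding F1 F2 eq12 ..
  also have "\<dots> = (\<integral>\<omega>. prim (Defs.cdf f (X \<omega>)) (q \<omega> + \<delta> \<omega> - a) - prim (Defs.cdf f (X \<omega>)) (q \<omega> - a) \<partial>M)"
  proof (intro Bochner_Integration.integral_cong refl)
    fix \<omega> assume w: "\<omega> \<in> space M"
    have "(LBINT t. g2 \<omega> t) = \<delta> \<omega> * (LBINT t:{0..1}. G \<omega> (q \<omega> - a + t * \<delta> \<omega>))"
      unfolding g2_def set_lebesgue_integral_def integral_mult_right_zero[symmetric]
      by (intro Bochner_Integration.integral_cong) (auto simp: algebra_simps)
    also have "\<dots> = prim (Defs.cdf f (X \<omega>)) (q \<omega> - a + \<delta> \<omega>) - prim (Defs.cdf f (X \<omega>)) (q \<omega> - a)"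
      by (rule prim_diff[symmetric]) (rule G_isCont[OF w])
    finally show "(LBINT t. g2 \<omega> t) = prim (Defs.cdf f (X \<omega>)) (q \<omega> + \<delta> \<omega> - a) - prim (Defs.cdf f (X \<omega>)) (q \<omega> - a)"
      by (simp add: algebra_simps)
  qed
  finally show ?thesis .
qed

text \<open>The convolved check loss after the substitution u = e + h v, with the kernel at unit
  scale.\<close>

definition rho_h :: "real \<Rightarrow> real \<Rightarrow> real \<Rightarrow> real" where
  "rho_h h \<tau> e = (LBINT v. k v * check_fun \<tau> (e + h * v))"

lemma check_fun_measurable [measurable]: "check_fun \<tau> \<in> borel_measurable borel"
  unfolding check_fun_def[abs_def] by measurable

lemma rho_h_measurable [measurable]: "rho_h h \<tau> \<in> borel_measurable borel"
  unfolding rho_h_def[abs_def] by measurable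

lemma Rh_eq:
  assumes "h > 0"
  shows "Rh M X Y k h \<tau> \<theta> = (\<integral>\<omega>. rho_h h \<tau> (resid \<theta> (X \<omega>) (Y \<omega>)) \<partial>M)"
proof -
  have "(LBINT u. check_fun \<tau> u * kh k h (u - e)) = rho_h h \<tau> e" for e
  proof -
    have "(LBINT u. check_fun \<tau> u * kh k h (u - e)) = h * (LBINT v. check_fun \<tau> (e + h * v) * kh k h (e + h * v - e))"
      using assms lborel_integral_real_affine[of h "\<lambda>u. check_fun \<tau> u * kh k h (u - e)" e] by simp
    also have "\<dots> = (LBINT v. h * (check_fun \<tau> (e + h * v) * kh k h (e + h * v - e)))" by simp
    also have "\<dots> = rho_h h \<tau> e"
      unfolding rho_h_def using assms by (intro Bochner_Integration.integral_cong) (auto simp: kh_def)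
    finally show ?thesis .
  qed
  then show ?thesis by (simp add: Rh_def)
qed

lemma integrable_check:
  assumes h: "h > 0" and t: "0 \<le> \<tau>" "\<tau> \<le> 1"
  shows "integrable lborel (\<lambda>v. k v * check_fun \<tau> (e + h * v))" "\<bar>rho_h h \<tau> e\<bar> \<le> \<bar>e\<bar> * mom 0 + h * mom 1"
proof -
  have i: "integrable lborel (\<lambda>v. \<bar>e\<bar> * (\<bar>v\<bar> ^ 0 * \<bar>k v\<bar>) + h * (\<bar>v\<bar> ^ 1 * \<bar>k v\<bar>))"
    by (intro Bochner_Integration.integrable_add integrable_mult_right integrable_abs_mom) auto
  have le: "\<bar>k v * check_fun \<tau> (e + h * v)\<bar> \<le> \<bar>e\<bar> * (\<bar>v\<bar> ^ 0 * \<bar>k v\<bar>) + h * (\<bar>v\<bar> ^ 1 * \<bar>k v\<bar>)" for v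
  proof -
    have "\<bar>check_fun \<tau> (e + h * v)\<bar> \<le> \<bar>e\<bar> + h * \<bar>v\<bar>"
      using order_trans[OF abs_check_fun_le[OF t] abs_triangle_ineq[of e "h * v"]] h by (simp add: abs_mult)
    from mult_left_mono[OF this abs_ge_zero[of "k v"]] show ?thesis by (simp add: abs_mult algebra_simps)
  qed
  show ii: "integrable lborel (\<lambda>v. k v * check_fun \<tau> (e + h * v))"
    by (rule Bochner_Integration.integrable_bound[OF i]) (use order_trans[OF le abs_ge_self] in auto)
  have "\<bar>rho_h h \<tau> e\<bar> \<le> (LBINT v. \<bar>k v * check_fun \<tau> (e + h * v)\<bar>)" unfolding rho_h_def by (rule integral_abs_bound)
  also have "\<dots> \<le> (LBINT v. \<bar>e\<bar> * (\<bar>v\<bar> ^ 0 * \<bar>k v\<bar>) + h * (\<bar>v\<bar> ^ 1 * \<bar>k v\<bar>))"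
    by (intro integral_mono integrable_abs ii i le)
  also have "\<dots> = \<bar>e\<bar> * mom 0 + h * mom 1"
    unfolding mom_def using integrable_abs_mom[of 0] integrable_abs_mom[of 1] by simp
  finally show "\<bar>rho_h h \<tau> e\<bar> \<le> \<bar>e\<bar> * mom 0 + h * mom 1" .
qed

lemma integrable_rho_h:
  assumes h: "h > 0" and t: "0 \<le> \<tau>" "\<tau> \<le> 1" and i: "integrable M g"
  shows "integrable M (\<lambda>\<omega>. rho_h h \<tau> (g \<omega>))"
proof (rule Bochner_Integration.integrable_bound)
  show "integrable M (\<lambda>\<omega>. \<bar>g \<omega>\<bar> * mom 0 + h * mom 1)" using i by simp
  show "(\<lambda>\<omega>. rho_h h \<tau> (g \<omega>)) \<in> borel_measurable M" using i by measurable
qed (use order_trans[OF integrable_check(2)[OF h t] abs_ge_self] in auto)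

text \<open>The factor 2 adds the slopes of the linear part and of the positive part; the point is
  that the constant is free of h.\<close>

lemma rho_h_Lipschitz:
  assumes h: "h > 0" and t: "0 \<le> \<tau>" "\<tau> \<le> 1"
  shows "\<bar>rho_h h \<tau> a - rho_h h \<tau> b\<bar> \<le> 2 * mom 0 * \<bar>a - b\<bar>"
proof -
  have "rho_h h \<tau> a - rho_h h \<tau> b = (LBINT v. k v * (check_fun \<tau> (a + h * v) - check_fun \<tau> (b + h * v)))"
    unfolding rho_h_def right_diff_distrib using integrable_check(1)[OF h t] by simp
  also have "\<bar>\<dots>\<bar> \<le> 2 * \<bar>a - b\<bar> * mom 0"
  proof (rule integrable_k_mult(2))
    fix v
    have "\<bar>\<tau> * (a - b)\<bar> \<le> \<bar>a - b\<bar>" using t by (simp add: abs_mult mult_left_le_one_le)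
    then have "\<bar>check_fun \<tau> (a + h * v) - check_fun \<tau> (b + h * v)\<bar> \<le> 2 * \<bar>a - b\<bar>"
    proof -
      have eq: "check_fun \<tau> (a + h * v) - check_fun \<tau> (b + h * v)
          = \<tau> * (a - b) + (max 0 (- (a + h * v)) - max 0 (- (b + h * v)))"
        unfolding check_fun_eq by (simp add: algebra_simps)
      have "\<bar>max 0 (- (a + h * v)) - max 0 (- (b + h * v))\<bar> \<le> \<bar>a - b\<bar>" by auto
      then have "\<bar>\<tau> * (a - b)\<bar> + \<bar>max 0 (- (a + h * v)) - max 0 (- (b + h * v))\<bar> \<le> \<bar>a - b\<bar> + \<bar>a - b\<bar>"
        using \<open>\<bar>\<tau> * (a - b)\<bar> \<le> \<bar>a - b\<bar>\<close> by (intro add_mono)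
      then show ?thesis unfolding eq using order_trans[OF abs_triangle_ineq] by fastforce
    qed
    then show "\<bar>check_fun \<tau> (a + h * v) - check_fun \<tau> (b + h * v)\<bar> \<le> 2 * \<bar>a - b\<bar> * \<bar>v\<bar> ^ 0" by simp
  qed auto
  finally show ?thesis by (simp add: mult_ac)
qed

text \<open>The linear part of the loss contributes - \<tau> \<delta> because k has mass 1. The
  positive part is treated for each kernel argument v with a = h v, after exchanging expectation and
  kernel integral. Increments are formed before the exchange: they are at most |\<delta>| and so
  admit a product bound, whereas the losses themselves grow with v.\<close>

lemma excess_risk:
  assumes h: "h > 0" and t: "0 \<le> \<tau>" "\<tau> \<le> 1"
    and q: "q \<in> borel_measurable S" "integrable M q" and \<delta>: "\<delta> \<in> borel_measurable S" "integrable M \<delta>"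
  shows "integrable M (\<lambda>\<omega>. smoothed_gain h \<tau> (prim (Defs.cdf f (X \<omega>))) (q \<omega>) (\<delta> \<omega>))"
    and "(\<integral>\<omega>. rho_h h \<tau> (Y \<omega> - q \<omega> - \<delta> \<omega>) \<partial>M) - (\<integral>\<omega>. rho_h h \<tau> (Y \<omega> - q \<omega>) \<partial>M)
       = (\<integral>\<omega>. smoothed_gain h \<tau> (prim (Defs.cdf f (X \<omega>))) (q \<omega>) (\<delta> \<omega>) \<partial>M)"
proof -
  note [measurable] = measurable_S[OF q(1)] measurable_S[OF \<delta>(1)]
  let ?P = "\<lambda>\<omega>. prim (Defs.cdf f (X \<omega>))"
  have ia: "integrable M (\<lambda>\<omega>. \<bar>\<delta> \<omega>\<bar>)" using \<delta> by simp
  have ik: "integrable lborel (\<lambda>v. \<bar>k v\<bar>)" using k_int by simp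
  define D where "D \<omega> v = max 0 (\<delta> \<omega> - (Y \<omega> - q \<omega> + h * v)) - max 0 (- (Y \<omega> - q \<omega> + h * v))" for \<omega> v
  define E where "E \<omega> v = ?P \<omega> (q \<omega> + \<delta> \<omega> - h * v) - ?P \<omega> (q \<omega> - h * v)" for \<omega> v
  have mD: "(\<lambda>(\<omega>, v). k v * D \<omega> v) \<in> borel_measurable (M \<Otimes>\<^sub>M lborel)" unfolding D_def by measurable
  have mE: "(\<lambda>(\<omega>, v). k v * E \<omega> v) \<in> borel_measurable (M \<Otimes>\<^sub>M lborel)"
    unfolding E_def prim_def set_lebesgue_integral_def by measurable
  have bD: "AE \<omega> in M. \<forall>v\<in>space lborel. \<bar>k v * D \<omega> v\<bar> \<le> \<bar>\<delta> \<omega>\<bar> * \<bar>k v\<bar>"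
  proof (intro AE_I2 ballI)
    fix \<omega> v
    have "\<bar>D \<omega> v\<bar> \<le> \<bar>\<delta> \<omega>\<bar>" unfolding D_def by (rule abs_pos_part_diff)
    from mult_left_mono[OF this, of "\<bar>k v\<bar>"] show "\<bar>k v * D \<omega> v\<bar> \<le> \<bar>\<delta> \<omega>\<bar> * \<bar>k v\<bar>"
      by (simp add: abs_mult mult.commute)
  qed
  have bE: "AE \<omega> in M. \<forall>v\<in>space lborel. \<bar>k v * E \<omega> v\<bar> \<le> \<bar>\<delta> \<omega>\<bar> * \<bar>k v\<bar>"
    using AE_G_le_1 AE_space
  proof eventually_elim
    case (elim \<omega>)
    have lip: "\<bar>?P \<omega> x - ?P \<omega> y\<bar> \<le> 1 * \<bar>x - y\<bar>" for x y
      by (rule abs_diff_le_of_deriv_bound[OF prim_deriv[OF G_isCont]]) (use elim G_nonneg in auto)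
    show ?case
    proof
      fix v
      have "\<bar>E \<omega> v\<bar> \<le> \<bar>\<delta> \<omega>\<bar>" using lip[of "q \<omega> + \<delta> \<omega> - h * v" "q \<omega> - h * v"] by (simp add: E_def)
      from mult_left_mono[OF this, of "\<bar>k v\<bar>"] show "\<bar>k v * E \<omega> v\<bar> \<le> \<bar>\<delta> \<omega>\<bar> * \<bar>k v\<bar>"
        by (simp add: abs_mult mult.commute)
    qed
  qed
  note sf = sigma_finite_measure_axioms lborel.sigma_finite_measure_axioms
  note FD = Fubini_bounded[OF sf mD ia ik bD] and FE = Fubini_bounded[OF sf mE ia ik bE]
  have gain: "smoothed_gain h \<tau> (?P \<omega>) (q \<omega>) (\<delta> \<omega>) = (LBINT v. k v * E \<omega> v) - \<tau> * \<delta> \<omega>" for \<omega>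
    by (simp add: smoothed_gain_def E_def)
  show "integrable M (\<lambda>\<omega>. smoothed_gain h \<tau> (?P \<omega>) (q \<omega>) (\<delta> \<omega>))"
    unfolding gain using FE(3) \<delta> by simp
  have i1: "integrable M (\<lambda>\<omega>. Y \<omega> - q \<omega> - \<delta> \<omega>)" "integrable M (\<lambda>\<omega>. Y \<omega> - q \<omega>)" using Y_int q \<delta> by auto
  have "(\<integral>\<omega>. rho_h h \<tau> (Y \<omega> - q \<omega> - \<delta> \<omega>) \<partial>M) - (\<integral>\<omega>. rho_h h \<tau> (Y \<omega> - q \<omega>) \<partial>M)
     = (\<integral>\<omega>. rho_h h \<tau> (Y \<omega> - q \<omega> - \<delta> \<omega>) - rho_h h \<tau> (Y \<omega> - q \<omega>) \<partial>M)"
    using i1 by (simp add: integrable_rho_h[OF h t])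
  also have "\<dots> = (\<integral>\<omega>. (LBINT v. k v * D \<omega> v) - \<tau> * \<delta> \<omega> \<partial>M)"
  proof (intro Bochner_Integration.integral_cong refl)
    fix \<omega>
    have kD: "integrable lborel (\<lambda>v. k v * D \<omega> v)"
      by (rule integrable_k_mult(1)[where j=0 and B="\<bar>\<delta> \<omega>\<bar>"]) (auto simp: D_def)
    have "rho_h h \<tau> (Y \<omega> - q \<omega> - \<delta> \<omega>) - rho_h h \<tau> (Y \<omega> - q \<omega>)
      = (LBINT v. k v * check_fun \<tau> (Y \<omega> - q \<omega> - \<delta> \<omega> + h * v) - k v * check_fun \<tau> (Y \<omega> - q \<omega> + h * v))"
      unfolding rho_h_def using integrable_check(1)[OF h t] by simp
    also have "\<dots> = (LBINT v. k v * D \<omega> v - (\<tau> * \<delta> \<omega>) * k v)"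
      by (intro Bochner_Integration.integral_cong refl) (simp add: check_fun_eq D_def algebra_simps)
    also have "\<dots> = (LBINT v. k v * D \<omega> v) - \<tau> * \<delta> \<omega>" using kD k_int k_one by simp
    finally show "rho_h h \<tau> (Y \<omega> - q \<omega> - \<delta> \<omega>) - rho_h h \<tau> (Y \<omega> - q \<omega>) = (LBINT v. k v * D \<omega> v) - \<tau> * \<delta> \<omega>" .
  qed
  also have "\<dots> = (\<integral>\<omega>. (LBINT v. k v * D \<omega> v) \<partial>M) - \<tau> * (\<integral>\<omega>. \<delta> \<omega> \<partial>M)" using FD(3) \<delta> by simp
  also have "(\<integral>\<omega>. (LBINT v. k v * D \<omega> v) \<partial>M) = (LBINT v. (\<integral>\<omega>. k v * D \<omega> v \<partial>M))" by (rule FD(2))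
  also have "\<dots> = (LBINT v. (\<integral>\<omega>. k v * E \<omega> v \<partial>M))"
    using expected_pos_part[OF q(1) \<delta>] by (simp add: D_def E_def)
  also have "\<dots> = (\<integral>\<omega>. (LBINT v. k v * E \<omega> v) \<partial>M)" by (rule FE(2)[symmetric])
  also have "\<dots> - \<tau> * (\<integral>\<omega>. \<delta> \<omega> \<partial>M) = (\<integral>\<omega>. smoothed_gain h \<tau> (?P \<omega>) (q \<omega>) (\<delta> \<omega>) \<partial>M)"
    unfolding gain using FE(3) \<delta> by simp
  finally show "(\<integral>\<omega>. rho_h h \<tau> (Y \<omega> - q \<omega> - \<delta> \<omega>) \<partial>M) - (\<integral>\<omega>. rho_h h \<tau> (Y \<omega> - q \<omega>) \<partial>M)
       = (\<integral>\<omega>. smoothed_gain h \<tau> (?P \<omega>) (q \<omega>) (\<delta> \<omega>) \<partial>M)" .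
qed

end

subsection \<open>Positive semidefinite kernels\<close>

text \<open>Iterated in the order in which the form V integrates; for continuous integrands it is a
  planar integral, from which linearity and symmetry are read off.\<close>

definition square_integral :: "(real \<Rightarrow> real \<Rightarrow> real) \<Rightarrow> real" where
  "square_integral H = (LBINT t:{0..1}. LBINT s:{0..1}. H s t)"

definition square_continuous :: "(real \<Rightarrow> real \<Rightarrow> real) \<Rightarrow> bool" where
  "square_continuous H \<longleftrightarrow> continuous_on ({0..1} \<times> {0..1}) (\<lambda>(s, t). H s t)"

lemma square_integral_eq:
  assumes "square_continuous H"
  shows "integrable lborel (\<lambda>p. indicator ({0..1} \<times> {0..1}) p * H (snd p) (fst p))"
    and "square_integral H = (\<integral>p. indicator ({0..1} \<times> {0..1}) p * H (snd p) (fst p) \<partial>lborel)"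
proof -
  have "continuous_on ({0..1} \<times> {0..1}) (\<lambda>p. (\<lambda>(s, t). H s t) (snd p, fst p))"
    by (rule continuous_on_compose2[OF assms[unfolded square_continuous_def]]) (auto intro!: continuous_intros)
  then have "integrable lborel (\<lambda>p. indicator ({0..1} \<times> {0..1}) p *\<^sub>R H (snd p) (fst p))"
    by (intro borel_integrable_compact) (auto intro: compact_Times)
  then show i: "integrable lborel (\<lambda>p. indicator ({0..1} \<times> {0..1}) p * H (snd p) (fst p))" by simp
  have "(\<integral>p. indicator ({0..1} \<times> {0..1}) p * H (snd p) (fst p) \<partial>lborel)
      = (LBINT t. LBINT s. indicator ({0..1} \<times> {0..1}) (t, s) * H s t)"
    using lborel_pair.integral_fst'[of "\<lambda>p. indicator ({0..1} \<times> {0..1}) p * H (snd p) (fst p)"] i by (simp add: lborel_prod)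
  also have "\<dots> = square_integral H"
    unfolding square_integral_def set_lebesgue_integral_def
    by (intro Bochner_Integration.integral_cong refl) (auto simp: indicator_times mult.assoc simp flip: integral_mult_right_zero)
  finally show "square_integral H = (\<integral>p. indicator ({0..1} \<times> {0..1}) p * H (snd p) (fst p) \<partial>lborel)" by simp
qed

lemma square_integral_add:
  assumes "square_continuous H" "square_continuous K"
  shows "square_integral (\<lambda>s t. a * H s t + b * K s t) = a * square_integral H + b * square_integral K"
proof -
  have c: "square_continuous (\<lambda>s t. a * H s t + b * K s t)"
    using assms by (auto simp: square_continuous_def case_prod_unfold intro!: continuous_intros)
  have "square_integral (\<lambda>s t. a * H s t + b * K s t)
     = (\<integral>p. a * (indicator ({0..1} \<times> {0..1}) p * H (snd p) (fst p)) + b * (indicator ({0..1} \<times> {0..1}) p * K (snd p) (fst p)) \<partial>lborel)"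
    unfolding square_integral_eq(2)[OF c] by (intro Bochner_Integration.integral_cong) (auto simp: algebra_simps)
  then show ?thesis using square_integral_eq[OF assms(1)] square_integral_eq[OF assms(2)] by simp
qed

lemma square_integral_mono:
  assumes "square_continuous H" "square_continuous K" "\<And>s t. s \<in> {0..1} \<Longrightarrow> t \<in> {0..1} \<Longrightarrow> H s t \<le> K s t"
  shows "square_integral H \<le> square_integral K"
  unfolding square_integral_eq(2)[OF assms(1)] square_integral_eq(2)[OF assms(2)]
  by (intro integral_mono square_integral_eq(1) assms(1,2)) (use assms(3) in \<open>auto simp: indicator_def\<close>)

lemma square_integral_abs_diff:
  assumes "square_continuous H" "square_continuous K" "square_continuous L"
    and "\<And>s t. s \<in> {0..1} \<Longrightarrow> t \<in> {0..1} \<Longrightarrow> \<bar>H s t - K s t\<bar> \<le> L s t"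
  shows "\<bar>square_integral H - square_integral K\<bar> \<le> square_integral L"
proof -
  have c: "square_continuous (\<lambda>s t. 1 * H s t + (-1) * K s t)" "square_continuous (\<lambda>s t. (-1) * H s t + 1 * K s t)"
    using assms by (auto simp: square_continuous_def case_prod_unfold intro!: continuous_intros)
  have "square_integral (\<lambda>s t. 1 * H s t + (-1) * K s t) \<le> square_integral L"
    "square_integral (\<lambda>s t. (-1) * H s t + 1 * K s t) \<le> square_integral L"
    by (intro square_integral_mono c assms(3); use assms(4) in \<open>force simp: abs_le_iff\<close>)+
  then show ?thesis
    unfolding square_integral_add[OF assms(1,2)] by linarith
qed

lemma square_continuous_mult:
  assumes "square_continuous K" "continuous_on {0..1} f" "continuous_on {0..1} g"
  shows "square_continuous (\<lambda>s t. K s t * f t * g s)"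
proof -
  have "continuous_on ({0..1} \<times> {0..1}) (\<lambda>p. f (snd p))" "continuous_on ({0..1} \<times> {0..1}) (\<lambda>p. g (fst p))"
    by (auto intro!: continuous_on_compose2[OF assms(2)] continuous_on_compose2[OF assms(3)] continuous_intros)
  then show ?thesis using assms(1) unfolding square_continuous_def case_prod_unfold by (intro continuous_intros)
qed

definition square_form :: "(real \<Rightarrow> real \<Rightarrow> real) \<Rightarrow> (real \<Rightarrow> real) \<Rightarrow> (real \<Rightarrow> real) \<Rightarrow> real" where
  "square_form C f g = square_integral (\<lambda>s t. C s t * f t * g s)"

lemma square_form_sym:
  assumes C: "square_continuous C" and sym: "\<And>s t. C s t = C t s"
    and f: "continuous_on {0..1} f" and g: "continuous_on {0..1} g"
  shows "square_form C g f = square_form C f g"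
proof -
  note c = square_continuous_mult[OF C]
  let ?h = "\<lambda>p. indicator ({0..1} \<times> {0..1}) p * (C (snd p) (fst p) * f (fst p) * g (snd p))"
  have "square_form C f g = (\<integral>p. ?h p \<partial>(lborel \<Otimes>\<^sub>M lborel))"
    unfolding square_form_def using square_integral_eq(2)[OF c[OF f g]] by (simp add: lborel_prod)
  also have "\<dots> = (\<integral>(x,y). ?h (y, x) \<partial>(lborel \<Otimes>\<^sub>M lborel))"
    by (rule lborel_pair.integral_product_swap[symmetric]) (use square_integral_eq(1)[OF c[OF f g]] in \<open>simp add: lborel_prod borel_measurable_integrable\<close>)
  also have "\<dots> = square_form C g f" unfolding square_form_def square_integral_eq(2)[OF c[OF g f]] lborel_prod
    by (intro Bochner_Integration.integral_cong) (auto simp: indicator_def sym mult_ac)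
  finally show ?thesis by simp
qed

lemma square_form_linear:
  assumes C: "square_continuous C" and f: "continuous_on {0..1} f" and g: "continuous_on {0..1} g" and k: "continuous_on {0..1} k"
  shows "square_form C (\<lambda>t. x * f t + y * g t) k = x * square_form C f k + y * square_form C g k"
proof -
  have "square_form C (\<lambda>t. x * f t + y * g t) k = square_integral (\<lambda>s t. x * (C s t * f t * k s) + y * (C s t * g t * k s))"
    by (simp add: square_form_def algebra_simps)
  then show ?thesis
    using square_integral_add[OF square_continuous_mult[OF C f k] square_continuous_mult[OF C g k]] by (simp add: square_form_def)
qed

text \<open>By biorthogonality the residual r_N of the expansion satisfies V(r_N, r_N) = V(b, b) - \<Sigma> V(b, \<phi>_\<nu>)^2;
  as V(r_N, r_N) tends to 0 this makes V(b, b) nonnegative.\<close>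
lemma square_form_nonneg_of_expansion:
  assumes C: "square_continuous C" and sym: "\<And>s t. C s t = C t s"
    and b: "continuous_on {0..1} b" and \<phi>: "\<And>n. n \<ge> 1 \<Longrightarrow> continuous_on {0..1} (\<phi> n)"
    and orth: "\<And>i j. i \<ge> 1 \<Longrightarrow> j \<ge> 1 \<Longrightarrow> square_form C (\<phi> i) (\<phi> j) = (if i = j then 1 else 0)"
    and r: "\<And>N. r N = (\<lambda>t. b t - (\<Sum>n=1..N. square_form C b (\<phi> n) * \<phi> n t))"
    and lim: "(\<lambda>N. square_form C (r N) (r N)) \<longlonglongrightarrow> 0"
  shows "0 \<le> square_form C b b"
proof -
  let ?c = "\<lambda>n. square_form C b (\<phi> n)"
  have rc: "continuous_on {0..1} (r N)" for N unfolding r by (intro continuous_intros b \<phi>) auto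
  have rS: "r (Suc N) = (\<lambda>t. 1 * r N t + (- ?c (Suc N)) * \<phi> (Suc N) t)" for N by (auto simp: r fun_eq_iff)
  \<comment> \<open>By biorthogonality, the subtractions made so far leave the later coefficients
    unchanged.\<close>
  have p: "square_form C (r N) (\<phi> j) = ?c j" if "j > N" for N j
    using that
  proof (induction N)
    case (Suc N)
    then show ?case
      using square_form_linear[OF C rc[of N] \<phi>[of "Suc N"] \<phi>[of j], of 1 "- ?c (Suc N)"] orth[of "Suc N" j]
      unfolding rS[symmetric] by simp
  qed (simp add: r)
  \<comment> \<open>Each new residual is orthogonal to the function just subtracted, so the form
    drops by the square of a coefficient; the computation is purely algebraic and presupposes no
    positivity.\<close>
  have dec: "square_form C (r N) (r N) \<le> square_form C b b" for N
  proof (induction N)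
    case (Suc N)
    note lin = square_form_linear[OF C rc[of N] \<phi>[of "Suc N"]]
    have "square_form C (r (Suc N)) (r (Suc N)) = square_form C (r N) (r (Suc N)) - ?c (Suc N) * square_form C (\<phi> (Suc N)) (r (Suc N))"
      using lin[OF _ rc[of "Suc N"], of 1 "- ?c (Suc N)"] unfolding rS[symmetric] by simp
    also have "square_form C (r N) (r (Suc N)) = square_form C (r (Suc N)) (r N)" by (rule square_form_sym[OF C sym rc rc])
    also have "square_form C (r (Suc N)) (r N) = square_form C (r N) (r N) - ?c (Suc N) * square_form C (\<phi> (Suc N)) (r N)"
      using lin[OF _ rc[of N], of 1 "- ?c (Suc N)"] unfolding rS[symmetric] by simp
    also have "square_form C (\<phi> (Suc N)) (r N) = ?c (Suc N)"
      using square_form_sym[OF C sym rc[of N] \<phi>[of "Suc N"]] p[of N "Suc N"] by simp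
    also have "square_form C (\<phi> (Suc N)) (r (Suc N)) = square_form C (r (Suc N)) (\<phi> (Suc N))"
      by (rule square_form_sym[OF C sym rc \<phi>]) simp
    also have "\<dots> = 0"
      using lin[OF _ \<phi>[of "Suc N"], of 1 "- ?c (Suc N)"] p[of N "Suc N"] orth[of "Suc N" "Suc N"] unfolding rS[symmetric] by simp
    finally have "square_form C (r (Suc N)) (r (Suc N)) = square_form C (r N) (r N) - (?c (Suc N))\<^sup>2"
      by (simp add: power2_eq_square)
    then show ?case using Suc by (smt (verit) zero_le_power2)
  qed (simp add: r)
  show ?thesis by (rule LIMSEQ_le_const2[OF lim]) (use dec in auto)
qed

lemma Weierstrass_poly:
  fixes g :: "real \<Rightarrow> real"
  assumes "continuous_on {0..1} g" "0 < e"
  obtains p where "\<And>t. t \<in> {0..1} \<Longrightarrow> \<bar>g t - poly p t\<bar> < e"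
proof -
  obtain r where r: "real_polynomial_function r" "\<And>x. x \<in> {0..1} \<Longrightarrow> \<bar>g x - r x\<bar> < e"
    using Stone_Weierstrass_real_polynomial_function[OF compact_Icc assms] by blast
  obtain a n where "r = (\<lambda>x. \<Sum>i\<le>n. a i * x ^ i)" using r(1) by (auto simp: real_polynomial_function_iff_sum)
  then have "r = poly (\<Sum>i\<le>n. monom (a i) i)" by (auto simp: fun_eq_iff poly_sum poly_monom)
  with r(2) that show ?thesis by blast
qed

text \<open>Positivity is required on polynomials, where the expansion in the Sobolev space supplies
  it; uniform approximation extends it to the tent functions used for localisation, whose kinks keep
  them out of smoother Sobolev spaces.\<close>

locale psd_kernel =
  fixes C :: "real \<Rightarrow> real \<Rightarrow> real"
  assumes C_cont: "square_continuous C"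
    and C_sym: "\<And>s t. C s t = C t s"
    and C_psd_poly: "\<And>p. 0 \<le> square_integral (\<lambda>s t. C s t * poly p t * poly p s)"
begin

lemma C_bound: obtains K where "K > 0" "\<And>s t. s \<in> {0..1} \<Longrightarrow> t \<in> {0..1} \<Longrightarrow> \<bar>C s t\<bar> \<le> K"
proof -
  have "bounded ((\<lambda>(s, t). C s t) ` ({0..1} \<times> {0..1}))"
    using C_cont unfolding square_continuous_def by (intro compact_imp_bounded compact_continuous_image compact_Times) auto
  then obtain K where "K > 0" "\<forall>x\<in>(\<lambda>(s, t). C s t) ` ({0..1} \<times> {0..1}). norm x \<le> K" unfolding bounded_pos by blast
  then show ?thesis by (intro that[of K]) force+
qed

lemma psd_continuous:
  assumes g: "continuous_on {0..1} g"
  shows "0 \<le> square_integral (\<lambda>s t. C s t * g t * g s)"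
proof (rule field_le_epsilon)
  fix e :: real assume e: "e > 0"
  obtain K where K: "K > 0" "\<And>s t. s \<in> {0..1} \<Longrightarrow> t \<in> {0..1} \<Longrightarrow> \<bar>C s t\<bar> \<le> K" using C_bound by blast
  obtain A where A: "A > 0" "\<And>t. t \<in> {0..1} \<Longrightarrow> \<bar>g t\<bar> \<le> A"
    using compact_imp_bounded[OF compact_continuous_image[OF g compact_Icc]] unfolding bounded_pos by auto
  \<comment> \<open>The cap 1 bounds the approximating polynomial by A + 1, so a product of two
    values is off by at most (2 A + 1) d, and the bound K of the kernel brings this to e.\<close>
  define d where "d = min 1 (e / (K * (2 * A + 1)))"
  have d: "d > 0" "d \<le> 1" using e K A by (auto simp: d_def)
  have dK: "K * ((2 * A + 1) * d) \<le> e"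
  proof -
    have "d * (K * (2 * A + 1)) \<le> e / (K * (2 * A + 1)) * (K * (2 * A + 1))"
      using K A by (intro mult_right_mono) (auto simp: d_def)
    also have "\<dots> = e" using K A by simp
    finally show ?thesis by (simp add: mult_ac)
  qed
  obtain p where p: "\<And>t. t \<in> {0..1} \<Longrightarrow> \<bar>g t - poly p t\<bar> < d" using Weierstrass_poly[OF g d(1)] by blast
  have pc: "continuous_on {0..1} (poly p)" by (intro continuous_intros)
  have "\<bar>square_integral (\<lambda>s t. C s t * g t * g s) - square_integral (\<lambda>s t. C s t * poly p t * poly p s)\<bar> \<le> square_integral (\<lambda>s t. e * 1)"
  proof (rule square_integral_abs_diff)
    fix s t :: real assume st: "s \<in> {0..1}" "t \<in> {0..1}"
    have "g t * g s - poly p t * poly p s = (g t - poly p t) * g s + poly p t * (g s - poly p s)" by (simp add: algebra_simps)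
    also have "\<bar>\<dots>\<bar> \<le> \<bar>g t - poly p t\<bar> * \<bar>g s\<bar> + \<bar>poly p t\<bar> * \<bar>g s - poly p s\<bar>"
      by (rule order_trans[OF abs_triangle_ineq]) (simp add: abs_mult)
    also have "\<dots> \<le> d * A + (A + 1) * d"
      using p[OF st(1)] p[OF st(2)] A(2)[OF st(1)] A(2)[OF st(2)] d A by (intro add_mono mult_mono) auto
    finally have "\<bar>C s t\<bar> * \<bar>g t * g s - poly p t * poly p s\<bar> \<le> K * (d * A + (A + 1) * d)"
      using K(2)[OF st] K(1) by (intro mult_mono) auto
    then show "\<bar>C s t * g t * g s - C s t * poly p t * poly p s\<bar> \<le> e * 1"
      using dK unfolding abs_mult[symmetric] by (simp add: algebra_simps)
  qed (use square_continuous_mult[OF C_cont g g] square_continuous_mult[OF C_cont pc pc] in \<open>auto simp: square_continuous_def case_prod_unfold\<close>)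
  also have "square_integral (\<lambda>s t. e * 1) = e" by (simp add: square_integral_def set_lebesgue_integral_def)
  finally show "0 \<le> square_integral (\<lambda>s t. C s t * g t * g s) + e" using C_psd_poly[of p] by linarith
qed

lemma psd_Cauchy_Schwarz:
  assumes f: "continuous_on {0..1} f" and g: "continuous_on {0..1} g"
  shows "(square_integral (\<lambda>s t. C s t * f t * g s))\<^sup>2 \<le> square_integral (\<lambda>s t. C s t * f t * f s) * square_integral (\<lambda>s t. C s t * g t * g s)"
proof -
  let ?V = "\<lambda>f g. square_integral (\<lambda>s t. C s t * f t * g s)"
  note c = square_continuous_mult[OF C_cont]
  have sym: "?V g f = ?V f g"
    using square_form_sym[OF C_cont C_sym f g] by (simp add: square_form_def)
  have q: "0 \<le> x\<^sup>2 * ?V f f + 2 * x * y * ?V f g + y\<^sup>2 * ?V g g" for x y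
  proof -
    have "0 \<le> ?V (\<lambda>t. x * f t + y * g t) (\<lambda>t. x * f t + y * g t)"
      by (intro psd_continuous continuous_intros f g)
    also have "\<dots> = square_integral (\<lambda>s t. 1 * (x\<^sup>2 * (C s t * f t * f s) + (x * y) * (C s t * f t * g s)) + 1 * ((x * y) * (C s t * g t * f s) + y\<^sup>2 * (C s t * g t * g s)))"
      by (simp add: power2_eq_square algebra_simps)
    also have "\<dots> = x\<^sup>2 * ?V f f + 2 * x * y * ?V f g + y\<^sup>2 * ?V g g"
      by (subst square_integral_add)
         (use c[OF f f] c[OF f g] c[OF g f] c[OF g g] sym in \<open>auto simp: square_integral_add square_continuous_def case_prod_unfold intro!: continuous_intros\<close>)
    finally show ?thesis .
  qed
  have gg: "0 \<le> ?V g g" by (rule psd_continuous[OF g])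
  have ff: "0 \<le> ?V f f" by (rule psd_continuous[OF f])
  show ?thesis
  proof (cases "?V g g = 0")
    case False
    have "0 \<le> (?V g g)\<^sup>2 * ?V f f + 2 * ?V g g * (- ?V f g) * ?V f g + (- ?V f g)\<^sup>2 * ?V g g" by (rule q)
    also have "\<dots> = ?V g g * (?V f f * ?V g g - (?V f g)\<^sup>2)" by (simp add: power2_eq_square algebra_simps)
    finally show ?thesis using False gg by (simp add: zero_le_mult_iff)
  next
    case True
    have "?V f g = 0"
    proof (rule ccontr)
      assume ne: "?V f g \<noteq> 0"
      \<comment> \<open>With the quadratic term gone the expression is affine in y; at this y it
        equals -1.\<close>
      define y where "y = - (?V f f + 1) / (2 * ?V f g)"
      have "0 \<le> 1\<^sup>2 * ?V f f + 2 * 1 * y * ?V f g + y\<^sup>2 * ?V g g" by (rule q)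
      also have "\<dots> = -1" using True ne by (simp add: y_def field_simps)
      finally show False by simp
    qed
    then show ?thesis using True by simp
  qed
qed

text \<open>Testing positivity against bump functions that concentrate at the two points.\<close>
lemma zero_diagonal:
  assumes t0: "t0 \<in> {0..1}" and z: "C t0 t0 = 0" and s0: "s0 \<in> {0..1}"
  shows "C s0 t0 = 0"
proof (rule ccontr)
  define r where "r = \<bar>C s0 t0\<bar>"
  assume "C s0 t0 \<noteq> 0"
  then have r: "r > 0" by (simp add: r_def)
  obtain K where K: "K > 0" "\<And>s t. s \<in> {0..1} \<Longrightarrow> t \<in> {0..1} \<Longrightarrow> \<bar>C s t\<bar> \<le> K" using C_bound by blast
  \<comment> \<open>The first bound keeps the cross form above r/2 times the masses of the tents;
    the second makes the product of the two diagonal forms smaller than the square of that, against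
    Cauchy-Schwarz.\<close>
  define e where "e = min (r / 2) (r\<^sup>2 / (8 * K))"
  have e: "e > 0" "e \<le> r / 2" "K * e < r\<^sup>2 / 4"
  proof -
    show "e > 0" "e \<le> r / 2" using r K by (auto simp: e_def)
    have "K * e \<le> K * (r\<^sup>2 / (8 * K))" using K by (intro mult_left_mono) (auto simp: e_def)
    also have "\<dots> < r\<^sup>2 / 4" using K r by simp
    finally show "K * e < r\<^sup>2 / 4" .
  qed
  have near: "\<exists>\<eta>>0. \<forall>u\<in>{0..1}. \<forall>v\<in>{0..1}. \<bar>u - a\<bar> < \<eta> \<longrightarrow> \<bar>v - b\<bar> < \<eta> \<longrightarrow> \<bar>C u v - C a b\<bar> \<le> e"
    if ab: "a \<in> {0..1}" "b \<in> {0..1}" for a b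
  proof -
    have "(a, b) \<in> {0..1} \<times> {0..1}" using ab by simp
    from C_cont[unfolded square_continuous_def continuous_on_iff case_prod_unfold, rule_format, OF this e(1)]
    obtain \<eta> where \<eta>: "\<eta> > 0" "\<forall>p\<in>{0..1} \<times> {0..1}. dist p (a, b) < \<eta> \<longrightarrow> dist (C (fst p) (snd p)) (C a b) < e"
      unfolding fst_conv snd_conv by (elim exE conjE)
    show ?thesis
    proof (intro exI[of _ "\<eta> / 2"] conjI ballI impI)
      fix u v assume uv: "u \<in> {0..1}" "v \<in> {0..1}" "\<bar>u - a\<bar> < \<eta> / 2" "\<bar>v - b\<bar> < \<eta> / 2"
      have "dist (u, v) (a, b) \<le> \<bar>u - a\<bar> + \<bar>v - b\<bar>"
        using sqrt_sum_squares_le_sum_abs[of "u - a" "v - b"] by (simp add: dist_Pair_Pair dist_real_def)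
      then show "\<bar>C u v - C a b\<bar> \<le> e" using uv bspec[OF \<eta>(2), of "(u, v)"] by (auto simp: dist_real_def)
    qed (use \<eta> in auto)
  qed
  from near[OF s0 t0] obtain \<eta>1 where \<eta>1: "\<eta>1 > 0"
    "\<forall>u\<in>{0..1}. \<forall>v\<in>{0..1}. \<bar>u - s0\<bar> < \<eta>1 \<longrightarrow> \<bar>v - t0\<bar> < \<eta>1 \<longrightarrow> \<bar>C u v - C s0 t0\<bar> \<le> e" by (elim exE conjE)
  from near[OF t0 t0] obtain \<eta>2 where \<eta>2: "\<eta>2 > 0"
    "\<forall>u\<in>{0..1}. \<forall>v\<in>{0..1}. \<bar>u - t0\<bar> < \<eta>2 \<longrightarrow> \<bar>v - t0\<bar> < \<eta>2 \<longrightarrow> \<bar>C u v - C t0 t0\<bar> \<le> e" by (elim exE conjE)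
  define \<eta> where "\<eta> = min \<eta>1 \<eta>2"
  have \<eta>: "\<eta> > 0" using \<eta>1 \<eta>2 by (simp add: \<eta>_def)
  define bump where "bump a t = max 0 (\<eta> - \<bar>t - a\<bar>)" for a t :: real
  have bc: "continuous_on {0..1} (bump a)" for a unfolding bump_def by (intro continuous_intros)
  have b0: "0 \<le> bump a t" for a t by (simp add: bump_def)
  have bz: "bump a t = 0" if "\<not> \<bar>t - a\<bar> < \<eta>" for a t using that by (simp add: bump_def)
  define m where "m a = (LBINT t:{0..1}. bump a t)" for a
  have m: "m a > 0" if "a \<in> {0..1}" for a
  proof -
    have i: "set_integrable lborel {0..1} (bump a)" by (rule borel_integrable_atLeastAtMost'[OF bc])
    have eq: "m a = integral {0..1} (bump a)" unfolding m_def by (rule set_borel_integral_eq_integral(2)[OF i])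
    have "integral {0..1} (bump a) \<ge> 0" by (intro integral_nonneg set_borel_integral_eq_integral(1)[OF i] b0)
    moreover have "integral {0..1} (bump a) \<noteq> 0"
    proof
      assume "integral {0..1} (bump a) = 0"
      then have "bump a a = 0" using integral_eq_0_iff[OF bc, of a] b0 that by simp
      then show False using \<eta> by (simp add: bump_def)
    qed
    ultimately show ?thesis using eq by simp
  qed
  let ?V = "\<lambda>a b. square_integral (\<lambda>s t. C s t * bump a t * bump b s)"
  have sc: "square_continuous (\<lambda>s t. x * bump a t * bump b s)" for x a b
    using square_continuous_mult[of "\<lambda>_ _. x", OF _ bc bc] by (simp add: square_continuous_def)
  have si: "square_integral (\<lambda>s t. x * bump a t * bump b s) = x * m a * m b" for x a b
    unfolding square_integral_def m_def by (simp add: mult.assoc)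
  have V: "\<bar>?V a b - x * m a * m b\<bar> \<le> e * m a * m b"
    if "\<And>s t. s \<in> {0..1} \<Longrightarrow> t \<in> {0..1} \<Longrightarrow> \<bar>s - b\<bar> < \<eta> \<Longrightarrow> \<bar>t - a\<bar> < \<eta> \<Longrightarrow> \<bar>C s t - x\<bar> \<le> e" for a b x
    unfolding si[symmetric]
  proof (rule square_integral_abs_diff[OF square_continuous_mult[OF C_cont bc bc] sc sc])
    fix s t :: real assume st: "s \<in> {0..1}" "t \<in> {0..1}"
    show "\<bar>C s t * bump a t * bump b s - x * bump a t * bump b s\<bar> \<le> e * bump a t * bump b s"
    proof (cases "\<bar>s - b\<bar> < \<eta> \<and> \<bar>t - a\<bar> < \<eta>")
      case True
      have "\<bar>C s t * bump a t * bump b s - x * bump a t * bump b s\<bar> = \<bar>C s t - x\<bar> * (bump a t * bump b s)"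
        using b0 by (simp add: abs_mult left_diff_distrib[symmetric] mult.assoc)
      also have "\<dots> \<le> e * (bump a t * bump b s)" using that[OF st] True b0 by (intro mult_right_mono) auto
      finally show ?thesis by (simp add: mult.assoc)
    qed (auto simp: bz)
  qed
  have V1: "\<bar>?V t0 s0 - C s0 t0 * m t0 * m s0\<bar> \<le> e * m t0 * m s0"
    by (rule V) (use \<eta>1(2) in \<open>simp add: \<eta>_def\<close>)
  have V2: "\<bar>?V t0 t0 - 0 * m t0 * m t0\<bar> \<le> e * m t0 * m t0"
    by (rule V) (use \<eta>2(2) z in \<open>simp add: \<eta>_def\<close>)
  have V3: "?V s0 s0 \<le> square_integral (\<lambda>s t. K * bump s0 t * bump s0 s)"
    by (intro square_integral_mono square_continuous_mult[OF C_cont bc bc] sc mult_right_mono b0)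
       (use K(2) in \<open>auto simp: abs_le_iff\<close>)
  define p where "p = m t0 * m s0"
  have p: "p > 0" using m t0 s0 by (simp add: p_def)
  have "(r / 2) * p \<le> \<bar>?V t0 s0\<bar>"
  proof -
    have "r * p - \<bar>?V t0 s0\<bar> \<le> e * p"
    proof -
      have "\<bar>C s0 t0 * p\<bar> = r * p" using p by (simp add: abs_mult r_def)
      moreover have "\<bar>?V t0 s0 - C s0 t0 * p\<bar> \<le> e * p" using V1 by (simp add: p_def mult.assoc)
      ultimately show ?thesis by linarith
    qed
    moreover have "e * p \<le> (r / 2) * p" using e p by (intro mult_right_mono) auto
    ultimately show ?thesis by (simp add: field_simps)
  qed
  then have "((r / 2) * p)\<^sup>2 \<le> (?V t0 s0)\<^sup>2" 
    using r p abs_le_square_iff[of "(r / 2) * p" "?V t0 s0"] by simp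
  also have "\<dots> \<le> ?V t0 t0 * ?V s0 s0" by (rule psd_Cauchy_Schwarz[OF bc bc])
  also have "\<dots> \<le> (e * m t0 * m t0) * (K * m s0 * m s0)"
    using V2 V3 e K m[OF t0] m[OF s0] psd_continuous[OF bc, of s0] unfolding si by (intro mult_mono) auto
  also have "\<dots> = (K * e) * p\<^sup>2" by (simp add: p_def power2_eq_square)
  also have "\<dots> < (r\<^sup>2 / 4) * p\<^sup>2" using e p by (intro mult_strict_right_mono) auto
  finally show False by (simp add: power2_eq_square)
qed

end

subsection \<open>The covariance operator\<close>

lemma compact_unit_box: "compact {c :: nat \<Rightarrow> real. \<forall>j. \<bar>c j\<bar> \<le> 1}"
proof -
  have "compactin (product_topology (\<lambda>_. euclidean) UNIV) (PiE UNIV (\<lambda>_::nat. {-1..1::real}))"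
    by (simp add: compactin_PiE)
  then have "compact (PiE UNIV (\<lambda>_::nat. {-1..1::real}))" by (simp add: euclidean_product_topology)
  moreover have "PiE UNIV (\<lambda>_::nat. {-1..1::real}) = {c. \<forall>j. \<bar>c j\<bar> \<le> 1}" by (auto simp: PiE_UNIV_domain abs_le_iff minus_le_iff Pi_def)
  ultimately show ?thesis by simp
qed

text \<open>Minimum over the l1 unit sphere, then homogeneity. Coefficients are functions on all
  naturals, so the sphere is cut with a box in all coordinates, which Tychonoff's theorem makes
  compact in the product topology; a given c is scaled and set to 0 from index m on to lie in
  it.\<close>

lemma quadratic_form_bounded_below:
  fixes A :: "nat \<Rightarrow> nat \<Rightarrow> real"
  assumes pos: "\<And>c. \<exists>j<m. c j \<noteq> 0 \<Longrightarrow> 0 < (\<Sum>i<m. \<Sum>j<m. c i * c j * A i j)"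
  shows "\<exists>\<kappa>>0. \<forall>c. \<kappa> * (\<Sum>j<m. \<bar>c j\<bar>)\<^sup>2 \<le> (\<Sum>i<m. \<Sum>j<m. c i * c j * A i j)"
proof (cases "m = 0")
  case True
  then show ?thesis by (auto intro!: exI[of _ 1])
next
  case False
  let ?Q = "\<lambda>c. \<Sum>i<m. \<Sum>j<m. c i * c j * A i j" and ?n = "\<lambda>c. \<Sum>j<m. \<bar>c j\<bar>"
  define K where "K = {c :: nat \<Rightarrow> real. \<forall>j. \<bar>c j\<bar> \<le> 1} \<inter> {c. ?n c = 1}"
  have co: "continuous_on UNIV (\<lambda>c :: nat \<Rightarrow> real. c j)" for j by (rule continuous_on_product_coordinates)
  have "compact K" unfolding K_def
    by (intro compact_Int_closed compact_unit_box closed_Collect_eq continuous_intros co)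
  moreover have "K \<noteq> {}"
  proof -
    have "(\<lambda>j. if j = 0 then 1 else 0) \<in> K" using False by (auto simp: K_def if_distrib[of abs] cong: if_cong)
    then show ?thesis by blast
  qed
  moreover have "continuous_on K ?Q" by (intro continuous_intros continuous_on_subset[OF co subset_UNIV])
  ultimately obtain e where e: "e \<in> K" "\<And>c. c \<in> K \<Longrightarrow> ?Q e \<le> ?Q c"
    using continuous_attains_inf[of K ?Q] by blast
  have "\<exists>j<m. e j \<noteq> 0"
  proof (rule ccontr)
    assume "\<not> (\<exists>j<m. e j \<noteq> 0)"
    then have "?n e = 0" by simp
    then show False using e(1) by (simp add: K_def)
  qed
  then have "?Q e > 0" by (rule pos)
  moreover have "?Q e * (?n c)\<^sup>2 \<le> ?Q c" for c
  proof (cases "?n c = 0")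
    case True
    then have "\<forall>j<m. c j = 0" by (subst (asm) sum_nonneg_eq_0_iff) auto
    then show ?thesis using True by simp
  next
    case False
    then have n: "?n c > 0" by (simp add: order_less_le sum_nonneg)
    define d where "d j = (if j < m then c j / ?n c else 0)" for j
    have "\<bar>c j\<bar> \<le> ?n c" if "j < m" for j using that by (intro member_le_sum) auto
    then have "\<bar>d j\<bar> \<le> 1" for j using n by (simp add: d_def)
    moreover have "?n d = 1"
    proof -
      have "?n d = (\<Sum>j<m. \<bar>c j\<bar> / ?n c)" using n by (intro sum.cong) (auto simp: d_def)
      then show ?thesis using n by (simp add: sum_divide_distrib[symmetric])
    qed
    ultimately have "?Q e \<le> ?Q d" by (intro e) (auto simp: K_def)
    also have "?Q d = (\<Sum>i<m. \<Sum>j<m. (c i * c j * A i j) / (?n c)\<^sup>2)"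
      by (intro sum.cong refl) (auto simp: d_def power2_eq_square)
    also have "\<dots> = ?Q c / (?n c)\<^sup>2" by (simp add: sum_divide_distrib)
    finally show ?thesis using n by (simp add: field_simps)
  qed
  ultimately show ?thesis by blast
qed

text \<open>\<open>b\<close> is the density weight as it occurs in the covariance operator,
  \<open>b'\<close> a measurable version with bounds valid everywhere. Injectivity and centring are
  statements about \<open>b\<close>, comparisons of moments use \<open>b'\<close>, and the null set
  \<open>Z\<close> separates the points where one may replace the other.\<close>

locale weighted_random_function = random_function M X for M :: "'a measure" and X +
  fixes b b' :: "'a \<Rightarrow> real" and C1 :: real
  assumes b'_meas [measurable]: "b' \<in> borel_measurable M"
    and AE_b: "AE \<omega> in M. b' \<omega> = b \<omega>"
    and b'_bounds: "\<And>\<omega>. 1 / C1 \<le> b' \<omega>" "\<And>\<omega>. b' \<omega> \<le> C1" and C1_pos: "0 < C1"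
    and X4: "integrable M (\<lambda>\<omega>. l2norm (X \<omega>) ^ 4)"
    and psd: "psd_kernel (\<lambda>s t. \<integral>\<omega>. b \<omega> * X \<omega> s * X \<omega> t \<partial>M)"
    and inj: "\<And>\<beta>. L2 \<beta> \<Longrightarrow> AE v in lborel. v \<in> {0..1} \<longrightarrow> (LBINT u:{0..1}. (\<integral>\<omega>. b \<omega> * X \<omega> u * X \<omega> v \<partial>M) * \<beta> u) = 0
        \<Longrightarrow> AE u in lborel. u \<in> {0..1} \<longrightarrow> \<beta> u = 0"
    and mean0: "\<And>t. t \<in> {0..1} \<Longrightarrow> (\<integral>\<omega>. b \<omega> * X \<omega> t \<partial>M) = 0"
begin

lemma X_section [measurable]: "(\<lambda>\<omega>. X \<omega> t) \<in> borel_measurable M"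
  using measurable_compose[OF measurable_Pair2' X_meas, of t] by simp

lemma b'_pos: "0 < b' \<omega>"
  using b'_bounds(1)[of \<omega>] C1_pos by (meson divide_pos_pos less_le_trans zero_less_one)

lemma X_norm_sq_int: "sq_int M (\<lambda>\<omega>. l2norm (X \<omega>))" "sq_int M (\<lambda>\<omega>. (l2norm (X \<omega>))\<^sup>2)"
proof -
  show 2: "sq_int M (\<lambda>\<omega>. (l2norm (X \<omega>))\<^sup>2)"
    using X4 by (simp add: sq_int_def power_even_eq[symmetric] flip: power_mult)
  have "sq_int M (\<lambda>_. 1)" by (simp add: sq_int_def)
  from sq_int_mult[OF 2 this] show "sq_int M (\<lambda>\<omega>. l2norm (X \<omega>))" by (simp add: sq_int_def)
qed

definition C :: "real \<Rightarrow> real \<Rightarrow> real" where "C s t = (\<integral>\<omega>. b \<omega> * X \<omega> s * X \<omega> t \<partial>M)"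

sublocale psd_kernel C
  using psd unfolding C_def[abs_def] .

definition Z :: "real set" where "Z = {t \<in> {0..1}. C t t = 0}"

lemma AE_notin_Z: "AE t in lborel. t \<notin> Z"
proof -
  have "continuous_on {0..1} (\<lambda>t. (\<lambda>(s, t). C s t) (t, t))"
    by (rule continuous_on_compose2[OF C_cont[unfolded square_continuous_def]]) (auto intro!: continuous_intros)
  then have "closed ({0..1} \<inter> (\<lambda>t. C t t) -` {0})"
    by (intro continuous_closed_preimage) auto
  also have "{0..1} \<inter> (\<lambda>t. C t t) -` {0} = Z" by (auto simp: Z_def)
  finally have Zb: "Z \<in> sets borel" by (rule borel_closed)
  have L: "L2 (indicator Z)"
    by (rule L2_bounded(1)[where B=1]) (use Zb in \<open>auto simp: cut01_def[abs_def] indicator_def[of Z]\<close>)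
  \<comment> \<open>The indicator of \<open>Z\<close> is the test function for injectivity: the
    operator annihilates it because C(u, v) = 0 for every u in \<open>Z\<close>.\<close>
  have "(LBINT u:{0..1}. C u v * indicator Z u) = 0" if "v \<in> {0..1}" for v
  proof -
    have eq: "C u v * indicator Z u = 0" for u
      using zero_diagonal[of u v] that C_sym[of u v] by (auto simp: Z_def indicator_def)
    show ?thesis unfolding set_lebesgue_integral_def eq by simp
  qed
  then have "AE u in lborel. u \<in> {0..1} \<longrightarrow> (indicator Z u :: real) = 0"
    by (intro inj[OF L]) (simp add: C_def)
  then show ?thesis by eventually_elim (auto simp: Z_def indicator_def)
qed

text \<open>Where the diagonal entry is nonzero its integrand is integrable, hence measurable; the weight b alone
  need not be measurable.\<close>
lemma replace_weight:
  assumes t: "t \<in> {0..1}" "t \<notin> Z"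
  shows "(\<integral>\<omega>. b' \<omega> * X \<omega> t \<partial>M) = 0" "C s t = (\<integral>\<omega>. b' \<omega> * X \<omega> s * X \<omega> t \<partial>M)"
proof -
  have "integrable M (\<lambda>\<omega>. b \<omega> * X \<omega> t * X \<omega> t)"
    using t not_integrable_integral_eq by (auto simp: Z_def C_def)
  \<comment> \<open>Division by zero yields 0, in agreement with the product b X(t) where X(t)
    vanishes, so the quotient recovers that product everywhere.\<close>
  then have "(\<lambda>\<omega>. b \<omega> * X \<omega> t * X \<omega> t / X \<omega> t) \<in> borel_measurable M"
    by (intro borel_measurable_divide borel_measurable_integrable X_section)
  then have m[measurable]: "(\<lambda>\<omega>. b \<omega> * X \<omega> t) \<in> borel_measurable M"
    by (rule measurable_cong[THEN iffD1, rotated]) auto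
  have "(\<integral>\<omega>. b' \<omega> * X \<omega> t \<partial>M) = (\<integral>\<omega>. b \<omega> * X \<omega> t \<partial>M)"
    by (intro integral_cong_AE) (use AE_b in \<open>auto elim!: eventually_mono\<close>)
  then show "(\<integral>\<omega>. b' \<omega> * X \<omega> t \<partial>M) = 0" using mean0[OF t(1)] by simp
  have "C s t = (\<integral>\<omega>. (b \<omega> * X \<omega> t) * X \<omega> s \<partial>M)" unfolding C_def by (simp add: mult_ac)
  also have "\<dots> = (\<integral>\<omega>. (b' \<omega> * X \<omega> t) * X \<omega> s \<partial>M)"
    by (intro integral_cong_AE) (use AE_b in \<open>auto elim!: eventually_mono\<close>)
  finally show "C s t = (\<integral>\<omega>. b' \<omega> * X \<omega> s * X \<omega> t \<partial>M)" by (simp add: mult_ac)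
qed

lemma lin_X_sq_int: "L2 \<beta> \<Longrightarrow> sq_int M (\<lambda>\<omega>. lin \<beta> (X \<omega>))"
  and lin_X_square_le: "L2 \<beta> \<Longrightarrow> (\<integral>\<omega>. (lin \<beta> (X \<omega>))\<^sup>2 \<partial>M) \<le> (l2norm \<beta>)\<^sup>2 * (\<integral>\<omega>. (l2norm (X \<omega>))\<^sup>2 \<partial>M)"
proof -
  assume \<beta>: "L2 \<beta>"
  have le: "(lin \<beta> (X \<omega>))\<^sup>2 \<le> (l2norm \<beta>)\<^sup>2 * (l2norm (X \<omega>))\<^sup>2" if "\<omega> \<in> space M" for \<omega>
    using power_mono[OF abs_lin_le[OF \<beta> X_L2[OF that]] abs_ge_zero, of 2] by (simp add: power_mult_distrib)
  have i: "integrable M (\<lambda>\<omega>. (l2norm \<beta>)\<^sup>2 * (l2norm (X \<omega>))\<^sup>2)" using X_norm_sq_int(1) by (simp add: sq_int_def)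
  show s: "sq_int M (\<lambda>\<omega>. lin \<beta> (X \<omega>))" unfolding sq_int_def
  proof
    show "integrable M (\<lambda>\<omega>. (lin \<beta> (X \<omega>))\<^sup>2)"
      by (rule Bochner_Integration.integrable_bound[OF i]) (use \<beta> le in auto)
  qed (use \<beta> in auto)
  have "(\<integral>\<omega>. (lin \<beta> (X \<omega>))\<^sup>2 \<partial>M) \<le> (\<integral>\<omega>. (l2norm \<beta>)\<^sup>2 * (l2norm (X \<omega>))\<^sup>2 \<partial>M)"
    by (intro integral_mono i sq_int_integrable[OF s] le)
  then show "(\<integral>\<omega>. (lin \<beta> (X \<omega>))\<^sup>2 \<partial>M) \<le> (l2norm \<beta>)\<^sup>2 * (\<integral>\<omega>. (l2norm (X \<omega>))\<^sup>2 \<partial>M)" by simp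
qed

text \<open>The domination is Cauchy-Schwarz twice: in t against the norms of \<beta> and X, then in
  \<omega> against w.\<close>

lemma Fubini_lin:
  assumes \<beta>: "L2 \<beta>" and w: "sq_int M w"
  shows "(\<integral>\<omega>. w \<omega> * lin \<beta> (X \<omega>) \<partial>M) = (LBINT t. (\<integral>\<omega>. w \<omega> * (cut01 \<beta> t * cut01 (X \<omega>) t) \<partial>M))"
proof -
  interpret P: pair_sigma_finite M lborel ..
  have [measurable]: "w \<in> borel_measurable M" "cut01 \<beta> \<in> borel_measurable borel"
    using w L2_measurable[OF \<beta>] by (auto simp: sq_int_def)
  let ?g = "\<lambda>\<omega> t. w \<omega> * (cut01 \<beta> t * cut01 (X \<omega>) t)"
  have i2: "integrable lborel (\<lambda>t. cut01 \<beta> t * cut01 (X \<omega>) t)" if "\<omega> \<in> space M" for \<omega>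
    using \<beta> X_L2[OF that] by (intro sq_int_mult) (auto simp: L2_iff_sq_int)
  have "integrable (M \<Otimes>\<^sub>M lborel) (\<lambda>(\<omega>, t). ?g \<omega> t)"
  proof (rule P.Fubini_integrable)
    show "AE \<omega> in M. integrable lborel (\<lambda>t. case (\<omega>, t) of (\<omega>, t) \<Rightarrow> ?g \<omega> t)" using i2 by auto
    show "integrable M (\<lambda>\<omega>. LBINT t. norm (case (\<omega>, t) of (\<omega>, t) \<Rightarrow> ?g \<omega> t))"
    proof (rule Bochner_Integration.integrable_bound)
      show "integrable M (\<lambda>\<omega>. l2norm \<beta> * \<bar>w \<omega> * l2norm (X \<omega>)\<bar>)"
        by (intro integrable_mult_right integrable_abs sq_int_mult w X_norm_sq_int)
      show "AE \<omega> in M. norm (LBINT t. norm (case (\<omega>, t) of (\<omega>, t) \<Rightarrow> ?g \<omega> t)) \<le> norm (l2norm \<beta> * \<bar>w \<omega> * l2norm (X \<omega>)\<bar>)"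
      proof (rule AE_I2)
        fix \<omega> assume "\<omega> \<in> space M"
        then have "(LBINT t. \<bar>cut01 \<beta> t * cut01 (X \<omega>) t\<bar>) \<le> l2norm \<beta> * l2norm (X \<omega>)"
          unfolding l2norm_eq using \<beta> X_L2 by (intro integral_abs_mult_le_sqrt) (auto simp: L2_iff_sq_int)
        from mult_left_mono[OF this, of "\<bar>w \<omega>\<bar>"]
        show "norm (LBINT t. norm (case (\<omega>, t) of (\<omega>, t) \<Rightarrow> ?g \<omega> t)) \<le> norm (l2norm \<beta> * \<bar>w \<omega> * l2norm (X \<omega>)\<bar>)"
          by (simp add: abs_mult[of "w \<omega>"] mult_ac)
      qed
    qed measurable
  qed measurable
  from P.Fubini_integral[OF this] show ?thesis by (simp add: lin_eq)
qed

text \<open>The centring condition is pointwise in t; integrating it against \<beta> transfers it to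
  linear functionals, since the points of \<open>Z\<close>, where the weight may not be replaced,
  form a null set.\<close>

lemma weighted_mean_zero:
  assumes "L2 \<beta>"
  shows "(\<integral>\<omega>. b' \<omega> * lin \<beta> (X \<omega>) \<partial>M) = 0"
proof -
  have "sq_int M b'" unfolding sq_int_def
  proof
    show "integrable M (\<lambda>\<omega>. (b' \<omega>)\<^sup>2)"
      by (rule integrable_const_bound[where B="C1\<^sup>2"]) (use b'_bounds b'_pos less_imp_le[OF b'_pos] in \<open>auto intro!: power_mono\<close>)
  qed simp
  from Fubini_lin[OF assms this]
  have "(\<integral>\<omega>. b' \<omega> * lin \<beta> (X \<omega>) \<partial>M) = (LBINT t. (\<integral>\<omega>. b' \<omega> * (cut01 \<beta> t * cut01 (X \<omega>) t) \<partial>M))" .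
  also have "\<dots> = 0"
  proof (rule integral_eq_zero_AE)
    show "AE t in lborel. (\<integral>\<omega>. b' \<omega> * (cut01 \<beta> t * cut01 (X \<omega>) t) \<partial>M) = 0"
      using AE_notin_Z
    proof eventually_elim
      case (elim t)
      have "(\<integral>\<omega>. b' \<omega> * (cut01 \<beta> t * cut01 (X \<omega>) t) \<partial>M) = (\<integral>\<omega>. cut01 \<beta> t * indicator {0..1} t * (b' \<omega> * X \<omega> t) \<partial>M)"
        by (simp add: cut01_def mult_ac)
      then show ?case using replace_weight(1)[of t] elim by (cases "t \<in> {0..1}") auto
    qed
  qed
  finally show ?thesis .
qed

text \<open>If the functional vanishes, so does E[b' X(v) \<integral>\<beta> X], and for almost
  every v this is the covariance operator applied to \<beta>. The exceptional v come from
  \<open>Z\<close> and from X(v) being square integrable for almost every v only.\<close>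

lemma lin_X_zero_imp_zero:
  assumes \<beta>: "L2 \<beta>" and z: "AE \<omega> in M. lin \<beta> (X \<omega>) = 0"
  shows "AE t in lborel. t \<in> {0..1} \<longrightarrow> \<beta> t = 0"
proof (rule inj[OF \<beta>])
  interpret P: pair_sigma_finite M lborel ..
  have "integrable (M \<Otimes>\<^sub>M lborel) (\<lambda>(\<omega>, t). (cut01 (X \<omega>) t)\<^sup>2)"
  proof (rule P.Fubini_integrable)
    show "AE \<omega> in M. integrable lborel (\<lambda>t. case (\<omega>, t) of (\<omega>, t) \<Rightarrow> (cut01 (X \<omega>) t)\<^sup>2)"
      using X_L2 by (auto simp: L2_iff_sq_int sq_int_def)
    show "integrable M (\<lambda>\<omega>. LBINT t. norm (case (\<omega>, t) of (\<omega>, t) \<Rightarrow> (cut01 (X \<omega>) t)\<^sup>2))"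
      using X_norm_sq_int(1) by (simp add: sq_int_def l2norm_square)
  qed measurable
  from P.AE_integrable_snd[OF this] AE_notin_Z
  show "AE v in lborel. v \<in> {0..1} \<longrightarrow> (LBINT u:{0..1}. (\<integral>\<omega>. b \<omega> * X \<omega> u * X \<omega> v \<partial>M) * \<beta> u) = 0"
  proof eventually_elim
    case (elim v)
    show ?case
    proof
      assume v: "v \<in> {0..1}"
      have "sq_int M (\<lambda>\<omega>. X \<omega> v)" using elim(1) v by (simp add: sq_int_def cut01_def)
      from sq_int_cmult[OF this, of C1] have w: "sq_int M (\<lambda>\<omega>. b' \<omega> * X \<omega> v)"
        by (rule sq_int_bound) (use b'_bounds less_imp_le[OF b'_pos] C1_pos in \<open>auto simp: abs_mult intro!: mult_right_mono\<close>)
      have "(LBINT u:{0..1}. (\<integral>\<omega>. b \<omega> * X \<omega> u * X \<omega> v \<partial>M) * \<beta> u) = (LBINT u. (\<integral>\<omega>. b' \<omega> * X \<omega> v * (cut01 \<beta> u * cut01 (X \<omega>) u) \<partial>M))"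
        unfolding set_lebesgue_integral_def
      proof (intro Bochner_Integration.integral_cong refl)
        fix u
        have "(\<integral>\<omega>. b \<omega> * X \<omega> u * X \<omega> v \<partial>M) = (\<integral>\<omega>. b' \<omega> * X \<omega> u * X \<omega> v \<partial>M)"
          using replace_weight(2)[OF v elim(2), of u] by (simp add: C_def)
        moreover have "(\<integral>\<omega>. b' \<omega> * X \<omega> v * (cut01 \<beta> u * cut01 (X \<omega>) u) \<partial>M) = (\<integral>\<omega>. indicator {0..1} u * \<beta> u * (b' \<omega> * X \<omega> u * X \<omega> v) \<partial>M)"
          by (intro Bochner_Integration.integral_cong) (auto simp: cut01_def indicator_def)
        ultimately show "indicator {0..1} u *\<^sub>R ((\<integral>\<omega>. b \<omega> * X \<omega> u * X \<omega> v \<partial>M) * \<beta> u) = (\<integral>\<omega>. b' \<omega> * X \<omega> v * (cut01 \<beta> u * cut01 (X \<omega>) u) \<partial>M)"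
          by simp
      qed
      also have "\<dots> = (\<integral>\<omega>. b' \<omega> * X \<omega> v * lin \<beta> (X \<omega>) \<partial>M)" by (rule Fubini_lin[OF \<beta> w, symmetric])
      also have "\<dots> = 0" by (rule integral_eq_zero_AE) (use z in \<open>auto elim!: eventually_mono\<close>)
      finally show "(LBINT u:{0..1}. (\<integral>\<omega>. b \<omega> * X \<omega> u * X \<omega> v \<partial>M) * \<beta> u) = 0" .
    qed
  qed
qed

text \<open>Under the weight \<open>b'\<close> the cross term between intercept and slope has mean
  zero; introducing the weight and removing it again costs a factor C1 each.\<close>

lemma intercept_slope_separation:
  assumes "L2 \<beta>"
  shows "a\<^sup>2 + (\<integral>\<omega>. (lin \<beta> (X \<omega>))\<^sup>2 \<partial>M) \<le> C1\<^sup>2 * (\<integral>\<omega>. (a + lin \<beta> (X \<omega>))\<^sup>2 \<partial>M)"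
proof -
  let ?x = "\<lambda>\<omega>. lin \<beta> (X \<omega>)"
  note x = lin_X_sq_int[OF assms]
  have c: "sq_int M (\<lambda>_. a)" by (simp add: sq_int_def)
  note ax = sq_int_add[OF c x]
  have [measurable]: "?x \<in> borel_measurable M" using assms by simp
  have bi: "integrable M (\<lambda>\<omega>. b' \<omega> * g \<omega>)" if "integrable M g" for g
  proof (rule Bochner_Integration.integrable_bound)
    show "integrable M (\<lambda>\<omega>. C1 * g \<omega>)" using that by simp
    show "(\<lambda>\<omega>. b' \<omega> * g \<omega>) \<in> borel_measurable M" using that by measurable
    show "AE \<omega> in M. norm (b' \<omega> * g \<omega>) \<le> norm (C1 * g \<omega>)"
      using b'_bounds(2) less_imp_le[OF b'_pos] C1_pos by (auto simp: abs_mult intro!: mult_right_mono)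
  qed
  have x1: "integrable M ?x" using sq_int_mult[OF x, of "\<lambda>_. 1"] by (simp add: sq_int_def)
  have sum: "integrable M (\<lambda>\<omega>. a\<^sup>2 + (?x \<omega>)\<^sup>2)" using x by (simp add: sq_int_def)
  have "(a\<^sup>2 + (\<integral>\<omega>. (?x \<omega>)\<^sup>2 \<partial>M)) / C1 = (\<integral>\<omega>. 1 / C1 * (a\<^sup>2 + (?x \<omega>)\<^sup>2) \<partial>M)"
    using x by (simp add: sq_int_def prob_space)
  also have "\<dots> \<le> (\<integral>\<omega>. b' \<omega> * (a\<^sup>2 + (?x \<omega>)\<^sup>2) \<partial>M)"
    by (intro integral_mono bi sum integrable_mult_right mult_right_mono b'_bounds) auto
  also have "\<dots> = (\<integral>\<omega>. b' \<omega> * (a\<^sup>2 + (?x \<omega>)\<^sup>2) + (2 * a) * (b' \<omega> * ?x \<omega>) \<partial>M)"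
    using bi[OF sum] bi[OF x1] weighted_mean_zero[OF assms] by simp
  also have "\<dots> = (\<integral>\<omega>. b' \<omega> * (a + ?x \<omega>)\<^sup>2 \<partial>M)"
    by (intro Bochner_Integration.integral_cong refl) (simp add: power2_eq_square algebra_simps)
  also have "\<dots> \<le> (\<integral>\<omega>. C1 * (a + ?x \<omega>)\<^sup>2 \<partial>M)"
    by (intro integral_mono bi integrable_mult_right mult_right_mono b'_bounds sq_int_integrable[OF ax]) auto
  also have "\<dots> = C1 * (\<integral>\<omega>. (a + ?x \<omega>)\<^sup>2 \<partial>M)" by simp
  finally have le: "(a\<^sup>2 + (\<integral>\<omega>. (?x \<omega>)\<^sup>2 \<partial>M)) / C1 \<le> C1 * (\<integral>\<omega>. (a + ?x \<omega>)\<^sup>2 \<partial>M)" .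
  have "x \<le> C1\<^sup>2 * y" if "x / C1 \<le> C1 * y" for x y
    using that C1_pos by (simp add: pos_divide_le_eq power2_eq_square mult_ac)
  from this[OF le] show ?thesis .
qed

end

lemma sob_build_cong: "(\<And>j. j < m \<Longrightarrow> c j = e j) \<Longrightarrow> sob_build m c w = sob_build m e w"
proof (induction m arbitrary: c e)
  case (Suc m)
  from Suc.IH[of "\<lambda>j. c (Suc j)" "\<lambda>j. e (Suc j)"] Suc.prems show ?case by simp
qed simp

lemma L2_zero: "L2 (\<lambda>_. 0)"
  by (intro L2_continuous) auto

lemma sob_build_sum:
  assumes t: "t \<in> {0..1}"
  shows "sob_build m c (\<lambda>_. 0) t = (\<Sum>i<m. c i * sob_build m (\<lambda>j. if j = i then 1 else 0) (\<lambda>_. 0) t)"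
proof -
  have "sob_build m (\<lambda>j. if j < n then c j else 0) (\<lambda>_. 0) t = (\<Sum>i<n. c i * sob_build m (\<lambda>j. if j = i then 1 else 0) (\<lambda>_. 0) t)" for n
  proof (induction n)
    case 0
    then show ?case using sob_build_linear[OF L2_zero L2_zero t, of m 0 c 0 c] by simp
  next
    case (Suc n)
    have "(\<lambda>j. if j < Suc n then c j else 0) = (\<lambda>j. 1 * (if j < n then c j else 0) + c n * (if j = n then 1 else 0))"
      by (auto simp: fun_eq_iff less_Suc_eq)
    then have "sob_build m (\<lambda>j. if j < Suc n then c j else 0) (\<lambda>_. 0) t
      = sob_build m (\<lambda>j. 1 * (if j < n then c j else 0) + c n * (if j = n then 1 else 0)) (\<lambda>t. 1 * 0 + c n * 0) t" by simp
    also note sob_build_linear[OF L2_zero L2_zero t, of m 1 _ "c n"]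
    finally show ?case using Suc by simp
  qed
  from this[of m] show ?thesis using sob_build_cong[of m c "\<lambda>j. if j < m then c j else 0"] by simp
qed

lemma lin_sum:
  fixes n :: nat
  assumes "L2 x" "\<And>i. i < n \<Longrightarrow> L2 (g i)"
  shows "L2 (\<lambda>t. \<Sum>i<n. c i * g i t) \<and> lin (\<lambda>t. \<Sum>i<n. c i * g i t) x = (\<Sum>i<n. c i * lin (g i) x)"
  using assms(2)
proof (induction n)
  case 0
  then show ?case using L2_zero by (simp add: lin_eq cut01_def)
next
  case (Suc n)
  then show ?case using assms(1) by (auto intro!: L2_add L2_cmult simp: lin_add L2_cmult lin_cmult)
qed

lemma lin_cong: "(\<And>t. t \<in> {0..1} \<Longrightarrow> b t = c t) \<Longrightarrow> lin b x = lin c x"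
  using cut01_eqI[of b c] by (simp add: lin_eq)

lemma l2norm_cong: "(\<And>t. t \<in> {0..1} \<Longrightarrow> b t = c t) \<Longrightarrow> l2norm b = l2norm c"
  using cut01_eqI[of b c] by (simp add: l2norm_eq)

text \<open>A minimizing sequence is Cauchy: the midpoint of two near-minimal points is not below
  the infimum, which forces the points together. \<open>N\<close> plays the role of a squared
  distance, of which only completeness with convergence of the objective is asked.\<close>

lemma strongly_convex_minimizer:
  fixes e :: "'b \<Rightarrow> real" and N :: "'b \<Rightarrow> 'b \<Rightarrow> real"
  assumes ne: "A \<noteq> {}" and lb: "\<And>x. x \<in> A \<Longrightarrow> B \<le> e x" and \<kappa>: "\<kappa> > 0"
    and mid: "\<And>x y. x \<in> A \<Longrightarrow> y \<in> A \<Longrightarrow> mid x y \<in> A"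
    and conv: "\<And>x y. x \<in> A \<Longrightarrow> y \<in> A \<Longrightarrow> \<kappa> * N x y \<le> e x + e y - 2 * e (mid x y)"
    and complete: "\<And>x. (\<And>n. x n \<in> A) \<Longrightarrow> (\<And>d. d > 0 \<Longrightarrow> \<exists>M. \<forall>i\<ge>M. \<forall>j\<ge>M. N (x i) (x j) < d)
        \<Longrightarrow> \<exists>y\<in>A. (\<lambda>n. e (x n)) \<longlonglongrightarrow> e y"
  shows "\<exists>x\<in>A. \<forall>y\<in>A. e x \<le> e y"
proof -
  define I where "I = Inf (e ` A)"
  have bdd: "bdd_below (e ` A)" using lb by (auto intro!: bdd_belowI[of _ B])
  have I: "I \<le> e x" if "x \<in> A" for x unfolding I_def using that bdd by (intro cInf_lower) auto
  have "\<exists>x\<in>A. e x < I + 1 / real (Suc n)" for n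
  proof -
    have "\<exists>z\<in>e ` A. z < I + 1 / real (Suc n)"
      using ne bdd unfolding I_def by (subst cInf_less_iff[symmetric]) auto
    then show ?thesis by auto
  qed
  then obtain x where x: "\<And>n. x n \<in> A" "\<And>n. e (x n) < I + 1 / real (Suc n)" by metis
  have inv: "(\<lambda>n. 1 / real (Suc n)) \<longlonglongrightarrow> 0" using LIMSEQ_inverse_real_of_nat by (simp add: inverse_eq_divide)
  have "\<exists>M. \<forall>i\<ge>M. \<forall>j\<ge>M. N (x i) (x j) < d" if "d > 0" for d
  proof -
    have "\<kappa> * d / 2 > 0" using \<kappa> that by simp
    from order_tendstoD(2)[OF inv this] obtain M where M: "\<And>n. n \<ge> M \<Longrightarrow> 1 / real (Suc n) < \<kappa> * d / 2"
      by (auto simp: eventually_sequentially)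
    have "N (x i) (x j) < d" if "i \<ge> M" "j \<ge> M" for i j
    proof -
      have "\<kappa> * N (x i) (x j) \<le> e (x i) + e (x j) - 2 * e (mid (x i) (x j))" by (intro conv x)
      also have "\<dots> < \<kappa> * d" using x(2)[of i] x(2)[of j] M[OF that(1)] M[OF that(2)] I[OF mid[OF x(1) x(1)], of i j] by linarith
      finally show ?thesis using \<kappa> by simp
    qed
    then show ?thesis by blast
  qed
  from complete[OF x(1) this] obtain y where y: "y \<in> A" "(\<lambda>n. e (x n)) \<longlonglongrightarrow> e y" by blast
  have "(\<lambda>n. I + 1 / real (Suc n)) \<longlonglongrightarrow> I + 0" by (intro tendsto_intros inv)
  from LIMSEQ_le[OF y(2) this] have "e y \<le> I" using less_imp_le[OF x(2)] by auto
  then show ?thesis using y(1) I by (intro bexI[of _ y]) (auto intro: order_trans)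
qed

context weighted_random_function
begin

text \<open>The functionals of the m basis polynomials have a Gram matrix of second moments; it is
  positive definite because the covariance operator is injective and the polynomials are
  independent.\<close>

lemma polynomial_part_coercive:
  "\<exists>\<kappa>>0. \<forall>c. \<kappa> * (\<Sum>j<m. \<bar>c j\<bar>)\<^sup>2 \<le> (\<integral>\<omega>. (lin (sob_build m c (\<lambda>_. 0)) (X \<omega>))\<^sup>2 \<partial>M)"
proof -
  define e where "e i = sob_build m (\<lambda>j. if j = i then 1 else 0) (\<lambda>_. 0)" for i
  define A where "A i j = (\<integral>\<omega>. lin (e i) (X \<omega>) * lin (e j) (X \<omega>) \<partial>M)" for i j
  have e: "L2 (e i)" for i unfolding e_def by (intro sob_build_L2 L2_zero)
  have lin: "lin (sob_build m c (\<lambda>_. 0)) (X \<omega>) = (\<Sum>i<m. c i * lin (e i) (X \<omega>))" if "\<omega> \<in> space M" for c \<omega>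
  proof -
    have "lin (sob_build m c (\<lambda>_. 0)) (X \<omega>) = lin (\<lambda>t. \<Sum>i<m. c i * e i t) (X \<omega>)"
      by (rule lin_cong) (simp add: sob_build_sum[of _ m c] e_def)
    then show ?thesis using lin_sum[of "X \<omega>" m e c] X_L2[OF that] e by simp
  qed
  have Q: "(\<integral>\<omega>. (lin (sob_build m c (\<lambda>_. 0)) (X \<omega>))\<^sup>2 \<partial>M) = (\<Sum>i<m. \<Sum>j<m. c i * c j * A i j)" for c
  proof -
    have "(\<integral>\<omega>. (lin (sob_build m c (\<lambda>_. 0)) (X \<omega>))\<^sup>2 \<partial>M) = (\<integral>\<omega>. (\<Sum>i<m. \<Sum>j<m. (c i * c j) * (lin (e i) (X \<omega>) * lin (e j) (X \<omega>))) \<partial>M)"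
      by (intro Bochner_Integration.integral_cong refl) (simp add: lin power2_eq_square sum_product mult_ac)
    also have "\<dots> = (\<Sum>i<m. \<Sum>j<m. \<integral>\<omega>. (c i * c j) * (lin (e i) (X \<omega>) * lin (e j) (X \<omega>)) \<partial>M)"
      by (subst Bochner_Integration.integral_sum, simp_all add: sq_int_mult lin_X_sq_int e)
    finally show ?thesis by (simp add: A_def)
  qed
  have "0 < (\<Sum>i<m. \<Sum>j<m. c i * c j * A i j)" if c: "\<exists>j<m. c j \<noteq> 0" for c
  proof (rule ccontr)
    note L = sob_build_L2[OF L2_zero, of m c]
    assume "\<not> ?thesis"
    then have "(\<integral>\<omega>. (lin (sob_build m c (\<lambda>_. 0)) (X \<omega>))\<^sup>2 \<partial>M) = 0"
      unfolding Q[symmetric] by (simp add: order_antisym integral_nonneg_AE)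
    then have "AE \<omega> in M. (lin (sob_build m c (\<lambda>_. 0)) (X \<omega>))\<^sup>2 = 0"
      by (subst (asm) integral_nonneg_eq_0_iff_AE[OF sq_int_integrable[OF lin_X_sq_int[OF L]]]) auto
    then have "AE \<omega> in M. lin (sob_build m c (\<lambda>_. 0)) (X \<omega>) = 0" by simp
    from sob_build_zero_iff[OF lin_X_zero_imp_zero[OF L this]] c show False by blast
  qed
  from quadratic_form_bounded_below[OF this] show ?thesis unfolding Q .
qed

text \<open>The penalty makes the m-th derivatives Cauchy in L2 but does not see the Taylor
  coefficients at 0. These are controlled by the second moment of the functional, through coercivity
  on polynomials, once the part built from the m-th derivative has been split off. Reassembling both
  limits gives the limit function.\<close>

lemma sobolev_complete:
  assumes g: "\<And>n. g n \<in> sobolev m"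
    and C1: "\<And>d. d > 0 \<Longrightarrow> \<exists>N. \<forall>i\<ge>N. \<forall>j\<ge>N. (\<integral>\<omega>. (lin (\<lambda>t. g i t - g j t) (X \<omega>))\<^sup>2 \<partial>M) < d"
    and C2: "\<And>d. d > 0 \<Longrightarrow> \<exists>N. \<forall>i\<ge>N. \<forall>j\<ge>N. Jpen m (\<lambda>t. g i t - g j t) (\<lambda>t. g i t - g j t) < d"
  shows "\<exists>b\<in>sobolev m. (\<lambda>n. l2norm (\<lambda>t. g n t - b t)) \<longlonglongrightarrow> 0 \<and> (\<lambda>n. Jpen m (\<lambda>t. g n t - b t) (\<lambda>t. g n t - b t)) \<longlonglongrightarrow> 0"
proof -
  have "\<forall>n. \<exists>d. sob_witness m (g n) d" using g by (auto simp: sobolev_def)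
  then obtain d where d: "\<And>n. sob_witness m (g n) (d n)" by metis
  define c where "c n j = d n j 0" for n j
  define w where "w n = d n m" for n
  have w: "L2 (w n)" for n unfolding w_def by (rule sob_witness_L2[OF d])
  have gb: "g n t = sob_build m (c n) (w n) t" if "t \<in> {0..1}" for n t
    unfolding c_def w_def by (rule sob_witness_eq_build[OF d that])
  have J: "Jpen m (\<lambda>t. g i t - g j t) (\<lambda>t. g i t - g j t) = (l2norm (\<lambda>t. w i t - w j t))\<^sup>2" for i j
    using Jpen_self[OF sob_witness_linear[OF d[of i] d[of j], of 1 "-1"]] by (simp add: w_def)
  have Cw: "\<exists>N. \<forall>i\<ge>N. \<forall>j\<ge>N. (l2norm (\<lambda>t. w i t - w j t))\<^sup>2 < e" if "e > 0" for e
    using C2[OF that] unfolding J .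
  have "\<exists>v. sq_int lborel v \<and> (\<lambda>n. \<integral>x. (cut01 (w n) x - v x)\<^sup>2 \<partial>lborel) \<longlonglongrightarrow> 0"
    by (rule Riesz_Fischer_L2) (use w Cw in \<open>auto simp: L2_iff_sq_int l2norm_square cut01_diff\<close>)
  then obtain v where v: "sq_int lborel v" "(\<lambda>n. \<integral>x. (cut01 (w n) x - v x)\<^sup>2 \<partial>lborel) \<longlonglongrightarrow> 0" by blast
  have cv: "sq_int lborel (cut01 v)"
    by (rule sq_int_bound[OF v(1)]) (use v(1) in \<open>auto simp: sq_int_def cut01_def[abs_def] indicator_def[of "{0..1}"]\<close>)
  then have Lv: "L2 v" by (simp add: L2_iff_sq_int)
  have wv: "(\<lambda>n. l2norm (\<lambda>t. w n t - v t)) \<longlonglongrightarrow> 0"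
  proof -
    have le: "(l2norm (\<lambda>t. w n t - v t))\<^sup>2 \<le> (\<integral>x. (cut01 (w n) x - v x)\<^sup>2 \<partial>lborel)" for n
      unfolding l2norm_square
      by (rule integral_mono') (use sq_int_diff[OF _ v(1), of "cut01 (w n)"] w[of n] in \<open>auto simp: L2_iff_sq_int sq_int_def cut01_def indicator_def\<close>)
    have "(\<lambda>n. (l2norm (\<lambda>t. w n t - v t))\<^sup>2) \<longlonglongrightarrow> 0"
      by (rule tendsto_sandwich[OF _ _ tendsto_const v(2)]) (use le in auto)
    from tendsto_real_sqrt[OF this] show ?thesis by simp
  qed
  obtain \<kappa> where \<kappa>: "\<kappa> > 0" "\<And>c. \<kappa> * (\<Sum>j<m. \<bar>c j\<bar>)\<^sup>2 \<le> (\<integral>\<omega>. (lin (sob_build m c (\<lambda>_. 0)) (X \<omega>))\<^sup>2 \<partial>M)"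
    using polynomial_part_coercive[of m] by blast
  define E where "E = (\<integral>\<omega>. (l2norm (X \<omega>))\<^sup>2 \<partial>M)"
  have E: "E \<ge> 0" unfolding E_def by simp
  \<comment> \<open>The polynomial part is the difference of the functions plus the remainder built
    from the reversed difference of derivatives, whose L2 norm is at most that of the
    derivatives.\<close>
  have coef: "\<kappa> * (\<Sum>j<m. \<bar>c i j - c k j\<bar>)\<^sup>2
      \<le> 2 * (\<integral>\<omega>. (lin (\<lambda>t. g i t - g k t) (X \<omega>))\<^sup>2 \<partial>M) + 2 * ((l2norm (\<lambda>t. w i t - w k t))\<^sup>2 * E)" for i k
  proof -
    let ?p = "sob_build m (\<lambda>j. c i j - c k j) (\<lambda>_. 0)" and ?q = "sob_build m (\<lambda>_. 0) (\<lambda>t. w k t - w i t)"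
    have Lw: "L2 (\<lambda>t. w k t - w i t)" by (intro L2_diff w)
    have Lp: "L2 ?p" and Lq: "L2 ?q" by (intro sob_build_L2 L2_zero Lw)+
    have Lg: "L2 (\<lambda>t. g i t - g k t)" by (intro L2_diff sobolev_L2[OF g])
    have "?p t = (g i t - g k t) + ?q t" if t: "t \<in> {0..1}" for t
      using sob_build_linear[OF w[of i] w[of k] t, of m 1 "c i" "-1" "c k"]
        sob_build_linear[OF _ Lw t, of "\<lambda>t. w i t - w k t" m 1 "\<lambda>j. c i j - c k j" 1 "\<lambda>_. 0"] gb[OF t] L2_diff[OF w w]
      by simp
    then have "lin ?p (X \<omega>) = lin (\<lambda>t. g i t - g k t) (X \<omega>) + lin ?q (X \<omega>)" if "\<omega> \<in> space M" for \<omega>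
      using lin_cong[of ?p "\<lambda>t. (g i t - g k t) + ?q t"] lin_add[OF Lg Lq X_L2[OF that]] by simp
    then have "(\<integral>\<omega>. (lin ?p (X \<omega>))\<^sup>2 \<partial>M) = (\<integral>\<omega>. (lin (\<lambda>t. g i t - g k t) (X \<omega>) + lin ?q (X \<omega>))\<^sup>2 \<partial>M)"
      by (intro Bochner_Integration.integral_cong) auto
    also have "\<dots> \<le> 2 * (\<integral>\<omega>. (lin (\<lambda>t. g i t - g k t) (X \<omega>))\<^sup>2 \<partial>M) + 2 * (\<integral>\<omega>. (lin ?q (X \<omega>))\<^sup>2 \<partial>M)"
      by (intro integral_square_add_le lin_X_sq_int Lg Lq)
    also have "(\<integral>\<omega>. (lin ?q (X \<omega>))\<^sup>2 \<partial>M) \<le> (l2norm ?q)\<^sup>2 * E" unfolding E_def by (rule lin_X_square_le[OF Lq])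
    also have "(l2norm ?q)\<^sup>2 \<le> (l2norm (\<lambda>t. w i t - w k t))\<^sup>2"
      using sob_build_bound(1)[OF Lw, of m "\<lambda>_. 0"] l2norm_minus_commute[of "w i" "w k"] by (intro power_mono) auto
    finally show ?thesis using \<kappa>(2)[of "\<lambda>j. c i j - c k j"] E by (simp add: mult_right_mono)
  qed
  have "\<exists>L. (\<lambda>n. c n j) \<longlonglongrightarrow> L" if j: "j < m" for j
  proof -
    have "Cauchy (\<lambda>n. c n j)"
    proof (rule metric_CauchyI)
      fix e :: real assume e: "e > 0"
      \<comment> \<open>Chosen so that 4 d (1 + E) = \<kappa> e^2; the summand 1 guards against E =
        0.\<close>
      define d where "d = \<kappa> * e\<^sup>2 / (4 * (1 + E))"
      have dp: "d > 0" using e \<kappa> E by (auto simp: d_def intro!: divide_pos_pos)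
      obtain N1 N2 where N1: "\<forall>i\<ge>N1. \<forall>k\<ge>N1. (\<integral>\<omega>. (lin (\<lambda>t. g i t - g k t) (X \<omega>))\<^sup>2 \<partial>M) < d"
        and N2: "\<forall>i\<ge>N2. \<forall>k\<ge>N2. (l2norm (\<lambda>t. w i t - w k t))\<^sup>2 < d"
        using C1[OF dp] Cw[OF dp] by blast
      have "dist (c i j) (c k j) < e" if "i \<ge> max N1 N2" "k \<ge> max N1 N2" for i k
      proof -
        have "\<kappa> * (\<Sum>j<m. \<bar>c i j - c k j\<bar>)\<^sup>2 < 2 * d + 2 * (d * (1 + E))"
        proof (rule le_less_trans[OF coef])
          have "(l2norm (\<lambda>t. w i t - w k t))\<^sup>2 * E \<le> d * (1 + E)"
            using N2 that E dp by (intro mult_mono) (auto intro: less_imp_le)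
          moreover have "(\<integral>\<omega>. (lin (\<lambda>t. g i t - g k t) (X \<omega>))\<^sup>2 \<partial>M) < d" using N1 that by simp
          ultimately show "2 * (\<integral>\<omega>. (lin (\<lambda>t. g i t - g k t) (X \<omega>))\<^sup>2 \<partial>M) + 2 * ((l2norm (\<lambda>t. w i t - w k t))\<^sup>2 * E) < 2 * d + 2 * (d * (1 + E))"
            by linarith
        qed
        also have "\<dots> \<le> 4 * (d * (1 + E))" using dp E by (simp add: algebra_simps)
        also have "\<dots> = \<kappa> * e\<^sup>2" using E by (simp add: d_def field_simps)
        finally have "(\<Sum>j<m. \<bar>c i j - c k j\<bar>)\<^sup>2 < e\<^sup>2" using \<kappa> by simp
        then have "(\<Sum>j<m. \<bar>c i j - c k j\<bar>) < e" using e by (simp add: power_less_imp_less_base)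
        moreover have "\<bar>c i j - c k j\<bar> \<le> (\<Sum>j<m. \<bar>c i j - c k j\<bar>)" using j by (intro member_le_sum) auto
        ultimately show ?thesis by (simp add: dist_real_def)
      qed
      then show "\<exists>M. \<forall>i\<ge>M. \<forall>k\<ge>M. dist (c i j) (c k j) < e" by blast
    qed
    then show ?thesis by (simp add: Cauchy_convergent_iff convergent_def)
  qed
  then obtain e where e: "\<And>j. j < m \<Longrightarrow> (\<lambda>n. c n j) \<longlonglongrightarrow> e j" by metis
  define b where "b = sob_build m e v"
  have db: "sob_witness m (\<lambda>t. 1 * g n t + (-1) * b t) (\<lambda>j t. 1 * d n j t + (-1) * sob_build (m - j) (\<lambda>i. e (i + j)) v t)" for n
    unfolding b_def by (rule sob_witness_linear[OF d sob_witness_build[OF Lv]])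
  have "Jpen m (\<lambda>t. g n t - b t) (\<lambda>t. g n t - b t) = (l2norm (\<lambda>t. w n t - v t))\<^sup>2" for n
    using Jpen_self[OF db[of n]] by (simp add: w_def)
  then have "(\<lambda>n. Jpen m (\<lambda>t. g n t - b t) (\<lambda>t. g n t - b t)) \<longlonglongrightarrow> 0"
    using tendsto_power[OF wv, of 2] by simp
  moreover have "(\<lambda>n. l2norm (\<lambda>t. g n t - b t)) \<longlonglongrightarrow> 0"
  proof (rule tendsto_sandwich[OF _ _ tendsto_const])
    have "(\<lambda>n. (\<Sum>j<m. \<bar>c n j - e j\<bar>) + l2norm (\<lambda>t. w n t - v t)) \<longlonglongrightarrow> (\<Sum>j<m. \<bar>e j - e j\<bar>) + 0"
      by (intro tendsto_intros e wv) auto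
    then show "(\<lambda>n. (\<Sum>j<m. \<bar>c n j - e j\<bar>) + l2norm (\<lambda>t. w n t - v t)) \<longlonglongrightarrow> 0" by simp
    have "l2norm (\<lambda>t. g n t - b t) = l2norm (sob_build m (\<lambda>j. c n j - e j) (\<lambda>t. w n t - v t))" for n
    proof (rule l2norm_cong)
      fix t :: real assume t: "t \<in> {0..1}"
      show "g n t - b t = sob_build m (\<lambda>j. c n j - e j) (\<lambda>t. w n t - v t) t"
        using sob_build_linear[OF w[of n] Lv t, of m 1 "c n" "-1" e] gb[OF t] by (simp add: b_def)
    qed
    then show "\<forall>\<^sub>F n in sequentially. l2norm (\<lambda>t. g n t - b t) \<le> (\<Sum>j<m. \<bar>c n j - e j\<bar>) + l2norm (\<lambda>t. w n t - v t)"
      using sob_build_bound(1)[OF L2_diff[OF w Lv]] by simp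
  qed simp
  moreover have "b \<in> sobolev m" unfolding b_def by (rule sobolev_build[OF Lv])
  ultimately show ?thesis by blast
qed

text \<open>The moment hypothesis concerns the functional without intercept. The inequality (u +
  v)^4 \<le> 8 (u^4 + v^4) splits the intercept off, and the separation of intercept and slope
  bounds both parts by C1^2 times the second moment of the sum, squared: hence C1^4.\<close>

lemma fourth_moment:
  assumes \<beta>: "L2 \<beta>" and M0: "(\<integral>\<omega>. \<bar>lin \<beta> (X \<omega>)\<bar> ^ 4 \<partial>M) \<le> M0 * (\<integral>\<omega>. \<bar>lin \<beta> (X \<omega>)\<bar> ^ 2 \<partial>M) ^ 2" and "0 \<le> M0"
  shows "sq_int M (\<lambda>\<omega>. (a + lin \<beta> (X \<omega>))\<^sup>2)"
    and "(\<integral>\<omega>. ((a + lin \<beta> (X \<omega>))\<^sup>2)\<^sup>2 \<partial>M) \<le> 8 * (1 + M0) * C1 ^ 4 * (\<integral>\<omega>. (a + lin \<beta> (X \<omega>))\<^sup>2 \<partial>M)\<^sup>2"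
proof -
  let ?x = "\<lambda>\<omega>. lin \<beta> (X \<omega>)"
  have [measurable]: "?x \<in> borel_measurable M" using \<beta> by simp
  have i4: "integrable M (\<lambda>\<omega>. ?x \<omega> ^ 4)"
  proof (rule Bochner_Integration.integrable_bound)
    show "integrable M (\<lambda>\<omega>. l2norm \<beta> ^ 4 * l2norm (X \<omega>) ^ 4)" using X4 by simp
    show "AE \<omega> in M. norm (?x \<omega> ^ 4) \<le> norm (l2norm \<beta> ^ 4 * l2norm (X \<omega>) ^ 4)"
    proof (rule AE_I2)
      fix \<omega> assume "\<omega> \<in> space M"
      from power_mono[OF abs_lin_le[OF \<beta> X_L2[OF this]] abs_ge_zero, of 4]
      show "norm (?x \<omega> ^ 4) \<le> norm (l2norm \<beta> ^ 4 * l2norm (X \<omega>) ^ 4)" by (simp add: power_mult_distrib power_abs)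
    qed
  qed simp
  have p4: "z ^ 4 = (z\<^sup>2)\<^sup>2" for z :: real by (simp flip: power_mult)
  have "((u + v)\<^sup>2)\<^sup>2 \<le> 8 * (u ^ 4 + v ^ 4)" for u v :: real
  proof -
    have 1: "(u + v)\<^sup>2 \<le> 2 * (u\<^sup>2 + v\<^sup>2)" for u v :: real
      using zero_le_power2[of "u - v"] by (simp add: power2_eq_square algebra_simps)
    have "((u + v)\<^sup>2)\<^sup>2 \<le> (2 * (u\<^sup>2 + v\<^sup>2))\<^sup>2" by (intro power_mono 1) auto
    also have "\<dots> = 4 * (u\<^sup>2 + v\<^sup>2)\<^sup>2" by (subst power_mult_distrib) simp
    also have "\<dots> \<le> 4 * (2 * ((u\<^sup>2)\<^sup>2 + (v\<^sup>2)\<^sup>2))" using 1[of "u\<^sup>2" "v\<^sup>2"] by (intro mult_left_mono) auto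
    finally show ?thesis unfolding p4 by linarith
  qed
  then have le: "((a + ?x \<omega>)\<^sup>2)\<^sup>2 \<le> 8 * (a ^ 4 + ?x \<omega> ^ 4)" for \<omega> .
  have ir: "integrable M (\<lambda>\<omega>. 8 * (a ^ 4 + ?x \<omega> ^ 4))" using i4 by simp
  show s: "sq_int M (\<lambda>\<omega>. (a + ?x \<omega>)\<^sup>2)" unfolding sq_int_def
    by (intro conjI, measurable, rule Bochner_Integration.integrable_bound[OF ir]) (use order_trans[OF le abs_ge_self] in auto)
  define D where "D = (\<integral>\<omega>. (a + ?x \<omega>)\<^sup>2 \<partial>M)"
  define v where "v = (\<integral>\<omega>. (?x \<omega>)\<^sup>2 \<partial>M)"
  have v: "0 \<le> v" by (simp add: v_def)
  have sep: "a\<^sup>2 + v \<le> C1\<^sup>2 * D" unfolding v_def D_def by (rule intercept_slope_separation[OF \<beta>])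
  have "(\<integral>\<omega>. ((a + ?x \<omega>)\<^sup>2)\<^sup>2 \<partial>M) \<le> (\<integral>\<omega>. 8 * (a ^ 4 + ?x \<omega> ^ 4) \<partial>M)"
    by (intro integral_mono sq_int_integrable[OF s] ir le)
  also have "\<dots> = 8 * (a ^ 4 + (\<integral>\<omega>. ?x \<omega> ^ 4 \<partial>M))" using i4 by (simp add: prob_space)
  also have "\<dots> \<le> 8 * ((a\<^sup>2)\<^sup>2 + M0 * v\<^sup>2)" using M0 by (simp add: v_def)
  also have "\<dots> \<le> 8 * ((1 + M0) * (C1\<^sup>2 * D)\<^sup>2)"
  proof -
    have "a\<^sup>2 \<le> C1\<^sup>2 * D" "v \<le> C1\<^sup>2 * D" using sep v zero_le_power2[of a] by linarith+
    then have "(a\<^sup>2)\<^sup>2 \<le> (C1\<^sup>2 * D)\<^sup>2" "v\<^sup>2 \<le> (C1\<^sup>2 * D)\<^sup>2" using v by (simp_all only: power_mono zero_le_power2)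
    then have "(a\<^sup>2)\<^sup>2 + M0 * v\<^sup>2 \<le> (C1\<^sup>2 * D)\<^sup>2 + M0 * (C1\<^sup>2 * D)\<^sup>2" using assms(3) by (intro add_mono mult_left_mono)
    then show ?thesis by (simp add: algebra_simps)
  qed
  also have "\<dots> = 8 * (1 + M0) * (C1\<^sup>2)\<^sup>2 * D\<^sup>2" by (simp only: power_mult_distrib mult.assoc)
  finally show "(\<integral>\<omega>. ((a + ?x \<omega>)\<^sup>2)\<^sup>2 \<partial>M) \<le> 8 * (1 + M0) * C1 ^ 4 * (\<integral>\<omega>. (a + ?x \<omega>)\<^sup>2 \<partial>M)\<^sup>2"
    unfolding p4[of C1] D_def .
qed

end

subsection \<open>Existence, uniqueness and rate of the penalised minimizer\<close>

lemma sqrt_Jpen_triangle: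
  assumes "b \<in> sobolev m" "g \<in> sobolev m"
  shows "sqrt (Jpen m (\<lambda>t. b t + g t) (\<lambda>t. b t + g t)) \<le> sqrt (Jpen m b b) + sqrt (Jpen m g g)"
proof -
  obtain d e where de: "sob_witness m b d" "sob_witness m g e" using assms by (auto simp: sobolev_def)
  have "Jpen m (\<lambda>t. b t + g t) (\<lambda>t. b t + g t) = (l2norm (\<lambda>t. d m t + e m t))\<^sup>2"
    using Jpen_self[OF sob_witness_linear[OF de, of 1 1]] by simp
  then show ?thesis
    using l2norm_triangle[OF sob_witness_L2[OF de(1)] sob_witness_L2[OF de(2)]] Jpen_self[OF de(1)] Jpen_self[OF de(2)] by simp
qed

lemma Jpen_midpoint:
  assumes "u \<in> sobolev m" "v \<in> sobolev m"
  shows "Jpen m u u + Jpen m v v - 2 * Jpen m (\<lambda>t. (u t + v t) / 2) (\<lambda>t. (u t + v t) / 2) = Jpen m (\<lambda>t. u t - v t) (\<lambda>t. u t - v t) / 2"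
  using Jpen_parallelogram[OF assms] Jpen_cmult[OF sobolev_add[OF assms], of "1/2"] by (simp add: power2_eq_square)

text \<open>What is common to all quantile levels, penalties and bandwidths; the weight is that of
  one reference level.\<close>

locale qr_core = qr_model M X Y f k s + weighted_random_function M X b b' C1
  for M :: "'a measure" and X Y f k s b b' C1 +
  fixes m :: nat and M0 :: real
  assumes m_ge: "1 \<le> m" and M0: "0 \<le> M0"
    and fourth: "\<And>\<beta>. \<beta> \<in> sobolev m \<Longrightarrow> (\<integral>\<omega>. \<bar>lin \<beta> (X \<omega>)\<bar> ^ 4 \<partial>M) \<le> M0 * (\<integral>\<omega>. \<bar>lin \<beta> (X \<omega>)\<bar> ^ 2 \<partial>M) ^ 2"
begin

definition K4 :: real where "K4 = sqrt (8 * (1 + M0) * C1 ^ 4)"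

abbreviation dl :: "real \<Rightarrow> (real \<Rightarrow> real) \<Rightarrow> 'a \<Rightarrow> real" where "dl a g \<omega> \<equiv> a + lin g (X \<omega>)"

text \<open>Squared reference norm, free of the weight B_\<tau> and hence the same for all quantile
  levels.\<close>

definition sqD :: "real \<Rightarrow> (real \<Rightarrow> real) \<Rightarrow> real" where "sqD a g = (\<integral>\<omega>. (dl a g \<omega>)\<^sup>2 \<partial>M)"

lemma sqD_nonneg: "0 \<le> sqD a g" by (simp add: sqD_def)

lemma dl_sq_int: "g \<in> sobolev m \<Longrightarrow> sq_int M (dl a g)"
  by (intro sq_int_add lin_X_sq_int sobolev_L2) (auto simp: sq_int_def)

lemma dl_integrable: "g \<in> sobolev m \<Longrightarrow> integrable M (dl a g)"
  using sq_int_mult[OF dl_sq_int, of g "\<lambda>_. 1" a] by (simp add: sq_int_def)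

lemma dl_S: "g \<in> sobolev m \<Longrightarrow> dl a g \<in> borel_measurable S"
  using lin_S[OF sobolev_L2] by measurable

lemma dl_square_sq_int: "g \<in> sobolev m \<Longrightarrow> sq_int M (\<lambda>\<omega>. (dl a g \<omega>)\<^sup>2)"
  by (rule fourth_moment(1)[OF sobolev_L2 fourth M0])

text \<open>Cauchy-Schwarz against the square of the functional, whose L2 norm is at most
  \<open>K4\<close> times its second moment. Taking \<eta> equal to the functional bounds the cubic
  Taylor error; other \<eta> serve the midpoint estimate.\<close>

lemma cubic_bound:
  assumes e: "sq_int M \<eta>" and g: "g \<in> sobolev m"
  shows "(\<integral>\<omega>. \<bar>\<eta> \<omega>\<bar> * (dl a g \<omega>)\<^sup>2 \<partial>M) \<le> sqrt (\<integral>\<omega>. (\<eta> \<omega>)\<^sup>2 \<partial>M) * K4 * sqD a g"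
proof -
  have "(\<integral>\<omega>. \<bar>\<eta> \<omega> * (dl a g \<omega>)\<^sup>2\<bar> \<partial>M) \<le> sqrt (\<integral>\<omega>. (\<eta> \<omega>)\<^sup>2 \<partial>M) * sqrt (\<integral>\<omega>. ((dl a g \<omega>)\<^sup>2)\<^sup>2 \<partial>M)"
    by (rule integral_abs_mult_le_sqrt[OF e dl_square_sq_int[OF g]])
  also have "sqrt (\<integral>\<omega>. ((dl a g \<omega>)\<^sup>2)\<^sup>2 \<partial>M) \<le> sqrt (8 * (1 + M0) * C1 ^ 4 * (sqD a g)\<^sup>2)"
    unfolding sqD_def by (intro real_sqrt_le_mono fourth_moment(2)[OF sobolev_L2[OF g] fourth[OF g] M0])
  also have "\<dots> = K4 * sqD a g" using sqD_nonneg by (simp add: K4_def real_sqrt_mult)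
  finally show ?thesis by (simp add: abs_mult mult.assoc mult_left_mono)
qed

lemma K4_nonneg: "0 \<le> K4" using M0 by (simp add: K4_def)

lemma dl_diff: "g \<in> sobolev m \<Longrightarrow> e \<in> sobolev m \<Longrightarrow> \<omega> \<in> space M \<Longrightarrow> dl a g \<omega> - dl u e \<omega> = dl (a - u) (\<lambda>t. g t - e t) \<omega>"
  by (simp add: lin_diff[OF sobolev_L2 sobolev_L2 X_L2])

lemma dl_mid: "g \<in> sobolev m \<Longrightarrow> e \<in> sobolev m \<Longrightarrow> \<omega> \<in> space M \<Longrightarrow> dl ((a + u) / 2) (\<lambda>t. (g t + e t) / 2) \<omega> = (dl a g \<omega> + dl u e \<omega>) / 2"
  using lin_cmult[of "1/2" "\<lambda>t. g t + e t" "X \<omega>"] lin_add[OF sobolev_L2 sobolev_L2 X_L2, of g m e m \<omega>] by (simp add: field_simps)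

lemma sobolev_mid: "g \<in> sobolev m \<Longrightarrow> e \<in> sobolev m \<Longrightarrow> (\<lambda>t. (g t + e t) / 2) \<in> sobolev m"
  using sobolev_linear[of g m e "1/2" "1/2"] by (simp add: add_divide_distrib)

text \<open>Separation removes the intercept, injectivity of the covariance operator makes the slope
  vanish almost everywhere, and continuity of Sobolev functions upgrades this to every point of the
  interval.\<close>

lemma sqD_zero_imp_zero:
  assumes g: "g \<in> sobolev m" and z: "sqD a g = 0"
  shows "a = 0 \<and> (\<forall>t\<in>{0..1}. g t = 0)"
proof -
  note L = sobolev_L2[OF g]
  have "a\<^sup>2 + (\<integral>\<omega>. (lin g (X \<omega>))\<^sup>2 \<partial>M) \<le> 0"
    using intercept_slope_separation[OF L, of a] z by (simp add: sqD_def)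
  moreover have "0 \<le> (\<integral>\<omega>. (lin g (X \<omega>))\<^sup>2 \<partial>M)" by simp
  ultimately have a: "a = 0" and i: "(\<integral>\<omega>. (lin g (X \<omega>))\<^sup>2 \<partial>M) = 0"
    using zero_le_power2[of a] by (smt (verit) zero_eq_power2)+
  from i have "AE \<omega> in M. lin g (X \<omega>) = 0"
    by (subst (asm) integral_nonneg_eq_0_iff_AE[OF sq_int_integrable[OF lin_X_sq_int[OF L]]]) auto
  from continuous_AE_zero_imp_zero[OF sobolev_continuous[OF g m_ge] lin_X_zero_imp_zero[OF L this]] a
  show ?thesis by blast
qed

end

text \<open>\<open>small1\<close> restricts the radius r independently of h and \<lambda>: inside
  the ball the third-order error is a small share of the curvature c. \<open>small2\<close> limits
  the curvature lost to smoothing, and \<open>small3\<close> puts the gain guaranteed outside the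
  ball above the penalty of the true parameter.\<close>

locale qr_point = qr_core M X Y f k s b b' C1 m M0
  for M :: "'a measure" and X Y f k s b b' C1 m M0 +
  fixes h \<tau> lam a0 L c r bias :: real and \<beta>0 :: "real \<Rightarrow> real"
  assumes h_pos: "0 < h" and \<tau>: "0 \<le> \<tau>" "\<tau> \<le> 1" and lam_pos: "0 < lam" and \<beta>0: "\<beta>0 \<in> sobolev m"
    and c_pos: "0 < c" and r_pos: "0 < r" and L_nonneg: "0 \<le> L"
    and reg: "AE \<omega> in M. smooth_cdf (prim (Defs.cdf f (X \<omega>))) (Defs.cdf f (X \<omega>)) (f (X \<omega>)) L \<and>
        c \<le> f (X \<omega>) (a0 + lin \<beta>0 (X \<omega>)) \<and> Defs.cdf f (X \<omega>) (a0 + lin \<beta>0 (X \<omega>)) = \<tau> \<and>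
        \<bar>(LBINT v. k v * Defs.cdf f (X \<omega>) (a0 + lin \<beta>0 (X \<omega>) - h * v)) - \<tau>\<bar> \<le> bias"
    and small1: "L * (r * K4) \<le> c / 8" and small2: "L * h * mom 1 \<le> c / 4"
    and small3: "2 * h * mom 1 + lam / 2 * Jpen m \<beta>0 \<beta>0 < c * r\<^sup>2 / 4"
begin

abbreviation q :: "'a \<Rightarrow> real" where "q \<equiv> dl a0 \<beta>0"

definition \<Phi> :: "'a \<Rightarrow> real \<Rightarrow> real" where
  "\<Phi> \<omega> d = smoothed_gain h \<tau> (prim (Defs.cdf f (X \<omega>))) (q \<omega>) d"

definition gainE :: "real \<Rightarrow> (real \<Rightarrow> real) \<Rightarrow> real" where "gainE a g = (\<integral>\<omega>. \<Phi> \<omega> (dl a g \<omega>) \<partial>M)"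

lemma \<Phi>_integrable: "g \<in> sobolev m \<Longrightarrow> integrable M (\<lambda>\<omega>. \<Phi> \<omega> (dl a g \<omega>))"
  unfolding \<Phi>_def by (intro excess_risk(1) h_pos \<tau> dl_S dl_integrable \<beta>0)

lemma gainE_eq:
  assumes "g \<in> sobolev m"
  shows "gainE a g = (\<integral>\<omega>. rho_h h \<tau> (Y \<omega> - q \<omega> - dl a g \<omega>) \<partial>M) - (\<integral>\<omega>. rho_h h \<tau> (Y \<omega> - q \<omega>) \<partial>M)"
  unfolding gainE_def \<Phi>_def by (rule excess_risk(2)[symmetric]) (intro h_pos \<tau> dl_S dl_integrable \<beta>0 assms)+

lemma AE_kernel: "AE \<omega> in M. smooth_cdf_kernel (prim (Defs.cdf f (X \<omega>))) (Defs.cdf f (X \<omega>)) (f (X \<omega>)) L k s h \<and>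
    c \<le> f (X \<omega>) (q \<omega>) \<and> Defs.cdf f (X \<omega>) (q \<omega>) = \<tau> \<and> \<bar>(LBINT v. k v * Defs.cdf f (X \<omega>) (q \<omega> - h * v)) - \<tau>\<bar> \<le> bias"
  using reg
  by eventually_elim (auto simp: smooth_cdf_kernel_def smooth_cdf_kernel_axioms_def h_pos intro: smoothing_kernel_axioms)

lemma abs_dl_sq_int:
  assumes "sq_int M \<eta>" "g \<in> sobolev m"
  shows "integrable M (\<lambda>\<omega>. \<bar>\<eta> \<omega>\<bar> * (dl a g \<omega>)\<^sup>2)"
proof -
  have "sq_int M (\<lambda>\<omega>. \<bar>\<eta> \<omega>\<bar>)" using assms(1) by (auto simp: sq_int_def)
  from sq_int_mult[OF this dl_square_sq_int[OF assms(2)]] show ?thesis .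
qed

text \<open>Curvature contributes c/2; smoothing takes at most c/8 and the cubic term at most c/16,
  so c/4 survives. The linear term is the smoothing bias times E|d|, which is at most the root of
  \<open>sqD\<close>.\<close>

lemma gainE_growth:
  assumes g: "g \<in> sobolev m" and D: "sqD a g \<le> r\<^sup>2"
  shows "c / 4 * sqD a g - bias * sqrt (sqD a g) \<le> gainE a g"
proof -
  let ?d = "dl a g"
  note s = dl_sq_int[OF g, of a]
  have i3: "integrable M (\<lambda>\<omega>. \<bar>?d \<omega>\<bar> * (?d \<omega>)\<^sup>2)" by (rule abs_dl_sq_int[OF s g])
  have bias0: "0 \<le> bias"
  proof -
    have "AE \<omega> in M. 0 \<le> bias" using AE_kernel by eventually_elim (auto intro: order_trans[OF abs_ge_zero])
    then show ?thesis by simp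
  qed
  have "(\<integral>\<omega>. (c - L * h * mom 1) / 2 * (?d \<omega>)\<^sup>2 - L / 2 * (\<bar>?d \<omega>\<bar> * (?d \<omega>)\<^sup>2) - bias * \<bar>?d \<omega>\<bar> \<partial>M) \<le> gainE a g"
    unfolding gainE_def
  proof (rule integral_mono_AE)
    show "integrable M (\<lambda>\<omega>. (c - L * h * mom 1) / 2 * (?d \<omega>)\<^sup>2 - L / 2 * (\<bar>?d \<omega>\<bar> * (?d \<omega>)\<^sup>2) - bias * \<bar>?d \<omega>\<bar>)"
      using i3 sq_int_integrable[OF s] dl_integrable[OF g, of a]
      by (intro Bochner_Integration.integrable_diff integrable_mult_right integrable_abs)
    show "AE \<omega> in M. (c - L * h * mom 1) / 2 * (?d \<omega>)\<^sup>2 - L / 2 * (\<bar>?d \<omega>\<bar> * (?d \<omega>)\<^sup>2) - bias * \<bar>?d \<omega>\<bar> \<le> \<Phi> \<omega> (?d \<omega>)"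
      using AE_kernel
    proof eventually_elim
      case (elim \<omega>)
      let ?B = "\<bar>(LBINT v. k v * Defs.cdf f (X \<omega>) (q \<omega> - h * v)) - \<tau>\<bar>"
      have "(?d \<omega>)\<^sup>2 / 2 * (c - L * \<bar>?d \<omega>\<bar> - L * h * mom 1) \<le> (?d \<omega>)\<^sup>2 / 2 * (f (X \<omega>) (q \<omega>) - L * \<bar>?d \<omega>\<bar> - L * h * mom 1)"
        using elim by (intro mult_left_mono) auto
      moreover have "\<bar>?d \<omega>\<bar> * ?B \<le> bias * \<bar>?d \<omega>\<bar>" using elim mult_left_mono[of ?B bias "\<bar>?d \<omega>\<bar>"] by (simp add: mult.commute)
      moreover have "(?d \<omega>)\<^sup>2 / 2 * (f (X \<omega>) (q \<omega>) - L * \<bar>?d \<omega>\<bar> - L * h * mom 1) - \<bar>?d \<omega>\<bar> * ?B \<le> \<Phi> \<omega> (?d \<omega>)"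
        unfolding \<Phi>_def using smooth_cdf_kernel.smoothed_gain_ge[OF conjunct1[OF elim]] .
      moreover have "(?d \<omega>)\<^sup>2 / 2 * (c - L * \<bar>?d \<omega>\<bar> - L * h * mom 1) = (c - L * h * mom 1) / 2 * (?d \<omega>)\<^sup>2 - L / 2 * (\<bar>?d \<omega>\<bar> * (?d \<omega>)\<^sup>2)"
        by (simp add: field_simps)
      ultimately show ?case by linarith
    qed
  qed (rule \<Phi>_integrable[OF g])
  also have "(\<integral>\<omega>. (c - L * h * mom 1) / 2 * (?d \<omega>)\<^sup>2 - L / 2 * (\<bar>?d \<omega>\<bar> * (?d \<omega>)\<^sup>2) - bias * \<bar>?d \<omega>\<bar> \<partial>M)
     = (c - L * h * mom 1) / 2 * sqD a g - L / 2 * (\<integral>\<omega>. \<bar>?d \<omega>\<bar> * (?d \<omega>)\<^sup>2 \<partial>M) - bias * (\<integral>\<omega>. \<bar>?d \<omega>\<bar> \<partial>M)"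
    using i3 sq_int_integrable[OF s] dl_integrable[OF g, of a] by (simp add: sqD_def)
  finally have main: "(c - L * h * mom 1) / 2 * sqD a g - L / 2 * (\<integral>\<omega>. \<bar>?d \<omega>\<bar> * (?d \<omega>)\<^sup>2 \<partial>M) - bias * (\<integral>\<omega>. \<bar>?d \<omega>\<bar> \<partial>M) \<le> gainE a g" .
  have "(\<integral>\<omega>. \<bar>?d \<omega>\<bar> * (?d \<omega>)\<^sup>2 \<partial>M) \<le> sqrt (sqD a g) * K4 * sqD a g"
    using cubic_bound[OF s g, of a] by (simp add: sqD_def)
  also have "\<dots> \<le> r * K4 * sqD a g"
    using D r_pos K4_nonneg sqD_nonneg by (intro mult_right_mono) (auto simp: real_le_lsqrt)
  finally have "L * (\<integral>\<omega>. \<bar>?d \<omega>\<bar> * (?d \<omega>)\<^sup>2 \<partial>M) \<le> L * (r * K4 * sqD a g)" using L_nonneg by (rule mult_left_mono)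
  also have "\<dots> \<le> c / 8 * sqD a g" using mult_right_mono[OF small1 sqD_nonneg] by (simp add: mult.assoc)
  finally have cub: "L * (\<integral>\<omega>. \<bar>?d \<omega>\<bar> * (?d \<omega>)\<^sup>2 \<partial>M) \<le> c / 8 * sqD a g" .
  have "(\<integral>\<omega>. \<bar>?d \<omega>\<bar> \<partial>M) \<le> sqrt (sqD a g)"
    using integral_abs_mult_le_sqrt[OF s, of "\<lambda>_. 1"] by (simp add: sqD_def sq_int_def prob_space)
  then have "bias * (\<integral>\<omega>. \<bar>?d \<omega>\<bar> \<partial>M) \<le> bias * sqrt (sqD a g)" using bias0 by (rule mult_left_mono)
  moreover have "L * h * mom 1 * sqD a g \<le> c / 4 * sqD a g" by (rule mult_right_mono[OF small2 sqD_nonneg])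
  moreover have "0 \<le> c * sqD a g" using c_pos sqD_nonneg by simp
  moreover have "(c - L * h * mom 1) / 2 * sqD a g - L / 2 * (\<integral>\<omega>. \<bar>?d \<omega>\<bar> * (?d \<omega>)\<^sup>2 \<partial>M)
      = c * sqD a g / 2 - L * h * mom 1 * sqD a g / 2 - L * (\<integral>\<omega>. \<bar>?d \<omega>\<bar> * (?d \<omega>)\<^sup>2 \<partial>M) / 2" by (simp add: field_simps)
  moreover have "A / 4 - e \<le> Q" if "A / 2 - W / 2 - V / 2 - B \<le> Q" "W \<le> A / 4" "V \<le> A / 8" "B \<le> e" "0 \<le> A" for A W V B e Q :: real
    using that by linarith
  note this[of "c * sqD a g" "L * h * mom 1 * sqD a g" "L * (\<integral>\<omega>. \<bar>?d \<omega>\<bar> * (?d \<omega>)\<^sup>2 \<partial>M)" "bias * (\<integral>\<omega>. \<bar>?d \<omega>\<bar> \<partial>M)" "gainE a g" "bias * sqrt (sqD a g)"]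
  ultimately show ?thesis using main cub by (simp only: times_divide_eq_left)
qed

text \<open>The quadratic bound is useless for large d, so d is shrunk by the factor t to the sphere
  of radius r. There the unsmoothed gain is at least c r^2 / 2 minus the cubic error, and convexity
  carries this out along the ray. Convexity is available for the unsmoothed gain, hence the detour
  through it at the price 2 h \<open>mom 1\<close>.\<close>

lemma gainE_far:
  assumes g: "g \<in> sobolev m" and D: "r\<^sup>2 < sqD a g"
  shows "c * r\<^sup>2 / 4 - 2 * h * mom 1 \<le> gainE a g"
proof -
  define t where "t = r / sqrt (sqD a g)"
  have sD: "r < sqrt (sqD a g)" using D r_pos by (simp add: real_less_rsqrt)
  have sp: "0 < sqrt (sqD a g)" using sD r_pos by linarith
  then have t: "0 < t" "t \<le> 1" using sD r_pos by (simp_all add: t_def)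
  let ?d = "dl a g"
  note s = dl_sq_int[OF g, of a]
  have i3: "integrable M (\<lambda>\<omega>. \<bar>?d \<omega>\<bar> * (?d \<omega>)\<^sup>2)" by (rule abs_dl_sq_int[OF s g])
  have t2: "t\<^sup>2 * sqD a g = r\<^sup>2" using D r_pos sqD_nonneg[of a g] by (auto simp: t_def power_divide)
  have "(\<integral>\<omega>. c * t\<^sup>2 / 2 * (?d \<omega>)\<^sup>2 - L * t ^ 3 / 2 * (\<bar>?d \<omega>\<bar> * (?d \<omega>)\<^sup>2) - t * (2 * h * mom 1) \<partial>M) \<le> (\<integral>\<omega>. t * \<Phi> \<omega> (?d \<omega>) \<partial>M)"
  proof (rule integral_mono_AE)
    show "integrable M (\<lambda>\<omega>. c * t\<^sup>2 / 2 * (?d \<omega>)\<^sup>2 - L * t ^ 3 / 2 * (\<bar>?d \<omega>\<bar> * (?d \<omega>)\<^sup>2) - t * (2 * h * mom 1))"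
      using i3 sq_int_integrable[OF s] by (intro Bochner_Integration.integrable_diff integrable_mult_right) auto
    show "AE \<omega> in M. c * t\<^sup>2 / 2 * (?d \<omega>)\<^sup>2 - L * t ^ 3 / 2 * (\<bar>?d \<omega>\<bar> * (?d \<omega>)\<^sup>2) - t * (2 * h * mom 1) \<le> t * \<Phi> \<omega> (?d \<omega>)"
      using AE_kernel
    proof eventually_elim
      case (elim \<omega>)
      interpret smooth_cdf_kernel "prim (Defs.cdf f (X \<omega>))" "Defs.cdf f (X \<omega>)" "f (X \<omega>)" L k s h using elim by simp
      let ?P = "prim (Defs.cdf f (X \<omega>))" and ?u = "?d \<omega>"
      have eq\<tau>: "Defs.cdf f (X \<omega>) (q \<omega>) = \<tau>" using elim by simp
      have "c * t\<^sup>2 / 2 * u\<^sup>2 - L * t ^ 3 / 2 * (\<bar>u\<bar> * u\<^sup>2) = (t * u)\<^sup>2 / 2 * (c - L * \<bar>t * u\<bar>)" for u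
        using t by (simp add: abs_mult power2_eq_square power3_eq_cube algebra_simps)
      then have "c * t\<^sup>2 / 2 * ?u\<^sup>2 - L * t ^ 3 / 2 * (\<bar>?u\<bar> * ?u\<^sup>2) = (t * ?u)\<^sup>2 / 2 * (c - L * \<bar>t * ?u\<bar>)" .
      also have "\<dots> \<le> (t * ?u)\<^sup>2 / 2 * (f (X \<omega>) (q \<omega>) - L * \<bar>t * ?u\<bar>)" using elim by (intro mult_left_mono) auto
      also have "\<dots> \<le> gain \<tau> ?P (q \<omega>) (t * ?u)" using gain_ge[of "t * ?u" "q \<omega>"] unfolding eq\<tau> .
      also have "\<dots> \<le> t * gain \<tau> ?P (q \<omega>) ?u" using t by (intro gain_convex) auto
      also have "\<dots> \<le> t * (\<Phi> \<omega> ?u + 2 * h * mom 1)"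
        using smoothed_gain_near_gain[of \<tau> "q \<omega>" ?u] t unfolding \<Phi>_def by (intro mult_left_mono) (auto simp: abs_le_iff)
      finally show ?case by (simp add: algebra_simps)
    qed
  qed (use \<Phi>_integrable[OF g] in auto)
  also have "\<dots> = t * gainE a g" by (simp add: gainE_def)
  also have "(\<integral>\<omega>. c * t\<^sup>2 / 2 * (?d \<omega>)\<^sup>2 - L * t ^ 3 / 2 * (\<bar>?d \<omega>\<bar> * (?d \<omega>)\<^sup>2) - t * (2 * h * mom 1) \<partial>M)
      = c / 2 * (t\<^sup>2 * sqD a g) - L * t ^ 3 / 2 * (\<integral>\<omega>. \<bar>?d \<omega>\<bar> * (?d \<omega>)\<^sup>2 \<partial>M) - t * (2 * h * mom 1)"
    using i3 sq_int_integrable[OF s] by (simp add: sqD_def prob_space)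
  finally have main: "c / 2 * r\<^sup>2 - L * t ^ 3 / 2 * (\<integral>\<omega>. \<bar>?d \<omega>\<bar> * (?d \<omega>)\<^sup>2 \<partial>M) - t * (2 * h * mom 1) \<le> t * gainE a g"
    unfolding t2 .
  have "t ^ 3 * (\<integral>\<omega>. \<bar>?d \<omega>\<bar> * (?d \<omega>)\<^sup>2 \<partial>M) \<le> t ^ 3 * (sqrt (sqD a g) * K4 * sqD a g)"
    using cubic_bound[OF s g, of a] t by (intro mult_left_mono) (auto simp: sqD_def)
  also have "\<dots> = (t * sqrt (sqD a g)) * K4 * (t\<^sup>2 * sqD a g)" by (simp add: power2_eq_square power3_eq_cube mult_ac)
  also have "\<dots> = r * K4 * r\<^sup>2" using sp unfolding t2 by (simp add: t_def)
  finally have "L * (t ^ 3 * (\<integral>\<omega>. \<bar>?d \<omega>\<bar> * (?d \<omega>)\<^sup>2 \<partial>M)) \<le> L * (r * K4 * r\<^sup>2)" using L_nonneg by (rule mult_left_mono)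
  also have "\<dots> \<le> c / 8 * r\<^sup>2" using mult_right_mono[OF small1, of "r\<^sup>2"] by (simp add: mult.assoc)
  finally have "L * t ^ 3 / 2 * (\<integral>\<omega>. \<bar>?d \<omega>\<bar> * (?d \<omega>)\<^sup>2 \<partial>M) \<le> c / 16 * r\<^sup>2" by simp
  moreover have "0 \<le> c * r\<^sup>2" using c_pos by simp
  ultimately have "c * r\<^sup>2 / 4 \<le> t * (gainE a g + 2 * h * mom 1)" using main by (simp add: algebra_simps)
  moreover have "0 < c * r\<^sup>2 / 4" using c_pos r_pos by simp
  \<comment> \<open>Positivity is needed before the factor t \<le> 1 may be dropped on the larger
    side.\<close>
  ultimately have "0 < gainE a g + 2 * h * mom 1" using t(1) zero_less_mult_pos[of t] by (metis less_le_trans)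
  then have "t * (gainE a g + 2 * h * mom 1) \<le> gainE a g + 2 * h * mom 1" using t by (simp add: mult_left_le_one_le)
  with \<open>c * r\<^sup>2 / 4 \<le> t * (gainE a g + 2 * h * mom 1)\<close> show ?thesis by linarith
qed

text \<open>The two perturbations need not be bounded by a constant, so the pointwise curvature loss
  is the random L (|d| + |e|); the cubic estimate absorbs it after integration against the squared
  difference. Of c/4, at most c/16 goes to smoothing and c/32 to each of the two cubic
  terms.\<close>

lemma gainE_midpoint:
  assumes g: "g \<in> sobolev m" "e \<in> sobolev m" and D: "sqD a g \<le> r\<^sup>2" "sqD u e \<le> r\<^sup>2"
  shows "c / 8 * sqD (a - u) (\<lambda>t. g t - e t) \<le> gainE a g + gainE u e - 2 * gainE ((a + u) / 2) (\<lambda>t. (g t + e t) / 2)"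
proof -
  let ?d = "dl a g" and ?e = "dl u e" and ?z = "dl (a - u) (\<lambda>t. g t - e t)"
  note ge = sobolev_diff[OF g]
  note s1 = dl_sq_int[OF g(1), of a] and s2 = dl_sq_int[OF g(2), of u] and sz = dl_sq_int[OF ge, of "a - u"]
  have i: "integrable M (\<lambda>\<omega>. \<bar>?d \<omega>\<bar> * (?z \<omega>)\<^sup>2)" "integrable M (\<lambda>\<omega>. \<bar>?e \<omega>\<bar> * (?z \<omega>)\<^sup>2)"
    by (rule abs_dl_sq_int[OF s1 ge], rule abs_dl_sq_int[OF s2 ge])
  note \<Phi>i = \<Phi>_integrable[OF g(1), of a] \<Phi>_integrable[OF g(2), of u] \<Phi>_integrable[OF sobolev_mid[OF g], of "(a + u) / 2"]
  have "(\<integral>\<omega>. (c - L * h * mom 1) / 4 * (?z \<omega>)\<^sup>2 - L / 4 * (\<bar>?d \<omega>\<bar> * (?z \<omega>)\<^sup>2) - L / 4 * (\<bar>?e \<omega>\<bar> * (?z \<omega>)\<^sup>2) \<partial>M)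
    \<le> (\<integral>\<omega>. \<Phi> \<omega> (?d \<omega>) + \<Phi> \<omega> (?e \<omega>) - 2 * \<Phi> \<omega> (dl ((a + u) / 2) (\<lambda>t. (g t + e t) / 2) \<omega>) \<partial>M)"
  proof (rule integral_mono_AE)
    show "integrable M (\<lambda>\<omega>. (c - L * h * mom 1) / 4 * (?z \<omega>)\<^sup>2 - L / 4 * (\<bar>?d \<omega>\<bar> * (?z \<omega>)\<^sup>2) - L / 4 * (\<bar>?e \<omega>\<bar> * (?z \<omega>)\<^sup>2))"
      using i sq_int_integrable[OF sz] by (intro Bochner_Integration.integrable_diff integrable_mult_right) auto
    show "integrable M (\<lambda>\<omega>. \<Phi> \<omega> (?d \<omega>) + \<Phi> \<omega> (?e \<omega>) - 2 * \<Phi> \<omega> (dl ((a + u) / 2) (\<lambda>t. (g t + e t) / 2) \<omega>))"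
      using \<Phi>i by (intro Bochner_Integration.integrable_diff Bochner_Integration.integrable_add integrable_mult_right)
    show "AE \<omega> in M. (c - L * h * mom 1) / 4 * (?z \<omega>)\<^sup>2 - L / 4 * (\<bar>?d \<omega>\<bar> * (?z \<omega>)\<^sup>2) - L / 4 * (\<bar>?e \<omega>\<bar> * (?z \<omega>)\<^sup>2)
       \<le> \<Phi> \<omega> (?d \<omega>) + \<Phi> \<omega> (?e \<omega>) - 2 * \<Phi> \<omega> (dl ((a + u) / 2) (\<lambda>t. (g t + e t) / 2) \<omega>)"
      using AE_kernel AE_space
    proof eventually_elim
      case (elim \<omega>)
      have z: "?z \<omega> = ?d \<omega> - ?e \<omega>" using dl_diff[OF g elim(2)] by simp
      have "(c - L * h * mom 1) / 4 * (?z \<omega>)\<^sup>2 - L / 4 * (\<bar>?d \<omega>\<bar> * (?z \<omega>)\<^sup>2) - L / 4 * (\<bar>?e \<omega>\<bar> * (?z \<omega>)\<^sup>2)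
          = ((?d \<omega> - ?e \<omega>) / 2)\<^sup>2 * (c - L * (\<bar>?d \<omega>\<bar> + \<bar>?e \<omega>\<bar>) - L * h * mom 1)"
        unfolding z by (simp add: power_divide field_simps)
      also have "\<dots> \<le> ((?d \<omega> - ?e \<omega>) / 2)\<^sup>2 * (f (X \<omega>) (q \<omega>) - L * (\<bar>?d \<omega>\<bar> + \<bar>?e \<omega>\<bar>) - L * h * mom 1)"
        using elim by (intro mult_left_mono) auto
      also have "\<dots> \<le> \<Phi> \<omega> (?d \<omega>) + \<Phi> \<omega> (?e \<omega>) - 2 * \<Phi> \<omega> ((?d \<omega> + ?e \<omega>) / 2)"
        unfolding \<Phi>_def by (rule smooth_cdf_kernel.smoothed_gain_second_difference) (use elim in auto)
      finally show ?case unfolding dl_mid[OF g elim(2)] .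
    qed
  qed
  also have "\<dots> = gainE a g + gainE u e - 2 * gainE ((a + u) / 2) (\<lambda>t. (g t + e t) / 2)"
    using \<Phi>i by (simp add: gainE_def)
  also have "(\<integral>\<omega>. (c - L * h * mom 1) / 4 * (?z \<omega>)\<^sup>2 - L / 4 * (\<bar>?d \<omega>\<bar> * (?z \<omega>)\<^sup>2) - L / 4 * (\<bar>?e \<omega>\<bar> * (?z \<omega>)\<^sup>2) \<partial>M)
     = (c - L * h * mom 1) / 4 * sqD (a - u) (\<lambda>t. g t - e t) - L / 4 * (\<integral>\<omega>. \<bar>?d \<omega>\<bar> * (?z \<omega>)\<^sup>2 \<partial>M) - L / 4 * (\<integral>\<omega>. \<bar>?e \<omega>\<bar> * (?z \<omega>)\<^sup>2 \<partial>M)"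
    using i sq_int_integrable[OF sz] by (simp add: sqD_def)
  finally have main: "(c - L * h * mom 1) / 4 * sqD (a - u) (\<lambda>t. g t - e t) - L / 4 * (\<integral>\<omega>. \<bar>?d \<omega>\<bar> * (?z \<omega>)\<^sup>2 \<partial>M) - L / 4 * (\<integral>\<omega>. \<bar>?e \<omega>\<bar> * (?z \<omega>)\<^sup>2 \<partial>M)
     \<le> gainE a g + gainE u e - 2 * gainE ((a + u) / 2) (\<lambda>t. (g t + e t) / 2)" .
  define N where "N = sqD (a - u) (\<lambda>t. g t - e t)"
  have N: "0 \<le> N" by (simp add: N_def sqD_nonneg)
  have cub: "L * (\<integral>\<omega>. \<bar>dl x y \<omega>\<bar> * (?z \<omega>)\<^sup>2 \<partial>M) \<le> c / 8 * N" if "y \<in> sobolev m" "sqD x y \<le> r\<^sup>2" for x y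
  proof -
    have "(\<integral>\<omega>. \<bar>dl x y \<omega>\<bar> * (?z \<omega>)\<^sup>2 \<partial>M) \<le> sqrt (sqD x y) * K4 * N"
      using cubic_bound[OF dl_sq_int[OF that(1)] ge] by (simp add: sqD_def N_def)
    also have "\<dots> \<le> r * K4 * N"
      using that r_pos K4_nonneg N by (intro mult_right_mono) (auto simp: real_le_lsqrt sqD_nonneg)
    finally have "L * (\<integral>\<omega>. \<bar>dl x y \<omega>\<bar> * (?z \<omega>)\<^sup>2 \<partial>M) \<le> L * (r * K4 * N)" using L_nonneg by (rule mult_left_mono)
    also have "\<dots> \<le> c / 8 * N" using mult_right_mono[OF small1 N] by (simp add: mult.assoc)
    finally show ?thesis .
  qed
  have "L * h * mom 1 * N \<le> c / 4 * N" by (rule mult_right_mono[OF small2 N])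
  moreover have "(c - L * h * mom 1) / 4 * N = c * N / 4 - L * h * mom 1 * N / 4" by (simp add: field_simps)
  moreover have "0 \<le> c * N" using c_pos N by simp
  moreover have "L / 4 * x = L * x / 4" for x by simp
  ultimately show ?thesis
    using main cub[OF g(1) D(1)] cub[OF g(2) D(2)] unfolding N_def[symmetric] by (simp only:)
qed

end

context qr_core
begin

lemma sqD_add_le:
  assumes "g \<in> sobolev m" "e \<in> sobolev m"
  shows "sqrt (sqD a g) \<le> sqrt (sqD u e) + sqrt (sqD (a - u) (\<lambda>t. g t - e t))"
proof -
  have "sqD a g = (\<integral>\<omega>. (dl u e \<omega> + dl (a - u) (\<lambda>t. g t - e t) \<omega>)\<^sup>2 \<partial>M)"
    unfolding sqD_def by (intro Bochner_Integration.integral_cong refl) (simp flip: dl_diff[OF assms])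
  then show ?thesis
    using sqrt_integral_square_triangle[OF dl_sq_int[OF assms(2), of u] dl_sq_int[OF sobolev_diff[OF assms], of "a - u"]]
    by (simp add: sqD_def)
qed

lemma sqD_mid_le:
  assumes "g \<in> sobolev m" "e \<in> sobolev m" "sqD a g \<le> B" "sqD u e \<le> B"
  shows "sqD ((a + u) / 2) (\<lambda>t. (g t + e t) / 2) \<le> B"
proof -
  have "sqD ((a + u) / 2) (\<lambda>t. (g t + e t) / 2) = (\<integral>\<omega>. (dl a g \<omega> + dl u e \<omega>)\<^sup>2 / 4 \<partial>M)"
    unfolding sqD_def
    by (intro Bochner_Integration.integral_cong refl) (simp add: dl_mid[OF assms(1,2)] power_divide)
  also have "\<dots> = (\<integral>\<omega>. (dl a g \<omega> + dl u e \<omega>)\<^sup>2 \<partial>M) / 4" by simp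
  also have "\<dots> \<le> (2 * sqD a g + 2 * sqD u e) / 4"
    unfolding sqD_def by (intro divide_right_mono integral_square_add_le dl_sq_int assms) auto
  finally show ?thesis using assms(3,4) by simp
qed

text \<open>Separation turns the joint Cauchy condition into one for the intercepts and one for the
  slopes. The slopes converge in L2 and in the penalty, and the L2 norm dominates the second moment
  of the functional.\<close>

lemma sqD_complete:
  assumes g: "\<And>n. g n \<in> sobolev m"
    and C: "\<And>d. d > 0 \<Longrightarrow> \<exists>N. \<forall>i\<ge>N. \<forall>j\<ge>N. sqD (a i - a j) (\<lambda>t. g i t - g j t) + Jpen m (\<lambda>t. g i t - g j t) (\<lambda>t. g i t - g j t) < d"
  shows "\<exists>u. \<exists>e\<in>sobolev m. (\<lambda>n. sqD (a n - u) (\<lambda>t. g n t - e t)) \<longlonglongrightarrow> 0 \<and> (\<lambda>n. Jpen m (\<lambda>t. g n t - e t) (\<lambda>t. g n t - e t)) \<longlonglongrightarrow> 0"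
proof -
  have sep: "(a i - a j)\<^sup>2 + (\<integral>\<omega>. (lin (\<lambda>t. g i t - g j t) (X \<omega>))\<^sup>2 \<partial>M) \<le> C1\<^sup>2 * sqD (a i - a j) (\<lambda>t. g i t - g j t)" for i j
    unfolding sqD_def by (intro intercept_slope_separation sobolev_L2[OF sobolev_diff[OF g g]])
  have nn: "0 \<le> (\<integral>\<omega>. (lin e (X \<omega>))\<^sup>2 \<partial>M)" for e by simp
  have C2: "C1\<^sup>2 > 0" using C1_pos by simp
  have C': "\<exists>N. \<forall>i\<ge>N. \<forall>j\<ge>N. (a i - a j)\<^sup>2 < d \<and> (\<integral>\<omega>. (lin (\<lambda>t. g i t - g j t) (X \<omega>))\<^sup>2 \<partial>M) < d \<and> Jpen m (\<lambda>t. g i t - g j t) (\<lambda>t. g i t - g j t) < d"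
    if d: "d > 0" for d
  proof -
    define d' where "d' = min d (d / C1\<^sup>2)"
    have "d' > 0" using d C2 by (simp add: d'_def)
    from C[OF this] obtain N where N: "\<forall>i\<ge>N. \<forall>j\<ge>N. sqD (a i - a j) (\<lambda>t. g i t - g j t) + Jpen m (\<lambda>t. g i t - g j t) (\<lambda>t. g i t - g j t) < d'" by blast
    show ?thesis
    proof (intro exI[of _ N] allI impI)
      fix i j assume "N \<le> i" "N \<le> j"
      then have *: "sqD (a i - a j) (\<lambda>t. g i t - g j t) + Jpen m (\<lambda>t. g i t - g j t) (\<lambda>t. g i t - g j t) < d'" using N by blast
      then have J: "Jpen m (\<lambda>t. g i t - g j t) (\<lambda>t. g i t - g j t) < d'" and S: "sqD (a i - a j) (\<lambda>t. g i t - g j t) < d'"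
        using sqD_nonneg[of "a i - a j" "\<lambda>t. g i t - g j t"] Jpen_nonneg[of m "\<lambda>t. g i t - g j t"] by linarith+
      have "C1\<^sup>2 * sqD (a i - a j) (\<lambda>t. g i t - g j t) < C1\<^sup>2 * (d / C1\<^sup>2)"
        using S C2 by (intro mult_strict_left_mono) (auto simp: d'_def)
      also have "\<dots> = d" using C2 by simp
      finally have lt: "C1\<^sup>2 * sqD (a i - a j) (\<lambda>t. g i t - g j t) < d" .
      have "A < d \<and> B < d" if "A + B < d" "0 \<le> A" "0 \<le> B" for A B :: real using that by linarith
      from this[OF le_less_trans[OF sep lt] zero_le_power2 nn]
      show "(a i - a j)\<^sup>2 < d \<and> (\<integral>\<omega>. (lin (\<lambda>t. g i t - g j t) (X \<omega>))\<^sup>2 \<partial>M) < d \<and> Jpen m (\<lambda>t. g i t - g j t) (\<lambda>t. g i t - g j t) < d"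
        using J by (simp add: d'_def)
    qed
  qed
  have "Cauchy a"
  proof (rule metric_CauchyI)
    fix d :: real assume d: "d > 0"
    then have "d\<^sup>2 > 0" by simp
    from C'[OF this] obtain N where "\<forall>i\<ge>N. \<forall>j\<ge>N. (a i - a j)\<^sup>2 < d\<^sup>2" by blast
    then show "\<exists>M. \<forall>i\<ge>M. \<forall>j\<ge>M. dist (a i) (a j) < d"
      using d by (intro exI[of _ N]) (auto simp: dist_real_def intro!: power_less_imp_less_base[of _ 2 d])
  qed
  then obtain u where u: "a \<longlonglongrightarrow> u" by (auto simp: Cauchy_convergent_iff convergent_def)
  have "\<exists>e\<in>sobolev m. (\<lambda>n. l2norm (\<lambda>t. g n t - e t)) \<longlonglongrightarrow> 0 \<and> (\<lambda>n. Jpen m (\<lambda>t. g n t - e t) (\<lambda>t. g n t - e t)) \<longlonglongrightarrow> 0"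
  proof (rule sobolev_complete[OF g])
    fix d :: real assume "d > 0"
    note C'[OF this]
    then show "\<exists>N. \<forall>i\<ge>N. \<forall>j\<ge>N. (\<integral>\<omega>. (lin (\<lambda>t. g i t - g j t) (X \<omega>))\<^sup>2 \<partial>M) < d"
      "\<exists>N. \<forall>i\<ge>N. \<forall>j\<ge>N. Jpen m (\<lambda>t. g i t - g j t) (\<lambda>t. g i t - g j t) < d" by blast+
  qed
  then obtain e where e: "e \<in> sobolev m" "(\<lambda>n. l2norm (\<lambda>t. g n t - e t)) \<longlonglongrightarrow> 0" "(\<lambda>n. Jpen m (\<lambda>t. g n t - e t) (\<lambda>t. g n t - e t)) \<longlonglongrightarrow> 0"
    by blast
  define E where "E = (\<integral>\<omega>. (l2norm (X \<omega>))\<^sup>2 \<partial>M)"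
  have le: "sqD (a n - u) (\<lambda>t. g n t - e t) \<le> 2 * (a n - u)\<^sup>2 + 2 * ((l2norm (\<lambda>t. g n t - e t))\<^sup>2 * E)" for n
  proof -
    note L = sobolev_L2[OF sobolev_diff[OF g e(1)], of n]
    have c: "sq_int M (\<lambda>_. a n - u)" by (simp add: sq_int_def)
    have "sqD (a n - u) (\<lambda>t. g n t - e t) \<le> 2 * (\<integral>\<omega>. (a n - u)\<^sup>2 \<partial>M) + 2 * (\<integral>\<omega>. (lin (\<lambda>t. g n t - e t) (X \<omega>))\<^sup>2 \<partial>M)"
      unfolding sqD_def by (rule integral_square_add_le[OF c lin_X_sq_int[OF L]])
    then show ?thesis using lin_X_square_le[OF L] by (simp add: E_def prob_space)
  qed
  have "(\<lambda>n. 2 * (a n - u)\<^sup>2 + 2 * ((l2norm (\<lambda>t. g n t - e t))\<^sup>2 * E)) \<longlonglongrightarrow> 2 * (u - u)\<^sup>2 + 2 * (0\<^sup>2 * E)"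
    by (intro tendsto_intros u e(2))
  then have lim: "(\<lambda>n. 2 * (a n - u)\<^sup>2 + 2 * ((l2norm (\<lambda>t. g n t - e t))\<^sup>2 * E)) \<longlonglongrightarrow> 0" by simp
  have "(\<lambda>n. sqD (a n - u) (\<lambda>t. g n t - e t)) \<longlonglongrightarrow> 0"
    by (rule tendsto_sandwich[OF _ _ tendsto_const lim]) (use le sqD_nonneg in auto)
  with e show ?thesis by blast
qed

end

context qr_point
begin

text \<open>The penalised smoothed risk in coordinates centred at the true parameter, with the
  smoothed risk of the true parameter subtracted.\<close>

definition obj :: "real \<Rightarrow> (real \<Rightarrow> real) \<Rightarrow> real" where
  "obj a g = gainE a g + lam / 2 * Jpen m (\<lambda>t. \<beta>0 t + g t) (\<lambda>t. \<beta>0 t + g t)"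

text \<open>Continuity in the reference norm alone; it provides both the lower bound on the ball and
  the passage to the limit along minimizing sequences.\<close>

lemma gainE_Lipschitz:
  assumes "g \<in> sobolev m" "e \<in> sobolev m"
  shows "\<bar>gainE a g - gainE u e\<bar> \<le> 2 * mom 0 * sqrt (sqD (a - u) (\<lambda>t. g t - e t))"
proof -
  let ?A = "\<lambda>a g \<omega>. rho_h h \<tau> (Y \<omega> - q \<omega> - dl a g \<omega>)"
  have i: "integrable M (?A a g)" if "g \<in> sobolev m" for a g
    using Y_int dl_integrable[OF \<beta>0, of a0] dl_integrable[OF that, of a] by (intro integrable_rho_h h_pos \<tau>) auto
  note z = sobolev_diff[OF assms]
  have "\<bar>gainE a g - gainE u e\<bar> = \<bar>\<integral>\<omega>. ?A a g \<omega> - ?A u e \<omega> \<partial>M\<bar>"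
    unfolding gainE_eq[OF assms(1)] gainE_eq[OF assms(2)] using i assms by simp
  also have "\<dots> \<le> (\<integral>\<omega>. \<bar>?A a g \<omega> - ?A u e \<omega>\<bar> \<partial>M)" by (rule integral_abs_bound)
  also have "\<dots> \<le> (\<integral>\<omega>. 2 * mom 0 * \<bar>dl (a - u) (\<lambda>t. g t - e t) \<omega>\<bar> \<partial>M)"
  proof (rule integral_mono)
    fix \<omega> assume "\<omega> \<in> space M"
    then have "Y \<omega> - q \<omega> - dl a g \<omega> - (Y \<omega> - q \<omega> - dl u e \<omega>) = - dl (a - u) (\<lambda>t. g t - e t) \<omega>"
      using dl_diff[OF assms, of \<omega> a u] by simp
    then show "\<bar>?A a g \<omega> - ?A u e \<omega>\<bar> \<le> 2 * mom 0 * \<bar>dl (a - u) (\<lambda>t. g t - e t) \<omega>\<bar>"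
      using rho_h_Lipschitz[OF h_pos \<tau>, of "Y \<omega> - q \<omega> - dl a g \<omega>" "Y \<omega> - q \<omega> - dl u e \<omega>"] by (simp only: abs_minus_cancel)
  qed (use i assms dl_integrable[OF z, of "a - u"] in auto)
  also have "\<dots> = 2 * mom 0 * (\<integral>\<omega>. \<bar>dl (a - u) (\<lambda>t. g t - e t) \<omega>\<bar> \<partial>M)" by simp
  also have "\<dots> \<le> 2 * mom 0 * sqrt (sqD (a - u) (\<lambda>t. g t - e t))"
    using integral_abs_mult_le_sqrt[OF dl_sq_int[OF z, of "a - u"], of "\<lambda>_. 1"] mom_nonneg[of 0]
    by (intro mult_left_mono) (auto simp: sqD_def sq_int_def prob_space)
  finally show ?thesis .
qed

lemma sqrt_Jpen_shift:
  assumes "g \<in> sobolev m" "e \<in> sobolev m"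
  shows "\<bar>sqrt (Jpen m (\<lambda>t. \<beta>0 t + g t) (\<lambda>t. \<beta>0 t + g t)) - sqrt (Jpen m (\<lambda>t. \<beta>0 t + e t) (\<lambda>t. \<beta>0 t + e t))\<bar> \<le> sqrt (Jpen m (\<lambda>t. g t - e t) (\<lambda>t. g t - e t))"
proof -
  have *: "sqrt (Jpen m (\<lambda>t. \<beta>0 t + g t) (\<lambda>t. \<beta>0 t + g t)) \<le> sqrt (Jpen m (\<lambda>t. \<beta>0 t + e t) (\<lambda>t. \<beta>0 t + e t)) + sqrt (Jpen m (\<lambda>t. g t - e t) (\<lambda>t. g t - e t))"
    if "g \<in> sobolev m" "e \<in> sobolev m" for g e
    using sqrt_Jpen_triangle[OF sobolev_add[OF \<beta>0 that(2)] sobolev_diff[OF that]] by simp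
  have "Jpen m (\<lambda>t. e t - g t) (\<lambda>t. e t - g t) = Jpen m (\<lambda>t. g t - e t) (\<lambda>t. g t - e t)"
    using Jpen_cmult[OF sobolev_diff[OF assms], of "-1"] by simp
  then show ?thesis using *[OF assms] *[OF assms(2,1)] by (simp add: abs_le_iff)
qed

text \<open>The gain is strongly convex in the reference norm on the ball, and the penalty adds
  strong convexity in the m-th derivative, so the squared distance can be taken as the sum of both,
  for which the space is complete. The modulus is the smaller of the two constants.\<close>

lemma obj_minimizer_exists:
  "\<exists>a g. g \<in> sobolev m \<and> sqD a g \<le> r\<^sup>2 \<and> (\<forall>u e. e \<in> sobolev m \<longrightarrow> sqD u e \<le> r\<^sup>2 \<longrightarrow> obj a g \<le> obj u e)"
proof -
  define A where "A = {p. snd p \<in> sobolev m \<and> sqD (fst p) (snd p) \<le> r\<^sup>2}"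
  define N where "N = (\<lambda>p p' :: real \<times> (real \<Rightarrow> real). sqD (fst p - fst p') (\<lambda>t. snd p t - snd p' t) + Jpen m (\<lambda>t. snd p t - snd p' t) (\<lambda>t. snd p t - snd p' t))"
  define mid where "mid = (\<lambda>p p' :: real \<times> (real \<Rightarrow> real). ((fst p + fst p') / 2, \<lambda>t. (snd p t + snd p' t) / 2))"
  let ?e = "\<lambda>p. obj (fst p) (snd p)"
  have "\<exists>x\<in>A. \<forall>y\<in>A. ?e x \<le> ?e y"
  proof (rule strongly_convex_minimizer[where mid=mid and N=N and \<kappa>="min (c / 8) (lam / 4)" and B="- (2 * mom 0 * r) + gainE 0 (\<lambda>_. 0)"])
    have z: "(\<lambda>_. 0) \<in> sobolev m" using sobolev_cmult[OF \<beta>0, of 0] by simp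
    have "sqD 0 (\<lambda>_. 0) = 0" by (simp add: sqD_def lin_def)
    then show "A \<noteq> {}" using z r_pos by (auto simp: A_def intro!: exI[of _ 0] exI[of _ "\<lambda>_. 0"])
    show "min (c / 8) (lam / 4) > 0" using c_pos lam_pos by simp
    show "mid x y \<in> A" if "x \<in> A" "y \<in> A" for x y
      using that by (auto simp: A_def mid_def intro!: sobolev_mid sqD_mid_le)
    show "- (2 * mom 0 * r) + gainE 0 (\<lambda>_. 0) \<le> ?e x" if x: "x \<in> A" for x
    proof -
      have "2 * mom 0 * sqrt (sqD (fst x) (snd x)) \<le> 2 * mom 0 * r"
        using x r_pos mom_nonneg[of 0] by (intro mult_left_mono) (auto simp: A_def real_le_lsqrt sqD_nonneg)
      then have "- (2 * mom 0 * r) + gainE 0 (\<lambda>_. 0) \<le> gainE (fst x) (snd x)"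
        using gainE_Lipschitz[of "snd x" "\<lambda>_. 0" "fst x" 0] x z by (simp add: A_def abs_le_iff)
      moreover have "0 \<le> lam / 2 * Jpen m (\<lambda>t. \<beta>0 t + snd x t) (\<lambda>t. \<beta>0 t + snd x t)"
        using lam_pos Jpen_nonneg by simp
      ultimately show ?thesis by (simp add: obj_def)
    qed
    show "min (c / 8) (lam / 4) * N x y \<le> ?e x + ?e y - 2 * ?e (mid x y)" if xy: "x \<in> A" "y \<in> A" for x y
    proof -
      let ?D = "sqD (fst x - fst y) (\<lambda>t. snd x t - snd y t)" and ?J = "Jpen m (\<lambda>t. snd x t - snd y t) (\<lambda>t. snd x t - snd y t)"
      have s: "snd x \<in> sobolev m" "snd y \<in> sobolev m" using xy by (auto simp: A_def)
      have f1: "c / 8 * ?D \<le> gainE (fst x) (snd x) + gainE (fst y) (snd y) - 2 * gainE (fst (mid x y)) (snd (mid x y))"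
        using xy unfolding mid_def fst_conv snd_conv by (intro gainE_midpoint) (auto simp: A_def)
      have "(\<lambda>t. \<beta>0 t + snd (mid x y) t) = (\<lambda>t. ((\<beta>0 t + snd x t) + (\<beta>0 t + snd y t)) / 2)"
        by (auto simp: mid_def field_simps)
      then have "Jpen m (\<lambda>t. \<beta>0 t + snd x t) (\<lambda>t. \<beta>0 t + snd x t) + Jpen m (\<lambda>t. \<beta>0 t + snd y t) (\<lambda>t. \<beta>0 t + snd y t)
          - 2 * Jpen m (\<lambda>t. \<beta>0 t + snd (mid x y) t) (\<lambda>t. \<beta>0 t + snd (mid x y) t) = ?J / 2"
        using Jpen_midpoint[OF sobolev_add[OF \<beta>0 s(1)] sobolev_add[OF \<beta>0 s(2)]] by simp
      from arg_cong[OF this, of "\<lambda>z. lam / 2 * z"]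
      have f2: "lam / 2 * Jpen m (\<lambda>t. \<beta>0 t + snd x t) (\<lambda>t. \<beta>0 t + snd x t) + lam / 2 * Jpen m (\<lambda>t. \<beta>0 t + snd y t) (\<lambda>t. \<beta>0 t + snd y t)
          - 2 * (lam / 2 * Jpen m (\<lambda>t. \<beta>0 t + snd (mid x y) t) (\<lambda>t. \<beta>0 t + snd (mid x y) t)) = lam / 4 * ?J"
        by (simp add: algebra_simps)
      have f3: "min (c / 8) (lam / 4) * N x y \<le> c / 8 * ?D + lam / 4 * ?J"
        unfolding N_def distrib_left using sqD_nonneg Jpen_nonneg by (intro add_mono mult_right_mono) auto
      have "n \<le> (G1 + J1) + (G2 + J2) - 2 * (G3 + J3)" if "D \<le> G1 + G2 - 2 * G3" "J1 + J2 - 2 * J3 = J" "n \<le> D + J"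
        for n G1 G2 G3 J1 J2 J3 D J :: real using that by (simp add: algebra_simps)
      from this[OF f1 f2 f3] show ?thesis unfolding obj_def .
    qed
    fix x :: "nat \<Rightarrow> real \<times> (real \<Rightarrow> real)" assume x: "\<And>n. x n \<in> A" and C: "\<And>d. d > 0 \<Longrightarrow> \<exists>M. \<forall>i\<ge>M. \<forall>j\<ge>M. N (x i) (x j) < d"
    have s: "snd (x n) \<in> sobolev m" for n using x by (simp add: A_def)
    have "\<exists>u. \<exists>e\<in>sobolev m. (\<lambda>n. sqD (fst (x n) - u) (\<lambda>t. snd (x n) t - e t)) \<longlonglongrightarrow> 0 \<and>
        (\<lambda>n. Jpen m (\<lambda>t. snd (x n) t - e t) (\<lambda>t. snd (x n) t - e t)) \<longlonglongrightarrow> 0"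
      by (rule sqD_complete[OF s C[unfolded N_def]])
    then obtain u e where e: "e \<in> sobolev m" and lD: "(\<lambda>n. sqD (fst (x n) - u) (\<lambda>t. snd (x n) t - e t)) \<longlonglongrightarrow> 0"
      and lJ: "(\<lambda>n. Jpen m (\<lambda>t. snd (x n) t - e t) (\<lambda>t. snd (x n) t - e t)) \<longlonglongrightarrow> 0"
      by blast
    have sD: "(\<lambda>n. sqrt (sqD (fst (x n) - u) (\<lambda>t. snd (x n) t - e t))) \<longlonglongrightarrow> 0" using tendsto_real_sqrt[OF lD] by simp
    have sJ: "(\<lambda>n. sqrt (Jpen m (\<lambda>t. snd (x n) t - e t) (\<lambda>t. snd (x n) t - e t))) \<longlonglongrightarrow> 0" using tendsto_real_sqrt[OF lJ] by simp
    \<comment> \<open>The ball is closed in the reference norm, so the limit is an admissible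
      competitor.\<close>
    have "sqrt (sqD u e) \<le> r"
    proof (rule LIMSEQ_le_const)
      show "(\<lambda>n. r + sqrt (sqD (fst (x n) - u) (\<lambda>t. snd (x n) t - e t))) \<longlonglongrightarrow> r"
        using tendsto_add[OF tendsto_const[of r] sD] by simp
      have "sqrt (sqD u e) \<le> r + sqrt (sqD (fst (x n) - u) (\<lambda>t. snd (x n) t - e t))" for n
      proof -
        have "sqD (u - fst (x n)) (\<lambda>t. e t - snd (x n) t) = sqD (fst (x n) - u) (\<lambda>t. snd (x n) t - e t)"
          unfolding sqD_def
        proof (intro Bochner_Integration.integral_cong refl)
          fix \<omega> assume w: "\<omega> \<in> space M"
          show "(dl (u - fst (x n)) (\<lambda>t. e t - snd (x n) t) \<omega>)\<^sup>2 = (dl (fst (x n) - u) (\<lambda>t. snd (x n) t - e t) \<omega>)\<^sup>2"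
            unfolding dl_diff[OF e s[of n] w, symmetric] dl_diff[OF s[of n] e w, symmetric] by (rule power2_commute)
        qed
        moreover have "sqrt (sqD (fst (x n)) (snd (x n))) \<le> r"
          using x[of n] r_pos by (auto simp: A_def real_le_lsqrt)
        ultimately show ?thesis using sqD_add_le[OF e s[of n], of u "fst (x n)"] by simp
      qed
      then show "\<exists>N. \<forall>n\<ge>N. sqrt (sqD u e) \<le> r + sqrt (sqD (fst (x n) - u) (\<lambda>t. snd (x n) t - e t))" by blast
    qed
    then have "sqD u e \<le> r\<^sup>2" by (rule sqrt_le_D)
    then have A: "(u, e) \<in> A" using e by (simp add: A_def)
    have lg: "(\<lambda>n. gainE (fst (x n)) (snd (x n))) \<longlonglongrightarrow> gainE u e"
    proof (rule LIM_zero_cancel, rule tendsto_rabs_zero_cancel, rule tendsto_sandwich[OF _ _ tendsto_const])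
      show "(\<lambda>n. 2 * mom 0 * sqrt (sqD (fst (x n) - u) (\<lambda>t. snd (x n) t - e t))) \<longlonglongrightarrow> 0"
        using tendsto_mult[OF tendsto_const[of "2 * mom 0"] sD] by simp
    qed (use gainE_Lipschitz[OF s e] in auto)
    have "(\<lambda>n. sqrt (Jpen m (\<lambda>t. \<beta>0 t + snd (x n) t) (\<lambda>t. \<beta>0 t + snd (x n) t))) \<longlonglongrightarrow> sqrt (Jpen m (\<lambda>t. \<beta>0 t + e t) (\<lambda>t. \<beta>0 t + e t))"
      by (rule LIM_zero_cancel, rule tendsto_rabs_zero_cancel, rule tendsto_sandwich[OF _ _ tendsto_const sJ])
         (use sqrt_Jpen_shift[OF s e] in auto)
    from tendsto_power[OF this, of 2]
    have "(\<lambda>n. Jpen m (\<lambda>t. \<beta>0 t + snd (x n) t) (\<lambda>t. \<beta>0 t + snd (x n) t)) \<longlonglongrightarrow> Jpen m (\<lambda>t. \<beta>0 t + e t) (\<lambda>t. \<beta>0 t + e t)"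
      by (simp add: Jpen_nonneg)
    from tendsto_add[OF lg tendsto_mult[OF tendsto_const[of "lam / 2"] this]]
    show "\<exists>y\<in>A. (\<lambda>n. ?e (x n)) \<longlonglongrightarrow> ?e y"
      using A by (intro bexI[of _ "(u, e)"]) (auto simp: obj_def)
  qed
  then show ?thesis by (auto simp: A_def)
qed

lemma ell_eq:
  assumes "\<theta> \<in> Hspace m"
  shows "ell M X Y k h m \<tau> lam \<theta> = (\<integral>\<omega>. rho_h h \<tau> (Y \<omega> - q \<omega>) \<partial>M) + obj (fst \<theta> - a0) (\<lambda>t. snd \<theta> t - \<beta>0 t)"
proof -
  have s: "snd \<theta> \<in> sobolev m" using assms by (auto simp: Hspace_def)
  have "(\<integral>\<omega>. rho_h h \<tau> (resid \<theta> (X \<omega>) (Y \<omega>)) \<partial>M) = (\<integral>\<omega>. rho_h h \<tau> (Y \<omega> - q \<omega> - dl (fst \<theta> - a0) (\<lambda>t. snd \<theta> t - \<beta>0 t) \<omega>) \<partial>M)"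
  proof (intro Bochner_Integration.integral_cong refl)
    fix \<omega> assume "\<omega> \<in> space M"
    from dl_diff[OF s \<beta>0 this, of "fst \<theta>" a0]
    have "resid \<theta> (X \<omega>) (Y \<omega>) = Y \<omega> - q \<omega> - dl (fst \<theta> - a0) (\<lambda>t. snd \<theta> t - \<beta>0 t) \<omega>" by (simp add: resid_def)
    then show "rho_h h \<tau> (resid \<theta> (X \<omega>) (Y \<omega>)) = rho_h h \<tau> (Y \<omega> - q \<omega> - dl (fst \<theta> - a0) (\<lambda>t. snd \<theta> t - \<beta>0 t) \<omega>)" by simp
  qed
  then show ?thesis
    unfolding ell_def Rh_eq[OF h_pos] obj_def gainE_eq[OF sobolev_diff[OF s \<beta>0]] by simp
qed

lemma obj_far:
  assumes "g \<in> sobolev m" "r\<^sup>2 < sqD a g"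
  shows "lam / 2 * Jpen m \<beta>0 \<beta>0 < obj a g"
proof -
  have "0 \<le> lam / 2 * Jpen m (\<lambda>t. \<beta>0 t + g t) (\<lambda>t. \<beta>0 t + g t)" using lam_pos Jpen_nonneg by simp
  then show ?thesis using gainE_far[OF assms] small3 by (simp add: obj_def)
qed

lemma obj_zero: "obj 0 (\<lambda>_. 0) = lam / 2 * Jpen m \<beta>0 \<beta>0"
  by (simp add: obj_def gainE_def \<Phi>_def smoothed_gain_def lin_def)

lemma zero_sobolev: "(\<lambda>_. 0) \<in> sobolev m"
  using sobolev_cmult[OF \<beta>0, of 0] by simp

text \<open>A minimizer over the ball is global: the true parameter lies in the ball, and everything
  outside has a larger value.\<close>

lemma minimizer_exists: "\<exists>\<theta>. is_minimizer M X Y k h m \<tau> lam \<theta>"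
proof -
  obtain a g where g: "g \<in> sobolev m" "sqD a g \<le> r\<^sup>2"
    and min: "\<And>u e. e \<in> sobolev m \<Longrightarrow> sqD u e \<le> r\<^sup>2 \<Longrightarrow> obj a g \<le> obj u e"
    using obj_minimizer_exists by blast
  define \<theta> where "\<theta> = (a0 + a, \<lambda>t. \<beta>0 t + g t)"
  have \<theta>: "\<theta> \<in> Hspace m" using sobolev_add[OF \<beta>0 g(1)] by (simp add: \<theta>_def Hspace_def)
  have "ell M X Y k h m \<tau> lam \<theta> \<le> ell M X Y k h m \<tau> lam \<theta>'" if "\<theta>' \<in> Hspace m" for \<theta>'
  proof -
    have s: "(\<lambda>t. snd \<theta>' t - \<beta>0 t) \<in> sobolev m" using that by (auto simp: Hspace_def intro!: sobolev_diff \<beta>0)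
    have "obj a g \<le> obj (fst \<theta>' - a0) (\<lambda>t. snd \<theta>' t - \<beta>0 t)"
    proof (cases "sqD (fst \<theta>' - a0) (\<lambda>t. snd \<theta>' t - \<beta>0 t) \<le> r\<^sup>2")
      case True
      then show ?thesis by (intro min s)
    next
      case False
      have "obj a g \<le> obj 0 (\<lambda>_. 0)" by (intro min zero_sobolev) (simp add: sqD_def lin_def)
      then show ?thesis using obj_far[OF s, of "fst \<theta>' - a0"] False obj_zero by simp
    qed
    then show ?thesis unfolding ell_eq[OF \<theta>] ell_eq[OF that] by (simp add: \<theta>_def)
  qed
  then show ?thesis using \<theta> by (intro exI[of _ \<theta>]) (simp add: is_minimizer_def)
qed

lemma minimizer_near:
  assumes "is_minimizer M X Y k h m \<tau> lam \<theta>"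
  shows "snd \<theta> \<in> sobolev m" "sqD (fst \<theta> - a0) (\<lambda>t. snd \<theta> t - \<beta>0 t) \<le> r\<^sup>2"
    "e \<in> sobolev m \<Longrightarrow> obj (fst \<theta> - a0) (\<lambda>t. snd \<theta> t - \<beta>0 t) \<le> obj u e"
proof -
  have \<theta>: "\<theta> \<in> Hspace m" and min: "\<And>\<theta>'. \<theta>' \<in> Hspace m \<Longrightarrow> ell M X Y k h m \<tau> lam \<theta> \<le> ell M X Y k h m \<tau> lam \<theta>'"
    using assms by (auto simp: is_minimizer_def)
  show s: "snd \<theta> \<in> sobolev m" using \<theta> by (auto simp: Hspace_def)
  have le: "obj (fst \<theta> - a0) (\<lambda>t. snd \<theta> t - \<beta>0 t) \<le> obj u e" if "e \<in> sobolev m" for u e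
  proof -
    have \<theta>': "(a0 + u, \<lambda>t. \<beta>0 t + e t) \<in> Hspace m" using sobolev_add[OF \<beta>0 that] by (simp add: Hspace_def)
    from min[OF \<theta>'] show ?thesis unfolding ell_eq[OF \<theta>] ell_eq[OF \<theta>'] by simp
  qed
  then show "e \<in> sobolev m \<Longrightarrow> obj (fst \<theta> - a0) (\<lambda>t. snd \<theta> t - \<beta>0 t) \<le> obj u e" .
  show "sqD (fst \<theta> - a0) (\<lambda>t. snd \<theta> t - \<beta>0 t) \<le> r\<^sup>2"
  proof (rule ccontr)
    assume "\<not> ?thesis"
    then have "lam / 2 * Jpen m \<beta>0 \<beta>0 < obj (fst \<theta> - a0) (\<lambda>t. snd \<theta> t - \<beta>0 t)"
      by (intro obj_far sobolev_diff[OF s \<beta>0]) simp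
    then show False using le[OF zero_sobolev, of 0] obj_zero by simp
  qed
qed

text \<open>All minimizers lie in the ball, and the midpoint of two of them cannot do better, so the
  midpoint inequality makes their distance zero; the penalty enters with a favourable sign. Slopes
  are compared on the unit interval, where alone they have meaning.\<close>

lemma minimizer_unique:
  assumes "is_minimizer M X Y k h m \<tau> lam \<theta>" "is_minimizer M X Y k h m \<tau> lam \<theta>'"
  shows "fst \<theta> = fst \<theta>' \<and> (\<forall>t\<in>{0..1}. snd \<theta> t = snd \<theta>' t)"
proof -
  let ?a = "fst \<theta> - a0" and ?g = "\<lambda>t. snd \<theta> t - \<beta>0 t" and ?u = "fst \<theta>' - a0" and ?e = "\<lambda>t. snd \<theta>' t - \<beta>0 t"
  note n = minimizer_near[OF assms(1)] and n' = minimizer_near[OF assms(2)]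
  note g = sobolev_diff[OF n(1) \<beta>0] and e = sobolev_diff[OF n'(1) \<beta>0]
  let ?h = "\<lambda>t. (?g t + ?e t) / 2"
  have mid: "obj ?a ?g \<le> obj ((?a + ?u) / 2) ?h" "obj ?u ?e \<le> obj ((?a + ?u) / 2) ?h"
    by (intro n(3) n'(3) sobolev_mid[OF g e])+
  have "c / 8 * sqD (?a - ?u) (\<lambda>t. ?g t - ?e t) \<le> gainE ?a ?g + gainE ?u ?e - 2 * gainE ((?a + ?u) / 2) ?h"
    by (rule gainE_midpoint[OF g e n(2) n'(2)])
  moreover have "Jpen m (\<lambda>t. \<beta>0 t + ?g t) (\<lambda>t. \<beta>0 t + ?g t) + Jpen m (\<lambda>t. \<beta>0 t + ?e t) (\<lambda>t. \<beta>0 t + ?e t) - 2 * Jpen m (\<lambda>t. \<beta>0 t + ?h t) (\<lambda>t. \<beta>0 t + ?h t)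
       = Jpen m (\<lambda>t. snd \<theta> t - snd \<theta>' t) (\<lambda>t. snd \<theta> t - snd \<theta>' t) / 2"
  proof -
    have "(\<lambda>t. \<beta>0 t + ?h t) = (\<lambda>t. (snd \<theta> t + snd \<theta>' t) / 2)" by (auto simp: field_simps)
    then show ?thesis using Jpen_midpoint[OF n(1) n'(1)] by simp
  qed
  then have "0 \<le> lam / 2 * (Jpen m (\<lambda>t. \<beta>0 t + ?g t) (\<lambda>t. \<beta>0 t + ?g t) + Jpen m (\<lambda>t. \<beta>0 t + ?e t) (\<lambda>t. \<beta>0 t + ?e t) - 2 * Jpen m (\<lambda>t. \<beta>0 t + ?h t) (\<lambda>t. \<beta>0 t + ?h t))"
    using lam_pos Jpen_nonneg[of m "\<lambda>t. snd \<theta> t - snd \<theta>' t"] by simp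
  ultimately have "c / 8 * sqD (?a - ?u) (\<lambda>t. ?g t - ?e t) \<le> obj ?a ?g + obj ?u ?e - 2 * obj ((?a + ?u) / 2) ?h"
    unfolding obj_def right_diff_distrib distrib_left by linarith
  also have "\<dots> \<le> 0" using mid by linarith
  finally have "sqD (?a - ?u) (\<lambda>t. ?g t - ?e t) \<le> 0" using c_pos by (simp add: mult_le_0_iff)
  then have "sqD (?a - ?u) (\<lambda>t. ?g t - ?e t) = 0" using sqD_nonneg by (rule antisym)
  from sqD_zero_imp_zero[OF sobolev_diff[OF g e] this] show ?thesis by simp
qed

lemma minimizer_basic_inequality:
  assumes "is_minimizer M X Y k h m \<tau> lam \<theta>"
  shows "c / 4 * sqD (fst \<theta> - a0) (\<lambda>t. snd \<theta> t - \<beta>0 t) + lam / 2 * Jpen m (snd \<theta>) (snd \<theta>)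
     \<le> bias * sqrt (sqD (fst \<theta> - a0) (\<lambda>t. snd \<theta> t - \<beta>0 t)) + lam / 2 * Jpen m \<beta>0 \<beta>0"
proof -
  note n = minimizer_near[OF assms]
  have "obj (fst \<theta> - a0) (\<lambda>t. snd \<theta> t - \<beta>0 t) \<le> obj 0 (\<lambda>_. 0)" by (rule n(3)[OF zero_sobolev])
  then show ?thesis using gainE_growth[OF sobolev_diff[OF n(1) \<beta>0] n(2)] obj_zero by (simp add: obj_def)
qed

text \<open>The bias is of order \<lambda>^(1/2) and multiplies the root of D, so part of the
  curvature absorbs it at cost \<lambda>. The weight w stands for B_\<tau>(X) at the level
  considered and need not be measurable; without integrability the weighted integral is 0 by
  convention and the bound is immediate.\<close>

lemma minimizer_rate:
  assumes min: "is_minimizer M X Y k h m \<tau> lam \<theta>"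
    and bias: "bias \<le> A * sqrt lam" and J0: "Jpen m \<beta>0 \<beta>0 \<le> C2"
    and w: "AE \<omega> in M. w \<omega> \<le> C1"
  shows "(\<integral>\<omega>. w \<omega> * (dl (fst \<theta> - a0) (\<lambda>t. snd \<theta> t - \<beta>0 t) \<omega>)\<^sup>2 \<partial>M)
       + lam * Jpen m (\<lambda>t. snd \<theta> t - \<beta>0 t) (\<lambda>t. snd \<theta> t - \<beta>0 t)
     \<le> (8 * C1 / c * (2 * A\<^sup>2 / c + C2 / 2) + 4 * (2 * A\<^sup>2 / c + C2 / 2) + 2 * C2) * lam"
proof -
  let ?g = "\<lambda>t. snd \<theta> t - \<beta>0 t" and ?a = "fst \<theta> - a0"
  define D where "D = sqD ?a ?g"
  define J where "J = Jpen m (snd \<theta>) (snd \<theta>)"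
  define H where "H = 2 * A\<^sup>2 / c + C2 / 2"
  note n = minimizer_near[OF min]
  note g = sobolev_diff[OF n(1) \<beta>0]
  have D0: "0 \<le> D" and Jn: "0 \<le> J" by (simp_all add: D_def J_def sqD_nonneg Jpen_nonneg)
  have "bias * sqrt D \<le> (A * sqrt lam) * sqrt D" using bias D0 by (intro mult_right_mono) auto
  also have "\<dots> \<le> c / 8 * D + 2 * A\<^sup>2 / c * lam"
  proof -
    \<comment> \<open>Completing the square: the share c/8 of the curvature pays for the bias and
      leaves 2 A^2 / c times \<lambda>.\<close>
    have "0 \<le> (c * sqrt D - 4 * (A * sqrt lam))\<^sup>2 / (8 * c)" using c_pos by simp
    also have "(c * sqrt D - 4 * (A * sqrt lam))\<^sup>2 = c\<^sup>2 * D - 8 * c * (A * sqrt lam * sqrt D) + 16 * (A\<^sup>2 * lam)"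
      using D0 lam_pos by (simp add: power2_diff power_mult_distrib)
    also have "\<dots> / (8 * c) = c / 8 * D - A * sqrt lam * sqrt D + 2 * A\<^sup>2 / c * lam"
      using c_pos by (simp add: field_simps power2_eq_square)
    finally show ?thesis by linarith
  qed
  finally have "bias * sqrt D \<le> c / 8 * D + 2 * A\<^sup>2 / c * lam" .
  moreover have "lam / 2 * Jpen m \<beta>0 \<beta>0 \<le> lam / 2 * C2" using J0 lam_pos by (intro mult_left_mono) auto
  moreover have "c / 4 * D + lam / 2 * J \<le> bias * sqrt D + lam / 2 * Jpen m \<beta>0 \<beta>0"
    using minimizer_basic_inequality[OF min] by (simp add: D_def J_def)
  moreover have "H * lam = 2 * A\<^sup>2 / c * lam + lam / 2 * C2" by (simp add: H_def algebra_simps)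
  ultimately have main: "c / 8 * D + lam / 2 * J \<le> H * lam" by linarith
  have "0 \<le> lam / 2 * J" "0 \<le> c / 8 * D" using lam_pos c_pos Jn D0 by simp_all
  with main have d1: "c / 8 * D \<le> H * lam" and d2: "lam / 2 * J \<le> H * lam" by linarith+
  have D: "C1 * D \<le> 8 * C1 / c * H * lam"
  proof -
    have "D \<le> 8 / c * (H * lam)" using d1 c_pos by (simp add: field_simps)
    from mult_left_mono[OF this, of C1] show ?thesis using C1_pos by (simp add: mult_ac)
  qed
  have J: "lam * J \<le> 2 * H * lam" using d2 by simp
  have "(\<integral>\<omega>. w \<omega> * (dl ?a ?g \<omega>)\<^sup>2 \<partial>M) \<le> C1 * D"
  proof (cases "integrable M (\<lambda>\<omega>. w \<omega> * (dl ?a ?g \<omega>)\<^sup>2)")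
    case True
    have i: "integrable M (\<lambda>\<omega>. C1 * (dl ?a ?g \<omega>)\<^sup>2)"
      using sq_int_integrable[OF dl_sq_int[OF g, of ?a]] by simp
    have "AE \<omega> in M. w \<omega> * (dl ?a ?g \<omega>)\<^sup>2 \<le> C1 * (dl ?a ?g \<omega>)\<^sup>2"
      using w by eventually_elim (simp add: mult_right_mono)
    from integral_mono_AE[OF True i this] show ?thesis by (simp add: D_def sqD_def)
  next
    case False
    then show ?thesis using C1_pos D0 by (simp add: not_integrable_integral_eq)
  qed
  \<comment> \<open>The parallelogram law with the nonnegative term of the sum discarded.\<close>
  moreover have "Jpen m ?g ?g \<le> 2 * J + 2 * C2"
    using Jpen_parallelogram[OF n(1) \<beta>0] Jpen_nonneg[of m "\<lambda>t. snd \<theta> t + \<beta>0 t"] J0 by (simp add: J_def)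
  from mult_left_mono[OF this, of lam] have "lam * Jpen m ?g ?g \<le> 2 * (lam * J) + 2 * C2 * lam"
    using lam_pos by (simp add: algebra_simps)
  ultimately show ?thesis using D J unfolding H_def[symmetric] by (simp add: algebra_simps)
qed

end

section \<open>From the assumptions to the hypotheses of the argument\<close>

context qr_model
begin

text \<open>On the almost sure event that X lies in its support, the density has mass 1 and the
  quantile model holds, everything concerns a single density on the line and follows from the
  deterministic facts.\<close>

lemma AE_regular:
  assumes s: "1 \<le> s"
    and diff: "\<And>x j y. x \<in> supp M X \<Longrightarrow> j < s \<Longrightarrow> ((deriv ^^ j) (f x) has_real_derivative (deriv ^^ Suc j) (f x) y) (at y)"
    and bdd: "\<And>x j y. x \<in> supp M X \<Longrightarrow> j \<le> s \<Longrightarrow> \<bar>(deriv ^^ j) (f x) y\<bar> \<le> L"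
    and model: "AE \<omega> in M. cond_quantile f (X \<omega>) \<tau> = q \<omega>"
    and lower: "AE \<omega> in M. c \<le> f (X \<omega>) (q \<omega>)"
    and \<tau>: "0 < \<tau>" "\<tau> < 1" and h: "0 < h"
  shows "AE \<omega> in M. smooth_cdf (prim (Defs.cdf f (X \<omega>))) (Defs.cdf f (X \<omega>)) (f (X \<omega>)) L \<and>
        c \<le> f (X \<omega>) (q \<omega>) \<and> Defs.cdf f (X \<omega>) (q \<omega>) = \<tau> \<and>
        \<bar>(LBINT v. k v * Defs.cdf f (X \<omega>) (q \<omega> - h * v)) - \<tau>\<bar> \<le> L * mom (s + 1) * h ^ (s + 1)"
  using AE_supp AE_mass_one model lower AE_space
proof eventually_elim
  case (elim \<omega>)
  let ?x = "X \<omega>"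
  have d1: "(f ?x has_real_derivative deriv (f ?x) y) (at y)" for y using diff[OF elim(1), of 0] s by simp
  have b1: "\<bar>deriv (f ?x) y\<bar> \<le> L" for y using bdd[OF elim(1), of 1] s by simp
  have sc: "smooth_cdf (prim (Defs.cdf f ?x)) (Defs.cdf f ?x) (f ?x) L"
    by (rule smooth_cdf_of_density[where f=f and x="X \<omega>", OF f_X_integrable[OF elim(5)] f_X_nonneg[OF elim(5)] elim(2) d1 b1])
  have q: "Defs.cdf f ?x (q \<omega>) = \<tau>"
    using cdf_cond_quantile[where f=f and x="X \<omega>", OF f_X_integrable[OF elim(5)] f_X_nonneg[OF elim(5)] elim(2) \<tau>] elim(3) by simp
  interpret smooth_cdf_kernel "prim (Defs.cdf f ?x)" "Defs.cdf f ?x" "f ?x" L k s h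
    using sc h by (auto simp: smooth_cdf_kernel_def smooth_cdf_kernel_axioms_def intro: smoothing_kernel_axioms)
  \<comment> \<open>Shift by one: the cdf comes first, so that the derivatives of the density of
    orders up to s are the derivatives of the cdf of orders up to s + 1.\<close>
  define D where "D j = (case j of 0 \<Rightarrow> Defs.cdf f ?x | Suc i \<Rightarrow> (deriv ^^ i) (f ?x))" for j
  have "\<bar>(LBINT v. k v * Defs.cdf f ?x (q \<omega> - h * v)) - Defs.cdf f ?x (q \<omega>)\<bar> \<le> L * mom (s + 1) * h ^ (s + 1)"
  proof (rule smoothing_bias[where D=D])
    show "(D j has_real_derivative D (Suc j) y) (at y)" if "j \<le> s" for j y
      using that F[of y] diff[OF elim(1), of "j - 1" y] by (cases j) (auto simp: D_def)
  qed (use bdd[OF elim(1), of s] in \<open>auto simp: D_def\<close>)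
  then show ?case using sc q elim(4) by simp
qed

text \<open>Measurability in \<omega> is known for the cdf. Difference quotients of the cdf at q
  with steps 1/(n+1) are therefore measurable, and so is their limit, which is the density almost
  surely.\<close>

lemma measurable_density_version:
  assumes q [measurable]: "q \<in> borel_measurable M"
    and d: "AE \<omega> in M. (Defs.cdf f (X \<omega>) has_real_derivative f (X \<omega>) (q \<omega>)) (at (q \<omega>))"
  shows "\<exists>b. b \<in> borel_measurable M \<and> (AE \<omega> in M. b \<omega> = f (X \<omega>) (q \<omega>))"
proof (intro exI conjI)
  let ?e = "\<lambda>n. 1 / real (Suc n)"
  let ?b = "\<lambda>\<omega>. lim (\<lambda>n. (G \<omega> (q \<omega> + ?e n) - G \<omega> (q \<omega>)) / ?e n)"
  show "?b \<in> borel_measurable M" by measurable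
  have e: "filterlim ?e (at 0) sequentially"
    using LIMSEQ_inverse_real_of_nat by (auto simp: filterlim_at inverse_eq_divide)
  show "AE \<omega> in M. ?b \<omega> = f (X \<omega>) (q \<omega>)"
    using d
  proof eventually_elim
    case (elim \<omega>)
    then have "((\<lambda>z. (G \<omega> (q \<omega> + z) - G \<omega> (q \<omega>)) / z) \<longlongrightarrow> f (X \<omega>) (q \<omega>)) (at 0)" by (simp add: DERIV_def)
    from limI[OF filterlim_compose[OF this e]] show ?case .
  qed
qed

end

text \<open>Since a g / 4 \<le> exp (a g / 4), the fourth power of g is at most (4 / a)^4 times the
  given exponential.\<close>

lemma integrable_power4_of_exp:
  fixes g :: "'a \<Rightarrow> real"
  assumes i: "integrable M (\<lambda>x. exp (a * g x))" and a: "0 < a" and g: "g \<in> borel_measurable M" "\<And>x. 0 \<le> g x"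
  shows "integrable M (\<lambda>x. g x ^ 4)"
proof (rule Bochner_Integration.integrable_bound)
  show "integrable M (\<lambda>x. (4 / a) ^ 4 * exp (a * g x))" using i by simp
  have "g x ^ 4 \<le> (4 / a) ^ 4 * exp (a * g x)" for x
  proof -
    have "a * g x / 4 \<le> exp (a * g x / 4)" using exp_ge_add_one_self[of "a * g x / 4"] by linarith
    then have "(a * g x / 4) ^ 4 \<le> exp (a * g x / 4) ^ 4"
      using a g(2)[of x] by (intro power_mono) auto
    also have "\<dots> = exp (a * g x)" by (simp flip: exp_of_nat_mult)
    finally have "(4 / a) ^ 4 * (a * g x / 4) ^ 4 \<le> (4 / a) ^ 4 * exp (a * g x)" by (intro mult_left_mono) auto
    also have "(4 / a) ^ 4 * (a * g x / 4) ^ 4 = g x ^ 4"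
      unfolding power_mult_distrib[symmetric] using a by simp
    finally show ?thesis .
  qed
  then show "AE x in M. norm (g x ^ 4) \<le> norm ((4 / a) ^ 4 * exp (a * g x))" by simp
qed (use g in auto)

theorem theorem1:
  fixes M :: "'a measure" and X :: "'a \<Rightarrow> real \<Rightarrow> real" and Y :: "'a \<Rightarrow> real"
    and f :: "(real \<Rightarrow> real) \<Rightarrow> real \<Rightarrow> real" and k :: "real \<Rightarrow> real"
    and h :: "real \<Rightarrow> real"
    and \<alpha>0 :: "real \<Rightarrow> real" and \<beta>0 :: "real \<Rightarrow> real \<Rightarrow> real"
    and m s :: nat and \<tau>l \<tau>u C2 :: real
  assumes prob: "prob_space M"
    and X_meas: "(\<lambda>(\<omega>, t). X \<omega> t) \<in> borel_measurable (M \<Otimes>\<^sub>M lborel)"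
    and X_L2: "\<forall>\<omega>\<in>space M. L2 (X \<omega>)"
    and Y_meas: "Y \<in> borel_measurable M"
    and Y_int: "integrable M Y"
    and tau_range: "0 < \<tau>l" "\<tau>l < \<tau>u" "\<tau>u < 1"
    and m_ge: "1 \<le> m"
    and cond_dens: "is_cond_density M X Y f"
    and model: "\<forall>\<tau>\<in>{\<tau>l..\<tau>u}. \<beta>0 \<tau> \<in> sobolev m \<and>
                  (AE \<omega> in M. cond_quantile f (X \<omega>) \<tau> = \<alpha>0 \<tau> + lin (\<beta>0 \<tau>) (X \<omega>))"
    \<comment> \<open>(A1)(a)\<close>
    and A1a: "\<forall>x\<in>supp M X. \<forall>y. 0 < f x y \<and>
               (\<forall>\<epsilon>>0. \<exists>\<delta>>0. \<forall>x'\<in>supp M X. \<forall>y'.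
                  \<bar>y' - y\<bar> < \<delta> \<and> l2norm (\<lambda>t. x' t - x t) < \<delta> \<longrightarrow> \<bar>f x' y' - f x y\<bar> < \<epsilon>)"
    \<comment> \<open>(A1)(b)\<close>
    and s_ge: "1 \<le> s"
    and A1b_diff: "\<forall>x\<in>supp M X. \<forall>j<s. \<forall>y.
               ((deriv ^^ j) (f x) has_real_derivative (deriv ^^ Suc j) (f x) y) (at y)"
    and A1b_unif: "\<forall>\<eta>>0. \<exists>\<epsilon>>0. \<forall>x\<in>supp M X. \<forall>y t.
               \<bar>t\<bar> \<le> \<epsilon> \<longrightarrow> \<bar>(deriv ^^ s) (f x) (y + t) - (deriv ^^ s) (f x) y\<bar> \<le> \<eta>"
    and A1b_bdd: "\<exists>B. \<forall>j\<le>s. \<forall>x\<in>supp M X. \<forall>y. \<bar>(deriv ^^ j) (f x) y\<bar> \<le> B"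
    and A1b_lim: "\<forall>j\<le>s. \<forall>x\<in>supp M X.
               ((deriv ^^ j) (f x) \<longlongrightarrow> 0) at_top \<and> ((deriv ^^ j) (f x) \<longlongrightarrow> 0) at_bot"
    \<comment> \<open>(A1)(c)\<close>
    and A1c: "\<exists>C1>0. \<forall>\<tau>\<in>{\<tau>l..\<tau>u}.
               (\<forall>t\<in>{0..1}. (\<integral>\<omega>. Btau f \<alpha>0 \<beta>0 \<tau> (X \<omega>) * X \<omega> t \<partial>M) = 0) \<and>
               (AE \<omega> in M. 1 / C1 \<le> Btau f \<alpha>0 \<beta>0 \<tau> (X \<omega>) \<and> Btau f \<alpha>0 \<beta>0 \<tau> (X \<omega>) \<le> C1)"
    \<comment> \<open>(A2)(a)\<close>
    and k_even: "\<forall>u. k (- u) = k u"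
    and k_int: "integrable lborel k"
    and k_diff: "\<forall>u. (k has_real_derivative deriv k u) (at u)"
    and k_diff2: "\<forall>u. (deriv k has_real_derivative deriv (deriv k) u) (at u)"
    and k_bdd: "\<exists>B. \<forall>u. \<bar>deriv k u\<bar> \<le> B \<and> \<bar>deriv (deriv k) u\<bar> \<le> B"
    and k_one: "(LBINT u. k u) = 1"
    and k_Kbar: "set_integrable lborel {0..} (\<lambda>u. Kbar k u * (1 - Kbar k u))"
                "0 < (LBINT u:{0..}. Kbar k u * (1 - Kbar k u))"
    and k_mom_int: "integrable lborel (\<lambda>u. u ^ (s + 1) * k u)"
    and k_mom0: "\<forall>j\<in>{1..s}. (LBINT u. u ^ j * k u) = 0"
    and k_mom: "(LBINT u. u ^ (s + 1) * k u) \<noteq> 0"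
    \<comment> \<open>bandwidth: h = h(lambda) > 0 with h = O(lambda^(1/(2s+2))) as lambda -> 0\<close>
    and h_pos: "\<forall>lam>0. 0 < h lam"
    and h_rate: "h \<in> O[at_right 0](\<lambda>lam. lam powr (1 / (2 * real s + 2)))"
    \<comment> \<open>(A3)\<close>
    and A3: "\<forall>\<tau>\<in>{\<tau>l..\<tau>u}.
               continuous_on ({0..1} \<times> {0..1}) (\<lambda>(u, v). Cov M X f \<alpha>0 \<beta>0 \<tau> u v) \<and>
               (\<forall>\<beta>. L2 \<beta> \<longrightarrow>
                  ((AE v in lborel. v \<in> {0..1} \<longrightarrow> (LBINT u:{0..1}. Cov M X f \<alpha>0 \<beta>0 \<tau> u v * \<beta> u) = 0)
                   \<longleftrightarrow> (AE u in lborel. u \<in> {0..1} \<longrightarrow> \<beta> u = 0)))"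
    \<comment> \<open>(A4)\<close>
    and A4: "\<exists>a C\<phi> l. 0 \<le> a \<and> 0 < C\<phi> \<and> a + 1 / 2 < l \<and>
               (\<forall>\<tau>\<in>{\<tau>l..\<tau>u}. \<exists>\<phi> :: nat \<Rightarrow> real \<Rightarrow> real. \<exists>\<rho> :: nat \<Rightarrow> real.
                  (\<forall>\<nu>\<ge>1. \<phi> \<nu> \<in> sobolev m \<and> l2norm (\<phi> \<nu>) \<le> C\<phi> * real \<nu> powr a) \<and>
                  (\<forall>\<mu>\<ge>1. \<forall>\<nu>\<ge>1.
                     Vform M X f \<alpha>0 \<beta>0 \<tau> (\<phi> \<mu>) (\<phi> \<nu>) = (if \<mu> = \<nu> then 1 else 0) \<and>
                     Jpen m (\<phi> \<mu>) (\<phi> \<nu>) = (if \<mu> = \<nu> then \<rho> \<nu> else 0)) \<and>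
                  (\<forall>\<nu>\<ge>1. 0 \<le> \<rho> \<nu>) \<and> mono_on {1..} \<rho> \<and>
                  \<rho> \<in> \<Theta>(\<lambda>\<nu>. real \<nu> powr (2 * l)) \<and>
                  (\<forall>\<beta>\<in>sobolev m. \<forall>lam>0.
                     ((\<lambda>N. let r = (\<lambda>t. \<beta> t - (\<Sum>\<nu>=1..N. Vform M X f \<alpha>0 \<beta>0 \<tau> \<beta> (\<phi> \<nu>) * \<phi> \<nu> t))
                           in Vform M X f \<alpha>0 \<beta>0 \<tau> r r + lam * Jpen m r r) \<longlongrightarrow> 0) sequentially))"
    \<comment> \<open>(A5)\<close>
    and A5_exp: "\<exists>s'. 0 < s' \<and> s' < 1 \<and> integrable M (\<lambda>\<omega>. exp (s' * l2norm (X \<omega>)))"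
    and A5_mom: "\<exists>M0>0. \<forall>\<beta>\<in>sobolev m.
               (\<integral>\<omega>. \<bar>lin \<beta> (X \<omega>)\<bar> ^ 4 \<partial>M) \<le> M0 * (\<integral>\<omega>. \<bar>lin \<beta> (X \<omega>)\<bar> ^ 2 \<partial>M) ^ 2"
    \<comment> \<open>uniform bound on the roughness of beta_0\<close>
    and C2_pos: "0 < C2"
    and J_bound: "\<forall>\<tau>\<in>{\<tau>l..\<tau>u}. Jpen m (\<beta>0 \<tau>) (\<beta>0 \<tau>) \<le> C2"
  shows "\<exists>C>0. \<forall>\<^sub>F lam in at_right 0. \<forall>\<tau>\<in>{\<tau>l..\<tau>u}.
           (\<exists>\<theta>. is_minimizer M X Y k (h lam) m \<tau> lam \<theta>) \<and>
           (\<forall>\<theta> \<theta>'. is_minimizer M X Y k (h lam) m \<tau> lam \<theta> \<and>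
                    is_minimizer M X Y k (h lam) m \<tau> lam \<theta>' \<longrightarrow>
                    fst \<theta> = fst \<theta>' \<and> (\<forall>t\<in>{0..1}. snd \<theta> t = snd \<theta>' t)) \<and>
           (\<forall>\<theta>. is_minimizer M X Y k (h lam) m \<tau> lam \<theta> \<longrightarrow>
                 thnorm M X f \<alpha>0 \<beta>0 m \<tau> lam (fst \<theta> - \<alpha>0 \<tau>, \<lambda>t. snd \<theta> t - \<beta>0 \<tau> t)
                   \<le> C * sqrt lam)"
proof -
  interpret random_function M X
    using prob X_meas X_L2 by (simp add: random_function_def random_function_axioms_def)
  interpret qr_model M X Y f k s
    by (intro qr_model.intro cond_density.intro cond_density_axioms.intro smoothing_kernel.intro random_function_axioms)
       (use Y_meas Y_int cond_dens k_int k_one k_mom_int k_mom0 in auto)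
  obtain C1 where C1: "0 < C1" and mean0: "\<And>\<tau> t. \<tau> \<in> {\<tau>l..\<tau>u} \<Longrightarrow> t \<in> {0..1} \<Longrightarrow> (\<integral>\<omega>. Btau f \<alpha>0 \<beta>0 \<tau> (X \<omega>) * X \<omega> t \<partial>M) = 0"
    and Bb: "\<And>\<tau>. \<tau> \<in> {\<tau>l..\<tau>u} \<Longrightarrow> AE \<omega> in M. 1 / C1 \<le> Btau f \<alpha>0 \<beta>0 \<tau> (X \<omega>) \<and> Btau f \<alpha>0 \<beta>0 \<tau> (X \<omega>) \<le> C1"
    using A1c by blast
  obtain B where B: "\<forall>j\<le>s. \<forall>x\<in>supp M X. \<forall>y. \<bar>(deriv ^^ j) (f x) y\<bar> \<le> B" using A1b_bdd by blast
  define L where "L = \<bar>B\<bar>"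
  have L0: "0 \<le> L" by (simp add: L_def)
  have bdd: "\<bar>(deriv ^^ j) (f x) y\<bar> \<le> L" if "x \<in> supp M X" "j \<le> s" for x j y
    using B that unfolding L_def by (meson abs_ge_self order_trans)
  have diff: "((deriv ^^ j) (f x) has_real_derivative (deriv ^^ Suc j) (f x) y) (at y)" if "x \<in> supp M X" "j < s" for x j y
    using A1b_diff that by blast
  obtain M0 where M0: "M0 > 0" "\<And>\<beta>. \<beta> \<in> sobolev m \<Longrightarrow> (\<integral>\<omega>. \<bar>lin \<beta> (X \<omega>)\<bar> ^ 4 \<partial>M) \<le> M0 * (\<integral>\<omega>. \<bar>lin \<beta> (X \<omega>)\<bar> ^ 2 \<partial>M) ^ 2"
    using A5_mom by blast
  obtain s' where s': "0 < s'" "integrable M (\<lambda>\<omega>. exp (s' * l2norm (X \<omega>)))" using A5_exp by blast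
  have X4: "integrable M (\<lambda>\<omega>. l2norm (X \<omega>) ^ 4)" by (rule integrable_power4_of_exp[OF s'(2,1)]) auto
  define Q where "Q \<tau> \<omega> = \<alpha>0 \<tau> + lin (\<beta>0 \<tau>) (X \<omega>)" for \<tau> \<omega>
  have sob: "\<beta>0 \<tau> \<in> sobolev m" and quant: "AE \<omega> in M. cond_quantile f (X \<omega>) \<tau> = Q \<tau> \<omega>" if "\<tau> \<in> {\<tau>l..\<tau>u}" for \<tau>
    using model that by (auto simp: Q_def)
  have reg: "AE \<omega> in M. smooth_cdf (prim (Defs.cdf f (X \<omega>))) (Defs.cdf f (X \<omega>)) (f (X \<omega>)) L \<and>
        1 / C1 \<le> f (X \<omega>) (Q \<tau> \<omega>) \<and> Defs.cdf f (X \<omega>) (Q \<tau> \<omega>) = \<tau> \<and>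
        \<bar>(LBINT v. k v * Defs.cdf f (X \<omega>) (Q \<tau> \<omega> - h' * v)) - \<tau>\<bar> \<le> L * mom (s + 1) * h' ^ (s + 1)"
    if t: "\<tau> \<in> {\<tau>l..\<tau>u}" and h': "0 < h'" for \<tau> h'
  proof (rule AE_regular[OF s_ge diff bdd quant[OF t] _ _ _ h'])
    show "AE \<omega> in M. 1 / C1 \<le> f (X \<omega>) (Q \<tau> \<omega>)" using Bb[OF t] by eventually_elim (simp add: Btau_def Q_def)
  qed (use t tau_range in auto)
  \<comment> \<open>The reference level. What is extracted from its covariance operator, coercivity
    on polynomials and the separation of intercept and slope, concerns second moments of functionals
    of X and serves every other level.\<close>
  define b where "b \<omega> = Btau f \<alpha>0 \<beta>0 \<tau>l (X \<omega>)" for \<omega>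
  have tl: "\<tau>l \<in> {\<tau>l..\<tau>u}" using tau_range by simp
  have "Q \<tau>l \<in> borel_measurable M" unfolding Q_def using lin_X_measurable[OF sobolev_L2[OF sob[OF tl]]] by measurable
  moreover have "AE \<omega> in M. (Defs.cdf f (X \<omega>) has_real_derivative f (X \<omega>) (Q \<tau>l \<omega>)) (at (Q \<tau>l \<omega>))"
    using reg[OF tl zero_less_one] by eventually_elim (auto intro: smooth_cdf.F)
  ultimately obtain b1 where b1: "b1 \<in> borel_measurable M" "AE \<omega> in M. b1 \<omega> = f (X \<omega>) (Q \<tau>l \<omega>)"
    using measurable_density_version by blast
  \<comment> \<open>Clipping makes the bounds hold everywhere and changes \<open>b1\<close> on a
    null event only; the lower bound does not exceed the upper one because both hold almost surely
    on a probability space.\<close>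
  define b' where "b' \<omega> = max (1 / C1) (min C1 (b1 \<omega>))" for \<omega>
  have "AE \<omega> in M. 1 / C1 \<le> C1" using Bb[OF tl] by eventually_elim auto
  then have C1C1: "1 / C1 \<le> C1" by simp
  let ?C = "Cov M X f \<alpha>0 \<beta>0 \<tau>l"
  have C_eq: "?C = (\<lambda>u v. \<integral>\<omega>. b \<omega> * X \<omega> u * X \<omega> v \<partial>M)" by (simp add: fun_eq_iff Cov_def b_def)
  have Cc: "square_continuous ?C" using A3 tl by (simp add: square_continuous_def)
  have Cs: "?C u v = ?C v u" for u v by (simp add: Cov_def mult_ac)
  have V: "Vform M X f \<alpha>0 \<beta>0 \<tau>l = square_form ?C"
    by (simp add: fun_eq_iff Vform_def square_form_def square_integral_def)
  have psd: "psd_kernel ?C"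
  proof
    fix p :: "real poly"
    obtain \<phi> where exp: "\<forall>\<beta>\<in>sobolev m. \<forall>lam>0.
          ((\<lambda>N. let r = (\<lambda>t. \<beta> t - (\<Sum>\<nu>=1..N. Vform M X f \<alpha>0 \<beta>0 \<tau>l \<beta> (\<phi> \<nu>) * \<phi> \<nu> t))
                in Vform M X f \<alpha>0 \<beta>0 \<tau>l r r + lam * Jpen m r r) \<longlongrightarrow> 0) sequentially"
      and \<phi>: "\<forall>\<nu>\<ge>1. \<phi> \<nu> \<in> sobolev m"
      and orth: "\<forall>\<mu>\<ge>1. \<forall>\<nu>\<ge>1. Vform M X f \<alpha>0 \<beta>0 \<tau>l (\<phi> \<mu>) (\<phi> \<nu>) = (if \<mu> = \<nu> then 1 else 0)"
      by (atomize_elim, insert A4, elim exE conjE, drule bspec, rule tl, elim exE conjE, intro exI conjI, assumption) blast+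
    define r where "r N = (\<lambda>t. poly p t - (\<Sum>\<nu>=1..N. square_form ?C (poly p) (\<phi> \<nu>) * \<phi> \<nu> t))" for N
    have e: "(\<lambda>N. square_form ?C (r N) (r N) + lam * Jpen m (r N) (r N)) \<longlonglongrightarrow> 0" if "lam > 0" for lam
      using exp[rule_format, OF sobolev_poly that, of p] unfolding V by (simp add: Let_def r_def)
    \<comment> \<open>The expansion converges for every penalty weight; combining the weights 1 and
      2 isolates V, which cannot be bounded by the sum as long as its positivity is unknown.\<close>
    have "(\<lambda>N. 2 * (square_form ?C (r N) (r N) + 1 * Jpen m (r N) (r N)) - (square_form ?C (r N) (r N) + 2 * Jpen m (r N) (r N))) \<longlonglongrightarrow> 2 * 0 - 0"
      by (intro tendsto_intros e) auto
    then have lim: "(\<lambda>N. square_form ?C (r N) (r N)) \<longlonglongrightarrow> 0" by simp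
    have "0 \<le> square_form ?C (poly p) (poly p)"
      by (rule square_form_nonneg_of_expansion[OF Cc Cs _ _ _ r_def lim])
         (use \<phi> orth[unfolded V] sobolev_continuous[OF _ m_ge] in \<open>auto intro!: continuous_intros\<close>)
    then show "0 \<le> square_integral (\<lambda>s t. ?C s t * poly p t * poly p s)" by (simp add: square_form_def)
  qed (rule Cc Cs)+
  interpret qr_core M X Y f k s b b' C1 m M0
  proof (intro qr_core.intro weighted_random_function.intro weighted_random_function_axioms.intro qr_core_axioms.intro
      qr_model_axioms random_function_axioms)
    show "b' \<in> borel_measurable M" unfolding b'_def using b1(1) by measurable
    show "AE \<omega> in M. b' \<omega> = b \<omega>" using b1(2) Bb[OF tl] by eventually_elim (auto simp: b'_def b_def Btau_def Q_def)
    show "psd_kernel (\<lambda>s t. \<integral>\<omega>. b \<omega> * X \<omega> s * X \<omega> t \<partial>M)" using psd unfolding C_eq .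
    show "AE u in lborel. u \<in> {0..1} \<longrightarrow> \<beta> u = 0"
      if "L2 \<beta>" "AE v in lborel. v \<in> {0..1} \<longrightarrow> (LBINT u:{0..1}. (\<integral>\<omega>. b \<omega> * X \<omega> u * X \<omega> v \<partial>M) * \<beta> u) = 0" for \<beta>
      using A3[rule_format, OF tl] that unfolding C_eq by blast
    show "(\<integral>\<omega>. b \<omega> * X \<omega> t \<partial>M) = 0" if "t \<in> {0..1}" for t using mean0[OF tl that] by (simp add: b_def)
  qed (use C1 C1C1 X4 m_ge M0 in \<open>auto simp: b'_def\<close>)
  define c where "c = 1 / C1"
  \<comment> \<open>The radius at which the cubic error reaches its allowed share of the curvature;
    the summand 1 covers the case L \<open>K4\<close> = 0.\<close>
  define r where "r = c / (8 * (L * K4 + 1))"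
  have c: "0 < c" using C1 by (simp add: c_def)
  have LK: "0 \<le> L * K4" using L0 K4_nonneg by simp
  have r: "0 < r" unfolding r_def using c LK by (intro divide_pos_pos) auto
  have small1: "L * (r * K4) \<le> c / 8"
  proof -
    have "L * (r * K4) = (c / 8) * (L * K4 / (L * K4 + 1))" by (simp add: r_def mult_ac)
    also have "\<dots> \<le> (c / 8) * 1" using c LK by (intro mult_left_mono) (auto simp: divide_le_eq)
    finally show ?thesis by simp
  qed
  \<comment> \<open>With this exponent h^(s+1) is of order \<lambda>^(1/2), so the squared smoothing
    bias and the penalty are of the same order.\<close>
  define p where "p = 1 / (2 * real s + 2)"
  have p: "0 < p" by (simp add: p_def)
  obtain ch where ch: "ch > 0" "eventually (\<lambda>lam. norm (h lam) \<le> ch * norm (lam powr p)) (at_right 0)"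
    using landau_o.bigE[OF h_rate] unfolding p_def by blast
  have pos: "eventually (\<lambda>lam::real. 0 < lam) (at_right 0)" by (rule eventually_at_right_less)
  have h_lim: "(h \<longlongrightarrow> 0) (at_right 0)"
  proof (rule Lim_null_comparison)
    show "eventually (\<lambda>lam. norm (h lam) \<le> ch * lam powr p) (at_right 0)" using ch(2) by eventually_elim simp
    have "((\<lambda>lam::real. lam powr p) \<longlongrightarrow> 0) (at_right 0)"
      using p by (intro tendsto_zero_powrI[where b=p]) (auto intro: tendsto_ident_at eventually_mono[OF pos])
    from tendsto_mult[OF tendsto_const[of ch] this] show "((\<lambda>lam. ch * lam powr p) \<longlongrightarrow> 0) (at_right 0)" by simp
  qed
  have ev2: "eventually (\<lambda>lam. L * h lam * mom 1 < c / 4) (at_right 0)"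
  proof (rule order_tendstoD(2))
    show "((\<lambda>lam. L * h lam * mom 1) \<longlongrightarrow> L * 0 * mom 1) (at_right 0)" by (intro tendsto_intros h_lim)
  qed (use c in simp)
  have ev3: "eventually (\<lambda>lam. 2 * h lam * mom 1 + lam / 2 * C2 < c * r\<^sup>2 / 4) (at_right 0)"
  proof (rule order_tendstoD(2))
    show "((\<lambda>lam. 2 * h lam * mom 1 + lam / 2 * C2) \<longlongrightarrow> 2 * 0 * mom 1 + 0 / 2 * C2) (at_right 0)"
      by (intro tendsto_intros h_lim) auto
  qed (use c r in simp)
  define A where "A = L * mom (s + 1) * ch ^ (s + 1)"
  \<comment> \<open>Bounds the squared norm in units of \<lambda>; it contains no quantile level,
    and its square root is the constant of the theorem.\<close>
  define K where "K = 8 * C1 / c * (2 * A\<^sup>2 / c + C2 / 2) + 4 * (2 * A\<^sup>2 / c + C2 / 2) + 2 * C2"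
  have K: "K > 0"
  proof -
    have "0 \<le> 2 * A\<^sup>2 / c" "0 \<le> 8 * C1 / c" using c C1 by simp_all
    then show ?thesis using C2_pos unfolding K_def by (intro add_nonneg_pos add_nonneg_nonneg mult_nonneg_nonneg) auto
  qed
  have "\<forall>\<^sub>F lam in at_right 0. \<forall>\<tau>\<in>{\<tau>l..\<tau>u}.
           (\<exists>\<theta>. is_minimizer M X Y k (h lam) m \<tau> lam \<theta>) \<and>
           (\<forall>\<theta> \<theta>'. is_minimizer M X Y k (h lam) m \<tau> lam \<theta> \<and>
                    is_minimizer M X Y k (h lam) m \<tau> lam \<theta>' \<longrightarrow>
                    fst \<theta> = fst \<theta>' \<and> (\<forall>t\<in>{0..1}. snd \<theta> t = snd \<theta>' t)) \<and>
           (\<forall>\<theta>. is_minimizer M X Y k (h lam) m \<tau> lam \<theta> \<longrightarrow>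
                 thnorm M X f \<alpha>0 \<beta>0 m \<tau> lam (fst \<theta> - \<alpha>0 \<tau>, \<lambda>t. snd \<theta> t - \<beta>0 \<tau> t)
                   \<le> sqrt K * sqrt lam)"
    using pos ch(2) ev2 ev3
  proof eventually_elim
    case (elim lam)
    have hp: "0 < h lam" using h_pos elim(1) by simp
    define bias where "bias = L * mom (s + 1) * h lam ^ (s + 1)"
    have "h lam ^ (s + 1) \<le> (ch * lam powr p) ^ (s + 1)" using elim(2) hp by (intro power_mono) auto
    also have "\<dots> = ch ^ (s + 1) * (lam powr p) ^ (s + 1)" by (rule power_mult_distrib)
    also have "(lam powr p) ^ (s + 1) = lam powr (p * real (s + 1))"
    proof -
      have "(lam powr p) powr real (s + 1) = (lam powr p) ^ (s + 1)" by (rule powr_realpow) (use elim(1) in simp)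
      then show ?thesis by (simp only: powr_powr)
    qed
    also have "p * real (s + 1) = 1 / 2" by (simp add: p_def field_simps)
    also have "lam powr (1 / 2) = sqrt lam" using elim(1) by (simp add: powr_half_sqrt)
    finally have hs: "h lam ^ (s + 1) \<le> ch ^ (s + 1) * sqrt lam" .
    have bias: "bias \<le> A * sqrt lam"
      using mult_left_mono[OF hs, of "L * mom (s + 1)"] L0 mom_nonneg[of "s + 1"] by (simp add: bias_def A_def mult_ac)
    show ?case
    proof
      fix \<tau> assume t: "\<tau> \<in> {\<tau>l..\<tau>u}"
      have J0: "Jpen m (\<beta>0 \<tau>) (\<beta>0 \<tau>) \<le> C2" using J_bound t by blast
      interpret pt: qr_point M X Y f k s b b' C1 m M0 "h lam" \<tau> lam "\<alpha>0 \<tau>" L c r bias "\<beta>0 \<tau>"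
      proof unfold_locales
        show "AE \<omega> in M. smooth_cdf (prim (Defs.cdf f (X \<omega>))) (Defs.cdf f (X \<omega>)) (f (X \<omega>)) L \<and>
          c \<le> f (X \<omega>) (\<alpha>0 \<tau> + lin (\<beta>0 \<tau>) (X \<omega>)) \<and> Defs.cdf f (X \<omega>) (\<alpha>0 \<tau> + lin (\<beta>0 \<tau>) (X \<omega>)) = \<tau> \<and>
          \<bar>(LBINT v. k v * Defs.cdf f (X \<omega>) (\<alpha>0 \<tau> + lin (\<beta>0 \<tau>) (X \<omega>) - h lam * v)) - \<tau>\<bar> \<le> bias"
          using reg[OF t hp] unfolding c_def bias_def Q_def .
        have "lam / 2 * Jpen m (\<beta>0 \<tau>) (\<beta>0 \<tau>) \<le> lam / 2 * C2" using J0 elim(1) by (intro mult_left_mono) auto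
        then show "2 * h lam * mom 1 + lam / 2 * Jpen m (\<beta>0 \<tau>) (\<beta>0 \<tau>) < c * r\<^sup>2 / 4" using elim(4) by linarith
        show "L * h lam * mom 1 \<le> c / 4" using elim(3) by simp
      qed (use hp t tau_range elim(1) sob[OF t] c r L0 small1 in auto)
      have "AE \<omega> in M. Btau f \<alpha>0 \<beta>0 \<tau> (X \<omega>) \<le> C1" using Bb[OF t] by eventually_elim simp
      note rate = pt.minimizer_rate[OF _ bias J0 this, folded K_def]
      have "thnorm M X f \<alpha>0 \<beta>0 m \<tau> lam (fst \<theta> - \<alpha>0 \<tau>, \<lambda>t. snd \<theta> t - \<beta>0 \<tau> t) \<le> sqrt K * sqrt lam"
        if "is_minimizer M X Y k (h lam) m \<tau> lam \<theta>" for \<theta>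
        unfolding thnorm_def fst_conv snd_conv real_sqrt_mult[symmetric]
        by (rule real_sqrt_le_mono[OF rate[OF that]])
      then show "(\<exists>\<theta>. is_minimizer M X Y k (h lam) m \<tau> lam \<theta>) \<and>
           (\<forall>\<theta> \<theta>'. is_minimizer M X Y k (h lam) m \<tau> lam \<theta> \<and>
                    is_minimizer M X Y k (h lam) m \<tau> lam \<theta>' \<longrightarrow>
                    fst \<theta> = fst \<theta>' \<and> (\<forall>t\<in>{0..1}. snd \<theta> t = snd \<theta>' t)) \<and>
           (\<forall>\<theta>. is_minimizer M X Y k (h lam) m \<tau> lam \<theta> \<longrightarrow>
                 thnorm M X f \<alpha>0 \<beta>0 m \<tau> lam (fst \<theta> - \<alpha>0 \<tau>, \<lambda>t. snd \<theta> t - \<beta>0 \<tau> t)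
                   \<le> sqrt K * sqrt lam)"
        using pt.minimizer_exists pt.minimizer_unique by blast
    qed
  qed
  then show ?thesis using K by (intro exI[of _ "sqrt K"]) auto
qed

end
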